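(* Let $\mathcal W$ and $\mathcal S$ be the even parts of $W(m,n;\underline t)$ and $S(m,n;\underline t)$ over a field $\mathbb F$ of characteristic $p>3$, with $m,n\ge3$, and regard $\mathcal W$ as an $\mathcal S$-module via the adjoint action. Then $$\mathrm{Der}(\mathcal S,\mathcal W)=\mathrm{ad}(\mathcal W)\oplus\mathrm{span}_{\mathbb F}\{(\mathrm{ad}\,D_i)^{p^{r_i}}\mid i\in Y_0,\ 1\le r_i<t_i\},$$ where $\mathrm{ad}\,E$ (for $E\in\mathcal W$) denotes the map $\mathcal S\to\mathcal W$, $X\mapsto [E,X]$, and $(\mathrm{ad}\,D_i)^{p^{r_i}}$ denotes its restriction to $\mathcal S$.
   Context: $\mathbb F$ is a field of characteristic $p>3$; $m,n\ge 3$; $\underline t=(t_1,\dots,t_m)$ positive integers, $\pi_i=p^{t_i}-1$. $Y_0=\{1,\dots,m\}$, $Y_1=\{m+1,\dots,m+n\}$, $Y=Y_0\cup Y_1$, $\tau(r)=\bar0$ on $Y_0$, $\bar1$ on $Y_1$. $\mathfrak A=\mathfrak A(m,n;\underline t)$ is the supercommutative superalgebra with basis $x^{(\alpha)}x^u$ ($\alpha\in\mathbb N_0^m$, $\alpha_i\le\pi_i$; $u$ an increasing sequence in $Y_1$, $x^u$ the corresponding product of odd generators $x_k$, $k\in Y_1$), with divided-power multiplication $x^{(\alpha)}x^{(\beta)}=\prod_i\binom{\alpha_i+\beta_i}{\alpha_i}x^{(\alpha+\beta)}$ (zero if some index exceeds $\pi_i$), anticommuting $x_k$, and parity of $x^{(\alpha)}x^u$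 equal to $|u|\bmod2$. $D_i$ ($i\in Y_0$) lowers $\alpha$ by $\varepsilon_i$, $D_k$ ($k\in Y_1$) is the odd partial derivative $\partial/\partial x_k$; $D_r$ has parity $\tau(r)$. $W=W(m,n;\underline t)=\{\sum f_rD_r:f_r\in\mathfrak A\}$ with the supercommutator bracket $[fD_r,gD_s]=fD_r(g)D_s-(-1)^{\mathrm p(fD_r)\mathrm p(gD_s)}gD_s(f)D_r$; the $\mathbb Z$-degree of $x^{(\alpha)}x^uD_r$ is $|\alpha|+|u|-1$. For $r,s\in Y$ and homogeneous $f\in\mathfrak A$, $D_{rs}(f)=(-1)^{\tau(r)\tau(s)}D_r(f)D_s-(-1)^{(\tau(r)+\tau(s))\mathrm p(f)}D_s(f)D_r$; $S=S(m,n;\underline t)=\mathrm{span}\{D_{rs}(f)\}$. $\mathcal W=W_{\bar0}$, $\mathcal S=S_{\bar0}$. For a Lie algebra $\mathfrak g$ and a $\mathfrak g$-module $V$, $\mathrm{Der}(\mathfrak g,V)$ is the space of linear maps $D:\mathfrak g\to V$ with $D([x,y])=x\cdot D(y)-y\cdot D(x)$. *)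

theory Defs
  imports Complex_Main "HOL-Library.Function_Algebras" "HOL-Computational_Algebra.Primes"
begin

text \<open>Conventions. Y0 = {1..m} (even indices), Y1 = {m+1..m+n} (odd indices).
A basis monomial x^(alpha) x^u of the divided power superalgebra is indexed by a pair
(alpha, u) with alpha :: nat => nat (alpha i = 0 outside Y0, alpha i <= p^(t i) - 1)
and u a subset of Y1 (the increasing sequence u is identified with its set of entries).
A basis element x^(alpha) x^u D_r of W is indexed by a triple (alpha, u, r), r in Y.
Elements of the algebra and of W are coefficient functions on these index types,
vanishing outside the basis.\<close>

type_synonym 'a ael = "(nat \<Rightarrow> nat) \<times> nat set \<Rightarrow> 'a"
type_synonym 'a wel = "(nat \<Rightarrow> nat) \<times> nat set \<times> nat \<Rightarrow> 'a"

definition Y0 :: "nat \<Rightarrow> nat set" where "Y0 m = {1..m}"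
definition Y1 :: "nat \<Rightarrow> nat \<Rightarrow> nat set" where "Y1 m n = {m+1..m+n}"
definition Y :: "nat \<Rightarrow> nat \<Rightarrow> nat set" where "Y m n = Y0 m \<union> Y1 m n"

definition tau :: "nat \<Rightarrow> nat \<Rightarrow> nat" where "tau m r = (if r \<le> m then 0 else 1)"

definition Abasis :: "nat \<Rightarrow> nat \<Rightarrow> nat \<Rightarrow> (nat \<Rightarrow> nat) \<Rightarrow> ((nat \<Rightarrow> nat) \<times> nat set) set" where
  "Abasis p m n t = {(\<alpha>, u). (\<forall>i. i \<notin> Y0 m \<longrightarrow> \<alpha> i = 0) \<and> (\<forall>i\<in>Y0 m. \<alpha> i \<le> p ^ t i - 1)
                              \<and> u \<subseteq> Y1 m n}"

definition Wbasis :: "nat \<Rightarrow> nat \<Rightarrow> nat \<Rightarrow> (nat \<Rightarrow> nat) \<Rightarrow> ((nat \<Rightarrow> nat) \<times> nat set \<times> nat) set" where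
  "Wbasis p m n t = {(\<alpha>, u, r). (\<alpha>, u) \<in> Abasis p m n t \<and> r \<in> Y m n}"

definition Acarrier :: "nat \<Rightarrow> nat \<Rightarrow> nat \<Rightarrow> (nat \<Rightarrow> nat) \<Rightarrow> ('a::field) ael set" where
  "Acarrier p m n t = {f. \<forall>b. b \<notin> Abasis p m n t \<longrightarrow> f b = 0}"

definition Wcarrier :: "nat \<Rightarrow> nat \<Rightarrow> nat \<Rightarrow> (nat \<Rightarrow> nat) \<Rightarrow> ('a::field) wel set" where
  "Wcarrier p m n t = {X. \<forall>b. b \<notin> Wbasis p m n t \<longrightarrow> X b = 0}"

definition sc :: "'a::field \<Rightarrow> ('b \<Rightarrow> 'a) \<Rightarrow> ('b \<Rightarrow> 'a)" where
  "sc c f = (\<lambda>x. c * f x)"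

definition single :: "'b \<Rightarrow> 'a::field \<Rightarrow> ('b \<Rightarrow> 'a)" where
  "single b c = (\<lambda>x. if x = b then c else 0)"

definition amul_basis :: "nat \<Rightarrow> nat \<Rightarrow> nat \<Rightarrow> (nat \<Rightarrow> nat) \<Rightarrow>
    (nat \<Rightarrow> nat) \<times> nat set \<Rightarrow> (nat \<Rightarrow> nat) \<times> nat set \<Rightarrow> ('a::field) ael" where
  "amul_basis p m n t a b = (case a of (\<alpha>, u) \<Rightarrow> case b of (\<beta>, v) \<Rightarrow>
     if u \<inter> v = {} \<and> (\<forall>i\<in>Y0 m. \<alpha> i + \<beta> i \<le> p ^ t i - 1)
     then single (\<lambda>i. \<alpha> i + \<beta> i, u \<union> v)
            ((-1) ^ card {(i, j). i \<in> u \<and> j \<in> v \<and> j < i}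
             * (\<Prod>i\<in>Y0 m. of_nat ((\<alpha> i + \<beta> i) choose (\<alpha> i))))
     else 0)"

definition amul :: "nat \<Rightarrow> nat \<Rightarrow> nat \<Rightarrow> (nat \<Rightarrow> nat) \<Rightarrow> ('a::field) ael \<Rightarrow> 'a ael \<Rightarrow> 'a ael" where
  "amul p m n t f g = (\<Sum>a\<in>Abasis p m n t. \<Sum>b\<in>Abasis p m n t. sc (f a * g b) (amul_basis p m n t a b))"

text \<open>partial derivative D_r on basis monomials (D_k odd, acting from the left for k in Y1)\<close>
definition Dbasis :: "nat \<Rightarrow> nat \<Rightarrow> (nat \<Rightarrow> nat) \<times> nat set \<Rightarrow> ('a::field) ael" where
  "Dbasis m r a = (case a of (\<alpha>, u) \<Rightarrow>
     if r \<le> m then (if 0 < \<alpha> r then single (\<alpha>(r := \<alpha> r - 1), u) 1 else 0)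
     else (if r \<in> u then single (\<alpha>, u - {r}) ((-1) ^ card {j \<in> u. j < r}) else 0))"

definition Dop :: "nat \<Rightarrow> nat \<Rightarrow> nat \<Rightarrow> (nat \<Rightarrow> nat) \<Rightarrow> nat \<Rightarrow> ('a::field) ael \<Rightarrow> 'a ael" where
  "Dop p m n t r f = (\<Sum>a\<in>Abasis p m n t. sc (f a) (Dbasis m r a))"

definition mkW :: "('a::field) ael \<Rightarrow> nat \<Rightarrow> 'a wel" where
  "mkW f r = (\<lambda>(\<alpha>, u, s). if s = r then f (\<alpha>, u) else 0)"

definition brb :: "nat \<Rightarrow> nat \<Rightarrow> nat \<Rightarrow> (nat \<Rightarrow> nat) \<Rightarrow>
    (nat \<Rightarrow> nat) \<times> nat set \<times> nat \<Rightarrow> (nat \<Rightarrow> nat) \<times> nat set \<times> nat \<Rightarrow> ('a::field) wel" where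
  "brb p m n t a b = (case a of (\<alpha>, u, r) \<Rightarrow> case b of (\<beta>, v, s) \<Rightarrow>
     mkW (amul p m n t (single (\<alpha>, u) 1) (Dop p m n t r (single (\<beta>, v) 1))) s
     - sc ((-1) ^ ((card u + tau m r) * (card v + tau m s)))
          (mkW (amul p m n t (single (\<beta>, v) 1) (Dop p m n t s (single (\<alpha>, u) 1))) r))"

definition bracket :: "nat \<Rightarrow> nat \<Rightarrow> nat \<Rightarrow> (nat \<Rightarrow> nat) \<Rightarrow> ('a::field) wel \<Rightarrow> 'a wel \<Rightarrow> 'a wel" where
  "bracket p m n t X Z = (\<Sum>a\<in>Wbasis p m n t. \<Sum>b\<in>Wbasis p m n t. sc (X a * Z b) (brb p m n t a b))"

definition Ahom :: "nat \<Rightarrow> nat \<Rightarrow> nat \<Rightarrow> (nat \<Rightarrow> nat) \<Rightarrow> nat \<Rightarrow> ('a::field) ael \<Rightarrow> bool" where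
  "Ahom p m n t q f \<longleftrightarrow> f \<in> Acarrier p m n t \<and> (\<forall>\<alpha> u. f (\<alpha>, u) \<noteq> 0 \<longrightarrow> card u mod 2 = q)"

definition Drs :: "nat \<Rightarrow> nat \<Rightarrow> nat \<Rightarrow> (nat \<Rightarrow> nat) \<Rightarrow> nat \<Rightarrow> nat \<Rightarrow> nat \<Rightarrow> ('a::field) ael \<Rightarrow> 'a wel" where
  "Drs p m n t r s q f =
     sc ((-1) ^ (tau m r * tau m s)) (mkW (Dop p m n t r f) s)
     - sc ((-1) ^ ((tau m r + tau m s) * q)) (mkW (Dop p m n t s f) r)"

definition Scarrier :: "nat \<Rightarrow> nat \<Rightarrow> nat \<Rightarrow> (nat \<Rightarrow> nat) \<Rightarrow> ('a::field) wel set" where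
  "Scarrier p m n t = module.span sc
     {Drs p m n t r s q f | r s q f. r \<in> Y m n \<and> s \<in> Y m n \<and> q < 2 \<and> Ahom p m n t q f}"

definition Weven :: "nat \<Rightarrow> nat \<Rightarrow> nat \<Rightarrow> (nat \<Rightarrow> nat) \<Rightarrow> ('a::field) wel set" where
  "Weven p m n t = {X \<in> Wcarrier p m n t. \<forall>\<alpha> u r. X (\<alpha>, u, r) \<noteq> 0 \<longrightarrow> even (card u + tau m r)}"

definition Seven :: "nat \<Rightarrow> nat \<Rightarrow> nat \<Rightarrow> (nat \<Rightarrow> nat) \<Rightarrow> ('a::field) wel set" where
  "Seven p m n t = Scarrier p m n t \<inter> Weven p m n t"

text \<open>Der(g, V): linear maps g -> V satisfying D[x,y] = x.D(y) - y.D(x), with action given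
by br. Maps are represented extensionally: they vanish outside g.\<close>
definition Der :: "('v::ab_group_add) set \<Rightarrow> 'v set \<Rightarrow> ('k \<Rightarrow> 'v \<Rightarrow> 'v) \<Rightarrow> ('v \<Rightarrow> 'v \<Rightarrow> 'v)
     \<Rightarrow> ('v \<Rightarrow> 'v) set" where
  "Der g V scale br = {D. (\<forall>x\<in>g. D x \<in> V)
      \<and> (\<forall>x\<in>g. \<forall>y\<in>g. D (x + y) = D x + D y)
      \<and> (\<forall>c. \<forall>x\<in>g. D (scale c x) = scale c (D x))
      \<and> (\<forall>x\<in>g. \<forall>y\<in>g. D (br x y) = br x (D y) - br y (D x))
      \<and> (\<forall>x. x \<notin> g \<longrightarrow> D x = 0)}"

definition restr :: "'v set \<Rightarrow> ('v \<Rightarrow> 'w::zero) \<Rightarrow> ('v \<Rightarrow> 'w)" where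
  "restr g F = (\<lambda>x. if x \<in> g then F x else 0)"

definition Dvec :: "nat \<Rightarrow> ('a::field) wel" where
  "Dvec i = single (\<lambda>_. 0, {}, i) 1"

end

theory Submission
  imports Defs "HOL-Algebra.Exponent"
begin

text \<open>Both algebras are graded by the exponents of all \<open>m + n\<close> variables, and a derivation \<open>D\<close> is the
  sum of its homogeneous parts, say of weight \<open>\<xi>\<close>. If some element \<open>h\<close> of the torus of the even part of \<open>S\<close> acts on weight
  \<open>\<xi>\<close> by a nonzero scalar \<open>c\<close>, then \<open>D\<close> is inner, given by \<open>- D(h) / c\<close>. Otherwise a truncated Poincare
  lemma provides an inner derivation after whose subtraction \<open>D\<close> kills every \<open>D\<^sub>i\<close>, \<open>i \<in> Y\<^sub>0\<close>. Such a \<open>D\<close> commutes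
  with all \<open>ad D\<^sub>i\<close>, so if it is nonzero then one of its values on a generator \<open>D\<^sub>r\<^sub>s(x\<^sup>\<beta> x\<^sup>u)\<close> has a term
  \<open>x\<^sup>v D\<^sub>q\<close> without even variables, which leaves few degrees to inspect: \<open>\<xi>\<close> is constant on \<open>Y\<^sub>1\<close> with value
  \<open>0\<close> or \<open>\<plusminus>1\<close>. Writing the generators in question as brackets shows \<open>D = 0\<close> for \<open>\<plusminus>1\<close>. For \<open>0\<close> the weight is
  \<open>- N\<close> with \<open>N\<close> supported on \<open>Y\<^sub>0\<close> and divisible by \<open>p\<close>; there \<open>D = 0\<close> unless \<open>N\<close> is \<open>p\<^sup>e\<close> at a single index \<open>i\<close>, which
  is the weight of \<open>(ad D\<^sub>i)\<close> to the power \<open>p\<^sup>e\<close>, or \<open>N = 0\<close>, where \<open>D\<close> is the adjoint action of a torus element.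
  The sum is direct because \<open>ad E\<close> never produces the constant term \<open>D\<^sub>j\<close> from \<open>x\<^sub>i\<close> to the power \<open>p\<^sup>e\<close> times \<open>D\<^sub>j\<close>.\<close>

text \<open>The obstacle that shapes the proof: the odd derivations \<open>D\<^sub>k\<close> are not
  even fields, so brackets with the available \<open>D\<^sub>i\<close> lower even exponents only.
  Odd variables cannot be stripped from a value of \<open>D\<close>; they are controlled by weights
  and by parity. Weights are kept as integers because the torus sees them only modulo p, while the
  derivations outside ad W have weights -p^e. Vanishing is proved by one mechanism: a generator is a
  nonzero multiple of a bracket of two fields that \<open>D\<close> kills by degree. The multiples
  are exponents or binomial coefficients and must be units modulo p. For x_c to the power p^e every
  intermediate binomial coefficient vanishes, no such splitting exists, and (ad D_c)^(p^e) survives.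
  The bound e < t_c reflects that D_c^(p^(t_c)) = 0. The numerical hypotheses enter thus: p > 3
  gives p at least 5, so integers in [-2, 2] are distinct modulo p; a third even index leaves one
  that avoids two given ones; with three odd indices, c_k + c_l = 0 for all pairs forces c = 0, and
  a pair of odd variables never exhausts Y_1.\<close>

section \<open>Coefficient functions as vectors\<close>

declare [[coercion_enabled = false]]

text \<open>As simplification rules, pointwise evaluation would expand every identity between vectors.\<close>

declare plus_fun_apply [simp del] zero_fun_apply [simp del] fun_diff_def [simp del] minus_apply [simp del] uminus_apply [simp del]

lemma sum_fun_apply: "(\<Sum>a\<in>A. f a) x = (\<Sum>a\<in>A. f a x)"
  by (induction A rule: infinite_finite_induct) (auto simp: plus_fun_apply zero_fun_apply)

lemma sc_apply: "sc c f x = c * f x"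
  by (simp add: sc_def)

lemmas pointwise = plus_fun_apply zero_fun_apply minus_apply uminus_apply sc_apply sum_fun_apply

lemma sc_simps [simp]:
  "sc c 0 = 0" "sc 0 f = 0" "sc 1 f = f" "sc c (sc d f) = sc (c * d) f"
  by (auto simp: fun_eq_iff pointwise)

lemma sc_add: "sc c (f + g) = sc c f + sc c g"
  and sc_diff: "sc c (f - g) = sc c f - sc c g"
  and sc_minus: "sc c (- f) = - sc c f"
  and sc_minus_left: "sc (- c) f = - sc c f"
  and sc_add_left: "sc (c + d) f = sc c f + sc d f"
  and sc_diff_left: "sc (c - d) f = sc c f - sc d f"
  by (auto simp: fun_eq_iff pointwise algebra_simps)

lemma sc_sum: "sc c (\<Sum>a\<in>A. f a) = (\<Sum>a\<in>A. sc c (f a))"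
  by (simp add: fun_eq_iff pointwise sum_distrib_left)

lemma sc_sum_left: "sc (\<Sum>a\<in>A. f a) g = (\<Sum>a\<in>A. sc (f a) g)"
  by (simp add: fun_eq_iff pointwise sum_distrib_right)

lemma single_apply: "single b c x = (if x = b then c else 0)"
  by (simp add: single_def)

lemma single_same [simp]: "single b c b = c"
  by (simp add: single_def)

lemma single_0 [simp]: "single b 0 = 0"
  by (auto simp: fun_eq_iff pointwise single_def)

lemma sc_single [simp]: "sc c (single b d) = single b (c * d)"
  by (auto simp: fun_eq_iff pointwise single_def)

lemma single_add: "single b (c + d) = single b c + single b d"
  by (auto simp: fun_eq_iff pointwise single_def)

lemma module_sc: "module (sc :: 'a::field \<Rightarrow> ('b \<Rightarrow> 'a) \<Rightarrow> 'b \<Rightarrow> 'a)"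
  by unfold_locales (auto simp: sc_add sc_add_left)

interpretation sc_module: module "sc :: 'a::field \<Rightarrow> ('b \<Rightarrow> 'a) \<Rightarrow> 'b \<Rightarrow> 'a"
  by (rule module_sc)

text \<open>By k C(p^e, k) = p^e C(p^e - 1, k - 1), a binomial coefficient prime to p would make p^e
  divide k. Both the truncated product rule and the p^e-th power of a derivation rest on
  this.\<close>

lemma prime_dvd_prime_power_choose:
  fixes p :: nat
  assumes "prime p" "0 < k" "k < p ^ e"
  shows "p dvd (p ^ e choose k)"
proof (rule ccontr)
  assume "\<not> p dvd (p ^ e choose k)"
  hence "coprime (p ^ e) (p ^ e choose k)"
    using assms(1) by (simp add: prime_imp_coprime)
  moreover have "p ^ e dvd k * (p ^ e choose k)"
    using times_binomial_minus1_eq[OF assms(2), of "p ^ e"] by simp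
  ultimately have "p ^ e dvd k"
    using coprime_dvd_mult_left_iff by blast
  with assms show False
    by (simp add: nat_dvd_not_less)
qed

text \<open>The witness is the exact power p^e dividing n. Writing n = p^e k, the coefficient C(p^e
  k, p^e) has the same p-adic valuation as k, namely 0, and k > 1 because n is not a power of
  p.\<close>

lemma choose_not_dvd:
  fixes p n :: nat
  assumes "prime p" "n > 0" "p dvd n" "\<And>e. e \<ge> 1 \<Longrightarrow> n \<noteq> p ^ e"
  obtains A where "0 < A" "A < n" "\<not> p dvd (n choose A)"
proof -
  let ?e = "multiplicity p n"
  define k where "k = n div p ^ ?e"
  have pe: "prime_elem p" using assms(1) by (rule prime_imp_prime_elem)
  have nu: "\<not> is_unit p" using pe by (rule prime_elem_not_unit)
  have k: "n = p ^ ?e * k" "\<not> p dvd k"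
    using multiplicity_decompose[of n p] multiplicity_dvd[of p n] assms(2) nu by (auto simp: k_def)
  have e1: "?e \<ge> 1"
    using prime_multiplicity_gt_zero_iff[OF pe, of n] assms(2,3) by simp
  have "k \<noteq> 1" using assms(4)[OF e1] k(1) by auto
  moreover have "k \<noteq> 0" using assms(2) k(1) by (metis mult_0_right neq0_conv)
  ultimately have "k > 1" by simp
  have p0: "p ^ ?e > 0" using assms(1) by (simp add: prime_gt_0_nat)
  have "p ^ ?e * 1 < p ^ ?e * k" using \<open>k > 1\<close> p0 by (intro mult_strict_left_mono)
  hence lt: "p ^ ?e < n" using k(1) by simp
  have "multiplicity p (p ^ ?e * k choose p ^ ?e) = multiplicity p k"
    by (rule const_p_fac) (use \<open>k > 1\<close> assms(1) in auto)
  also have "\<dots> = 0" using k(2) by (rule not_dvd_imp_multiplicity_0)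
  finally have "multiplicity p (n choose p ^ ?e) = 0" using k(1) by simp
  moreover have "n choose p ^ ?e \<noteq> 0" using lt by simp
  ultimately have "\<not> p dvd (n choose p ^ ?e)"
    using prime_elem_multiplicity_eq_zero_iff[OF pe] by blast
  thus thesis using that p0 lt by blast
qed

section \<open>The divided power superalgebra\<close>

locale divided_superalgebra =
  fixes p m n :: nat and t :: "nat \<Rightarrow> nat" and ty :: "'a::field itself"
  assumes p_char: "p = CHAR('a)" and p_prime: "prime p" and p_gt_3: "p > 3"
    and m_ge_3: "m \<ge> 3" and n_ge_3: "n \<ge> 3" and t_ge_1: "\<forall>i\<in>Y0 m. t i \<ge> 1"
begin

abbreviation AB where "AB \<equiv> Abasis p m n t"
abbreviation WB where "WB \<equiv> Wbasis p m n t"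
abbreviation AC :: "'a ael set" where "AC \<equiv> Acarrier p m n t"
abbreviation WC :: "'a wel set" where "WC \<equiv> Wcarrier p m n t"
abbreviation W0 :: "'a wel set" where "W0 \<equiv> Weven p m n t"
abbreviation S0 :: "'a wel set" where "S0 \<equiv> Seven p m n t"
abbreviation mul :: "'a ael \<Rightarrow> 'a ael \<Rightarrow> 'a ael" (infixl "\<odot>" 70)
  where "f \<odot> g \<equiv> amul p m n t f g"
abbreviation pd :: "nat \<Rightarrow> 'a ael \<Rightarrow> 'a ael" where "pd \<equiv> Dop p m n t"
abbreviation br :: "'a wel \<Rightarrow> 'a wel \<Rightarrow> 'a wel" where "br \<equiv> bracket p m n t"
abbreviation hom :: "nat \<Rightarrow> 'a ael \<Rightarrow> bool" where "hom \<equiv> Ahom p m n t"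
abbreviation tt where "tt \<equiv> tau m"
abbreviation pm :: "nat \<Rightarrow> nat" where "pm i \<equiv> p ^ t i - 1"
abbreviation E0 :: "nat set" where "E0 \<equiv> Y0 m"
abbreviation E1 :: "nat set" where "E1 \<equiv> Y1 m n"
abbreviation EE :: "nat set" where "EE \<equiv> Y m n"

lemma finite_Y [simp]: "finite E0" "finite E1" "finite EE"
  by (auto simp: Y0_def Y1_def Y_def)

lemma Y_disj: "i \<in> E0 \<Longrightarrow> i \<notin> E1" "i \<in> E1 \<Longrightarrow> i \<notin> E0"
  by (auto simp: Y0_def Y1_def)

lemma tt_simps [simp]: "i \<in> E0 \<Longrightarrow> tt i = 0" "i \<in> E1 \<Longrightarrow> tt i = 1"
  by (auto simp: Y0_def Y1_def tau_def)

lemma tt_le: "tt i = 0 \<or> tt i = 1"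
  by (auto simp: tau_def)

lemma EE_cases: "r \<in> EE \<longleftrightarrow> r \<in> E0 \<or> r \<in> E1"
  by (auto simp: Y_def)

lemma Y0_le: "i \<in> E0 \<Longrightarrow> i \<le> m" and Y1_gt: "i \<in> E1 \<Longrightarrow> \<not> i \<le> m"
  by (auto simp: Y0_def Y1_def)

lemma finite_AB [simp]: "finite AB"
proof -
  let ?F = "{\<alpha>::nat\<Rightarrow>nat. \<forall>x. (x \<in> E0 \<longrightarrow> \<alpha> x \<in> {..Max (pm ` E0)}) \<and> (x \<notin> E0 \<longrightarrow> \<alpha> x = 0)}"
  have "finite ?F"
    by (rule finite_set_of_finite_funs) auto
  hence "finite (?F \<times> Pow E1)"
    by simp
  moreover have "AB \<subseteq> ?F \<times> Pow E1"
  proof safe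
    fix \<alpha> u x assume a: "(\<alpha>, u) \<in> AB"
    { assume "x \<in> E0"
      hence *: "\<alpha> x \<le> pm x" "pm x \<le> Max (pm ` E0)"
        using a by (auto simp: Abasis_def intro!: Max_ge)
      show "\<alpha> x \<le> Max (pm ` E0)"
        using le_trans[OF *] . }
    { assume "x \<notin> E0"
      thus "\<alpha> x = 0" using a by (auto simp: Abasis_def) }
    { assume "x \<in> u" thus "x \<in> E1" using a by (auto simp: Abasis_def) }
  qed
  ultimately show ?thesis
    by (rule rev_finite_subset)
qed

lemma WB_eq: "WB = (\<lambda>((\<alpha>, u), r). (\<alpha>, u, r)) ` (AB \<times> EE)"
  by (force simp: Wbasis_def)

lemma finite_WB [simp]: "finite WB"
  by (simp add: WB_eq)

lemma AC_simps [simp]: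
  "0 \<in> AC" "f \<in> AC \<Longrightarrow> g \<in> AC \<Longrightarrow> f + g \<in> AC" "f \<in> AC \<Longrightarrow> g \<in> AC \<Longrightarrow> f - g \<in> AC"
  "f \<in> AC \<Longrightarrow> sc c f \<in> AC" "f \<in> AC \<Longrightarrow> - f \<in> AC" "a \<in> AB \<Longrightarrow> single a c \<in> AC"
  by (auto simp: Acarrier_def single_def pointwise)

lemma AC_sum [simp]: "(\<And>a. a \<in> A \<Longrightarrow> f a \<in> AC) \<Longrightarrow> (\<Sum>a\<in>A. f a) \<in> AC"
  by (induction A rule: infinite_finite_induct) auto

lemma AC_expand: "f \<in> AC \<Longrightarrow> f = (\<Sum>a\<in>AB. sc (f a) (single a 1))"
  by (auto simp: fun_eq_iff pointwise single_apply Acarrier_def if_distrib[of "\<lambda>x. _ * x"]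
      cong: if_cong)

lemma AC_induct [consumes 1, case_names single add sc]:
  assumes "f \<in> AC" and single: "\<And>a. a \<in> AB \<Longrightarrow> P (single a 1)"
    and add: "\<And>f g. f \<in> AC \<Longrightarrow> g \<in> AC \<Longrightarrow> P f \<Longrightarrow> P g \<Longrightarrow> P (f + g)"
    and sc: "\<And>c f. f \<in> AC \<Longrightarrow> P f \<Longrightarrow> P (sc c f)"
  shows "P f"
proof -
  have "(\<lambda>_. 0, {}) \<in> AB" by (auto simp: Abasis_def)
  from sc[OF _ single[OF this], of 0] this have P0: "P 0" by simp
  have "P (\<Sum>a\<in>F. sc (f a) (single a 1))" if "finite F" "F \<subseteq> AB" for F
    using that
  proof (induction F)
    case (insert x F)
    moreover have "(\<Sum>a\<in>F. sc (f a) (single a 1)) \<in> AC"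
      using insert by (intro AC_sum AC_simps) auto
    ultimately show ?case by (auto simp del: sc_single intro!: add sc single)
  qed (use P0 in simp)
  from this[of AB] AC_expand[OF assms(1)] show ?thesis by simp
qed

lemma mul_add_left: "(f + g) \<odot> h = f \<odot> h + g \<odot> h"
  and mul_add_right: "h \<odot> (f + g) = h \<odot> f + h \<odot> g"
  and mul_sc_left: "sc c f \<odot> g = sc c (f \<odot> g)"
  and mul_sc_right: "f \<odot> sc c g = sc c (f \<odot> g)"
  by (auto simp: amul_def sum.distrib[symmetric] sc_sum algebra_simps sc_add_left pointwise
      intro!: sum.cong)

lemma mul_0 [simp]: "0 \<odot> f = 0" "f \<odot> 0 = 0"
  using mul_sc_left[of 0 0 f] mul_sc_right[of f 0 0] by simp_all

lemma mul_minus: "(- f) \<odot> g = - (f \<odot> g)" "f \<odot> (- g) = - (f \<odot> g)"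
  using mul_sc_left[of "-1" f g] mul_sc_right[of f "-1" g] by (simp_all add: sc_minus_left)

lemma mul_diff_left: "(f - g) \<odot> h = f \<odot> h - g \<odot> h"
  and mul_diff_right: "h \<odot> (f - g) = h \<odot> f - h \<odot> g"
  using mul_add_left[of f "-g" h] mul_add_right[of h f "-g"] by (simp_all add: mul_minus)

lemma mul_sum_left: "(\<Sum>a\<in>A. f a) \<odot> g = (\<Sum>a\<in>A. f a \<odot> g)"
  by (induction A rule: infinite_finite_induct) (auto simp: mul_add_left)

lemma mul_sum_right: "g \<odot> (\<Sum>a\<in>A. f a) = (\<Sum>a\<in>A. g \<odot> f a)"
  by (induction A rule: infinite_finite_induct) (auto simp: mul_add_right)

lemma pd_add: "pd r (f + g) = pd r f + pd r g"
  and pd_sc: "pd r (sc c f) = sc c (pd r f)"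
  by (auto simp: Dop_def sum.distrib[symmetric] sc_sum algebra_simps sc_add_left pointwise
      intro!: sum.cong)

lemma pd_0 [simp]: "pd r 0 = 0"
  using pd_sc[of r 0 0] by simp

lemma pd_minus: "pd r (- f) = - pd r f"
  using pd_sc[of r "-1" f] by (simp add: sc_minus_left)

lemma pd_diff: "pd r (f - g) = pd r f - pd r g"
  using pd_add[of r f "-g"] by (simp add: pd_minus)

lemma pd_sum: "pd r (\<Sum>a\<in>A. f a) = (\<Sum>a\<in>A. pd r (f a))"
  by (induction A rule: infinite_finite_induct) (auto simp: pd_add)

lemma amul_basis_closed: "a \<in> AB \<Longrightarrow> b \<in> AB \<Longrightarrow> amul_basis p m n t a b \<in> AC"
  by (cases a; cases b) (auto simp: amul_basis_def Abasis_def Acarrier_def single_apply pointwise)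

lemma mul_AC [simp]: "f \<odot> g \<in> AC"
  unfolding amul_def by (intro AC_sum AC_simps amul_basis_closed)

lemma Dbasis_closed: "a \<in> AB \<Longrightarrow> Dbasis m r a \<in> AC"
proof (cases a)
  case (Pair \<alpha> u)
  assume "a \<in> AB"
  hence a: "\<And>i. i \<notin> E0 \<Longrightarrow> \<alpha> i = 0" "\<And>i. i \<in> E0 \<Longrightarrow> \<alpha> i \<le> pm i" "u \<subseteq> E1"
    by (auto simp: Abasis_def Pair)
  have "i \<in> E0" if "\<alpha> i > 0" for i
    using a(1) that by (metis less_numeral_extra(3))
  moreover have "\<alpha> r - Suc 0 \<le> p ^ t r - Suc 0" if "r \<in> E0"
    using a(2)[OF that] by simp
  ultimately show ?thesis
    using a(2,3) by (auto simp: Pair Dbasis_def Acarrier_def Abasis_def single_apply pointwise)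
qed

lemma pd_AC [simp]: "pd r f \<in> AC"
  unfolding Dop_def by (intro AC_sum AC_simps Dbasis_closed)

lemma pd_single: "a \<in> AB \<Longrightarrow> pd r (single a c) = sc c (Dbasis m r a)"
proof -
  assume a: "a \<in> AB"
  have "pd r (single a c) = (\<Sum>b\<in>AB. if b = a then sc c (Dbasis m r a) else 0)"
    unfolding Dop_def by (rule sum.cong) (auto simp: single_apply)
  thus ?thesis using a by simp
qed

lemma mul_single: "a \<in> AB \<Longrightarrow> b \<in> AB \<Longrightarrow> single a c \<odot> single b d = sc (c * d) (amul_basis p m n t a b)"
proof -
  assume a: "a \<in> AB" "b \<in> AB"
  have "single a c \<odot> single b d
      = (\<Sum>a'\<in>AB. if a' = a then \<Sum>b'\<in>AB. if b' = b then sc (c * d) (amul_basis p m n t a b) else 0 else 0)"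
    unfolding amul_def
  proof (intro sum.cong refl)
    fix a' assume "a' \<in> AB"
    have "(\<Sum>b'\<in>AB. sc (single a c a' * single b d b') (amul_basis p m n t a' b'))
      = (\<Sum>b'\<in>AB. if b' = b then sc (single a c a' * d) (amul_basis p m n t a' b) else 0)"
      by (rule sum.cong) (auto simp: single_apply)
    thus "(\<Sum>b'\<in>AB. sc (single a c a' * single b d b') (amul_basis p m n t a' b'))
      = (if a' = a then \<Sum>b'\<in>AB. if b' = b then sc (c * d) (amul_basis p m n t a b) else 0 else 0)"
      using a by (simp add: single_apply)
  qed
  thus ?thesis using a by simp
qed

text \<open>At the top exponent the raised index lies outside the basis, where \<open>f\<close>
  vanishes, so the coefficient formula needs no case for the truncation.\<close>

lemma pd_even_apply:
  assumes "f \<in> AC" "r \<in> E0"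
  shows "pd r f (\<alpha>, u) = f (\<alpha>(r := Suc (\<alpha> r)), u)"
proof -
  have "Dbasis m r a (\<alpha>, u) = (if a = (\<alpha>(r := Suc (\<alpha> r)), u) then 1 else (0::'a))" for a
  proof (cases a)
    case (Pair \<beta> v)
    have "\<beta> r > 0 \<Longrightarrow> \<alpha> = \<beta>(r := \<beta> r - 1) \<longleftrightarrow> \<beta> = \<alpha>(r := Suc (\<alpha> r))"
      by (metis Suc_pred' diff_Suc_1 fun_upd_same fun_upd_triv fun_upd_upd)
    moreover have "\<beta> r = 0 \<Longrightarrow> \<beta> \<noteq> \<alpha>(r := Suc (\<alpha> r))"
      by auto
    ultimately show ?thesis
      using Y0_le[OF assms(2)] by (cases "\<beta> r = 0") (auto simp: Pair Dbasis_def single_apply pointwise)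
  qed
  hence "pd r f (\<alpha>, u) = (\<Sum>a\<in>AB. if a = (\<alpha>(r := Suc (\<alpha> r)), u) then f a else 0)"
    unfolding Dop_def sum_fun_apply sc_apply by (intro sum.cong) auto
  thus ?thesis using assms(1) by (auto simp: Acarrier_def)
qed

lemma pd_odd_apply:
  assumes "f \<in> AC" "r \<in> E1"
  shows "pd r f (\<alpha>, u) = (if r \<in> u then 0 else (-1) ^ card {j\<in>u. j < r} * f (\<alpha>, insert r u))"
proof -
  have s: "{j. (j = r \<or> j \<in> u) \<and> j < r} = {j\<in>u. j < r}" by auto
  have "Dbasis m r a (\<alpha>, u) = (if r \<notin> u \<and> a = (\<alpha>, insert r u) then (-1) ^ card {j\<in>u. j < r} else (0::'a))" for a
    using Y1_gt[OF assms(2)] by (cases a) (auto simp: Dbasis_def single_apply s insert_absorb pointwise)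
  hence "pd r f (\<alpha>, u) = (\<Sum>a\<in>AB. if a = (\<alpha>, insert r u) then if r \<in> u then 0 else (-1) ^ card {j\<in>u. j < r} * f a else 0)"
    unfolding Dop_def sum_fun_apply sc_apply by (intro sum.cong) auto
  thus ?thesis using assms(1) by (auto simp: Acarrier_def)
qed

text \<open>The only delicate case is r < s, both odd: inserting r raises by one the number of
  indices below s, while inserting s leaves the number below r unchanged. This produces the single
  sign.\<close>

lemma pd_commute:
  assumes "f \<in> AC" "r \<in> EE" "s \<in> EE"
  shows "pd r (pd s f) = sc ((-1) ^ (tt r * tt s)) (pd s (pd r f))"
proof -
  have fin: "finite u" if "f (\<alpha>, u) \<noteq> 0" for \<alpha> u
  proof (rule finite_subset[OF _ finite_Y(2)])
    have "(\<alpha>, u) \<in> AB" using that assms(1) by (auto simp: Acarrier_def)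
    thus "u \<subseteq> E1" by (simp add: Abasis_def)
  qed
  have odd: "pd r (pd s f) (\<alpha>, u) = - pd s (pd r f) (\<alpha>, u)"
    if rs: "r \<in> E1" "s \<in> E1" and "r < s" for r s \<alpha> u
  proof (cases "finite u \<and> r \<notin> u \<and> s \<notin> u")
    case True
    have "{j \<in> insert r u. j < s} = insert r {j \<in> u. j < s}" "{j \<in> insert s u. j < r} = {j \<in> u. j < r}"
      using \<open>r < s\<close> by auto
    thus ?thesis
      using True \<open>r < s\<close> rs assms(1) by (simp add: pd_odd_apply insert_commute)
  next
    case False
    have "f (\<alpha>, insert r (insert s u)) = 0" if "infinite u"
      using fin[of \<alpha> "insert r (insert s u)"] that by auto
    thus ?thesis
      using False rs assms(1) \<open>r < s\<close>
      by (auto simp: pd_odd_apply insert_commute insert_absorb)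
  qed
  have "pd r (pd s f) (\<alpha>, u) = sc ((-1) ^ (tt r * tt s)) (pd s (pd r f)) (\<alpha>, u)" for \<alpha> u
  proof (cases "r = s")
    case True
    thus ?thesis
      using assms by (auto simp: EE_cases pd_odd_apply pd_even_apply pointwise)
  next
    case False
    consider "r \<in> E0" "s \<in> E0" | "r \<in> E0" "s \<in> E1" | "r \<in> E1" "s \<in> E0" | "r \<in> E1" "s \<in> E1"
      using assms by (auto simp: EE_cases)
    thus ?thesis
    proof cases
      case 4
      thus ?thesis
        using odd[of r s] odd[of s r] False by (cases "r < s") (auto simp: pointwise)
    qed (use assms(1) False in \<open>auto simp: pd_odd_apply pd_even_apply fun_upd_twist pointwise\<close>)
  qed
  thus ?thesis by (auto simp: fun_eq_iff)
qed

text \<open>Putting the truncation into each factor turns the side condition of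
  \<open>amul_basis\<close> into the vanishing of a product, so identities of structure constants
  can be checked one variable at a time.\<close>

definition tbinom :: "nat \<Rightarrow> nat \<Rightarrow> nat \<Rightarrow> 'a" where
  "tbinom i a b = (if a + b \<le> pm i then of_nat ((a + b) choose a) else 0)"

text \<open>The value 0 on overlapping sets encodes that odd variables square to zero.\<close>

definition msign :: "nat set \<Rightarrow> nat set \<Rightarrow> 'a" where
  "msign u v = (if u \<inter> v = {} then (-1) ^ card {(i, j). i \<in> u \<and> j \<in> v \<and> j < i} else 0)"

lemma amul_basis_eq:
  "amul_basis p m n t (\<alpha>, u) (\<beta>, v)
    = single (\<lambda>i. \<alpha> i + \<beta> i, u \<union> v) (msign u v * (\<Prod>i\<in>E0. tbinom i (\<alpha> i) (\<beta> i)))"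
proof (cases "\<forall>i\<in>E0. \<alpha> i + \<beta> i \<le> pm i")
  case True
  hence "(\<Prod>i\<in>E0. tbinom i (\<alpha> i) (\<beta> i)) = (\<Prod>i\<in>E0. of_nat ((\<alpha> i + \<beta> i) choose (\<alpha> i)))"
    by (intro prod.cong) (auto simp: tbinom_def)
  thus ?thesis using True by (auto simp: amul_basis_def msign_def)
next
  case False
  hence z: "(\<Prod>i\<in>E0. tbinom i (\<alpha> i) (\<beta> i)) = 0"
    by (auto simp: tbinom_def)
  have "amul_basis p m n t (\<alpha>, u) (\<beta>, v) = (0 :: 'a ael)"
    using False by (simp only: amul_basis_def prod.case) simp
  thus ?thesis by (simp only: z mult_zero_right single_0)
qed

lemma tbinom_comm: "tbinom i a b = tbinom i b a"
  using binomial_symmetric[of a "a + b"] by (simp add: tbinom_def add.commute)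

text \<open>Within the range both sides are the multinomial coefficient of (a, b, c). If a + b + c
  is too large, the second factor vanishes on either side.\<close>

lemma tbinom_assoc: "tbinom i a b * tbinom i (a + b) c = tbinom i b c * tbinom i a (b + c)"
proof -
  have "((a + b + c) choose (a + b)) * ((a + b) choose a) = ((a + b + c) choose a) * ((b + c) choose b)"
    using choose_mult[of a "a + b" "a + b + c"] by (simp add: add.assoc)
  thus ?thesis
    by (auto simp: tbinom_def add.assoc mult.commute simp flip: of_nat_mult)
qed

text \<open>For disjoint sets every pair in u x v is an inversion for exactly one of the two orders,
  so the two inversion numbers add up to \<open>card u * card v\<close>.\<close>

lemma msign_comm:
  assumes "finite u" "finite v"
  shows "msign u v = (-1) ^ (card u * card v) * msign v u"
proof (cases "u \<inter> v = {}")
  case True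
  let ?A = "{(i, j). i \<in> u \<and> j \<in> v \<and> j < i}" and ?B = "{(i, j). i \<in> v \<and> j \<in> u \<and> j < i}"
  let ?C = "{(i, j). i \<in> u \<and> j \<in> v \<and> i < j}"
  have *: "i < j \<or> j < i" if "i \<in> u" "j \<in> v" for i j
    using True that by (cases i j rule: linorder_cases) auto
  have "u \<times> v = ?A \<union> ?C"
    using * by blast
  moreover have "?A \<inter> ?C = {}"
    by auto
  moreover have "finite ?A"
    by (rule finite_subset[of _ "u \<times> v"]) (use assms in auto)
  moreover have "finite ?C"
    by (rule finite_subset[of _ "u \<times> v"]) (use assms in auto)
  ultimately have "card (u \<times> v) = card ?A + card ?C"
    by (simp only: card_Un_disjoint)
  hence "card u * card v = card ?A + card ?C"
    by (simp add: card_cartesian_product)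
  moreover have "card ?C = card ?B"
    by (rule bij_betw_same_card[of prod.swap]) (auto simp: bij_betw_def inj_on_def)
  ultimately show ?thesis
    using True by (simp add: msign_def Int_commute minus_one_power_iff)
qed (auto simp: msign_def Int_commute)

lemma msign_un_right:
  assumes "finite u" "finite v" "finite w" "v \<inter> w = {}"
  shows "msign u (v \<union> w) = msign u v * msign u w"
proof -
  have e: "{(i, j). i \<in> u \<and> (j \<in> v \<or> j \<in> w) \<and> j < i}
      = {(i, j). i \<in> u \<and> j \<in> v \<and> j < i} \<union> {(i, j). i \<in> u \<and> j \<in> w \<and> j < i}" by auto
  have f: "finite {(i, j). i \<in> u \<and> j \<in> x \<and> j < i}" if "finite x" for x
    by (rule finite_subset[of _ "u \<times> x"]) (use assms that in auto)
  have "card {(i, j). i \<in> u \<and> (j \<in> v \<or> j \<in> w) \<and> j < i}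
      = card {(i, j). i \<in> u \<and> j \<in> v \<and> j < i} + card {(i, j). i \<in> u \<and> j \<in> w \<and> j < i}"
    unfolding e by (rule card_Un_disjoint) (use assms f in auto)
  thus ?thesis
    by (auto simp: msign_def power_add Int_Un_distrib)
qed

lemma msign_un_left:
  assumes "finite u" "finite v" "finite w" "v \<inter> w = {}"
  shows "msign (v \<union> w) u = msign v u * msign w u"
proof -
  have e: "{(i, j). (i \<in> v \<or> i \<in> w) \<and> j \<in> u \<and> j < i}
      = {(i, j). i \<in> v \<and> j \<in> u \<and> j < i} \<union> {(i, j). i \<in> w \<and> j \<in> u \<and> j < i}" by auto
  have f: "finite {(i, j). i \<in> x \<and> j \<in> u \<and> j < i}" if "finite x" for x
    by (rule finite_subset[of _ "x \<times> u"]) (use assms that in auto)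
  have "card {(i, j). (i \<in> v \<or> i \<in> w) \<and> j \<in> u \<and> j < i}
      = card {(i, j). i \<in> v \<and> j \<in> u \<and> j < i} + card {(i, j). i \<in> w \<and> j \<in> u \<and> j < i}"
    unfolding e by (rule card_Un_disjoint) (use assms f in auto)
  thus ?thesis
    by (auto simp: msign_def power_add Int_Un_distrib2)
qed

lemma msign_assoc:
  assumes "finite u" "finite v" "finite w"
  shows "msign u v * msign (u \<union> v) w = msign v w * msign u (v \<union> w)"
proof (cases "u \<inter> v = {} \<and> v \<inter> w = {}")
  case True
  thus ?thesis using assms by (simp add: msign_un_left msign_un_right)
next
  case False
  thus ?thesis by (auto simp: msign_def Int_Un_distrib Int_Un_distrib2)
qed

lemma AB_finite: "(\<alpha>, u) \<in> AB \<Longrightarrow> finite u"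
  using finite_subset[OF _ finite_Y(2)] by (auto simp: Abasis_def)

lemma mul_e:
  "(\<alpha>, u) \<in> AB \<Longrightarrow> (\<beta>, v) \<in> AB \<Longrightarrow> single (\<alpha>, u) c \<odot> single (\<beta>, v) d
    = single (\<lambda>i. \<alpha> i + \<beta> i, u \<union> v) (c * d * (msign u v * (\<Prod>i\<in>E0. tbinom i (\<alpha> i) (\<beta> i))))"
  by (simp add: mul_single amul_basis_eq)

lemma AB_prod:
  assumes "(\<alpha>, u) \<in> AB" "(\<beta>, v) \<in> AB" "(\<Prod>i\<in>E0. tbinom i (\<alpha> i) (\<beta> i)) \<noteq> 0"
  shows "(\<lambda>i. \<alpha> i + \<beta> i, u \<union> v) \<in> AB"
proof -
  have "tbinom i (\<alpha> i) (\<beta> i) \<noteq> 0" if "i \<in> E0" for i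
    using assms(3) that by (meson finite_Y(1) prod_zero_iff)
  hence "\<alpha> i + \<beta> i \<le> pm i" if "i \<in> E0" for i
    using that unfolding tbinom_def by metis
  thus ?thesis using assms(1,2) by (auto simp: Abasis_def)
qed

lemma mul_assoc:
  assumes "f \<in> AC" "g \<in> AC" "h \<in> AC"
  shows "(f \<odot> g) \<odot> h = f \<odot> (g \<odot> h)"
  using assms
proof (induction f rule: AC_induct)
  case s1: (single a)
  show ?case using \<open>g \<in> AC\<close> \<open>h \<in> AC\<close>
  proof (induction g rule: AC_induct)
    case s2: (single b)
    show ?case using \<open>h \<in> AC\<close>
    proof (induction h rule: AC_induct)
      case (single c)
      obtain \<alpha> u \<beta> v \<gamma> w where abc: "a = (\<alpha>, u)" "b = (\<beta>, v)" "c = (\<gamma>, w)"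
        by (cases a; cases b; cases c) auto
      note AB = s1(1)[unfolded abc] s2(1)[unfolded abc] single(1)[unfolded abc]
      let ?q = "(\<lambda>i. \<alpha> i + \<beta> i + \<gamma> i, u \<union> v \<union> w)"
      let ?c1 = "msign u v * (\<Prod>i\<in>E0. tbinom i (\<alpha> i) (\<beta> i)) * (msign (u \<union> v) w * (\<Prod>i\<in>E0. tbinom i (\<alpha> i + \<beta> i) (\<gamma> i)))"
      let ?c2 = "msign v w * (\<Prod>i\<in>E0. tbinom i (\<beta> i) (\<gamma> i)) * (msign u (v \<union> w) * (\<Prod>i\<in>E0. tbinom i (\<alpha> i) (\<beta> i + \<gamma> i)))"
      have "(single a 1 \<odot> single b 1) \<odot> single c 1 = single ?q ?c1"
      proof (cases "(\<Prod>i\<in>E0. tbinom i (\<alpha> i) (\<beta> i)) = 0")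
        case True
        thus ?thesis unfolding abc using AB by (simp only: mul_e True mult_zero_right mult_zero_left single_0 mul_0)
      next
        case False
        thus ?thesis unfolding abc using AB AB_prod[OF AB(1,2)] by (simp add: mul_e)
      qed
      moreover have "single a 1 \<odot> (single b 1 \<odot> single c 1) = single ?q ?c2"
      proof (cases "(\<Prod>i\<in>E0. tbinom i (\<beta> i) (\<gamma> i)) = 0")
        case True
        thus ?thesis unfolding abc using AB by (simp only: mul_e True mult_zero_right mult_zero_left single_0 mul_0)
      next
        case False
        thus ?thesis unfolding abc using AB AB_prod[OF AB(2,3)] by (simp add: mul_e add.assoc Un_assoc)
      qed
      moreover have "?c1 = (msign u v * msign (u \<union> v) w) * (\<Prod>i\<in>E0. tbinom i (\<alpha> i) (\<beta> i) * tbinom i (\<alpha> i + \<beta> i) (\<gamma> i))"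
        by (simp add: prod.distrib)
      moreover have "?c2 = (msign v w * msign u (v \<union> w)) * (\<Prod>i\<in>E0. tbinom i (\<beta> i) (\<gamma> i) * tbinom i (\<alpha> i) (\<beta> i + \<gamma> i))"
        by (simp add: prod.distrib)
      ultimately show ?case
        using AB[THEN AB_finite] by (simp add: tbinom_assoc msign_assoc)
    qed (auto simp: mul_add_right mul_sc_right)
  qed (auto simp: mul_add_left mul_add_right mul_sc_left mul_sc_right)
qed (auto simp: mul_add_left mul_sc_left)

lemma hom_AC: "hom q f \<Longrightarrow> f \<in> AC"
  by (simp add: Ahom_def)

lemma mul_commute:
  assumes "hom q f" "hom q' g"
  shows "f \<odot> g = sc ((-1) ^ (q * q')) (g \<odot> f)"
proof -
  have pw: "(-1::'a) ^ k = (-1) ^ l" if "k mod 2 = l mod 2" for k l :: nat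
    using that by (metis even_iff_mod_2_eq_zero minus_one_power_iff)
  have "f \<odot> g = (\<Sum>a\<in>AB. \<Sum>b\<in>AB. sc (f a * g b) (amul_basis p m n t a b))"
    by (simp add: amul_def)
  also have "\<dots> = (\<Sum>a\<in>AB. \<Sum>b\<in>AB. sc ((-1) ^ (q * q')) (sc (g b * f a) (amul_basis p m n t b a)))"
  proof (intro sum.cong refl)
    fix a b assume ab: "a \<in> AB" "b \<in> AB"
    obtain \<alpha> u \<beta> v where e: "a = (\<alpha>, u)" "b = (\<beta>, v)" by (cases a; cases b) auto
    show "sc (f a * g b) (amul_basis p m n t a b)
        = sc ((-1) ^ (q * q')) (sc (g b * f a) (amul_basis p m n t b a))"
    proof (cases "f a = 0 \<or> g b = 0")
      case False
      hence "card u mod 2 = q" "card v mod 2 = q'"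
        using assms by (auto simp: Ahom_def e)
      hence "(card u * card v) mod 2 = (q * q') mod 2"
        using mod_mult_eq[of "card u" 2 "card v"] by simp
      hence "(-1::'a) ^ (card u * card v) = (-1) ^ (q * q')"
        by (rule pw)
      moreover have "finite u" "finite v"
        using ab AB_finite e by auto
      ultimately have "msign u v = (-1) ^ (q * q') * msign v u"
        using msign_comm[of u v] by (simp only:)
      moreover have "(\<Prod>i\<in>E0. tbinom i (\<alpha> i) (\<beta> i)) = (\<Prod>i\<in>E0. tbinom i (\<beta> i) (\<alpha> i))"
        by (intro prod.cong refl tbinom_comm)
      moreover have "(\<lambda>i. \<alpha> i + \<beta> i, u \<union> v) = (\<lambda>i. \<beta> i + \<alpha> i, v \<union> u)"
        by (simp add: add.commute Un_commute)
      ultimately have "(amul_basis p m n t a b :: 'a ael) = sc ((-1) ^ (q * q')) (amul_basis p m n t b a)"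
        unfolding e amul_basis_eq by (simp only: sc_single mult.assoc)
      thus ?thesis
        by (simp add: mult_ac)
    qed auto
  qed
  also have "\<dots> = sc ((-1) ^ (q * q')) (\<Sum>b\<in>AB. \<Sum>a\<in>AB. sc (g b * f a) (amul_basis p m n t b a))"
    by (subst (2) sum.swap) (simp only: sc_sum)
  finally show ?thesis by (simp add: amul_def)
qed

lemma p_pow_gt_1:
  assumes "i \<in> E0"
  shows "p ^ t i > 1"
proof (rule one_less_power)
  show "1 < p" using p_gt_3 by simp
  show "0 < t i" using t_ge_1 assms by (metis less_eq_Suc_le One_nat_def)
qed

lemma tbinom_pascal:
  assumes "i \<in> E0" "a \<le> pm i" "b \<le> pm i"
  shows "(if a > 0 then tbinom i (a - 1) b else 0) + (if b > 0 then tbinom i a (b - 1) else 0)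
    = (if a + b > 0 then tbinom i a b else 0)"
proof -
  have pp: "p ^ t i > 0" using p_pow_gt_1[OF assms(1)] by linarith
  consider "a = 0" | "b = 0" | "a > 0" "b > 0" "a + b \<le> pm i" | "a > 0" "b > 0" "a + b = p ^ t i"
    | "a > 0" "b > 0" "a + b > p ^ t i"
    using pp by linarith
  thus ?thesis
  proof cases
    case 1
    thus ?thesis using assms by (auto simp: tbinom_def)
  next
    case 2
    thus ?thesis using assms by (auto simp: tbinom_def)
  next
    case 3
    then obtain a' b' where "a = Suc a'" "b = Suc b'" by (metis gr0_conv_Suc)
    thus ?thesis using 3 by (auto simp: tbinom_def add.commute simp flip: of_nat_add)
  next
    \<comment> \<open>The one place where truncation could break Pascal's rule: the right side is
      already cut off, while the two terms on the left are in range and add up to C(p^t, a), which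
      is 0 modulo p.\<close>
    case 4
    then obtain a' b' where ab: "a = Suc a'" "b = Suc b'" by (metis gr0_conv_Suc)
    have "p dvd (p ^ t i choose a)"
      by (rule prime_dvd_prime_power_choose) (use p_prime 4 in auto)
    hence "of_nat ((a + b) choose a) = (0::'a)"
      using 4 p_char by (simp add: of_nat_eq_0_iff_char_dvd)
    thus ?thesis using 4 ab by (auto simp: tbinom_def add.commute simp flip: of_nat_add)
  next
    case 5
    thus ?thesis by (auto simp: tbinom_def)
  qed
qed

text \<open>The product rule survives the truncation because \<open>p\<close> divides \<open>p\<^sup>t choose k\<close> for \<open>0 < k < p\<^sup>t\<close>.\<close>

lemma mul_pd_even:
  assumes "f \<in> AC" "g \<in> AC" "r \<in> E0"
  shows "pd r (f \<odot> g) = pd r f \<odot> g + f \<odot> pd r g"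
  using assms(1,2)
proof (induction f rule: AC_induct)
  case s1: (single a)
  show ?case using \<open>g \<in> AC\<close>
  proof (induction g rule: AC_induct)
    case s2: (single b)
    obtain \<alpha> u \<beta> v where ab: "a = (\<alpha>, u)" "b = (\<beta>, v)" by (cases a; cases b) auto
    note AB = s1(1)[unfolded ab] s2(1)[unfolded ab]
    let ?P = "\<Prod>i\<in>E0-{r}. tbinom i (\<alpha> i) (\<beta> i)"
    let ?q = "((\<lambda>i. \<alpha> i + \<beta> i)(r := \<alpha> r + \<beta> r - 1), u \<union> v)"
    have prod: "(\<Prod>i\<in>E0. tbinom i (\<gamma> i) (\<delta> i)) = tbinom r (\<gamma> r) (\<delta> r) * ?P"
      if "\<And>i. i \<noteq> r \<Longrightarrow> \<gamma> i = \<alpha> i" "\<And>i. i \<noteq> r \<Longrightarrow> \<delta> i = \<beta> i" for \<gamma> \<delta>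
      using assms(3) by (subst prod.remove[of _ r]) (auto simp: that intro!: prod.cong)
    have r: "r \<le> m" using Y0_le assms(3) by simp
    have L: "pd r (single a 1 \<odot> single b 1) = single ?q (msign u v * (if \<alpha> r + \<beta> r > 0 then tbinom r (\<alpha> r) (\<beta> r) else 0) * ?P)"
    proof (cases "(\<Prod>i\<in>E0. tbinom i (\<alpha> i) (\<beta> i)) = 0")
      case True
      have "pd r (single a 1 \<odot> single b 1) = 0"
        unfolding ab using AB by (simp only: mul_e True mult_zero_right single_0 pd_0)
      moreover have "tbinom r (\<alpha> r) (\<beta> r) * ?P = 0"
        using True prod[of \<alpha> \<beta>] by (simp only:)
      hence "msign u v * (if \<alpha> r + \<beta> r > 0 then tbinom r (\<alpha> r) (\<beta> r) else 0) * ?P = 0"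
        by (cases "\<alpha> r + \<beta> r > 0") (simp_all only: if_True if_False mult.assoc mult_zero_left mult_zero_right)
      ultimately show ?thesis by (simp only: single_0)
    next
      case False
      thus ?thesis unfolding ab using AB AB_prod[OF AB] r
        by (auto simp: mul_e pd_single Dbasis_def prod[of \<alpha> \<beta>] mult.assoc)
    qed
    have D: "\<alpha>(r := \<alpha> r - 1) \<in> {\<gamma>. (\<gamma>, u) \<in> AB}" "\<beta>(r := \<beta> r - 1) \<in> {\<gamma>. (\<gamma>, v) \<in> AB}"
    proof -
      have "\<alpha> r \<le> pm r" "\<beta> r \<le> pm r" using AB assms(3) by (auto simp: Abasis_def)
      hence "\<alpha> r - Suc 0 \<le> p ^ t r - Suc 0" "\<beta> r - Suc 0 \<le> p ^ t r - Suc 0" by auto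
      thus "\<alpha>(r := \<alpha> r - 1) \<in> {\<gamma>. (\<gamma>, u) \<in> AB}" "\<beta>(r := \<beta> r - 1) \<in> {\<gamma>. (\<gamma>, v) \<in> AB}"
        using AB assms(3) by (auto simp: Abasis_def)
    qed
    have R1: "pd r (single a 1) \<odot> single b 1 = single ?q (msign u v * (if \<alpha> r > 0 then tbinom r (\<alpha> r - 1) (\<beta> r) else 0) * ?P)"
    proof (cases "\<alpha> r > 0")
      case True
      have "(\<Prod>i\<in>E0. tbinom i (if i = r then \<alpha> r - Suc 0 else \<alpha> i) (\<beta> i)) = tbinom r (\<alpha> r - Suc 0) (\<beta> r) * ?P"
        using prod[of "\<alpha>(r := \<alpha> r - Suc 0)" \<beta>] by simp
      moreover have "(\<lambda>i. (\<alpha>(r := \<alpha> r - 1)) i + \<beta> i) = (\<lambda>i. \<alpha> i + \<beta> i)(r := \<alpha> r + \<beta> r - 1)"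
        using True by auto
      ultimately show ?thesis unfolding ab using AB D r True
        by (simp add: pd_single Dbasis_def mul_e mult.assoc)
    qed (use AB r in \<open>auto simp: ab pd_single Dbasis_def\<close>)
    have R2: "single a 1 \<odot> pd r (single b 1) = single ?q (msign u v * (if \<beta> r > 0 then tbinom r (\<alpha> r) (\<beta> r - 1) else 0) * ?P)"
    proof (cases "\<beta> r > 0")
      case True
      have "(\<Prod>i\<in>E0. tbinom i (\<alpha> i) (if i = r then \<beta> r - Suc 0 else \<beta> i)) = tbinom r (\<alpha> r) (\<beta> r - Suc 0) * ?P"
        using prod[of \<alpha> "\<beta>(r := \<beta> r - Suc 0)"] by simp
      moreover have "(\<lambda>i. \<alpha> i + (\<beta>(r := \<beta> r - 1)) i) = (\<lambda>i. \<alpha> i + \<beta> i)(r := \<alpha> r + \<beta> r - 1)"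
        using True by auto
      ultimately show ?thesis unfolding ab using AB D r True
        by (simp add: pd_single Dbasis_def mul_e mult.assoc)
    qed (use AB r in \<open>auto simp: ab pd_single Dbasis_def\<close>)
    have "\<alpha> r \<le> pm r" "\<beta> r \<le> pm r" using AB assms(3) by (auto simp: Abasis_def)
    from tbinom_pascal[OF assms(3) this] show ?case
      unfolding L R1 R2 by (simp only: distrib_left[symmetric] distrib_right[symmetric] single_add[symmetric])
  qed (auto simp: mul_add_right mul_sc_right pd_add pd_sc sc_add)
qed (auto simp: mul_add_left mul_sc_left pd_add pd_sc sc_add)

lemma msign_singleton_left: "finite v \<Longrightarrow> r \<notin> v \<Longrightarrow> msign {r} v = (-1) ^ card {j\<in>v. j < r}"
proof -
  assume "finite v" "r \<notin> v"
  have "{(i, j). i \<in> {r} \<and> j \<in> v \<and> j < i} = Pair r ` {j\<in>v. j < r}" by auto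
  thus ?thesis using \<open>r \<notin> v\<close> by (simp add: msign_def card_image inj_on_def)
qed

lemma msign_singleton_right: "finite u \<Longrightarrow> r \<notin> u \<Longrightarrow> msign u {r} = (-1) ^ card {j\<in>u. r < j}"
proof -
  assume "finite u" "r \<notin> u"
  have "{(i, j). i \<in> u \<and> j \<in> {r} \<and> j < i} = (\<lambda>j. (j, r)) ` {j\<in>u. r < j}" by auto
  thus ?thesis using \<open>r \<notin> u\<close> by (simp add: msign_def card_image inj_on_def)
qed

lemma card_split_at:
  assumes "finite u"
  shows "card (u - {r}) = card {j\<in>u. j < r} + card {j\<in>u. r < (j::nat)}"
proof -
  have "u - {r} = {j\<in>u. j < r} \<union> {j\<in>u. r < j}" by auto
  thus ?thesis using assms by (simp add: card_Un_disjoint disjoint_iff)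
qed

lemma msign_remove_left:
  assumes "finite u" "finite v" "r \<in> u" "r \<notin> v"
  shows "msign u v = msign (u - {r}) v * (-1) ^ card {j\<in>v. j < r}"
  using msign_un_left[of v "u - {r}" "{r}"] msign_singleton_left[of v r] assms by (simp add: insert_absorb)

lemma msign_remove_right:
  assumes "finite u" "finite v" "r \<notin> u" "r \<in> v"
  shows "msign u v = msign u (v - {r}) * (-1) ^ card {j\<in>u. r < j}"
  using msign_un_right[of u "v - {r}" "{r}"] msign_singleton_right[of u r] assms by (simp add: insert_absorb)

text \<open>The parity automorphism. It makes the odd product rule linear in both factors, so that
  it can be checked on monomials without assuming homogeneity.\<close>

definition par_twist :: "'a ael \<Rightarrow> 'a ael" where
  "par_twist f = (\<lambda>(\<alpha>, u). (-1) ^ card u * f (\<alpha>, u))"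

lemma par_twist_add: "par_twist (f + g) = par_twist f + par_twist g" and par_twist_sc: "par_twist (sc c f) = sc c (par_twist f)"
  by (auto simp: par_twist_def fun_eq_iff pointwise algebra_simps)

lemma par_twist_single: "par_twist (single (\<alpha>, u) c) = single (\<alpha>, u) ((-1) ^ card u * c)"
  by (auto simp: par_twist_def fun_eq_iff single_apply)

lemma par_twist_hom: "hom q f \<Longrightarrow> par_twist f = sc ((-1) ^ q) f"
proof -
  assume h: "hom q f"
  have "(-1) ^ card u * f (\<alpha>, u) = (-1) ^ q * f (\<alpha>, u)" for \<alpha> u
  proof (cases "f (\<alpha>, u) = 0")
    case False
    hence "card u mod 2 = q" using h by (auto simp: Ahom_def)
    hence "even (card u) = even q" by auto
    thus ?thesis by (simp add: minus_one_power_iff)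
  qed simp
  thus ?thesis by (auto simp: par_twist_def fun_eq_iff pointwise)
qed

lemma mul_pd_odd:
  assumes "f \<in> AC" "g \<in> AC" "r \<in> E1"
  shows "pd r (f \<odot> g) = pd r f \<odot> g + par_twist f \<odot> pd r g"
  using assms(1,2)
proof (induction f rule: AC_induct)
  case s1: (single a)
  show ?case using \<open>g \<in> AC\<close>
  proof (induction g rule: AC_induct)
    case s2: (single b)
    obtain \<alpha> u \<beta> v where ab: "a = (\<alpha>, u)" "b = (\<beta>, v)" by (cases a; cases b) auto
    note AB = s1(1)[unfolded ab] s2(1)[unfolded ab]
    have fin: "finite u" "finite v" using AB AB_finite by auto
    let ?P = "\<Prod>i\<in>E0. tbinom i (\<alpha> i) (\<beta> i)" and ?i = "\<lambda>i. \<alpha> i + \<beta> i"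
    have r: "\<not> r \<le> m" using Y1_gt assms(3) by simp
    have L: "pd r (single a 1 \<odot> single b 1)
        = single (?i, u \<union> v - {r}) (?P * (if r \<in> u \<union> v then (-1) ^ card {j \<in> u \<union> v. j < r} * msign u v else 0))"
    proof (cases "?P = 0")
      case True
      have "single a 1 \<odot> single b 1 = 0"
        unfolding ab using AB by (simp only: mul_e True mult_zero_right single_0)
      thus ?thesis by (simp only: True mult_zero_left single_0 pd_0)
    next
      case False
      thus ?thesis unfolding ab using AB AB_prod[OF AB] r
        by (auto simp: mul_e pd_single Dbasis_def mult_ac)
    qed
    have D: "(\<alpha>, u - {r}) \<in> AB" "(\<beta>, v - {r}) \<in> AB" using AB by (auto simp: Abasis_def)
    have R1: "pd r (single a 1) \<odot> single b 1
        = single (?i, u - {r} \<union> v) (?P * (if r \<in> u then (-1) ^ card {j \<in> u. j < r} * msign (u - {r}) v else 0))"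
      unfolding ab using AB D r by (auto simp: pd_single Dbasis_def mul_e mult_ac)
    have R2: "par_twist (single a 1) \<odot> pd r (single b 1)
        = single (?i, u \<union> (v - {r})) (?P * (if r \<in> v then (-1) ^ card u * (-1) ^ card {j \<in> v. j < r} * msign u (v - {r}) else 0))"
      unfolding ab using AB D r by (auto simp: par_twist_single pd_single Dbasis_def mul_e mult_ac)
    have cun: "card {j \<in> u \<union> v. j < r} = card {j\<in>u. j < r} + card {j\<in>v. j < r}" if "u \<inter> v = {}"
    proof -
      have "{j \<in> u \<union> v. j < r} = {j\<in>u. j < r} \<union> {j\<in>v. j < r}" by auto
      thus ?thesis using fin that by (subst card_Un_disjoint[symmetric]) auto
    qed
    consider "r \<in> u" "r \<notin> v" | "r \<notin> u" "r \<in> v" | "r \<in> u" "r \<in> v" | "r \<notin> u" "r \<notin> v" by blast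
    hence "pd r (single a 1 \<odot> single b 1) = pd r (single a 1) \<odot> single b 1 + par_twist (single a 1) \<odot> pd r (single b 1)"
    proof cases
      case 1
      have "(-1) ^ card {j \<in> u \<union> v. j < r} * msign u v = (-1) ^ card {j \<in> u. j < r} * msign (u - {r}) v"
      proof (cases "u \<inter> v = {}")
        case True
        thus ?thesis using msign_remove_left[OF fin 1] cun
          by (simp add: minus_one_power_iff)
      next
        case False
        thus ?thesis using 1 by (auto simp: msign_def)
      qed
      moreover have "u \<union> v - {r} = u - {r} \<union> v" using 1 by auto
      ultimately show ?thesis unfolding L R1 R2 using 1 by simp
    next
      case 2
      have "(-1) ^ card {j \<in> u \<union> v. j < r} * msign u v = (-1) ^ card u * (-1) ^ card {j \<in> v. j < r} * msign u (v - {r})"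
      proof (cases "u \<inter> v = {}")
        case True
        thus ?thesis using msign_remove_right[OF fin 2] cun card_split_at[OF fin(1), of r] 2
          by (simp add: minus_one_power_iff)
      next
        case False
        thus ?thesis using 2 by (auto simp: msign_def)
      qed
      moreover have "u \<union> v - {r} = u \<union> (v - {r})" using 2 by auto
      ultimately show ?thesis unfolding L R1 R2 using 2 by simp
    next
      \<comment> \<open>Here x_r divides both factors, so their product is 0 and the two terms on
        the right have to cancel. The extra sign comes from \<open>card u\<close> counting r
        itself.\<close>
      case 3
      have "msign u v = 0" using 3 by (auto simp: msign_def)
      moreover have "msign (u - {r}) v = msign (u - {r}) (v - {r}) * (-1) ^ card {j \<in> u - {r}. r < j}"
        by (rule msign_remove_right) (use fin 3 in auto)
      moreover have "{j \<in> u - {r}. r < j} = {j \<in> u. r < j}" by auto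
      moreover have "msign u (v - {r}) = msign (u - {r}) (v - {r}) * (-1) ^ card {j \<in> v - {r}. j < r}"
        by (rule msign_remove_left) (use fin 3 in auto)
      moreover have "{j \<in> v - {r}. j < r} = {j \<in> v. j < r}" by auto
      moreover have "card u = Suc (card {j\<in>u. j < r} + card {j\<in>u. r < j})"
        using card_split_at[OF fin(1), of r] fin 3 by (metis card.remove)
      ultimately have "(-1) ^ card u * (-1) ^ card {j \<in> v. j < r} * msign u (v - {r})
          = - ((-1) ^ card {j \<in> u. j < r} * msign (u - {r}) v)"
        by (simp add: minus_one_power_iff)
      moreover have "u - {r} \<union> v = u \<union> (v - {r})" using 3 by auto
      ultimately show ?thesis unfolding L R1 R2 using 3 \<open>msign u v = 0\<close>
        by (simp flip: single_add distrib_left)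
    next
      case 4
      thus ?thesis unfolding L R1 R2 by simp
    qed
    thus ?case .
  qed (auto simp: mul_add_right mul_sc_right pd_add pd_sc sc_add)
qed (auto simp: mul_add_left mul_sc_left pd_add pd_sc sc_add par_twist_add par_twist_sc)

lemma mul_pd:
  assumes "hom q f" "g \<in> AC" "r \<in> EE"
  shows "pd r (f \<odot> g) = pd r f \<odot> g + sc ((-1) ^ (tt r * q)) (f \<odot> pd r g)"
  using assms hom_AC[OF assms(1)] by (auto simp: EE_cases mul_pd_even mul_pd_odd par_twist_hom mul_sc_left)

section \<open>The Lie algebra of even fields\<close>

lemma hom_mul:
  assumes "hom q f" "hom q' g"
  shows "hom ((q + q') mod 2) (f \<odot> g)"
  unfolding Ahom_def
proof (intro conjI allI impI)
  fix \<gamma> w assume "(f \<odot> g) (\<gamma>, w) \<noteq> 0"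
  then obtain a b where ab: "a \<in> AB" "b \<in> AB" "f a * g b * amul_basis p m n t a b (\<gamma>, w) \<noteq> 0"
    unfolding amul_def sum_fun_apply sc_apply by (metis (no_types, lifting) sum.neutral)
  obtain \<alpha> u \<beta> v where e: "a = (\<alpha>, u)" "b = (\<beta>, v)" by (cases a; cases b) auto
  have "msign u v \<noteq> 0" "w = u \<union> v"
    using ab(3) unfolding e amul_basis_eq single_apply by (auto split: if_splits)
  hence "u \<inter> v = {}" by (auto simp: msign_def split: if_splits)
  hence "card w = card u + card v"
    using \<open>w = u \<union> v\<close> ab AB_finite e by (auto simp: card_Un_disjoint)
  moreover have "card u mod 2 = q" "card v mod 2 = q'"
    using ab(3) assms by (auto simp: e Ahom_def)
  ultimately show "card w mod 2 = (q + q') mod 2"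
    using mod_add_eq[of "card u" 2 "card v"] by simp
qed simp

lemma hom_pd:
  assumes "hom q f" "r \<in> EE"
  shows "hom ((q + tt r) mod 2) (pd r f)"
  unfolding Ahom_def
proof (intro conjI allI impI)
  fix \<alpha> u assume a: "pd r f (\<alpha>, u) \<noteq> 0"
  show "card u mod 2 = (q + tt r) mod 2"
  proof (cases "r \<in> E0")
    case True
    thus ?thesis
      using a assms(1) by (force simp: pd_even_apply Ahom_def)
  next
    case False
    hence r: "r \<in> E1" using assms by (auto simp: EE_cases)
    hence *: "r \<notin> u" "f (\<alpha>, insert r u) \<noteq> 0"
      using a assms(1) by (auto simp: pd_odd_apply hom_AC split: if_splits)
    hence "(\<alpha>, insert r u) \<in> AB" using assms(1) hom_AC by (auto simp: Acarrier_def)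
    hence "finite u" using AB_finite[of \<alpha> "insert r u"] by simp
    have "card (insert r u) mod 2 = q" using * assms(1) by (auto simp: Ahom_def)
    hence "q = Suc (card u) mod 2" using * \<open>finite u\<close> by simp
    thus ?thesis using r by (simp add: mod_Suc)
  qed
qed simp

lemma hom_add: "hom q f \<Longrightarrow> hom q g \<Longrightarrow> hom q (f + g)"
  unfolding Ahom_def by (auto simp: pointwise) (metis add.right_neutral)

lemma hom_sc: "hom q f \<Longrightarrow> hom q (sc c f)"
  unfolding Ahom_def by (auto simp: pointwise)

lemma hom_0 [simp]: "hom q 0"
  by (auto simp: Ahom_def pointwise)

lemma hom_minus: "hom q f \<Longrightarrow> hom q (- f)"
  using hom_sc[of q f "-1"] by (simp add: sc_minus_left)

lemma hom_diff: "hom q f \<Longrightarrow> hom q g \<Longrightarrow> hom q (f - g)"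
  using hom_add[of q f "- g"] by (simp add: hom_minus)

lemma hom_sum: "(\<And>a. a \<in> A \<Longrightarrow> hom q (f a)) \<Longrightarrow> hom q (\<Sum>a\<in>A. f a)"
  by (induction A rule: infinite_finite_induct) (auto intro: hom_add)

lemma hom_single: "(\<alpha>, u) \<in> AB \<Longrightarrow> hom (card u mod 2) (single (\<alpha>, u) c)"
  by (auto simp: Ahom_def single_apply)

definition coef :: "nat \<Rightarrow> 'a wel \<Rightarrow> 'a ael" where
  "coef r X = (\<lambda>(\<alpha>, u). X (\<alpha>, u, r))"

lemma coef_apply: "coef r X (\<alpha>, u) = X (\<alpha>, u, r)"
  by (simp add: coef_def)

lemma coef_simps: "coef r (X + Z) = coef r X + coef r Z" "coef r (X - Z) = coef r X - coef r Z"
  "coef r (sc c X) = sc c (coef r X)" "coef r 0 = 0" "coef r (- X) = - coef r X"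
  by (auto simp: coef_def fun_eq_iff pointwise)

lemma coef_sum: "coef r (\<Sum>a\<in>A. f a) = (\<Sum>a\<in>A. coef r (f a))"
  by (auto simp: coef_def fun_eq_iff pointwise)

lemma coef_mkW: "coef s (mkW f r) = (if s = r then f else 0)"
  by (auto simp: coef_def mkW_def fun_eq_iff pointwise)

lemma W0_WC: "X \<in> W0 \<Longrightarrow> X \<in> WC"
  by (simp add: Weven_def)

lemma coef_AC [simp]: "X \<in> WC \<Longrightarrow> coef r X \<in> AC"
  by (auto simp: Wcarrier_def Acarrier_def coef_apply Wbasis_def)

lemma coef_hom: "X \<in> W0 \<Longrightarrow> hom (tt r) (coef r X)"
  unfolding Ahom_def
proof (intro conjI allI impI)
  fix \<alpha> u assume X: "X \<in> W0" "coef r X (\<alpha>, u) \<noteq> 0"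
  hence "even (card u + tt r)" by (auto simp: Weven_def coef_apply)
  thus "card u mod 2 = tt r"
    using tt_le[of r] by presburger
qed (simp add: W0_WC)

lemma WC_eqI:
  assumes "X \<in> WC" "Z \<in> WC" "\<And>s. s \<in> EE \<Longrightarrow> coef s X = coef s Z"
  shows "X = Z"
proof
  fix b :: "(nat \<Rightarrow> nat) \<times> nat set \<times> nat"
  obtain \<alpha> u r where b: "b = (\<alpha>, u, r)" by (cases b) auto
  show "X b = Z b"
  proof (cases "r \<in> EE")
    case True
    thus ?thesis using fun_cong[OF assms(3)[OF True], of "(\<alpha>, u)"] by (simp add: b coef_apply)
  next
    case False
    hence "b \<notin> WB" by (simp add: b Wbasis_def)
    thus ?thesis using assms(1,2) unfolding Wcarrier_def by (metis (mono_tags, lifting) mem_Collect_eq)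
  qed
qed

lemma W0I:
  assumes "\<And>s. s \<in> EE \<Longrightarrow> hom (tt s) (coef s X)" "\<And>s. s \<notin> EE \<Longrightarrow> coef s X = 0"
  shows "X \<in> W0"
proof -
  have 1: "(\<alpha>, u) \<in> AB \<and> r \<in> EE \<and> even (card u + tt r)" if "X (\<alpha>, u, r) \<noteq> 0" for \<alpha> u r
  proof -
    have ne: "coef r X (\<alpha>, u) \<noteq> 0" using that by (simp add: coef_apply)
    hence r: "r \<in> EE" using assms(2)[of r] by (metis zero_fun_apply)
    from assms(1)[OF this] ne have "(\<alpha>, u) \<in> AB" "card u mod 2 = tt r"
      by (auto simp: Ahom_def Acarrier_def)
    moreover from this have "even (card u + tt r)"
      using tt_le[of r] by presburger
    ultimately show ?thesis using r by simp
  qed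
  have "X b = 0" if "b \<notin> WB" for b
    using 1 that by (cases b) (auto simp: Wbasis_def)
  thus ?thesis using 1 by (auto simp: Weven_def Wcarrier_def)
qed

lemma W0_iff:
  "X \<in> W0 \<longleftrightarrow> (\<forall>b. b \<notin> WB \<or> odd (card (fst (snd b)) + tt (snd (snd b))) \<longrightarrow> X b = 0)"
  unfolding Weven_def Wcarrier_def by (simp only: mem_Collect_eq split_paired_All fst_conv snd_conv) blast

lemma W0_simps [simp]:
  "0 \<in> W0" "X \<in> W0 \<Longrightarrow> Z \<in> W0 \<Longrightarrow> X + Z \<in> W0" "X \<in> W0 \<Longrightarrow> Z \<in> W0 \<Longrightarrow> X - Z \<in> W0"
  "X \<in> W0 \<Longrightarrow> sc c X \<in> W0" "X \<in> W0 \<Longrightarrow> - X \<in> W0"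
  by (auto simp: W0_iff pointwise)

lemma W0_sum: "(\<And>a. a \<in> A \<Longrightarrow> f a \<in> W0) \<Longrightarrow> (\<Sum>a\<in>A. f a) \<in> W0"
  by (induction A rule: infinite_finite_induct) auto

lemma mkW_W0: "hom (tt r) f \<Longrightarrow> r \<in> EE \<Longrightarrow> mkW f r \<in> W0"
  by (rule W0I) (auto simp: coef_mkW)

lemma mkW_simps: "mkW (f + g) r = mkW f r + mkW g r" "mkW (f - g) r = mkW f r - mkW g r"
   "mkW (sc c f) r = sc c (mkW f r)" "mkW 0 r = 0" "mkW (- f) r = - mkW f r"
  by (auto simp: mkW_def fun_eq_iff pointwise)

definition act :: "'a wel \<Rightarrow> 'a ael \<Rightarrow> 'a ael" where
  "act X f = (\<Sum>r\<in>EE. coef r X \<odot> pd r f)"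

lemma act_simps: "act X (f + g) = act X f + act X g" "act X (f - g) = act X f - act X g"
  "act X (sc c f) = sc c (act X f)" "act X 0 = 0"
  "act (X + Z) f = act X f + act Z f" "act (X - Z) f = act X f - act Z f"
  "act (sc c X) f = sc c (act X f)" "act 0 f = 0"
  by (auto simp: act_def pd_add pd_diff pd_sc mul_add_right mul_diff_right mul_sc_right coef_simps
     mul_add_left mul_diff_left mul_sc_left sum.distrib sum_subtractf sc_sum)

lemma act_sum: "act X (\<Sum>a\<in>A. f a) = (\<Sum>a\<in>A. act X (f a))"
  by (induction A rule: infinite_finite_induct) (auto simp: act_simps)

lemma act_mkW: "r \<in> EE \<Longrightarrow> act (mkW g r) f = g \<odot> pd r f"
  by (simp add: act_def coef_mkW if_distrib[of "\<lambda>x. x \<odot> _"] cong: if_cong)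

lemma act_hom:
  assumes "X \<in> W0" "hom q f"
  shows "hom q (act X f)"
  unfolding act_def
proof (rule hom_sum)
  fix r assume r: "r \<in> EE"
  show "hom q (coef r X \<odot> pd r f)"
  proof (cases "q < 2")
    case True
    have "hom ((tt r + (q + tt r) mod 2) mod 2) (coef r X \<odot> pd r f)"
      using hom_mul[OF coef_hom hom_pd] assms r by blast
    moreover have "(tt r + (q + tt r) mod 2) mod 2 = q"
      using True by presburger
    ultimately show ?thesis by simp
  next
    case False
    have "f (\<alpha>, u) = 0" for \<alpha> u
      using assms(2) False mod_less_divisor[of 2 "card u"] unfolding Ahom_def by (metis pos2)
    hence "f = 0" by (auto simp: fun_eq_iff pointwise)
    thus ?thesis by simp
  qed
qed

lemma sum_WB: "(\<Sum>a\<in>WB. F a) = (\<Sum>r\<in>EE. \<Sum>x\<in>AB. F (fst x, snd x, r))"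
proof -
  have "inj_on (\<lambda>((\<alpha>, u), r). (\<alpha>, u, r)) (AB \<times> EE)" by (auto simp: inj_on_def)
  hence "(\<Sum>a\<in>WB. F a) = (\<Sum>y\<in>AB \<times> EE. F (fst (fst y), snd (fst y), snd y))"
    unfolding WB_eq by (subst sum.reindex) (auto intro!: sum.cong)
  also have "\<dots> = (\<Sum>x\<in>AB. \<Sum>r\<in>EE. F (fst x, snd x, r))"
    by (subst sum.cartesian_product) (auto intro!: sum.cong)
  finally show ?thesis by (simp add: sum.swap[of _ AB])
qed

lemma br_bilinear:
  "br (X + X') Z = br X Z + br X' Z" "br X (Z + Z') = br X Z + br X Z'"
  "br (sc c X) Z = sc c (br X Z)" "br X (sc c Z) = sc c (br X Z)"
  by (auto simp: bracket_def pointwise algebra_simps sc_add_left sc_sum sum.distrib)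

lemma br_0 [simp]: "br 0 Z = 0" "br X 0 = 0"
  using br_bilinear(3)[of 0 0 Z] br_bilinear(4)[of X 0 0] by auto

lemma br_minus: "br (- X) Z = - br X Z" "br X (- Z) = - br X Z"
  using br_bilinear(3)[of "-1" X Z] br_bilinear(4)[of X "-1" Z] by (auto simp: sc_minus_left)

lemma br_diff: "br (X - X') Z = br X Z - br X' Z" "br X (Z - Z') = br X Z - br X Z'"
  using br_bilinear(1)[of X "- X'" Z] br_bilinear(2)[of X Z "- Z'"] by (auto simp: br_minus)

lemma br_sum: "br (\<Sum>a\<in>A. f a) Z = (\<Sum>a\<in>A. br (f a) Z)" "br X (\<Sum>a\<in>A. f a) = (\<Sum>a\<in>A. br X (f a))"
  by (induction A rule: infinite_finite_induct) (auto simp: br_bilinear)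

lemma coef_br_outside: "s \<notin> EE \<Longrightarrow> coef s (br X Z) = 0"
proof -
  assume s: "s \<notin> EE"
  have "coef s (brb p m n t a b) = 0" if "a \<in> WB" "b \<in> WB" for a b
    using that s by (cases a; cases b) (auto simp: brb_def Wbasis_def coef_simps coef_mkW)
  thus ?thesis unfolding bracket_def coef_sum coef_simps by simp
qed

lemma act_expand:
  assumes "X \<in> WC" "f \<in> AC"
  shows "act X f = (\<Sum>r\<in>EE. \<Sum>x\<in>AB. \<Sum>y\<in>AB. sc (coef r X x * f y) (single x 1 \<odot> pd r (single y 1)))"
proof -
  have "coef r X \<odot> pd r f = (\<Sum>x\<in>AB. \<Sum>y\<in>AB. sc (coef r X x * f y) (single x 1 \<odot> pd r (single y 1)))" for r
  proof -
    have "coef r X \<odot> pd r f = (\<Sum>x\<in>AB. sc (coef r X x) (single x 1)) \<odot> pd r (\<Sum>y\<in>AB. sc (f y) (single y 1))"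
      using AC_expand[OF coef_AC[OF assms(1)], of r, symmetric] AC_expand[OF assms(2), symmetric] by (simp only:)
    also have "\<dots> = (\<Sum>x\<in>AB. sc (coef r X x) (single x 1) \<odot> pd r (\<Sum>y\<in>AB. sc (f y) (single y 1)))"
      by (rule mul_sum_left)
    also have "\<dots> = (\<Sum>x\<in>AB. \<Sum>y\<in>AB. sc (coef r X x * f y) (single x 1 \<odot> pd r (single y 1)))"
      by (simp only: pd_sum pd_sc mul_sum_right mul_sc_left mul_sc_right sc_simps(4) mult.commute)
    finally show ?thesis .
  qed
  thus ?thesis by (simp add: act_def)
qed

text \<open>For even fields the sign in \<open>brb\<close> is +1 on every pair of terms that occurs,
  so the superbracket reduces to the ordinary commutator of vector fields. All later bracket
  computations go through this formula.\<close>

lemma coef_br: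
  assumes "X \<in> W0" "Z \<in> W0" "s \<in> EE"
  shows "coef s (br X Z) = act X (coef s Z) - act Z (coef s X)"
proof -
  let ?e = "\<lambda>x. single x 1 :: 'a ael"
  define U where "U r x s' y = (if s' = s then ?e x \<odot> pd r (?e y) else 0)" for r x s' y
  have trm: "coef s (sc (X (fst x, snd x, r) * Z (fst y, snd y, s')) (brb p m n t (fst x, snd x, r) (fst y, snd y, s')))
     = sc (coef r X x * coef s' Z y) (U r x s' y) - sc (coef r X x * coef s' Z y) (U s' y r x)" for r x s' y
  proof (cases "X (fst x, snd x, r) = 0 \<or> Z (fst y, snd y, s') = 0")
    case True
    thus ?thesis by (cases x; cases y) (auto simp: coef_apply coef_simps)
  next
    case False
    hence "even (card (snd x) + tt r)" using assms by (auto simp: Weven_def)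
    hence "(-1 :: 'a) ^ ((card (snd x) + tt r) * (card (snd y) + tt s')) = 1" by simp
    thus ?thesis
      by (cases x; cases y) (simp add: brb_def coef_simps coef_mkW U_def coef_apply sc_diff)
  qed
  have "coef s (br X Z) = (\<Sum>r\<in>EE. \<Sum>x\<in>AB. \<Sum>s'\<in>EE. \<Sum>y\<in>AB.
      sc (coef r X x * coef s' Z y) (U r x s' y) - sc (coef r X x * coef s' Z y) (U s' y r x))"
    unfolding bracket_def sum_WB coef_sum trm ..
  also have "\<dots> = (\<Sum>r\<in>EE. \<Sum>x\<in>AB. \<Sum>s'\<in>EE. \<Sum>y\<in>AB. sc (coef r X x * coef s' Z y) (U r x s' y))
      - (\<Sum>r\<in>EE. \<Sum>x\<in>AB. \<Sum>s'\<in>EE. \<Sum>y\<in>AB. sc (coef r X x * coef s' Z y) (U s' y r x))"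
    by (simp only: sum_subtractf)
  also have "(\<Sum>r\<in>EE. \<Sum>x\<in>AB. \<Sum>s'\<in>EE. \<Sum>y\<in>AB. sc (coef r X x * coef s' Z y) (U r x s' y)) = act X (coef s Z)"
  proof -
    have "(\<Sum>s'\<in>EE. \<Sum>y\<in>AB. sc (coef r X x * coef s' Z y) (U r x s' y))
       = (\<Sum>s'\<in>EE. if s' = s then \<Sum>y\<in>AB. sc (coef r X x * coef s Z y) (?e x \<odot> pd r (?e y)) else 0)" for r x
      by (rule sum.cong) (auto simp: U_def)
    thus ?thesis using assms by (simp add: act_expand W0_WC)
  qed
  also have "(\<Sum>r\<in>EE. \<Sum>x\<in>AB. \<Sum>s'\<in>EE. \<Sum>y\<in>AB. sc (coef r X x * coef s' Z y) (U s' y r x)) = act Z (coef s X)"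
  proof -
    have "(\<Sum>r\<in>EE. \<Sum>x\<in>AB. \<Sum>s'\<in>EE. \<Sum>y\<in>AB. sc (coef r X x * coef s' Z y) (U s' y r x))
        = (\<Sum>r\<in>EE. if r = s then \<Sum>x\<in>AB. \<Sum>s'\<in>EE. \<Sum>y\<in>AB. sc (coef s X x * coef s' Z y) (?e y \<odot> pd s' (?e x)) else 0)"
      by (rule sum.cong) (auto simp: U_def)
    also have "\<dots> = (\<Sum>x\<in>AB. \<Sum>s'\<in>EE. \<Sum>y\<in>AB. sc (coef s' Z y * coef s X x) (?e y \<odot> pd s' (?e x)))"
      using assms by (simp add: mult.commute)
    also have "\<dots> = (\<Sum>s'\<in>EE. \<Sum>x\<in>AB. \<Sum>y\<in>AB. sc (coef s' Z y * coef s X x) (?e y \<odot> pd s' (?e x)))"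
      by (rule sum.swap)
    also have "\<dots> = (\<Sum>s'\<in>EE. \<Sum>y\<in>AB. \<Sum>x\<in>AB. sc (coef s' Z y * coef s X x) (?e y \<odot> pd s' (?e x)))"
      by (intro sum.cong refl sum.swap)
    finally show ?thesis using assms by (simp add: act_expand W0_WC)
  qed
  finally show ?thesis .
qed

lemma br_W0 [simp]:
  assumes "X \<in> W0" "Z \<in> W0"
  shows "br X Z \<in> W0"
  by (rule W0I) (use assms in \<open>auto simp: coef_br coef_br_outside intro!: hom_diff act_hom coef_hom\<close>)

lemma br_anti: "X \<in> W0 \<Longrightarrow> Z \<in> W0 \<Longrightarrow> br X Z = - br Z X"
  by (rule WC_eqI) (auto simp: W0_WC coef_br coef_simps)

text \<open>The coefficient of D_r in an even field has the parity of D_r. Moving it past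
  \<open>f\<close> costs exactly the sign that the product rule for D_r introduced, so even fields
  act as derivations without signs.\<close>

lemma act_mul:
  assumes "X \<in> W0" "hom q f" "g \<in> AC"
  shows "act X (f \<odot> g) = act X f \<odot> g + f \<odot> act X g"
proof -
  have "coef r X \<odot> pd r (f \<odot> g) = (coef r X \<odot> pd r f) \<odot> g + f \<odot> (coef r X \<odot> pd r g)" if r: "r \<in> EE" for r
  proof -
    note AC = hom_AC[OF assms(2)] assms(3) coef_AC[OF W0_WC[OF assms(1)]]
    have "coef r X \<odot> f = sc ((-1) ^ (tt r * q)) (f \<odot> coef r X)"
      using mul_commute[OF coef_hom[OF assms(1)] assms(2)] .
    hence "sc ((-1) ^ (tt r * q)) (coef r X \<odot> (f \<odot> pd r g)) = f \<odot> (coef r X \<odot> pd r g)"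
      using AC by (simp add: mul_assoc[symmetric] mul_sc_left minus_one_power_iff)
    thus ?thesis
      using AC mul_pd[OF assms(2,3) r] by (simp add: mul_add_right mul_sc_right mul_assoc)
  qed
  thus ?thesis by (simp add: act_def sum.distrib mul_sum_left mul_sum_right)
qed

text \<open>The second-order terms cancel: exchanging the two coefficients and exchanging D_r with
  D_s produce the same sign, so the double sum is symmetric in the two fields.\<close>

lemma act_br:
  assumes "X \<in> W0" "Z \<in> W0" "f \<in> AC"
  shows "act (br X Z) f = act X (act Z f) - act Z (act X f)"
proof -
  have XZ: "act X (act Z f) = (\<Sum>r\<in>EE. act X (coef r Z) \<odot> pd r f)
      + (\<Sum>r\<in>EE. \<Sum>s\<in>EE. coef r Z \<odot> (coef s X \<odot> pd s (pd r f)))" if "X \<in> W0" "Z \<in> W0" for X Z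
  proof -
    have "act X (act Z f) = (\<Sum>r\<in>EE. act X (coef r Z \<odot> pd r f))"
      unfolding act_def[of Z] act_sum ..
    also have "\<dots> = (\<Sum>r\<in>EE. act X (coef r Z) \<odot> pd r f + coef r Z \<odot> act X (pd r f))"
      by (intro sum.cong refl act_mul[OF that(1) coef_hom[OF that(2)]]) simp
    finally show ?thesis
      by (simp add: sum.distrib act_def[of X "pd _ f"] mul_sum_right)
  qed
  have "(\<Sum>r\<in>EE. \<Sum>s\<in>EE. coef r Z \<odot> (coef s X \<odot> pd s (pd r f)))
      = (\<Sum>r\<in>EE. \<Sum>s\<in>EE. coef s X \<odot> (coef r Z \<odot> pd r (pd s f)))"
  proof (intro sum.cong refl)
    fix r s assume rs: "r \<in> EE" "s \<in> EE"
    note AC = assms(3) coef_AC[OF W0_WC[OF assms(1)]] coef_AC[OF W0_WC[OF assms(2)]]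
    have "coef r Z \<odot> coef s X = sc ((-1) ^ (tt r * tt s)) (coef s X \<odot> coef r Z)"
      by (rule mul_commute) (use assms coef_hom in auto)
    moreover have "pd s (pd r f) = sc ((-1) ^ (tt s * tt r)) (pd r (pd s f))"
      by (rule pd_commute) (use assms rs in auto)
    ultimately show "coef r Z \<odot> (coef s X \<odot> pd s (pd r f)) = coef s X \<odot> (coef r Z \<odot> pd r (pd s f))"
      using AC by (simp add: mul_assoc[symmetric] mul_sc_left mul_sc_right minus_one_power_iff)
  qed
  also have "\<dots> = (\<Sum>s\<in>EE. \<Sum>r\<in>EE. coef s X \<odot> (coef r Z \<odot> pd r (pd s f)))"
    by (rule sum.swap)
  finally have sym: "(\<Sum>r\<in>EE. \<Sum>s\<in>EE. coef r Z \<odot> (coef s X \<odot> pd s (pd r f)))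
      = (\<Sum>s\<in>EE. \<Sum>r\<in>EE. coef s X \<odot> (coef r Z \<odot> pd r (pd s f)))" .
  have "act (br X Z) f = (\<Sum>r\<in>EE. (act X (coef r Z) - act Z (coef r X)) \<odot> pd r f)"
    unfolding act_def[of "br X Z"] using assms by (intro sum.cong refl) (simp add: coef_br)
  thus ?thesis
    unfolding XZ[OF assms(1,2)] XZ[OF assms(2,1)] sym by (simp add: mul_diff_left sum_subtractf)
qed

lemma jacobi:
  assumes "X \<in> W0" "V \<in> W0" "Z \<in> W0"
  shows "br X (br V Z) = br (br X V) Z + br V (br X Z)"
proof (rule WC_eqI)
  fix s assume "s \<in> EE"
  thus "coef s (br X (br V Z)) = coef s (br (br X V) Z + br V (br X Z))"
    using assms by (simp add: coef_br coef_simps act_br act_simps W0_WC)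
qed (use assms W0_WC in auto)

section \<open>The even part of S: generators, divergence and closure under the bracket\<close>

definition even_part :: "'a wel \<Rightarrow> 'a wel" where
  "even_part X = (\<lambda>(\<alpha>, u, r). if even (card u + tt r) then X (\<alpha>, u, r) else 0)"

lemma even_part_simps: "even_part (X + Z) = even_part X + even_part Z" "even_part (sc c X) = sc c (even_part X)" "even_part 0 = 0" "X \<in> W0 \<Longrightarrow> even_part X = X"
  by (auto simp: even_part_def fun_eq_iff pointwise Weven_def)

abbreviation DD :: "nat \<Rightarrow> nat \<Rightarrow> nat \<Rightarrow> 'a ael \<Rightarrow> 'a wel" where "DD \<equiv> Drs p m n t"

lemma DD_simps: "DD r s q (f + g) = DD r s q f + DD r s q g" "DD r s q (sc c f) = sc c (DD r s q f)"
  "DD r s q 0 = 0" "DD r s q (- f) = - DD r s q f" "DD r s q (f - g) = DD r s q f - DD r s q g"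
  by (auto simp: Drs_def pd_add pd_sc pd_diff pd_minus mkW_simps sc_add sc_diff sc_minus mult.commute)

lemma DD_sum: "DD r s q (\<Sum>a\<in>A. f a) = (\<Sum>a\<in>A. DD r s q (f a))"
  by (induction A rule: infinite_finite_induct) (auto simp: DD_simps)

lemma coef_DD: "coef s' (DD r s q f) = sc ((-1) ^ (tt r * tt s)) (if s' = s then pd r f else 0)
   - sc ((-1) ^ ((tt r + tt s) * q)) (if s' = r then pd s f else 0)"
  by (simp add: Drs_def coef_simps coef_mkW)

lemma DD_W0:
  assumes "r \<in> EE" "s \<in> EE" "hom q f" "q < 2" "even (q + tt r + tt s)"
  shows "DD r s q f \<in> W0"
proof -
  have "(q + tt r) mod 2 = tt s" "(q + tt s) mod 2 = tt r"
    using assms(4,5) tt_le[of r] tt_le[of s] by (auto; presburger)+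
  hence "hom (tt s) (pd r f)" "hom (tt r) (pd s f)"
    using hom_pd[OF assms(3)] assms(1,2) by metis+
  thus ?thesis
    using assms unfolding Drs_def by (intro W0_simps mkW_W0) auto
qed

lemma even_part_DD_odd:
  assumes "r \<in> EE" "s \<in> EE" "hom q f" "q < 2" "odd (q + tt r + tt s)"
  shows "even_part (DD r s q f) = 0"
proof -
  have h: "hom ((q + tt r) mod 2) (pd r f)" "hom ((q + tt s) mod 2) (pd s f)"
    using hom_pd[OF assms(3)] assms(1,2) by auto
  have "pd r f (\<alpha>, u) = 0" if "even (card u + tt s)" for \<alpha> u
  proof (rule ccontr)
    assume "pd r f (\<alpha>, u) \<noteq> 0"
    hence "card u mod 2 = (q + tt r) mod 2" using h(1) by (simp add: Ahom_def)
    thus False using that assms(5) by presburger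
  qed
  moreover have "pd s f (\<alpha>, u) = 0" if "even (card u + tt r)" for \<alpha> u
  proof (rule ccontr)
    assume "pd s f (\<alpha>, u) \<noteq> 0"
    hence "card u mod 2 = (q + tt s) mod 2" using h(2) by (simp add: Ahom_def)
    thus False using that assms(5) by presburger
  qed
  ultimately show ?thesis
    by (auto simp: even_part_def Drs_def fun_eq_iff pointwise mkW_def)
qed

abbreviation gen :: "nat \<Rightarrow> nat \<Rightarrow> (nat \<Rightarrow> nat) \<Rightarrow> nat set \<Rightarrow> 'a wel" where
  "gen r s \<beta> u \<equiv> DD r s (card u mod 2) (single (\<beta>, u) 1)"

definition gens :: "'a wel set" where
  "gens = {gen r s \<beta> u | r s \<beta> u. r \<in> EE \<and> s \<in> EE \<and> (\<beta>, u) \<in> AB \<and> even (card u + tt r + tt s)}"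

lemma gen_S0:
  assumes "r \<in> EE" "s \<in> EE" "(\<beta>, u) \<in> AB" "even (card u + tt r + tt s)"
  shows "gen r s \<beta> u \<in> S0"
proof -
  have "even (card u mod 2 + tt r + tt s)" using assms(4) by presburger
  hence "gen r s \<beta> u \<in> W0"
    using assms by (intro DD_W0 hom_single) auto
  moreover have "gen r s \<beta> u \<in> Scarrier p m n t"
    unfolding Scarrier_def using assms hom_single[OF assms(3)]
    by (intro sc_module.span_base CollectI exI[of _ r] exI[of _ s] exI[of _ "card u mod 2"] exI[of _ "single (\<beta>, u) 1"]) simp
  ultimately show ?thesis by (simp add: Seven_def)
qed

lemma S0_W0: "X \<in> S0 \<Longrightarrow> X \<in> W0"
  by (simp add: Seven_def)

lemma subspace_S0: "sc_module.subspace S0"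
  unfolding sc_module.subspace_def Seven_def Scarrier_def
  by (auto intro: sc_module.span_add sc_module.span_scale sc_module.span_zero)

text \<open>Projecting a combination of the D_rs(f) onto even fields either keeps or kills each
  term, because f is homogeneous; a term that is kept is expanded over the monomials of f.\<close>

lemma S0_eq_span: "S0 = sc_module.span gens"
proof
  show "sc_module.span gens \<subseteq> S0"
    by (rule sc_module.span_minimal[OF _ subspace_S0]) (use gen_S0 in \<open>unfold gens_def, blast\<close>)
  have "even_part X \<in> sc_module.span gens" if "X \<in> Scarrier p m n t" for X
    using that unfolding Scarrier_def
  proof (induction rule: sc_module.span_induct_alt)
    case base
    show ?case by (simp add: even_part_simps sc_module.span_zero)
  next
    case (step c x y)
    then obtain r s q f where x: "x = DD r s q f" "r \<in> EE" "s \<in> EE" "q < 2" "hom q f" by auto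
    have "even_part x \<in> sc_module.span gens"
    proof (cases "even (q + tt r + tt s)")
      case False
      thus ?thesis using x even_part_DD_odd[of r s q f] by (simp add: sc_module.span_zero)
    next
      case True
      have "DD r s q f = (\<Sum>a\<in>AB. sc (f a) (DD r s q (single a 1)))"
        using x by (subst AC_expand[of f]) (auto simp: hom_AC DD_sum DD_simps simp del: sc_single)
      also have "\<dots> \<in> sc_module.span gens"
      proof (rule sc_module.span_sum)
        fix a assume a: "a \<in> AB"
        obtain \<beta> u where e: "a = (\<beta>, u)" by (cases a)
        show "sc (f a) (DD r s q (single a 1)) \<in> sc_module.span gens"
        proof (cases "f a = 0")
          case False
          hence "card u mod 2 = q" using x by (auto simp: Ahom_def e)
          moreover from this True have "even (card u + tt r + tt s)" by presburger
          ultimately show ?thesis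
            using x a by (intro sc_module.span_scale sc_module.span_base) (auto simp: gens_def e)
        qed (simp add: sc_module.span_zero)
      qed
      finally show ?thesis using x DD_W0[of r s q f] True by (simp add: even_part_simps)
    qed
    thus ?case using step by (simp add: even_part_simps sc_module.span_add sc_module.span_scale)
  qed
  thus "S0 \<subseteq> sc_module.span gens"
    by (auto simp: Seven_def) (metis even_part_simps(4))
qed

lemma DD_S0:
  assumes "r \<in> EE" "s \<in> EE" "hom q f" "q < 2" "even (q + tt r + tt s)"
  shows "DD r s q f \<in> S0"
  unfolding Seven_def Scarrier_def using assms DD_W0[OF assms]
  by (auto intro!: sc_module.span_base)

text \<open>The superdivergence of an even field. The sign is the one for D_r passing its own
  coefficient, which has the parity of D_r; with it all D_rs(f) become divergence free.\<close>

definition divg :: "'a wel \<Rightarrow> 'a ael" where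
  "divg X = (\<Sum>r\<in>EE. sc ((-1) ^ tt r) (pd r (coef r X)))"

lemma divg_DD:
  assumes "r \<in> EE" "s \<in> EE" "f \<in> AC" "even (q + tt r + tt s)"
  shows "divg (DD r s q f) = 0"
proof -
  have "divg (DD r s q f) = (\<Sum>s'\<in>EE. if s' = s then sc ((-1) ^ tt s * (-1) ^ (tt r * tt s)) (pd s (pd r f)) else 0)
     - (\<Sum>s'\<in>EE. if s' = r then sc ((-1) ^ tt r * (-1) ^ ((tt r + tt s) * q)) (pd r (pd s f)) else 0)"
    unfolding divg_def sum_subtractf[symmetric]
    by (intro sum.cong refl) (auto simp: coef_DD pd_diff pd_sc sc_diff)
  also have "\<dots> = sc ((-1) ^ tt s * (-1) ^ (tt r * tt s)) (pd s (pd r f)) - sc ((-1) ^ tt r * (-1) ^ ((tt r + tt s) * q)) (pd r (pd s f))"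
    using assms by simp
  also have "pd r (pd s f) = sc ((-1) ^ (tt r * tt s)) (pd s (pd r f))"
    by (rule pd_commute) (use assms in auto)
  finally show ?thesis
    using assms(4) tt_le[of r] tt_le[of s] by (auto simp: minus_one_power_iff)
qed

lemma divg_S0: "X \<in> S0 \<Longrightarrow> divg X = 0"
  unfolding S0_eq_span
proof (induction rule: sc_module.span_induct_alt)
  case base
  show ?case by (simp add: divg_def coef_simps)
next
  case (step c x y)
  then obtain r s \<beta> u where x: "x = gen r s \<beta> u" "r \<in> EE" "s \<in> EE" "(\<beta>, u) \<in> AB" "even (card u + tt r + tt s)"
    by (auto simp: gens_def)
  hence "even (card u mod 2 + tt r + tt s)" by presburger
  hence "divg x = 0" using x divg_DD by simp
  moreover have "divg (sc c x + y) = sc c (divg x) + divg y"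
    by (simp add: divg_def coef_simps pd_add pd_sc sc_sum sum.distrib sc_add mult.commute)
  ultimately show ?case using step by simp
qed

lemma two_neq_0: "(2::'a) \<noteq> 0"
proof
  assume "(2::'a) = 0"
  hence "of_nat 2 = (0::'a)" by simp
  hence "p dvd 2" unfolding p_char of_nat_eq_0_iff_char_dvd .
  thus False using p_gt_3 by (auto dest: dvd_imp_le)
qed

text \<open>The product rule turns the right side into divg(X) g + X(g). It presents the
  coefficients of a bracket as sums of derivatives, as needed for a curl.\<close>

lemma act_div_free:
  assumes "X \<in> W0" "divg X = 0" "g \<in> AC"
  shows "act X g = (\<Sum>r\<in>EE. sc ((-1) ^ tt r) (pd r (coef r X \<odot> g)))"
proof -
  have "sc ((-1) ^ tt r) (pd r (coef r X \<odot> g)) = sc ((-1) ^ tt r) (pd r (coef r X)) \<odot> g + coef r X \<odot> pd r g"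
    if "r \<in> EE" for r
    using mul_pd[OF coef_hom[OF assms(1)] assms(3) that] tt_le[of r]
    by (auto simp: sc_add mul_sc_left)
  hence "(\<Sum>r\<in>EE. sc ((-1) ^ tt r) (pd r (coef r X \<odot> g))) = divg X \<odot> g + act X g"
    by (simp add: sum.distrib divg_def act_def mul_sum_left)
  thus ?thesis using assms(2) by simp
qed

text \<open>The bracket of two divergence-free fields is a curl:
  it equals half the sum of the \<open>D\<^sub>r\<^sub>s(X\<^sub>r Z\<^sub>s - Z\<^sub>r X\<^sub>s)\<close> up to signs.\<close>

lemma br_S0:
  assumes "X \<in> S0" "Z \<in> S0"
  shows "br X Z \<in> S0"
proof -
  note W = S0_W0[OF assms(1)] S0_W0[OF assms(2)]
  define c where "c r s = coef r X \<odot> coef s Z - coef r Z \<odot> coef s X" for r s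
  define q where "q r s = (tt r + tt s) mod 2" for r s
  have hc: "hom (q r s) (c r s)" for r s
    unfolding c_def q_def by (intro hom_diff hom_mul coef_hom W)
  have cAC: "c r s \<in> AC" for r s by (simp add: c_def)
  \<comment> \<open>This super-antisymmetry makes the two halves of each curl contribute equally;
    hence the factor 2, which is invertible.\<close>
  have anti: "c s r = - sc ((-1) ^ (tt r * tt s)) (c r s)" for r s
    using mul_commute[OF coef_hom[OF W(1)] coef_hom[OF W(2)], of s r]
      mul_commute[OF coef_hom[OF W(2)] coef_hom[OF W(1)], of s r]
    by (simp add: c_def sc_diff mult.commute)
  define R where "R = (\<Sum>r\<in>EE. \<Sum>s\<in>EE. sc ((-1) ^ (tt r + tt r * tt s)) (DD r s (q r s) (c r s)))"
  have R: "R \<in> S0"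
    unfolding R_def using subspace_S0 hc
    by (intro sc_module.subspace_sum[OF subspace_S0] sc_module.subspace_scale[OF subspace_S0] DD_S0) (auto simp: q_def)
  have "sc 2 (br X Z) = R"
  proof (rule WC_eqI)
    fix s assume s: "s \<in> EE"
    have "coef s (br X Z) = (\<Sum>r\<in>EE. sc ((-1) ^ tt r) (pd r (c r s)))"
      using s W assms by (simp add: coef_br act_div_free divg_S0 W0_WC c_def pd_diff sc_diff sum_subtractf)
    moreover have "coef s R = (\<Sum>r\<in>EE. sc ((-1) ^ tt r) (pd r (c r s))) + (\<Sum>r\<in>EE. sc ((-1) ^ tt r) (pd r (c r s)))"
    proof -
      have "coef s R = (\<Sum>r\<in>EE. \<Sum>s'\<in>EE. (if s' = s then sc ((-1) ^ tt r) (pd r (c r s)) else 0)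
           - (if r = s then sc ((-1) ^ (tt s + tt s * tt s') * (-1) ^ ((tt s + tt s') * q s s')) (pd s' (c s s')) else 0))"
        unfolding R_def coef_sum coef_simps
        by (intro sum.cong refl) (use tt_le in \<open>auto simp: coef_DD sc_diff minus_one_power_iff\<close>)
      also have "\<dots> = (\<Sum>r\<in>EE. sc ((-1) ^ tt r) (pd r (c r s)))
          - (\<Sum>r\<in>EE. if r = s then \<Sum>s'\<in>EE. sc ((-1) ^ (tt s + tt s * tt s') * (-1) ^ ((tt s + tt s') * q s s')) (pd s' (c s s')) else 0)"
      proof -
        have *: "(\<Sum>s'\<in>EE. if r = s then g s' else 0) = (if r = s then \<Sum>s'\<in>EE. g s' else 0)" for r and g :: "nat \<Rightarrow> 'a ael"
          by simp
        show ?thesis using s by (simp add: sum_subtractf *)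
      qed
      also have "(\<Sum>r\<in>EE. if r = s then \<Sum>s'\<in>EE. sc ((-1) ^ (tt s + tt s * tt s') * (-1) ^ ((tt s + tt s') * q s s')) (pd s' (c s s')) else 0)
         = (\<Sum>s'\<in>EE. sc ((-1) ^ (tt s + tt s * tt s') * (-1) ^ ((tt s + tt s') * q s s')) (pd s' (c s s')))"
        using s by simp
      also have "\<dots> = (\<Sum>r\<in>EE. - sc ((-1) ^ tt r) (pd r (c r s)))"
      proof (intro sum.cong refl)
        fix r assume "r \<in> EE"
        show "sc ((-1) ^ (tt s + tt s * tt r) * (-1) ^ ((tt s + tt r) * q s r)) (pd r (c s r)) = - sc ((-1) ^ tt r) (pd r (c r s))"
          using tt_le[of r] tt_le[of s] unfolding anti[of s r]
          by (auto simp: q_def pd_minus pd_sc sc_minus sc_minus_left)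
      qed
      finally show ?thesis by (simp only: sum_negf diff_minus_eq_add)
    qed
    moreover have "sc 2 f = f + f" for f :: "'a ael"
      unfolding fun_eq_iff sc_apply plus_fun_apply mult_2 by (rule allI refl)+
    ultimately show "coef s (sc 2 (br X Z)) = coef s R" by (simp only: coef_simps)
  qed (use W R S0_W0 W0_WC in auto)
  hence "br X Z = sc (1/2) R"
    using two_neq_0 by (metis (no_types, lifting) sc_simps(3,4) divide_self_if times_divide_eq_left mult_1)
  thus ?thesis using sc_module.subspace_scale[OF subspace_S0 R] by simp
qed

section \<open>Degrees, torus and homogeneous derivations\<close>

abbreviation ep :: "nat \<Rightarrow> nat \<Rightarrow> int" where "ep r \<equiv> (\<lambda>i. if i = r then 1 else 0)"

definition adeg :: "(nat \<Rightarrow> nat) \<times> nat set \<Rightarrow> nat \<Rightarrow> int" where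
  "adeg a = (\<lambda>i. int (fst a i) + (if i \<in> snd a then 1 else 0))"

text \<open>The derivation index counts as -1. The values are integers: modulo p, the weight of a
  p^e-th power of ad D_i could not be told from 0.\<close>

definition wdeg :: "(nat \<Rightarrow> nat) \<times> nat set \<times> nat \<Rightarrow> nat \<Rightarrow> int" where
  "wdeg b = (\<lambda>i. int (fst b i) + (if i \<in> fst (snd b) then 1 else 0) - (if i = snd (snd b) then 1 else 0))"

lemma wdeg_adeg: "wdeg (\<alpha>, u, r) = adeg (\<alpha>, u) - ep r"
  by (auto simp: wdeg_def adeg_def fun_eq_iff pointwise)

definition Ad :: "(nat \<Rightarrow> int) \<Rightarrow> 'a ael \<Rightarrow> bool" where
  "Ad \<nu> f \<longleftrightarrow> f \<in> AC \<and> (\<forall>a. f a \<noteq> 0 \<longrightarrow> adeg a = \<nu>)"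

definition Wd :: "(nat \<Rightarrow> int) \<Rightarrow> 'a wel set" where
  "Wd \<mu> = {X \<in> W0. \<forall>b. X b \<noteq> 0 \<longrightarrow> wdeg b = \<mu>}"

lemma Wd_W0: "X \<in> Wd \<mu> \<Longrightarrow> X \<in> W0"
  by (simp add: Wd_def)

lemma WdD: "X \<in> Wd \<mu> \<Longrightarrow> X b \<noteq> 0 \<Longrightarrow> wdeg b = \<mu>"
  unfolding Wd_def by blast

lemma AdD: "Ad \<nu> f \<Longrightarrow> f a \<noteq> 0 \<Longrightarrow> adeg a = \<nu>"
  unfolding Ad_def by blast

lemma W0_supp: "X \<in> W0 \<Longrightarrow> X b \<noteq> 0 \<Longrightarrow> b \<in> WB"
  unfolding W0_iff by blast

lemma Ad_AC: "Ad \<nu> f \<Longrightarrow> f \<in> AC"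
  by (simp add: Ad_def)

lemma Ad_simps: "Ad \<nu> 0" "Ad \<nu> f \<Longrightarrow> Ad \<nu> g \<Longrightarrow> Ad \<nu> (f + g)" "Ad \<nu> f \<Longrightarrow> Ad \<nu> (sc c f)"
  "Ad \<nu> f \<Longrightarrow> Ad \<nu> g \<Longrightarrow> Ad \<nu> (f - g)"
  unfolding Ad_def by (auto simp: pointwise) (metis add.right_neutral, metis diff_0_right)

lemma Ad_minus: "Ad \<nu> f \<Longrightarrow> Ad \<nu> (- f)"
  using Ad_simps(3)[of \<nu> f "-1"] by (simp add: sc_minus_left)

lemma Ad_sum: "(\<And>a. a \<in> A \<Longrightarrow> Ad \<nu> (f a)) \<Longrightarrow> Ad \<nu> (\<Sum>a\<in>A. f a)"
  by (induction A rule: infinite_finite_induct) (auto intro: Ad_simps)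

lemma Ad_single: "a \<in> AB \<Longrightarrow> Ad (adeg a) (single a c)"
  by (auto simp: Ad_def single_apply)

lemma Ad_mul:
  assumes "Ad \<mu> f" "Ad \<nu> g"
  shows "Ad (\<mu> + \<nu>) (f \<odot> g)"
  unfolding Ad_def
proof (intro conjI allI impI)
  fix c assume "(f \<odot> g) c \<noteq> 0"
  then obtain a b where ab: "a \<in> AB" "b \<in> AB" "f a * g b * amul_basis p m n t a b c \<noteq> 0"
    unfolding amul_def sum_fun_apply sc_apply by (metis (no_types, lifting) sum.neutral)
  obtain \<alpha> u \<beta> v where e: "a = (\<alpha>, u)" "b = (\<beta>, v)" by (cases a; cases b) auto
  have "msign u v \<noteq> 0" "c = (\<lambda>i. \<alpha> i + \<beta> i, u \<union> v)"
    using ab(3) unfolding e amul_basis_eq single_apply by (auto split: if_splits)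
  hence "u \<inter> v = {}" by (auto simp: msign_def split: if_splits)
  hence "adeg c = adeg a + adeg b"
    using \<open>c = _\<close> by (auto simp: adeg_def e fun_eq_iff pointwise)
  moreover have "adeg a = \<mu>" "adeg b = \<nu>"
    using ab(3) assms unfolding Ad_def by (metis mult_zero_left mult_zero_right)+
  ultimately show "adeg c = \<mu> + \<nu>" by simp
qed simp

lemma Ad_pd:
  assumes "Ad \<nu> f" "r \<in> EE"
  shows "Ad (\<nu> - ep r) (pd r f)"
  unfolding Ad_def
proof (intro conjI allI impI)
  fix a assume a: "pd r f a \<noteq> 0"
  obtain \<alpha> u where e: "a = (\<alpha>, u)" by (cases a)
  show "adeg a = \<nu> - ep r"
  proof (cases "r \<in> E0")
    case True
    hence "f (\<alpha>(r := Suc (\<alpha> r)), u) \<noteq> 0"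
      using a e assms by (simp add: pd_even_apply Ad_AC)
    hence "adeg (\<alpha>(r := Suc (\<alpha> r)), u) = \<nu>" using assms by (simp add: Ad_def)
    thus ?thesis by (auto simp: adeg_def e fun_eq_iff pointwise split: if_splits)
  next
    case False
    hence "f (\<alpha>, insert r u) \<noteq> 0" "r \<notin> u"
      using a e assms by (auto simp: pd_odd_apply EE_cases Ad_AC split: if_splits)
    hence "adeg (\<alpha>, insert r u) = \<nu>" using assms by (simp add: Ad_def)
    thus ?thesis using \<open>r \<notin> u\<close> by (auto simp: adeg_def e fun_eq_iff pointwise split: if_splits)
  qed
qed simp

lemma Wd_coef: "X \<in> Wd \<mu> \<Longrightarrow> Ad (\<mu> + ep r) (coef r X)"
proof -
  assume X: "X \<in> Wd \<mu>"
  have "adeg a = \<mu> + ep r" if "coef r X a \<noteq> 0" for a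
  proof -
    obtain \<alpha> u where a: "a = (\<alpha>, u)" by (cases a)
    hence "wdeg (\<alpha>, u, r) = \<mu>" using X that by (auto simp: Wd_def coef_apply)
    hence "adeg a - ep r + ep r = \<mu> + ep r" by (simp only: wdeg_adeg a)
    thus ?thesis by simp
  qed
  thus ?thesis using X by (auto simp: Ad_def Wd_W0 W0_WC)
qed

lemma WdI:
  assumes "X \<in> W0" "\<And>r. r \<in> EE \<Longrightarrow> Ad (\<mu> + ep r) (coef r X)"
  shows "X \<in> Wd \<mu>"
proof -
  have "wdeg b = \<mu>" if "X b \<noteq> 0" for b
  proof -
    obtain \<alpha> u r where b: "b = (\<alpha>, u, r)" by (cases b)
    have "b \<in> WB" using that assms(1) unfolding W0_iff by metis
    hence "Ad (\<mu> + ep r) (coef r X)" using assms(2) b by (auto simp: Wbasis_def)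
    hence "adeg (\<alpha>, u) = \<mu> + ep r" using that by (auto simp: Ad_def coef_apply b)
    thus ?thesis by (simp add: b wdeg_adeg)
  qed
  thus ?thesis using assms(1) by (simp add: Wd_def)
qed

lemma act_Ad:
  assumes "X \<in> Wd \<mu>" "Ad \<nu> f"
  shows "Ad (\<mu> + \<nu>) (act X f)"
  unfolding act_def
proof (rule Ad_sum)
  fix r assume "r \<in> EE"
  hence "Ad (\<mu> + ep r + (\<nu> - ep r)) (coef r X \<odot> pd r f)"
    using assms by (intro Ad_mul Wd_coef Ad_pd)
  thus "Ad (\<mu> + \<nu>) (coef r X \<odot> pd r f)" by (simp add: algebra_simps)
qed

lemma br_Wd:
  assumes "X \<in> Wd \<mu>" "Z \<in> Wd \<nu>"
  shows "br X Z \<in> Wd (\<mu> + \<nu>)"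
proof (rule WdI)
  fix s assume s: "s \<in> EE"
  have "Ad (\<mu> + (\<nu> + ep s)) (act X (coef s Z))" "Ad (\<nu> + (\<mu> + ep s)) (act Z (coef s X))"
    using assms by (auto intro!: act_Ad Wd_coef)
  hence "Ad (\<mu> + \<nu> + ep s) (act X (coef s Z))" "Ad (\<mu> + \<nu> + ep s) (act Z (coef s X))"
    by (simp_all add: algebra_simps)
  thus "Ad (\<mu> + \<nu> + ep s) (coef s (br X Z))"
    using assms s by (simp add: coef_br Wd_W0 Ad_simps)
qed (use assms Wd_W0 in auto)

lemma Wd_simps: "0 \<in> Wd \<mu>" "X \<in> Wd \<mu> \<Longrightarrow> Z \<in> Wd \<mu> \<Longrightarrow> X + Z \<in> Wd \<mu>" "X \<in> Wd \<mu> \<Longrightarrow> sc c X \<in> Wd \<mu>"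
  "X \<in> Wd \<mu> \<Longrightarrow> Z \<in> Wd \<mu> \<Longrightarrow> X - Z \<in> Wd \<mu>"
  unfolding Wd_def by (auto simp: pointwise) (metis add.right_neutral, metis diff_0_right)

section \<open>The unit, the variables and the torus\<close>

definition one :: "'a ael" where "one = single (\<lambda>_. 0, {}) 1"

lemma zero_AB: "(\<lambda>_. 0, {}) \<in> AB"
  by (auto simp: Abasis_def)

lemma tbinom_0: "b \<le> pm i \<Longrightarrow> tbinom i 0 b = 1"
  by (simp add: tbinom_def)

lemma msign_empty: "msign {} u = 1" "msign u {} = 1"
  by (auto simp: msign_def)

lemma AB_le: "(\<alpha>, u) \<in> AB \<Longrightarrow> i \<in> E0 \<Longrightarrow> \<alpha> i \<le> pm i"
  by (simp add: Abasis_def)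

lemma one_mul: "f \<in> AC \<Longrightarrow> one \<odot> f = f"
proof (induction f rule: AC_induct)
  case (single a)
  obtain \<alpha> u where "a = (\<alpha>, u)" by (cases a)
  moreover have "(\<Prod>i\<in>E0. tbinom i 0 (\<alpha> i)) = 1"
    using single AB_le[of \<alpha> u] \<open>a = _\<close> by (intro prod.neutral) (auto simp: tbinom_0)
  ultimately show ?case
    using single zero_AB by (simp add: one_def mul_e msign_empty)
qed (auto simp: mul_add_right mul_sc_right)

lemma one_hom: "hom 0 one"
  using hom_single[OF zero_AB, of 1] by (simp add: one_def)

lemma mul_one: "f \<in> AC \<Longrightarrow> f \<odot> one = f"
proof (induction f rule: AC_induct)
  case (single a)
  obtain \<alpha> u where a: "a = (\<alpha>, u)" by (cases a)
  have "single a 1 \<odot> one = one \<odot> single a 1"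
    using mul_commute[OF hom_single one_hom, of \<alpha> u 1] single a by simp
  thus ?case using single by (simp add: one_mul)
qed (auto simp: mul_add_left mul_sc_left)

lemma pd_one: "pd r one = 0"
  using zero_AB by (auto simp: one_def pd_single Dbasis_def)

lemma Dvec_mkW: "Dvec i = mkW one i"
  by (auto simp: Dvec_def mkW_def one_def single_apply fun_eq_iff)

lemma Dvec_W0: "i \<in> E0 \<Longrightarrow> Dvec i \<in> W0"
  unfolding Dvec_mkW by (rule mkW_W0) (auto simp: one_hom EE_cases)

lemma act_one: "act X one = 0"
  by (simp add: act_def pd_one)

lemma coef_br_Dvec: "X \<in> W0 \<Longrightarrow> i \<in> E0 \<Longrightarrow> s \<in> EE \<Longrightarrow> coef s (br (Dvec i) X) = pd i (coef s X)"
  by (simp add: coef_br Dvec_W0)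
     (auto simp: Dvec_mkW coef_mkW act_mkW EE_cases one_mul act_simps act_one)

lemma br_Dvec:
  assumes "X \<in> W0" "i \<in> E0"
  shows "br (Dvec i) X (\<alpha>, u, r) = X (\<alpha>(i := Suc (\<alpha> i)), u, r)"
proof (cases "r \<in> EE")
  case True
  have "coef r (br (Dvec i) X) (\<alpha>, u) = pd i (coef r X) (\<alpha>, u)"
    using assms True by (simp add: coef_br_Dvec)
  thus ?thesis using assms by (simp add: coef_apply pd_even_apply W0_WC)
next
  case False
  have "br (Dvec i) X \<in> WC" "X \<in> WC" using assms by (auto simp: W0_WC Dvec_W0)
  thus ?thesis using False by (auto simp: Wcarrier_def Wbasis_def)
qed

definition gvar :: "nat \<Rightarrow> 'a ael" where
  "gvar r = (if r \<le> m then single (\<lambda>i. if i = r then 1 else 0, {}) 1 else single (\<lambda>_. 0, {r}) 1)"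

lemma pm_ge: "i \<in> E0 \<Longrightarrow> 4 \<le> pm i"
proof -
  assume i: "i \<in> E0"
  hence "t i \<ge> 1" using t_ge_1 by blast
  have "p \<noteq> 4" using p_prime prime_nat_not_dvd[of 4 2] by auto
  hence "p \<ge> 5" using p_gt_3 by simp
  moreover have "p ^ 1 \<le> p ^ t i" using \<open>t i \<ge> 1\<close> \<open>p \<ge> 5\<close> by (intro power_increasing) auto
  ultimately show ?thesis by simp
qed

lemma gvar_AB: "r \<in> E0 \<Longrightarrow> (\<lambda>i. if i = r then 1 else 0, {}) \<in> AB" "r \<in> E1 \<Longrightarrow> (\<lambda>_. 0, {r}) \<in> AB"
  using pm_ge[of r] by (auto simp: Abasis_def)

lemma gvar_hom: "r \<in> EE \<Longrightarrow> hom (tt r) (gvar r)"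
  using hom_single[OF gvar_AB(1), of r 1] hom_single[OF gvar_AB(2), of r 1]
  by (auto simp: EE_cases gvar_def Y0_le Y1_gt)

lemma gvar_AC: "r \<in> EE \<Longrightarrow> gvar r \<in> AC"
  using hom_AC[OF gvar_hom] .

lemma gvar_Ad: "r \<in> EE \<Longrightarrow> Ad (ep r) (gvar r)"
proof -
  assume r: "r \<in> EE"
  have "adeg (\<lambda>i. if i = r then 1 else 0, {}) = ep r" "adeg (\<lambda>_. 0, {r}) = ep r"
    by (auto simp: adeg_def fun_eq_iff)
  thus ?thesis
    using Ad_single[OF gvar_AB(1), of r 1] Ad_single[OF gvar_AB(2), of r 1] r
    by (auto simp: EE_cases gvar_def Y0_le Y1_gt)
qed

lemma pd_gvar: "r \<in> EE \<Longrightarrow> s \<in> EE \<Longrightarrow> pd s (gvar r) = (if s = r then one else 0)"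
proof -
  assume rs: "r \<in> EE" "s \<in> EE"
  have "(\<lambda>i. if i = r then 1 else 0)(r := 0) = (\<lambda>i. 0::nat)" by auto
  moreover have e: "{j. j = r \<and> j < r} = {}" by auto
  ultimately show ?thesis
    using rs gvar_AB[of r] Y0_le Y1_gt
    by (auto simp: EE_cases gvar_def pd_single Dbasis_def one_def e)
qed

text \<open>The field x_r D_r is an Euler operator: in divided powers x_r times x_r^(b-1) is b
  x_r^(b), and in an odd variable the sign of removing x_r is undone by putting it back in
  front.\<close>

lemma gvar_pd_single:
  assumes "(\<beta>, u) \<in> AB" "r \<in> EE"
  shows "gvar r \<odot> pd r (single (\<beta>, u) 1) = sc (of_int (adeg (\<beta>, u) r)) (single (\<beta>, u) 1)"
proof (cases "r \<in> E0")
  case True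
  have ru: "r \<notin> u" using True assms Y_disj by (auto simp: Abasis_def)
  have le: "\<beta> r \<le> pm r" using AB_le[OF assms(1) True] .
  show ?thesis
  proof (cases "\<beta> r > 0")
    case pos: True
    have B: "(\<beta>(r := \<beta> r - 1), u) \<in> AB" using assms(1) le by (auto simp: Abasis_def)
    have "(\<Prod>i\<in>E0. tbinom i (if i = r then 1 else 0) ((\<beta>(r := \<beta> r - 1)) i)) = tbinom r 1 (\<beta> r - 1) * (\<Prod>i\<in>E0-{r}. tbinom i 0 (\<beta> i))"
      using True by (subst prod.remove[of _ r]) (auto intro!: prod.cong)
    also have "(\<Prod>i\<in>E0-{r}. tbinom i 0 (\<beta> i)) = 1"
      using AB_le[OF assms(1)] by (intro prod.neutral) (auto simp: tbinom_0)
    also have "tbinom r 1 (\<beta> r - 1) = of_nat (\<beta> r)"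
      using le pos by (simp add: tbinom_def)
    finally have "(\<Prod>i\<in>E0. tbinom i (if i = r then 1 else 0) ((\<beta>(r := \<beta> r - 1)) i)) = of_nat (\<beta> r)" by simp
    moreover have "(\<lambda>i. (if i = r then 1 else 0) + (\<beta>(r := \<beta> r - 1)) i) = \<beta>" using pos by auto
    ultimately show ?thesis
      using True assms B ru gvar_AB(1)[of r] Y0_le[OF True] pos
      by (simp add: gvar_def pd_single Dbasis_def mul_e msign_empty adeg_def del: fun_upd_apply)
  next
    case False
    thus ?thesis using True assms Y0_le[OF True] ru
      by (simp add: pd_single Dbasis_def adeg_def)
  qed
next
  case False
  hence r: "r \<in> E1" using assms(2) by (simp add: EE_cases)
  hence "\<beta> r = 0" using assms Y_disj by (auto simp: Abasis_def)
  show ?thesis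
  proof (cases "r \<in> u")
    case True
    have B: "(\<beta>, u - {r}) \<in> AB" using assms by (auto simp: Abasis_def)
    have "(\<Prod>i\<in>E0. tbinom i 0 (\<beta> i)) = 1"
      using AB_le[OF assms(1)] by (intro prod.neutral) (auto simp: tbinom_0)
    moreover have "{j \<in> u - {r}. j < r} = {j\<in>u. j < r}" by auto
    moreover have "msign {r} (u - {r}) = (-1) ^ card {j \<in> u - {r}. j < r}"
      using AB_finite[OF assms(1)] by (intro msign_singleton_left) auto
    ultimately show ?thesis
      using r True assms B gvar_AB(2)[of r] Y1_gt[OF r] \<open>\<beta> r = 0\<close>
      by (simp add: gvar_def pd_single Dbasis_def mul_e adeg_def insert_absorb)
  next
    case False
    thus ?thesis using r assms Y1_gt[OF r] \<open>\<beta> r = 0\<close>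
      by (simp add: pd_single Dbasis_def adeg_def)
  qed
qed

lemma gvar_pd:
  assumes "Ad \<nu> f" "r \<in> EE"
  shows "gvar r \<odot> pd r f = sc (of_int (\<nu> r)) f"
proof -
  have f: "f \<in> AC" using assms by (simp add: Ad_def)
  have "gvar r \<odot> pd r f = gvar r \<odot> pd r (\<Sum>a\<in>AB. sc (f a) (single a 1))"
    by (simp only: AC_expand[OF f, symmetric])
  also have "\<dots> = (\<Sum>a\<in>AB. sc (f a) (gvar r \<odot> pd r (single a 1)))"
    by (simp only: pd_sum mul_sum_right pd_sc mul_sc_right)
  also have "\<dots> = (\<Sum>a\<in>AB. sc (of_int (\<nu> r)) (sc (f a) (single a 1)))"
  proof (intro sum.cong refl)
    fix a assume a: "a \<in> AB"
    have "gvar r \<odot> pd r (single a 1) = sc (of_int (adeg a r)) (single a 1)"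
      using gvar_pd_single[of "fst a" "snd a" r] a assms by simp
    thus "sc (f a) (gvar r \<odot> pd r (single a 1)) = sc (of_int (\<nu> r)) (sc (f a) (single a 1))"
      using AdD[OF assms(1), of a] by (cases "f a = 0") (auto simp: mult.commute)
  qed
  also have "\<dots> = sc (of_int (\<nu> r)) f"
    by (simp only: sc_sum[symmetric] AC_expand[OF f, symmetric])
  finally show ?thesis .
qed

text \<open>The full diagonal torus of W is included. Only suitable combinations lie in S, but in
  weight zero the whole of it is needed to absorb the eigenvalues of a derivation.\<close>

definition torus :: "(nat \<Rightarrow> 'a) \<Rightarrow> 'a wel" where
  "torus b = (\<Sum>r\<in>EE. mkW (sc (b r) (gvar r)) r)"

lemma coef_torus: "s \<in> EE \<Longrightarrow> coef s (torus b) = sc (b s) (gvar s)"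
proof -
  assume s: "s \<in> EE"
  have "coef s (torus b) = (\<Sum>r\<in>EE. if s = r then sc (b s) (gvar s) else 0)"
    unfolding torus_def coef_sum coef_mkW by (intro sum.cong) auto
  thus ?thesis using s by simp
qed

lemma torus_Wd: "torus b \<in> Wd 0"
proof (rule WdI)
  show "torus b \<in> W0"
    unfolding torus_def by (intro W0_sum mkW_W0 hom_sc gvar_hom)
  show "Ad (0 + ep r) (coef r (torus b))" if "r \<in> EE" for r
    using that by (simp add: coef_torus Ad_simps gvar_Ad)
qed

lemma torus_W0: "torus b \<in> W0"
  using torus_Wd by (rule Wd_W0)

lemma act_torus: "Ad \<nu> f \<Longrightarrow> act (torus b) f = sc (\<Sum>r\<in>EE. b r * of_int (\<nu> r)) f"
proof -
  assume f: "Ad \<nu> f"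
  have "act (torus b) f = (\<Sum>r\<in>EE. sc (b r * of_int (\<nu> r)) f)"
    unfolding act_def by (intro sum.cong refl) (simp add: coef_torus mul_sc_left gvar_pd[OF f])
  thus ?thesis by (simp add: sc_sum_left)
qed

lemma br_torus:
  assumes "X \<in> Wd \<mu>"
  shows "br (torus b) X = sc (\<Sum>r\<in>EE. b r * of_int (\<mu> r)) X"
proof (rule WC_eqI)
  fix s assume s: "s \<in> EE"
  have "act X (gvar s) = coef s X"
  proof -
    have "act X (gvar s) = (\<Sum>r\<in>EE. if r = s then coef s X else 0)"
      unfolding act_def using s assms
      by (intro sum.cong refl) (auto simp: pd_gvar mul_one W0_WC Wd_W0)
    thus ?thesis using s by simp
  qed
  moreover have "(\<Sum>r\<in>EE. b r * of_int ((\<mu> + ep s) r)) = (\<Sum>r\<in>EE. b r * of_int (\<mu> r)) + b s"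
  proof -
    have "(\<Sum>r\<in>EE. b r * of_int ((\<mu> + ep s) r)) = (\<Sum>r\<in>EE. b r * of_int (\<mu> r) + (if r = s then b s else 0))"
      by (intro sum.cong) (auto simp: pointwise algebra_simps)
    thus ?thesis using s by (simp add: sum.distrib)
  qed
  ultimately show "coef s (br (torus b) X) = coef s (sc (\<Sum>r\<in>EE. b r * of_int (\<mu> r)) X)"
    using s assms by (simp add: coef_br torus_W0 Wd_W0 coef_torus act_simps act_torus[OF Wd_coef] coef_simps sc_add_left)
qed (use assms torus_W0 in \<open>auto simp: W0_WC Wd_W0\<close>)

definition deg_part :: "(nat \<Rightarrow> int) \<Rightarrow> 'a wel \<Rightarrow> 'a wel" where
  "deg_part \<mu> X = (\<lambda>b. if wdeg b = \<mu> then X b else 0)"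

lemma deg_part_simps: "deg_part \<mu> (X + Z) = deg_part \<mu> X + deg_part \<mu> Z" "deg_part \<mu> (X - Z) = deg_part \<mu> X - deg_part \<mu> Z"
  "deg_part \<mu> (sc c X) = sc c (deg_part \<mu> X)" "deg_part \<mu> 0 = 0"
  by (auto simp: deg_part_def fun_eq_iff pointwise)

lemma deg_part_sum: "deg_part \<mu> (\<Sum>a\<in>A. f a) = (\<Sum>a\<in>A. deg_part \<mu> (f a))"
  by (induction A rule: infinite_finite_induct) (auto simp: deg_part_simps)

lemma deg_part_Wd: "X \<in> W0 \<Longrightarrow> deg_part \<mu> X \<in> Wd \<mu>"
  by (auto simp: Wd_def deg_part_def W0_iff)

lemma deg_part_W0: "X \<in> W0 \<Longrightarrow> deg_part \<mu> X \<in> W0"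
  using deg_part_Wd Wd_W0 by blast

lemma deg_part_of_Wd: "X \<in> Wd \<nu> \<Longrightarrow> deg_part \<mu> X = (if \<nu> = \<mu> then X else 0)"
proof
  assume X: "X \<in> Wd \<nu>"
  fix b show "deg_part \<mu> X b = (if \<nu> = \<mu> then X else 0) b"
    using WdD[OF X, of b] by (cases "X b = 0") (auto simp: deg_part_def pointwise)
qed

definition degrees :: "(nat \<Rightarrow> int) set" where "degrees = wdeg ` WB"

lemma finite_degrees [simp]: "finite degrees"
  by (simp add: degrees_def)

lemma sum_deg_part:
  assumes "X \<in> W0" "finite M" "degrees \<subseteq> M"
  shows "(\<Sum>\<mu>\<in>M. deg_part \<mu> X) = X"
proof
  fix b
  have "(\<Sum>\<mu>\<in>M. deg_part \<mu> X) b = (if wdeg b \<in> M then X b else 0)"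
    using assms(2) by (simp add: sum_fun_apply deg_part_def)
  moreover have "wdeg b \<in> M" if "X b \<noteq> 0"
  proof -
    have "b \<in> WB" using that assms(1) unfolding W0_iff by metis
    thus ?thesis using assms(3) by (auto simp: degrees_def)
  qed
  ultimately show "(\<Sum>\<mu>\<in>M. deg_part \<mu> X) b = X b" by auto
qed

lemma gen_Wd:
  assumes "r \<in> EE" "s \<in> EE" "(\<beta>, u) \<in> AB" "even (card u + tt r + tt s)"
  shows "gen r s \<beta> u \<in> Wd (adeg (\<beta>, u) - ep r - ep s)"
proof (rule WdI)
  show "gen r s \<beta> u \<in> W0" using gen_S0[OF assms] S0_W0 by simp
  fix s' assume "s' \<in> EE"
  have "Ad (adeg (\<beta>, u) - ep r) (pd r (single (\<beta>, u) 1))" "Ad (adeg (\<beta>, u) - ep s) (pd s (single (\<beta>, u) 1))"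
    using assms by (auto intro!: Ad_pd Ad_single)
  thus "Ad (adeg (\<beta>, u) - ep r - ep s + ep s') (coef s' (gen r s \<beta> u))"
    by (auto simp: coef_DD intro!: Ad_simps Ad_minus)
qed

lemma deg_part_S0: "X \<in> S0 \<Longrightarrow> deg_part \<mu> X \<in> S0"
proof -
  assume "X \<in> S0"
  hence "X \<in> sc_module.span gens" by (simp add: S0_eq_span)
  thus ?thesis
  proof (induction rule: sc_module.span_induct_alt)
    case base
    show ?case using subspace_S0 by (simp add: deg_part_simps sc_module.subspace_0)
  next
    case (step c x y)
    then obtain r s \<beta> u where x: "x = gen r s \<beta> u" "r \<in> EE" "s \<in> EE" "(\<beta>, u) \<in> AB" "even (card u + tt r + tt s)"
      by (auto simp: gens_def)
    hence "deg_part \<mu> x \<in> S0"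
      using deg_part_of_Wd[OF gen_Wd[OF x(2-5)]] gen_S0 subspace_S0 by (auto simp: sc_module.subspace_0)
    thus ?case
      using step subspace_S0 by (auto simp: deg_part_simps intro!: sc_module.subspace_add sc_module.subspace_scale)
  qed
qed

lemma deg_part_br:
  assumes "X \<in> Wd \<mu>" "Z \<in> W0"
  shows "deg_part (\<mu> + \<kappa>) (br X Z) = br X (deg_part \<kappa> Z)"
proof -
  have "deg_part (\<mu> + \<kappa>) (br X Z) = deg_part (\<mu> + \<kappa>) (br X (\<Sum>\<nu>\<in>insert \<kappa> degrees. deg_part \<nu> Z))"
    by (simp only: sum_deg_part[OF assms(2) finite.insertI[OF finite_degrees] subset_insertI])
  also have "\<dots> = (\<Sum>\<nu>\<in>insert \<kappa> degrees. deg_part (\<mu> + \<kappa>) (br X (deg_part \<nu> Z)))"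
    unfolding br_sum deg_part_sum ..
  also have "\<dots> = (\<Sum>\<nu>\<in>insert \<kappa> degrees. if \<nu> = \<kappa> then br X (deg_part \<kappa> Z) else 0)"
    by (intro sum.cong refl) (auto simp: deg_part_of_Wd[OF br_Wd[OF assms(1) deg_part_Wd[OF assms(2)]]])
  also have "\<dots> = br X (deg_part \<kappa> Z)"
    by (subst sum.delta) auto
  finally show ?thesis .
qed

section \<open>Derivations into the even fields and their homogeneous parts\<close>

abbreviation DER :: "('a wel \<Rightarrow> 'a wel) set" where "DER \<equiv> Der S0 W0 sc br"

lemma DERD:
  assumes "D \<in> DER"
  shows "x \<in> S0 \<Longrightarrow> D x \<in> W0" "x \<in> S0 \<Longrightarrow> y \<in> S0 \<Longrightarrow> D (x + y) = D x + D y"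
    "x \<in> S0 \<Longrightarrow> D (sc c x) = sc c (D x)" "x \<in> S0 \<Longrightarrow> y \<in> S0 \<Longrightarrow> D (br x y) = br x (D y) - br y (D x)"
    "x \<notin> S0 \<Longrightarrow> D x = 0"
  using assms by (auto simp: Der_def)

lemma S0_simps: "0 \<in> S0" "x \<in> S0 \<Longrightarrow> y \<in> S0 \<Longrightarrow> x + y \<in> S0" "x \<in> S0 \<Longrightarrow> sc c x \<in> S0"
  "x \<in> S0 \<Longrightarrow> - x \<in> S0" "x \<in> S0 \<Longrightarrow> y \<in> S0 \<Longrightarrow> x - y \<in> S0"
  using subspace_S0 sc_module.subspace_neg[OF subspace_S0] sc_module.subspace_diff[OF subspace_S0]
  by (auto simp: sc_module.subspace_def)

lemma S0_sum: "(\<And>a. a \<in> A \<Longrightarrow> f a \<in> S0) \<Longrightarrow> (\<Sum>a\<in>A. f a) \<in> S0"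
  by (rule sc_module.subspace_sum[OF subspace_S0])

lemma DER_0: "D \<in> DER \<Longrightarrow> D 0 = 0"
  using DERD(3)[of D 0 0] S0_simps(1) by simp

lemma DER_minus: "D \<in> DER \<Longrightarrow> x \<in> S0 \<Longrightarrow> D (- x) = - D x"
  using DERD(3)[of D x "-1"] by (simp add: sc_minus_left)

lemma DER_diff: "D \<in> DER \<Longrightarrow> x \<in> S0 \<Longrightarrow> y \<in> S0 \<Longrightarrow> D (x - y) = D x - D y"
  using DERD(2)[of D x "- y"] by (simp add: DER_minus S0_simps)

lemma DER_sum: "D \<in> DER \<Longrightarrow> (\<And>a. a \<in> A \<Longrightarrow> f a \<in> S0) \<Longrightarrow> D (\<Sum>a\<in>A. f a) = (\<Sum>a\<in>A. D (f a))"
  by (induction A rule: infinite_finite_induct) (auto simp: DER_0 DERD(2) S0_sum)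

lemma DER_add: "D \<in> DER \<Longrightarrow> D' \<in> DER \<Longrightarrow> D + D' \<in> DER"
  unfolding Der_def by (auto simp: pointwise br_bilinear sc_add algebra_simps)

lemma DER_scale: "D \<in> DER \<Longrightarrow> (\<lambda>x. sc c (D x)) \<in> DER"
  unfolding Der_def by (auto simp: sc_add br_bilinear sc_diff mult.commute)

lemma restr_DER:
  assumes "\<And>x. x \<in> W0 \<Longrightarrow> F x \<in> W0" "\<And>x y. F (x + y) = F x + F y" "\<And>c x. F (sc c x) = sc c (F x)"
    "\<And>x y. x \<in> W0 \<Longrightarrow> y \<in> W0 \<Longrightarrow> F (br x y) = br (F x) y + br x (F y)"
  shows "restr S0 F \<in> DER"
proof -
  have "F (br x y) = br x (F y) - br y (F x)" if "x \<in> W0" "y \<in> W0" for x y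
    using assms(4)[OF that] br_anti[of "F x" y] assms(1) that by simp
  thus ?thesis
    using assms(1-3) unfolding Der_def restr_def by (auto simp: S0_W0 S0_simps br_S0)
qed

lemma ad_DER: "E \<in> W0 \<Longrightarrow> restr S0 (br E) \<in> DER"
  by (rule restr_DER) (simp_all add: br_bilinear jacobi[of E, symmetric])

lemma funpow_additive:
  assumes "\<And>x y. G (x + y) = G x + G y" "\<And>c x. G (sc c x) = sc c (G x)" "\<And>x. x \<in> W0 \<Longrightarrow> G x \<in> W0"
  shows "(G ^^ k) (x + y) = (G ^^ k) x + (G ^^ k) y" "(G ^^ k) (sc c x) = sc c ((G ^^ k) x)"
    "x \<in> W0 \<Longrightarrow> (G ^^ k) x \<in> W0"
  by (induction k) (auto simp: assms)

lemma leibniz_funpow: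
  fixes G :: "'a wel \<Rightarrow> 'a wel"
  assumes add: "\<And>x y. G (x + y) = G x + G y" and scl: "\<And>c x. G (sc c x) = sc c (G x)" and W: "\<And>x. x \<in> W0 \<Longrightarrow> G x \<in> W0"
    and der: "\<And>x y. x \<in> W0 \<Longrightarrow> y \<in> W0 \<Longrightarrow> G (br x y) = br (G x) y + br x (G y)"
    and xy: "x \<in> W0" "y \<in> W0"
  shows "(G ^^ k) (br x y) = (\<Sum>i\<le>k. sc (of_nat (k choose i)) (br ((G ^^ i) x) ((G ^^ (k - i)) y)))"
proof (induction k)
  case (Suc k)
  note cl = funpow_additive(3)[OF add scl W]
  have Gsum: "G (\<Sum>i\<in>A. f i) = (\<Sum>i\<in>A. G (f i))" for f :: "nat \<Rightarrow> 'a wel" and A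
    by (induction A rule: infinite_finite_induct) (use scl[of 0 0] in \<open>auto simp: add\<close>)
  let ?B = "\<lambda>i. br ((G ^^ i) x) ((G ^^ (Suc k - i)) y)"
  have "(G ^^ Suc k) (br x y) = (\<Sum>i\<le>k. sc (of_nat (k choose i)) (br ((G ^^ Suc i) x) ((G ^^ (k - i)) y) + br ((G ^^ i) x) ((G ^^ Suc (k - i)) y)))"
    using Suc xy by (simp add: Gsum scl der cl)
  also have "\<dots> = (\<Sum>i\<le>k. sc (of_nat (k choose i)) (?B (Suc i)) + sc (of_nat (k choose i)) (?B i))"
    by (intro sum.cong refl) (simp add: sc_add Suc_diff_le)
  also have "\<dots> = (\<Sum>i\<le>k. sc (of_nat (k choose i)) (?B (Suc i))) + (\<Sum>i\<le>k. sc (of_nat (k choose i)) (?B i))"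
    by (rule sum.distrib)
  also have "(\<Sum>i\<le>k. sc (of_nat (k choose i)) (?B i)) = (\<Sum>i\<le>Suc k. sc (of_nat (k choose i)) (?B i))"
    by (simp add: binomial_eq_0)
  also have "\<dots> = ?B 0 + (\<Sum>i\<le>k. sc (of_nat (k choose Suc i)) (?B (Suc i)))"
    by (subst sum.atMost_Suc_shift) simp
  also have "(\<Sum>i\<le>k. sc (of_nat (k choose i)) (?B (Suc i))) + (?B 0 + (\<Sum>i\<le>k. sc (of_nat (k choose Suc i)) (?B (Suc i))))
      = ?B 0 + (\<Sum>i\<le>k. sc (of_nat (k choose i)) (?B (Suc i)) + sc (of_nat (k choose Suc i)) (?B (Suc i)))"
    by (simp only: sum.distrib add.assoc add.left_commute)
  also have "\<dots> = ?B 0 + (\<Sum>i\<le>k. sc (of_nat (Suc k choose Suc i)) (?B (Suc i)))"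
    by (simp add: sc_add_left)
  also have "\<dots> = (\<Sum>i\<le>Suc k. sc (of_nat (Suc k choose i)) (?B i))"
    by (subst sum.atMost_Suc_shift) simp
  finally show ?case .
qed simp

text \<open>In characteristic p all middle terms of the Leibniz formula for a p^e-th power
  vanish.\<close>

lemma pow_DER:
  assumes "i \<in> E0"
  shows "restr S0 (br (Dvec i) ^^ (p ^ e)) \<in> DER"
proof (rule restr_DER)
  let ?G = "br (Dvec i)"
  note G = br_bilinear(2)[of "Dvec i"] br_bilinear(4)[of "Dvec i"] br_W0[OF Dvec_W0[OF assms]]
  show "(?G ^^ (p ^ e)) (x + y) = (?G ^^ (p ^ e)) x + (?G ^^ (p ^ e)) y" "(?G ^^ (p ^ e)) (sc c x) = sc c ((?G ^^ (p ^ e)) x)" for x y c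
    by (rule funpow_additive; use G in simp)+
  show "(?G ^^ (p ^ e)) x \<in> W0" if "x \<in> W0" for x
    by (rule funpow_additive; use G that in simp)
  fix x y assume xy: "x \<in> W0" "y \<in> W0"
  let ?T = "\<lambda>k. sc (of_nat (p ^ e choose k)) (br ((?G ^^ k) x) ((?G ^^ (p ^ e - k)) y))"
  have "(?G ^^ (p ^ e)) (br x y) = (\<Sum>k\<le>p ^ e. ?T k)"
    by (rule leibniz_funpow[OF G jacobi[OF Dvec_W0[OF assms]] xy])
  also have "\<dots> = (\<Sum>k\<in>{0, p ^ e}. ?T k)"
  proof (rule sum.mono_neutral_right)
    show "\<forall>k\<in>{..p ^ e} - {0, p ^ e}. ?T k = 0"
    proof
      fix k assume "k \<in> {..p ^ e} - {0, p ^ e}"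
      hence "p dvd (p ^ e choose k)" using p_prime by (intro prime_dvd_prime_power_choose) auto
      hence "of_nat (p ^ e choose k) = (0::'a)" using p_char by (simp add: of_nat_eq_0_iff_char_dvd)
      thus "?T k = 0" by simp
    qed
  qed auto
  also have "\<dots> = br ((?G ^^ (p ^ e)) x) y + br x ((?G ^^ (p ^ e)) y)"
    using p_gt_3 by (simp add: add.commute)
  finally show "(?G ^^ (p ^ e)) (br x y) = br ((?G ^^ (p ^ e)) x) y + br x ((?G ^^ (p ^ e)) y)" .
qed

definition has_degree :: "(nat \<Rightarrow> int) \<Rightarrow> ('a wel \<Rightarrow> 'a wel) \<Rightarrow> bool" where
  "has_degree \<xi> D \<longleftrightarrow> (\<forall>\<mu> x. x \<in> S0 \<and> x \<in> Wd \<mu> \<longrightarrow> D x \<in> Wd (\<mu> + \<xi>))"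

definition der_part :: "('a wel \<Rightarrow> 'a wel) \<Rightarrow> (nat \<Rightarrow> int) \<Rightarrow> 'a wel \<Rightarrow> 'a wel" where
  "der_part D \<xi> = restr S0 (\<lambda>x. \<Sum>\<mu>\<in>degrees. deg_part (\<mu> + \<xi>) (D (deg_part \<mu> x)))"

lemma Wd_nz_degrees: "x \<in> Wd \<mu> \<Longrightarrow> x \<noteq> 0 \<Longrightarrow> \<mu> \<in> degrees"
proof -
  assume x: "x \<in> Wd \<mu>" "x \<noteq> 0"
  then obtain b where "x b \<noteq> 0" by (auto simp: fun_eq_iff pointwise)
  hence "b \<in> WB" "wdeg b = \<mu>" using WdD[OF x(1)] W0_supp[OF Wd_W0[OF x(1)]] by blast+
  thus ?thesis by (auto simp: degrees_def)
qed

lemma der_part_homogeneous: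
  assumes "D \<in> DER" "x \<in> S0" "x \<in> Wd \<mu>"
  shows "der_part D \<xi> x = deg_part (\<mu> + \<xi>) (D x)"
proof -
  have "(\<Sum>\<nu>\<in>degrees. deg_part (\<nu> + \<xi>) (D (deg_part \<nu> x))) = (\<Sum>\<nu>\<in>degrees. if \<nu> = \<mu> then deg_part (\<mu> + \<xi>) (D x) else 0)"
    by (intro sum.cong refl) (auto simp: deg_part_of_Wd[OF assms(3)] DER_0[OF assms(1)] deg_part_simps)
  also have "\<dots> = deg_part (\<mu> + \<xi>) (D x)"
    using Wd_nz_degrees[OF assms(3)] by (cases "x = 0") (auto simp: DER_0[OF assms(1)] deg_part_simps)
  finally show ?thesis using assms by (simp add: der_part_def restr_def)
qed

text \<open>For homogeneous arguments the derivation rule for \<open>D\<close> is compared in one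
  fixed degree, where \<open>deg_part_br\<close> applies; bilinearity over the finitely many degrees
  extends it to all arguments.\<close>

lemma der_part_DER:
  assumes D: "D \<in> DER"
  shows "der_part D \<xi> \<in> DER"
proof -
  let ?C = "der_part D \<xi>"
  have W: "?C x \<in> W0" if "x \<in> S0" for x
    using that by (auto simp: der_part_def restr_def intro!: W0_sum deg_part_W0 DERD(1)[OF D] deg_part_S0)
  have add: "?C (x + y) = ?C x + ?C y" if "x \<in> S0" "y \<in> S0" for x y
    using that by (simp add: der_part_def restr_def S0_simps deg_part_simps DERD(2)[OF D] deg_part_S0 sum.distrib)
  have scl: "?C (sc c x) = sc c (?C x)" if "x \<in> S0" for x c
    using that by (simp add: der_part_def restr_def S0_simps deg_part_simps DERD(3)[OF D] deg_part_S0 sc_sum)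
  have out: "?C x = 0" if "x \<notin> S0" for x
    using that by (simp add: der_part_def restr_def)
  have C0: "?C 0 = 0" using scl[of 0 0] S0_simps(1) by simp
  have Csum: "?C (\<Sum>a\<in>A. f a) = (\<Sum>a\<in>A. ?C (f a))" if "\<And>a. a \<in> A \<Longrightarrow> f a \<in> S0" for A :: "(nat \<Rightarrow> int) set" and f
    using that by (induction A rule: infinite_finite_induct) (auto simp: C0 add S0_sum)
  have hom: "?C (br x y) = br x (?C y) - br y (?C x)" if xy: "x \<in> S0" "x \<in> Wd \<mu>" "y \<in> S0" "y \<in> Wd \<nu>" for x y \<mu> \<nu>
  proof -
    have "?C (br x y) = deg_part (\<mu> + \<nu> + \<xi>) (br x (D y) - br y (D x))"
      using der_part_homogeneous[OF D br_S0 br_Wd] xy DERD(4)[OF D] by simp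
    also have "\<dots> = deg_part (\<mu> + (\<nu> + \<xi>)) (br x (D y)) - deg_part (\<nu> + (\<mu> + \<xi>)) (br y (D x))"
      by (simp add: deg_part_simps add.assoc add.left_commute)
    also have "\<dots> = br x (?C y) - br y (?C x)"
      using xy by (simp add: deg_part_br DERD(1)[OF D] der_part_homogeneous[OF D])
    finally show ?thesis .
  qed
  have "?C (br x y) = br x (?C y) - br y (?C x)" if xy: "x \<in> S0" "y \<in> S0" for x y
  proof -
    have x: "(\<Sum>\<mu>\<in>degrees. deg_part \<mu> x) = x" and y: "(\<Sum>\<mu>\<in>degrees. deg_part \<mu> y) = y"
      using xy sum_deg_part S0_W0 by auto
    have Cx: "(\<Sum>\<mu>\<in>degrees. ?C (deg_part \<mu> x)) = ?C x" and Cy: "(\<Sum>\<mu>\<in>degrees. ?C (deg_part \<mu> y)) = ?C y"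
      using Csum[of degrees "\<lambda>\<mu>. deg_part \<mu> x"] Csum[of degrees "\<lambda>\<mu>. deg_part \<mu> y"] x y xy by (auto simp: deg_part_S0)
    have "br x y = (\<Sum>\<mu>\<in>degrees. \<Sum>\<nu>\<in>degrees. br (deg_part \<mu> x) (deg_part \<nu> y))"
      by (simp only: br_sum[symmetric] x y)
    hence "?C (br x y) = (\<Sum>\<mu>\<in>degrees. \<Sum>\<nu>\<in>degrees. ?C (br (deg_part \<mu> x) (deg_part \<nu> y)))"
      using xy by (simp only:) (subst Csum | intro S0_sum br_S0 deg_part_S0 sum.cong refl | assumption)+
    also have "\<dots> = (\<Sum>\<mu>\<in>degrees. \<Sum>\<nu>\<in>degrees. br (deg_part \<mu> x) (?C (deg_part \<nu> y)) - br (deg_part \<nu> y) (?C (deg_part \<mu> x)))"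
      by (intro sum.cong refl hom[OF deg_part_S0 deg_part_Wd deg_part_S0 deg_part_Wd] S0_W0 xy)
    also have "\<dots> = br x (?C y) - (\<Sum>\<mu>\<in>degrees. \<Sum>\<nu>\<in>degrees. br (deg_part \<nu> y) (?C (deg_part \<mu> x)))"
      by (simp only: sum_subtractf br_sum[symmetric] x Cy)
    also have "(\<Sum>\<mu>\<in>degrees. \<Sum>\<nu>\<in>degrees. br (deg_part \<nu> y) (?C (deg_part \<mu> x))) = br y (?C x)"
      by (simp only: br_sum[symmetric] y Cx)
    finally show ?thesis .
  qed
  thus ?thesis using W add scl out by (auto simp: Der_def)
qed

lemma has_degree_der_part: "D \<in> DER \<Longrightarrow> has_degree \<xi> (der_part D \<xi>)"
  unfolding has_degree_def using der_part_homogeneous deg_part_Wd DERD(1) by metis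

lemma sum_der_part:
  assumes D: "D \<in> DER"
  shows "D = (\<Sum>\<xi>\<in>(\<lambda>(\<mu>, \<nu>). \<nu> - \<mu>) ` (degrees \<times> degrees). der_part D \<xi>)"
proof
  fix x
  \<comment> \<open>Differences of two occurring degrees: no other shift can lead from one basis
    element to another.\<close>
  let ?L = "(\<lambda>(\<mu>, \<nu>). \<nu> - \<mu>) ` (degrees \<times> degrees)"
  show "D x = (\<Sum>\<xi>\<in>?L. der_part D \<xi>) x"
  proof (cases "x \<in> S0")
    case True
    have in1: "(\<Sum>\<xi>\<in>?L. deg_part (\<mu> + \<xi>) (D (deg_part \<mu> x))) = D (deg_part \<mu> x)" if \<mu>: "\<mu> \<in> degrees" for \<mu>
    proof -
      have inj: "inj_on ((+) \<mu>) ?L" by (auto simp: inj_on_def)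
      have "(\<Sum>\<xi>\<in>?L. deg_part (\<mu> + \<xi>) (D (deg_part \<mu> x))) = (\<Sum>\<kappa>\<in>(+) \<mu> ` ?L. deg_part \<kappa> (D (deg_part \<mu> x)))"
        by (subst sum.reindex[OF inj]) simp
      also have "\<dots> = D (deg_part \<mu> x)"
      proof (rule sum_deg_part)
        show "D (deg_part \<mu> x) \<in> W0" using True deg_part_S0 DERD(1)[OF D] by blast
        show "degrees \<subseteq> (+) \<mu> ` ?L"
        proof
          fix \<nu> assume "\<nu> \<in> degrees"
          hence "\<nu> - \<mu> \<in> ?L" using \<mu> by auto
          thus "\<nu> \<in> (+) \<mu> ` ?L" by (metis imageI add.commute diff_add_cancel)
        qed
      qed simp
      finally show ?thesis .
    qed
    have "(\<Sum>\<xi>\<in>?L. der_part D \<xi>) x = (\<Sum>\<xi>\<in>?L. \<Sum>\<mu>\<in>degrees. deg_part (\<mu> + \<xi>) (D (deg_part \<mu> x)))"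
      using True by (simp add: sum_fun_apply der_part_def restr_def)
    also have "\<dots> = (\<Sum>\<mu>\<in>degrees. \<Sum>\<xi>\<in>?L. deg_part (\<mu> + \<xi>) (D (deg_part \<mu> x)))"
      by (rule sum.swap)
    also have "\<dots> = (\<Sum>\<mu>\<in>degrees. D (deg_part \<mu> x))"
      by (intro sum.cong refl in1)
    also have "\<dots> = D (\<Sum>\<mu>\<in>degrees. deg_part \<mu> x)"
      using True by (simp add: DER_sum[OF D] deg_part_S0)
    also have "\<dots> = D x" using True by (simp add: sum_deg_part S0_W0)
    finally show ?thesis by simp
  next
    case False
    thus ?thesis by (simp add: sum_fun_apply der_part_def restr_def DERD(5)[OF D])
  qed
qed

section \<open>Brackets with generators\<close>

text \<open>Since D_r and D_s annihilate \<open>g\<close>, both commute with multiplication by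
  \<open>g\<close>, and g D_b commutes with forming the curl: it merely acts on the
  argument.\<close>

lemma br_mkW_DD:
  assumes b: "b \<in> E0" and g: "hom 0 g" and f: "hom q f" "q < 2" and rs: "r \<in> EE" "s \<in> EE"
    and even_part: "even (q + tt r + tt s)" and "pd r g = 0" "pd s g = 0"
  shows "br (mkW g b) (DD r s q f) = DD r s q (g \<odot> pd b f)"
proof (rule WC_eqI)
  have bE: "b \<in> EE" using b by (simp add: EE_cases)
  have W: "mkW g b \<in> W0" "DD r s q f \<in> W0"
    using b g f rs even_part by (auto intro!: mkW_W0 DD_W0 simp: EE_cases)
  have h: "hom q (g \<odot> pd b f)"
    using hom_mul[OF g hom_pd[OF f(1) bE]] b f(2) by simp
  show "br (mkW g b) (DD r s q f) \<in> WC" "DD r s q (g \<odot> pd b f) \<in> WC"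
    using W DD_W0[OF rs h f(2) even_part] by (auto intro: W0_WC)
  have c: "g \<odot> pd b (pd x f) = pd x (g \<odot> pd b f)" if "x \<in> EE" "pd x g = 0" for x
    using mul_pd[OF g, of "pd b f" x] pd_commute[OF hom_AC[OF f(1)] bE that(1)] that b by simp
  fix s' assume s': "s' \<in> EE"
  have "act (DD r s q f) g = (\<Sum>x\<in>EE. 0)"
    unfolding act_def
    by (intro sum.cong refl) (auto simp: coef_DD mul_diff_left mul_sc_left assms)
  hence "act (DD r s q f) (coef s' (mkW g b)) = 0"
    by (simp add: coef_mkW act_simps)
  thus "coef s' (br (mkW g b) (DD r s q f)) = coef s' (DD r s q (g \<odot> pd b f))"
    using W s' bE by (simp add: coef_br act_mkW coef_DD pd_diff pd_sc mul_diff_right mul_sc_right c assms)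
qed

text \<open>Besides acting on the argument, x_a D_b moves the indices, because [x_a D_b, D_a] =
  -D_b. This accounts for the terms with a replaced by b.\<close>

lemma br_gvar_DD:
  assumes a: "a \<in> E0" and b: "b \<in> E0" and f: "hom q f" "q < 2" and rs: "r \<in> EE" "s \<in> EE"
    and even_part: "even (q + tt r + tt s)" and ab: "a \<noteq> b"
  shows "br (mkW (gvar a) b) (DD r s q f) = DD r s q (gvar a \<odot> pd b f)
    - (if r = a then DD b s q f else 0) - (if s = a then DD r b q f else 0)"
proof (rule WC_eqI)
  let ?g = "gvar a"
  have abE: "a \<in> EE" "b \<in> EE" using a b by (simp_all add: EE_cases)
  have g: "hom 0 ?g" using gvar_hom[OF abE(1)] a by simp
  have W: "mkW ?g b \<in> W0" "DD r s q f \<in> W0"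
    using b g f rs even_part by (auto intro!: mkW_W0 DD_W0 simp: EE_cases)
  have h: "hom q (?g \<odot> pd b f)"
    using hom_mul[OF g hom_pd[OF f(1) abE(2)]] b f(2) by simp
  have "r = a \<Longrightarrow> DD b s q f \<in> W0" "s = a \<Longrightarrow> DD r b q f \<in> W0"
    using f rs even_part a b abE by (auto intro!: DD_W0)
  thus "br (mkW ?g b) (DD r s q f) \<in> WC" "DD r s q (?g \<odot> pd b f)
      - (if r = a then DD b s q f else 0) - (if s = a then DD r b q f else 0) \<in> WC"
    using W DD_W0[OF rs h f(2) even_part] by (auto intro!: W0_WC)
  have c: "?g \<odot> pd b (pd x f) = pd x (?g \<odot> pd b f) - (if x = a then pd b f else 0)" if "x \<in> EE" for x
    using mul_pd[OF g, of "pd b f" x] pd_commute[OF hom_AC[OF f(1)] abE(2) that] that b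
    by (simp add: pd_gvar abE one_mul)
  fix s' assume s': "s' \<in> EE"
  have "act (DD r s q f) ?g = (\<Sum>x\<in>EE. if x = a then coef a (DD r s q f) else 0)"
    unfolding act_def using W(2)
    by (intro sum.cong refl) (auto simp: pd_gvar abE mul_one W0_WC)
  hence "act (DD r s q f) (coef s' (mkW ?g b)) = (if s' = b then coef a (DD r s q f) else 0)"
    using abE by (simp add: coef_mkW act_simps)
  thus "coef s' (br (mkW ?g b) (DD r s q f)) = coef s' (DD r s q (?g \<odot> pd b f)
      - (if r = a then DD b s q f else 0) - (if s = a then DD r b q f else 0))"
    using W s' abE rs a b ab
    by (auto simp: coef_br act_mkW coef_DD pd_diff pd_sc mul_diff_right mul_sc_right c coef_simps sc_diff)
qed

text \<open>Each of the two derivatives hits only one factor, so D_i(f g) = f D_i(g) and D_s(f g) =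
  D_s(f) g; these are the coefficients of the bracket.\<close>

lemma DD_mul:
  assumes "i \<in> E0" "s \<in> E0" "hom 0 f" "hom 0 g" "pd i f = 0" "pd s g = 0"
  shows "DD i s 0 (f \<odot> g) = br (mkW f i) (mkW g s)"
proof (rule WC_eqI)
  have E: "i \<in> EE" "s \<in> EE" using assms by (simp_all add: EE_cases)
  have W: "mkW f i \<in> W0" "mkW g s \<in> W0"
    using assms by (auto intro!: mkW_W0 simp: EE_cases)
  have h: "hom 0 (f \<odot> g)" using hom_mul[OF assms(3,4)] by simp
  show "DD i s 0 (f \<odot> g) \<in> WC" "br (mkW f i) (mkW g s) \<in> WC"
    using W DD_W0[OF E h] assms by (auto intro!: W0_WC)
  have "pd i (f \<odot> g) = f \<odot> pd i g" "pd s (f \<odot> g) = pd s f \<odot> g"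
    using mul_pd[OF assms(3) hom_AC[OF assms(4)]] E assms by simp_all
  moreover have "pd s f \<odot> g = g \<odot> pd s f"
    using mul_commute[OF hom_pd[OF assms(3) E(2)] assms(4)] by simp
  ultimately show "coef s' (DD i s 0 (f \<odot> g)) = coef s' (br (mkW f i) (mkW g s))" if "s' \<in> EE" for s'
    using W that E assms by (auto simp: coef_br act_mkW coef_DD coef_mkW act_simps)
qed

text \<open>Every coefficient on both sides is a second derivative of \<open>F\<close>; the identity
  is the super commutation of the three partial derivatives. It trades two odd indices for one even
  and one odd.\<close>

lemma DD_odd_odd:
  assumes "a \<in> E0" "k \<in> E1" "l \<in> E1" "hom 0 F"
  shows "DD k l 0 (pd a F) = - DD a k 1 (pd l F) - DD a l 1 (pd k F)"
proof (rule WC_eqI)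
  have E: "a \<in> EE" "k \<in> EE" "l \<in> EE" using assms by (simp_all add: EE_cases)
  have h: "hom 0 (pd a F)" "hom 1 (pd l F)" "hom 1 (pd k F)"
    using hom_pd[OF assms(4) E(1)] hom_pd[OF assms(4) E(2)] hom_pd[OF assms(4) E(3)] assms by simp_all
  show "DD k l 0 (pd a F) \<in> WC" "- DD a k 1 (pd l F) - DD a l 1 (pd k F) \<in> WC"
    using DD_W0[OF E(2,3) h(1)] DD_W0[OF E(1,2) h(2)] DD_W0[OF E(1,3) h(3)] assms by (auto intro!: W0_WC)
  fix s assume "s \<in> EE"
  show "coef s (DD k l 0 (pd a F)) = coef s (- DD a k 1 (pd l F) - DD a l 1 (pd k F))"
    using pd_commute[OF hom_AC[OF assms(4)] E(1,2)] pd_commute[OF hom_AC[OF assms(4)] E(1,3)]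
      pd_commute[OF hom_AC[OF assms(4)] E(2,3)] assms Y_disj
    by (auto simp: coef_DD coef_simps sc_minus_left)
qed

lemma DD_even_odd:
  assumes "j \<in> E0" "s \<in> E0" "k \<in> E1" "hom 1 F"
  shows "DD j k 1 (pd s F) = DD s k 1 (pd j F) - DD j s 0 (pd k F)"
proof (rule WC_eqI)
  have E: "j \<in> EE" "s \<in> EE" "k \<in> EE" using assms by (simp_all add: EE_cases)
  have h: "hom 1 (pd s F)" "hom 1 (pd j F)" "hom 0 (pd k F)"
    using hom_pd[OF assms(4) E(1)] hom_pd[OF assms(4) E(2)] hom_pd[OF assms(4) E(3)] assms by simp_all
  show "DD j k 1 (pd s F) \<in> WC" "DD s k 1 (pd j F) - DD j s 0 (pd k F) \<in> WC"
    using DD_W0[OF E(1,3) h(1)] DD_W0[OF E(2,3) h(2)] DD_W0[OF E(1,2) h(3)] assms by (auto intro!: W0_WC)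
  fix s' assume "s' \<in> EE"
  show "coef s' (DD j k 1 (pd s F)) = coef s' (DD s k 1 (pd j F) - DD j s 0 (pd k F))"
    using pd_commute[OF hom_AC[OF assms(4)] E(1,2)] pd_commute[OF hom_AC[OF assms(4)] E(1,3)]
      pd_commute[OF hom_AC[OF assms(4)] E(2,3)] assms Y_disj
    by (auto simp: coef_DD coef_simps sc_minus_left)
qed

lemma DD_swap: "DD s r q f = sc (- ((-1) ^ (tt r * tt s + (tt r + tt s) * q))) (DD r s q f)"
  by (simp add: Drs_def mkW_simps sc_diff power_add minus_one_power_iff mult.commute add.commute sc_minus_left)

lemma pd_e_even: "(\<beta>, u) \<in> AB \<Longrightarrow> b \<in> E0 \<Longrightarrow> pd b (single (\<beta>, u) 1) = (if \<beta> b > 0 then single (\<beta>(b := \<beta> b - 1), u) 1 else 0)"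
  using Y0_le[of b] by (auto simp: pd_single Dbasis_def)

lemma pd_e_odd: "(\<beta>, u) \<in> AB \<Longrightarrow> k \<in> E1 \<Longrightarrow> pd k (single (\<beta>, u) 1) = (if k \<in> u then single (\<beta>, u - {k}) ((-1) ^ card {j\<in>u. j < k}) else 0)"
  using Y1_gt[of k] by (auto simp: pd_single Dbasis_def)

lemma AB_iff: "(\<beta>, u) \<in> AB \<longleftrightarrow> (\<forall>i. i \<notin> E0 \<longrightarrow> \<beta> i = 0) \<and> (\<forall>i\<in>E0. \<beta> i \<le> pm i) \<and> u \<subseteq> E1"
  by (auto simp: Abasis_def)

lemma AB_upd: "(\<beta>, u) \<in> AB \<Longrightarrow> a \<in> E0 \<Longrightarrow> x \<le> pm a \<Longrightarrow> (\<beta>(a := x), u) \<in> AB"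
  by (auto simp: AB_iff)

lemma of_nat_neq_0: "of_nat x \<noteq> (0::'a) \<longleftrightarrow> \<not> p dvd x"
  by (simp add: of_nat_eq_0_iff_char_dvd p_char)

lemma mul_e_nz:
  assumes "(\<gamma>, v) \<in> AB" "(\<delta>, w) \<in> AB" "v \<inter> w = {}"
    and "\<And>i. i \<in> E0 \<Longrightarrow> \<gamma> i + \<delta> i \<le> pm i \<and> \<not> p dvd ((\<gamma> i + \<delta> i) choose \<gamma> i)"
  obtains c where "c \<noteq> 0" "single (\<gamma>, v) 1 \<odot> single (\<delta>, w) 1 = single (\<lambda>i. \<gamma> i + \<delta> i, v \<union> w) c"
proof
  have "tbinom i (\<gamma> i) (\<delta> i) \<noteq> 0" if "i \<in> E0" for i
    using assms(4)[OF that] by (simp add: tbinom_def of_nat_neq_0)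
  thus "msign v w * (\<Prod>i\<in>E0. tbinom i (\<gamma> i) (\<delta> i)) \<noteq> 0"
    using assms(3) by (simp add: msign_def)
  show "single (\<gamma>, v) 1 \<odot> single (\<delta>, w) 1 = single (\<lambda>i. \<gamma> i + \<delta> i, v \<union> w) (msign v w * (\<Prod>i\<in>E0. tbinom i (\<gamma> i) (\<delta> i)))"
    using assms(1,2) by (simp add: mul_e)
qed

lemma p_ge_5: "p \<ge> 5"
proof -
  have "p \<noteq> 4" using p_prime prime_nat_not_dvd[of 4 2] by auto
  thus ?thesis using p_gt_3 by simp
qed

text \<open>\<open>\<beta>'\<close> is chosen so that D_b removes the extra x_b; multiplying by x_a
  then restores the exponent of x_a and contributes the factor \<open>\<beta> a\<close>.\<close>

lemma gvar_pd_e: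
  assumes "(\<beta>, u) \<in> AB" "a \<in> E0" "b \<in> E0" "a \<noteq> b" "\<beta> a \<ge> 1" "\<beta> b < pm b"
  defines "\<beta>' \<equiv> \<beta>(a := \<beta> a - 1, b := Suc (\<beta> b))"
  shows "(\<beta>', u) \<in> AB" "gvar a \<odot> pd b (single (\<beta>', u) 1) = single (\<beta>, u) (of_nat (\<beta> a))"
proof -
  have le: "\<beta> a \<le> pm a" using AB_le assms by blast
  show B: "(\<beta>', u) \<in> AB"
    unfolding \<beta>'_def using assms le by (intro AB_upd) auto
  let ?\<gamma> = "\<beta>(a := \<beta> a - 1)"
  have G: "(?\<gamma>, u) \<in> AB" using assms le by (intro AB_upd) auto
  have p1: "pd b (single (\<beta>', u) 1) = single (?\<gamma>, u) 1"
  proof -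
    have "\<beta>'(b := \<beta>' b - 1) = ?\<gamma>" using assms(4) by (auto simp: \<beta>'_def)
    moreover have "\<beta>' b > 0" by (simp add: \<beta>'_def)
    ultimately show ?thesis using pd_e_even[OF B assms(3)] by simp
  qed
  have p2: "pd a (single (\<beta>, u) 1) = single (?\<gamma>, u) 1"
    using pd_e_even[OF assms(1,2)] assms(5) by simp
  have "a \<notin> u" using assms(1,2) Y_disj by (auto simp: AB_iff)
  hence "adeg (\<beta>, u) a = int (\<beta> a)" by (simp add: adeg_def)
  thus "gvar a \<odot> pd b (single (\<beta>', u) 1) = single (\<beta>, u) (of_nat (\<beta> a))"
    using gvar_pd_single[OF assms(1), of a] assms(2) by (simp add: p1 p2 EE_cases)
qed

lemma br_gvar_gen:
  assumes "(\<beta>, u) \<in> AB" "a \<in> E0" "b \<in> E0" "a \<noteq> b" "\<beta> a \<ge> 1" "\<beta> b < pm b"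
    and "r \<in> EE" "s \<in> EE" "even (card u + tt r + tt s)"
  defines "\<beta>' \<equiv> \<beta>(a := \<beta> a - 1, b := Suc (\<beta> b))"
  shows "br (mkW (gvar a) b) (gen r s \<beta>' u) = sc (of_nat (\<beta> a)) (gen r s \<beta> u)
    - (if r = a then gen b s \<beta>' u else 0) - (if s = a then gen r b \<beta>' u else 0)"
proof -
  note B = gvar_pd_e[OF assms(1-6), folded \<beta>'_def]
  have "even (card u mod 2 + tt r + tt s)" using assms(9) by presburger
  thus ?thesis
    using br_gvar_DD[OF assms(2,3) hom_single[OF B(1)] _ assms(7,8) _ assms(4), of 1] B(2)
    by (simp flip: DD_simps(2))
qed

text \<open>As D_b annihilates the monomial, raising x_a by one gives a potential whose curl has
  only the D_b half. This places many fields x^\<gamma> x^v D_b in S.\<close>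

lemma mkW_eq_gen:
  assumes "(\<gamma>, v) \<in> AB" "b \<in> E0" "\<gamma> b = 0" "even (card v)" "a \<in> E0" "a \<noteq> b" "\<gamma> a < pm a"
  shows "mkW (single (\<gamma>, v) 1) b = gen a b (\<gamma>(a := Suc (\<gamma> a))) v" "(\<gamma>(a := Suc (\<gamma> a)), v) \<in> AB"
proof -
  show B: "(\<gamma>(a := Suc (\<gamma> a)), v) \<in> AB" using assms by (intro AB_upd) auto
  show "mkW (single (\<gamma>, v) 1) b = gen a b (\<gamma>(a := Suc (\<gamma> a))) v"
    using assms pd_e_even[OF B assms(5)] pd_e_even[OF B assms(2)]
    by (simp add: Drs_def mkW_simps)
qed

lemma mkW_gen_Wd:
  assumes "(\<gamma>, v) \<in> AB" "b \<in> EE" "even (card v + tt b)"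
  shows "mkW (single (\<gamma>, v) c) b \<in> Wd (wdeg (\<gamma>, v, b))"
proof (rule WdI)
  have "card v mod 2 = tt b" using assms(3) tt_le[of b] by presburger
  thus "mkW (single (\<gamma>, v) c) b \<in> W0"
    using hom_single[OF assms(1), of c] assms(2) by (auto intro!: mkW_W0)
  show "Ad (wdeg (\<gamma>, v, b) + ep r) (coef r (mkW (single (\<gamma>, v) c) b))" for r
    using Ad_single[OF assms(1), of c] by (auto simp: coef_mkW Ad_simps wdeg_adeg)
qed

text \<open>\<open>m_ge_3\<close> enters here: two indices are usually occupied by a generator or by
  a bracket, and a third has to be free.\<close>

lemma ex_other:
  obtains c where "c \<in> E0" "c \<noteq> a" "c \<noteq> b"
proof -
  have "card E0 \<ge> 3" using m_ge_3 by (simp add: Y0_def)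
  moreover have "card {a, b} \<le> 2" by (cases "a = b") auto
  ultimately have "\<not> E0 \<subseteq> {a, b}"
    using card_mono[of "{a, b}" E0] by fastforce
  thus thesis using that by auto
qed

lemma ex_other_odd:
  obtains c where "c \<in> E1" "c \<noteq> a" "c \<noteq> b"
proof -
  have "card E1 \<ge> 3" using n_ge_3 by (simp add: Y1_def)
  moreover have "card {a, b} \<le> 2" by (cases "a = b") auto
  ultimately have "\<not> E1 \<subseteq> {a, b}"
    using card_mono[of "{a, b}" E1] by fastforce
  thus thesis using that by auto
qed

lemma mkW_S0:
  assumes "(\<gamma>, v) \<in> AB" "b \<in> E0" "\<gamma> b = 0" "even (card v)" "a \<in> E0" "a \<noteq> b" "\<gamma> a < pm a"
  shows "mkW (single (\<gamma>, v) 1) b \<in> S0"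
  unfolding mkW_eq_gen(1)[OF assms]
  using assms mkW_eq_gen(2)[OF assms] by (intro gen_S0) (auto simp: EE_cases)

lemma pm_pos: "i \<in> E0 \<Longrightarrow> 0 < pm i"
  using pm_ge[of i] by linarith

lemma mkW_odd_S0:
  assumes "v \<subseteq> E1" "b \<in> E0" "even (card v)"
  shows "mkW (single (\<lambda>_. 0, v) 1) b \<in> S0"
proof -
  obtain a where "a \<in> E0" "a \<noteq> b" using ex_other[of b b] by auto
  thus ?thesis using assms pm_pos by (intro mkW_S0[of _ _ _ a]) (auto simp: AB_iff)
qed

lemma Dvec_S0: "i \<in> E0 \<Longrightarrow> Dvec i \<in> S0"
  unfolding Dvec_mkW one_def by (rule mkW_odd_S0) auto

lemma Dvec_Wd: "i \<in> E0 \<Longrightarrow> Dvec i \<in> Wd (- ep i)"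
proof -
  assume i: "i \<in> E0"
  have "wdeg (\<lambda>_. 0, {}, i) = - ep i" by (auto simp: wdeg_def fun_eq_iff pointwise)
  thus ?thesis using mkW_gen_Wd[OF zero_AB, of i 1] i by (simp add: Dvec_mkW one_def EE_cases)
qed

lemma gvar_e: "a \<in> E0 \<Longrightarrow> gvar a = single ((\<lambda>_. 0)(a := 1), {}) 1"
  using Y0_le[of a] by (simp add: gvar_def fun_upd_def del: One_nat_def)

lemma mkW_gvar_S0:
  assumes "a \<in> E0" "b \<in> E0" "a \<noteq> b"
  shows "mkW (gvar a) b \<in> S0" "mkW (gvar a) b \<in> Wd (ep a - ep b)"
proof -
  have B: "((\<lambda>_. 0)(a := 1), {}) \<in> AB" using pm_pos[OF assms(1)] assms(1) by (auto simp: AB_iff)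
  obtain c where "c \<in> E0" "c \<noteq> a" "c \<noteq> b" using ex_other[of a b] by auto
  thus "mkW (gvar a) b \<in> S0"
    unfolding gvar_e[OF assms(1)] using assms B pm_pos by (intro mkW_S0[of _ _ _ c]) auto
  have "wdeg ((\<lambda>_. 0)(a := 1), {}, b) = ep a - ep b" by (auto simp: wdeg_def fun_eq_iff pointwise)
  thus "mkW (gvar a) b \<in> Wd (ep a - ep b)"
    using mkW_gen_Wd[OF B, of b 1] assms by (simp add: gvar_e EE_cases)
qed

lemma br_Dvec_gen:
  assumes "(\<beta>, u) \<in> AB" "i \<in> E0" "r \<in> EE" "s \<in> EE" "even (card u + tt r + tt s)"
  shows "br (Dvec i) (gen r s \<beta> u) = (if \<beta> i > 0 then gen r s (\<beta>(i := \<beta> i - 1)) u else 0)"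
proof -
  have "even (card u mod 2 + tt r + tt s)" using assms(5) by presburger
  hence "br (Dvec i) (gen r s \<beta> u) = DD r s (card u mod 2) (one \<odot> pd i (single (\<beta>, u) 1))"
    unfolding Dvec_mkW by (intro br_mkW_DD assms one_hom hom_single pd_one) simp_all
  also have "one \<odot> pd i (single (\<beta>, u) 1) = pd i (single (\<beta>, u) 1)"
    by (rule one_mul) simp
  finally show ?thesis
    using pd_e_even[OF assms(1,2)] by (simp add: DD_simps)
qed

lemma has_degreeD: "has_degree \<xi> D \<Longrightarrow> x \<in> S0 \<Longrightarrow> x \<in> Wd \<mu> \<Longrightarrow> D x \<in> Wd (\<mu> + \<xi>)"
  by (simp add: has_degree_def)

definition W0B :: "((nat \<Rightarrow> nat) \<times> nat set \<times> nat) set" where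
  "W0B = {(\<alpha>, u, r). (\<alpha>, u, r) \<in> WB \<and> even (card u + tt r)}"

lemma W0_supp_W0B: "X \<in> W0 \<Longrightarrow> X (\<alpha>, u, r) \<noteq> 0 \<Longrightarrow> (\<alpha>, u, r) \<in> W0B"
  unfolding W0_iff W0B_def by (metis (mono_tags, lifting) case_prodI fst_conv snd_conv mem_Collect_eq)

lemma nonzero_coeff: "X \<noteq> (0 :: 'a wel) \<Longrightarrow> \<exists>\<alpha> u r. X (\<alpha>, u, r) \<noteq> 0"
  by (metis prod_cases3 ext zero_fun_apply)

lemma has_degree_kill:
  assumes "has_degree \<xi> D" "x \<in> S0" "x \<in> Wd \<mu>"
    and "\<And>\<alpha> u r. (\<alpha>, u, r) \<in> W0B \<Longrightarrow> \<forall>i. \<mu> i + \<xi> i = wdeg (\<alpha>, u, r) i \<Longrightarrow> False"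
  shows "D x = 0"
proof (rule ccontr)
  assume "D x \<noteq> 0"
  then obtain \<alpha> u r where nz: "D x (\<alpha>, u, r) \<noteq> 0" using nonzero_coeff by blast
  have "D x \<in> Wd (\<mu> + \<xi>)" using has_degreeD assms by blast
  hence "(\<alpha>, u, r) \<in> W0B" "wdeg (\<alpha>, u, r) = \<mu> + \<xi>"
    using nz W0_supp_W0B[OF Wd_W0] WdD by blast+
  thus False using assms(4)[of \<alpha> u r] by (simp add: plus_fun_apply)
qed

text \<open>\<open>D\<close> commutes with all \<open>ad D\<^sub>i\<close>; applying them lowers a nonzero value until it has a term without even variables.\<close>

lemma ex_const_coeff:
  assumes D: "D \<in> DER" "\<And>i. i \<in> E0 \<Longrightarrow> D (Dvec i) = 0"
    and g: "(\<beta>, u) \<in> AB" "r \<in> EE" "s \<in> EE" "even (card u + tt r + tt s)" "D (gen r s \<beta> u) \<noteq> 0"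
  shows "\<exists>\<beta>' v q. (\<beta>', u) \<in> AB \<and> (\<forall>i. \<beta>' i \<le> \<beta> i) \<and> D (gen r s \<beta>' u) (\<lambda>_. 0, v, q) \<noteq> 0"
  using g(1,5)
proof (induction "\<Sum>i\<in>E0. \<beta> i" arbitrary: \<beta> rule: less_induct)
  case less
  let ?g = "gen r s \<beta> u"
  have gS: "?g \<in> S0" using gen_S0 g less by blast
  hence DW: "D ?g \<in> W0" using DERD(1)[OF D(1)] by blast
  obtain \<alpha> v q where nz: "D ?g (\<alpha>, v, q) \<noteq> 0" using nonzero_coeff less(3) by blast
  hence aB: "(\<alpha>, v) \<in> AB" using W0_supp_W0B[OF DW] by (auto simp: W0B_def Wbasis_def)
  show ?case
  proof (cases "\<alpha> = (\<lambda>_. 0)")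
    case True
    thus ?thesis using nz less(2) by blast
  next
    case False
    then obtain i where "\<alpha> i > 0" by (auto simp: fun_eq_iff)
    hence i: "i \<in> E0" using aB by (auto simp: AB_iff)
    have "br (Dvec i) (D ?g) (\<alpha>(i := \<alpha> i - 1), v, q) \<noteq> 0"
      using br_Dvec[OF DW i] nz \<open>\<alpha> i > 0\<close> by simp
    moreover have "br (Dvec i) (D ?g) = D (br (Dvec i) ?g)"
      using DERD(4)[OF D(1) Dvec_S0[OF i] gS] D(2)[OF i] by simp
    ultimately have nz': "D (br (Dvec i) ?g) \<noteq> 0" by (auto simp: pointwise)
    hence pos: "\<beta> i > 0" and nz2: "D (gen r s (\<beta>(i := \<beta> i - 1)) u) \<noteq> 0"
      using br_Dvec_gen[OF less(2) i g(2-4)] DER_0[OF D(1)] by (auto split: if_splits)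
    have B: "(\<beta>(i := \<beta> i - 1), u) \<in> AB"
      using less(2) i AB_le[OF less(2) i] by (intro AB_upd) auto
    have "(\<Sum>j\<in>E0. (\<beta>(i := \<beta> i - 1)) j) < (\<Sum>j\<in>E0. \<beta> j)"
      by (rule sum_strict_mono_ex1) (use pos i in auto)
    from less(1)[OF this B nz2] obtain \<beta>' v' q' where
      "(\<beta>', u) \<in> AB" "\<forall>j. \<beta>' j \<le> (\<beta>(i := \<beta> i - 1)) j" "D (gen r s \<beta>' u) (\<lambda>_. 0, v', q') \<noteq> 0" by blast
    moreover have "(\<beta>(i := \<beta> i - 1)) j \<le> \<beta> j" for j by simp
    ultimately show ?thesis by (meson le_trans)
  qed
qed

lemma DER_ext_gens:
  assumes "D \<in> DER" "\<And>r s \<beta> u. (\<beta>, u) \<in> AB \<Longrightarrow> r \<in> EE \<Longrightarrow> s \<in> EE \<Longrightarrow> even (card u + tt r + tt s) \<Longrightarrow> D (gen r s \<beta> u) = 0"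
  shows "D = 0"
proof
  fix x show "D x = 0 x"
  proof (cases "x \<in> S0")
    case True
    hence "x \<in> sc_module.span gens" by (simp add: S0_eq_span)
    hence "x \<in> S0 \<and> D x = 0"
    proof (induction rule: sc_module.span_induct_alt)
      case base
      show ?case using DER_0[OF assms(1)] S0_simps(1) by simp
    next
      case (step c x y)
      from \<open>x \<in> gens\<close> obtain r s \<beta> u where x: "x = gen r s \<beta> u" and
        *: "r \<in> EE" "s \<in> EE" "(\<beta>, u) \<in> AB" "even (card u + tt r + tt s)"
        unfolding gens_def by blast
      have "x \<in> S0" "D x = 0" unfolding x using assms(2) gen_S0 * by blast+
      thus ?case using step DERD(2,3)[OF assms(1)] S0_simps by simp
    qed
    thus ?thesis by (simp add: zero_fun_apply)
  next
    case False
    thus ?thesis using DERD(5)[OF assms(1)] by (simp add: zero_fun_apply)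
  qed
qed

lemma DER_br_kill: "D \<in> DER \<Longrightarrow> x \<in> S0 \<Longrightarrow> y \<in> S0 \<Longrightarrow> D x = 0 \<Longrightarrow> D y = 0 \<Longrightarrow> D (br x y) = 0"
  by (simp add: DERD(4))

lemma DER_sc_kill: "D \<in> DER \<Longrightarrow> x \<in> S0 \<Longrightarrow> c \<noteq> 0 \<Longrightarrow> D (sc c x) = 0 \<Longrightarrow> D x = 0"
  using DERD(3)[of D x c] by (metis sc_simps(1,3,4) left_inverse)

section \<open>Normalization of a homogeneous derivation\<close>

lemma has_degree_add: "has_degree \<xi> D \<Longrightarrow> has_degree \<xi> D' \<Longrightarrow> has_degree \<xi> (D + D')"
  unfolding has_degree_def by (simp add: plus_fun_apply Wd_simps)

lemma has_degree_scale: "has_degree \<xi> D \<Longrightarrow> has_degree \<xi> (\<lambda>x. sc c (D x))"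
  unfolding has_degree_def by (simp add: Wd_simps)

lemma has_degree_ad: "E \<in> Wd \<xi> \<Longrightarrow> has_degree \<xi> (restr S0 (br E))"
  unfolding has_degree_def restr_def using br_Wd[of E \<xi>] by (simp add: add.commute[of _ \<xi>])

text \<open>From [D_i, D_l] = 0: the family V_i = D(D_i) is closed, D_i V_l = D_l V_i, written on
  coefficients.\<close>

lemma DER_Dvec_comm:
  assumes D: "D \<in> DER" and il: "i \<in> E0" "l \<in> E0"
  shows "D (Dvec l) (\<alpha>(i := Suc (\<alpha> i)), u, r) = D (Dvec i) (\<alpha>(l := Suc (\<alpha> l)), u, r)"
proof -
  have "br (Dvec i) (Dvec l) = (0 :: 'a wel)"
  proof
    fix b :: "(nat \<Rightarrow> nat) \<times> nat set \<times> nat"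
    obtain \<alpha> u r where b: "b = (\<alpha>, u, r)" by (cases b)
    have "\<alpha>(i := Suc (\<alpha> i)) \<noteq> (\<lambda>_. 0)" by (metis fun_upd_same nat.distinct(1))
    thus "br (Dvec i) (Dvec l) b = (0 :: 'a wel) b"
      unfolding b br_Dvec[OF Dvec_W0[OF il(2)] il(1)] by (simp add: Dvec_def single_apply zero_fun_apply)
  qed
  hence "br (Dvec i) (D (Dvec l)) = br (Dvec l) (D (Dvec i))"
    using DERD(4)[OF D Dvec_S0[OF il(1)] Dvec_S0[OF il(2)]] DER_0[OF D] by simp
  thus ?thesis
    using br_Dvec[OF DERD(1)[OF D Dvec_S0[OF il(2)]] il(1), of \<alpha> u r]
      br_Dvec[OF DERD(1)[OF D Dvec_S0[OF il(1)]] il(2), of \<alpha> u r] by simp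
qed

text \<open>A closed family \<open>v\<^sub>i\<close> in truncated divided powers is exact up to terms in \<open>x\<^sub>i\<close>
  to the maximal power alone, since \<open>D\<^sub>i\<close> misses exactly the top power of \<open>x\<^sub>i\<close>.\<close>

lemma normalize_on_Dvec:
  assumes D: "D \<in> DER" "has_degree \<xi> D"
  obtains E where "E \<in> Wd \<xi>"
    "\<And>i \<alpha> u r. i \<in> E0 \<Longrightarrow> (D + restr S0 (br E)) (Dvec i) (\<alpha>, u, r) \<noteq> 0 \<Longrightarrow>
       \<alpha> i = pm i \<and> (\<forall>l\<in>E0. l \<noteq> i \<longrightarrow> \<alpha> l = 0)"
proof -
  define V where "V i = D (Dvec i)" for i
  have VW: "V i \<in> Wd (\<xi> - ep i)" if "i \<in> E0" for i
    using has_degreeD[OF D(2) Dvec_S0[OF that] Dvec_Wd[OF that]] by (simp add: V_def)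
  define pick where "pick \<alpha> = (SOME i. i \<in> E0 \<and> \<alpha> i > 0)" for \<alpha> :: "nat \<Rightarrow> nat"
  \<comment> \<open>The potential: integrate V along any even variable that occurs in the monomial.
    Closedness makes the choice irrelevant, and [E, D_i] = -D_i E explains why \<open>E\<close> is
    added.\<close>
  define E :: "'a wel" where "E = (\<lambda>(\<alpha>, u, r). if (\<alpha>, u, r) \<in> WB \<and> (\<exists>i\<in>E0. \<alpha> i > 0)
      then V (pick \<alpha>) (\<alpha>(pick \<alpha> := \<alpha> (pick \<alpha>) - 1), u, r) else 0)"
  have pick: "pick \<alpha> \<in> E0 \<and> \<alpha> (pick \<alpha>) > 0" if "\<exists>i\<in>E0. \<alpha> i > 0" for \<alpha>
    unfolding pick_def by (rule someI_ex) (use that in blast)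
  have Eeq: "E (\<alpha>, u, r) = V i (\<alpha>(i := \<alpha> i - 1), u, r)" if i: "i \<in> E0" "\<alpha> i > 0" and b: "(\<alpha>, u, r) \<in> WB" for \<alpha> u r i
  proof -
    let ?l = "pick \<alpha>"
    have l: "?l \<in> E0" "\<alpha> ?l > 0" using pick i by blast+
    have "V ?l (\<alpha>(?l := \<alpha> ?l - 1), u, r) = V i (\<alpha>(i := \<alpha> i - 1), u, r)"
    proof (cases "?l = i")
      case False
      let ?g = "\<alpha>(i := \<alpha> i - 1, ?l := \<alpha> ?l - 1)"
      have "?g(i := Suc (?g i)) = \<alpha>(?l := \<alpha> ?l - 1)" "?g(?l := Suc (?g ?l)) = \<alpha>(i := \<alpha> i - 1)"
        using False i l by auto
      thus ?thesis using DER_Dvec_comm[OF D(1) i(1) l(1), of ?g u r] by (simp add: V_def)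
    qed simp
    thus ?thesis using i b by (auto simp: E_def)
  qed
  have Enz: "b \<in> WB \<and> even (card (fst (snd b)) + tt (snd (snd b))) \<and> wdeg b = \<xi>" if "E b \<noteq> 0" for b
  proof -
    obtain \<alpha> u r where b: "b = (\<alpha>, u, r)" by (cases b)
    have WB: "b \<in> WB" and ex: "\<exists>i\<in>E0. \<alpha> i > 0" using that by (auto simp: E_def b split: if_splits)
    let ?l = "pick \<alpha>"
    have l: "?l \<in> E0" "\<alpha> ?l > 0" using pick ex by blast+
    have nz: "V ?l (\<alpha>(?l := \<alpha> ?l - 1), u, r) \<noteq> 0" using that WB ex by (auto simp: E_def b split: if_splits)
    have "even (card u + tt r)" using W0_supp_W0B[OF Wd_W0[OF VW[OF l(1)]] nz] by (simp add: W0B_def)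
    moreover have "wdeg b = \<xi>"
    proof
      fix x
      have "wdeg (\<alpha>(?l := \<alpha> ?l - 1), u, r) x = \<xi> x - ep ?l x"
        using WdD[OF VW[OF l(1)] nz] by (simp add: minus_apply)
      thus "wdeg b x = \<xi> x"
        using l(2) by (cases "x = ?l") (simp_all add: wdeg_def b of_nat_diff)
    qed
    ultimately show ?thesis using WB by (simp add: b)
  qed
  have EW: "E \<in> W0" unfolding W0_iff using Enz by blast
  hence EWd: "E \<in> Wd \<xi>" using Enz by (auto simp: Wd_def)
  let ?D = "D + restr S0 (br E)"
  have D': "?D \<in> DER" using D EW by (intro DER_add ad_DER)
  have val: "?D (Dvec i) (\<alpha>, u, r) = V i (\<alpha>, u, r) - E (\<alpha>(i := Suc (\<alpha> i)), u, r)" if "i \<in> E0" for i \<alpha> u r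
    using that br_anti[OF EW Dvec_W0[OF that]] br_Dvec[OF EW that, of \<alpha> u r]
    by (simp add: plus_fun_apply restr_def Dvec_S0 V_def uminus_apply minus_apply)
  \<comment> \<open>Below the top exponent the raised monomial still belongs to the basis, and its
    coefficient in \<open>E\<close> cancels that of V_i.\<close>
  have top: "\<alpha> i = pm i" if i: "i \<in> E0" and nz: "?D (Dvec i) (\<alpha>, u, r) \<noteq> 0" for i \<alpha> u r
  proof (rule ccontr)
    assume ne: "\<alpha> i \<noteq> pm i"
    have WB: "(\<alpha>, u, r) \<in> WB" using W0_supp[OF DERD(1)[OF D' Dvec_S0[OF i]] nz] .
    hence "\<alpha> i < pm i" using ne i AB_le[of \<alpha> u i] by (auto simp: Wbasis_def)
    hence "(\<alpha>(i := Suc (\<alpha> i)), u, r) \<in> WB"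
      using WB i by (auto simp: Wbasis_def intro!: AB_upd)
    hence "E (\<alpha>(i := Suc (\<alpha> i)), u, r) = V i (\<alpha>, u, r)"
      using Eeq[OF i, of "\<alpha>(i := Suc (\<alpha> i))" u r] by simp
    thus False using nz val[OF i] by simp
  qed
  \<comment> \<open>If x_l occurred, closedness would move the coefficient to the value at D_l, with
    the exponent of x_i one above its maximum.\<close>
  have "\<alpha> l = 0" if i: "i \<in> E0" and nz: "?D (Dvec i) (\<alpha>, u, r) \<noteq> 0" and l: "l \<in> E0" "l \<noteq> i" for i \<alpha> u r l
  proof (rule ccontr)
    assume "\<alpha> l \<noteq> 0"
    let ?b = "\<alpha>(l := \<alpha> l - 1)"
    have "?b(l := Suc (?b l)) = \<alpha>" using \<open>\<alpha> l \<noteq> 0\<close> by auto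
    hence "?D (Dvec l) (?b(i := Suc (?b i)), u, r) \<noteq> 0"
      using DER_Dvec_comm[OF D' i l(1), of ?b u r] nz by simp
    hence "(?b(i := Suc (?b i)), u, r) \<in> WB" using W0_supp[OF DERD(1)[OF D' Dvec_S0[OF l(1)]]] by blast
    hence "Suc (?b i) \<le> pm i" using i AB_le[of "?b(i := Suc (?b i))" u i] by (auto simp: Wbasis_def)
    thus False using top[OF i nz] l by simp
  qed
  thus thesis using that EWd top by blast
qed

section \<open>Torus elements of S and the weights they detect\<close>

lemma sum_two_weights:
  assumes "i \<in> EE" "j \<in> EE" "i \<noteq> j"
  shows "(\<Sum>r\<in>EE. (if r = i then x else if r = j then y else 0) * f r) = x * f i + y * (f j :: 'a)"
proof -
  have "(\<Sum>r\<in>EE. (if r = i then x else if r = j then y else 0) * f r)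
      = (\<Sum>r\<in>EE. (if r = i then x * f i else 0) + (if r = j then y * f j else 0))"
    using assms(3) by (intro sum.cong) auto
  thus ?thesis using assms by (simp add: sum.distrib)
qed

text \<open>D_ij(x_i x_j) = x_j D_j - x_i D_i.\<close>

lemma torus_even_S0:
  assumes i: "i \<in> E0" and j: "j \<in> E0" and ij: "i \<noteq> j"
  shows "torus (\<lambda>r. if r = i then 1 else if r = j then -1 else 0) \<in> S0"
proof -
  let ?b = "(\<lambda>_. 0)(i := 1, j := 1) :: nat \<Rightarrow> nat"
  have B: "(?b, {}) \<in> AB" using i j pm_pos[OF i] pm_pos[OF j] by (auto simp: AB_iff)
  have E: "i \<in> EE" "j \<in> EE" using i j by (simp_all add: EE_cases)
  have g: "gen i j ?b {} \<in> S0" using gen_S0[OF E B] i j by simp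
  have 1: "?b(i := 0) = (\<lambda>_. 0)(j := 1)" "?b(j := 0) = (\<lambda>_. 0)(i := 1)" using ij by auto
  have pd: "pd i (single (?b, {}) 1) = gvar j" "pd j (single (?b, {}) 1) = gvar i"
    unfolding gvar_e[OF i] gvar_e[OF j] pd_e_even[OF B i] pd_e_even[OF B j] using ij 1 by auto
  have "torus (\<lambda>r. if r = i then 1 else if r = j then -1 else 0) = - gen i j ?b {}"
  proof (rule WC_eqI)
    fix s assume "s \<in> EE"
    thus "coef s (torus (\<lambda>r. if r = i then 1 else if r = j then -1 else 0)) = coef s (- gen i j ?b {})"
      using i j ij E pd by (auto simp: coef_torus coef_simps coef_DD sc_minus_left)
  qed (intro W0_WC torus_W0 S0_W0 S0_simps(4) g)+
  thus ?thesis using g S0_simps by simp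
qed

text \<open>D_ik(x_i x_k) = x_i D_i + x_k D_k; the parity sign turns the difference of the even case
  into a sum.\<close>

lemma torus_odd_S0:
  assumes i: "i \<in> E0" and k: "k \<in> E1"
  shows "torus (\<lambda>r. if r = i then 1 else if r = k then 1 else 0) = gen i k ((\<lambda>_. 0)(i := 1)) {k}"
    "torus (\<lambda>r. if r = i then 1 else if r = k then 1 else 0) \<in> S0"
proof -
  let ?b = "(\<lambda>_. 0)(i := 1) :: nat \<Rightarrow> nat"
  have B: "(?b, {k}) \<in> AB" using i k pm_pos[OF i] by (auto simp: AB_iff)
  have E: "i \<in> EE" "k \<in> EE" using i k by (simp_all add: EE_cases)
  have ik: "i \<noteq> k" using Y_disj i k by blast
  have g: "gen i k ?b {k} \<in> S0" using gen_S0[OF E B] i k by simp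
  have e: "{j. j = k \<and> j < k} = {}" by auto
  have "?b(i := 0) = (\<lambda>_. 0)" by auto
  hence pd: "pd i (single (?b, {k}) 1) = gvar k" "pd k (single (?b, {k}) 1) = gvar i"
    unfolding gvar_e[OF i] pd_e_even[OF B i] pd_e_odd[OF B k] using Y1_gt[OF k] by (simp_all add: gvar_def e)
  show eq: "torus (\<lambda>r. if r = i then 1 else if r = k then 1 else 0) = gen i k ?b {k}"
  proof (rule WC_eqI)
    fix s assume "s \<in> EE"
    thus "coef s (torus (\<lambda>r. if r = i then 1 else if r = k then 1 else 0)) = coef s (gen i k ?b {k})"
      using i k ik E pd by (auto simp: coef_torus coef_simps coef_DD sc_minus_left)
  qed (intro W0_WC torus_W0 S0_W0 S0_simps(4) g)+
  thus "torus (\<lambda>r. if r = i then 1 else if r = k then 1 else 0) \<in> S0" using g by simp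
qed

text \<open>Apply \<open>D\<close> to [h, x] = \<mu>(h) x. Since D x has weight \<mu> + \<xi>, the
  terms in \<mu>(h) cancel and \<xi>(h) D x = -[D h, x] remains.\<close>

lemma torus_inner:
  assumes D: "D \<in> DER" "has_degree \<xi> D" and h: "torus b \<in> S0" and w: "(\<Sum>r\<in>EE. b r * of_int (\<xi> r)) \<noteq> 0"
  shows "\<exists>E\<in>W0. D + restr S0 (br E) = 0"
proof -
  let ?w = "\<Sum>r\<in>EE. b r * of_int (\<xi> r)"
  let ?E = "sc (1 / ?w) (D (torus b))"
  have DW: "D (torus b) \<in> W0" using DERD(1)[OF D(1) h] .
  have EW: "?E \<in> W0" using DW by simp
  have "D + restr S0 (br ?E) = 0"
  proof (rule DER_ext_gens)
    show "D + restr S0 (br ?E) \<in> DER" using D(1) EW by (intro DER_add ad_DER)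
    fix r s \<beta> u assume g: "(\<beta>, u) \<in> AB" "r \<in> EE" "s \<in> EE" "even (card u + tt r + tt s)"
    let ?x = "gen r s \<beta> u" and ?\<mu> = "adeg (\<beta>, u) - ep r - ep s"
    have x: "?x \<in> S0" "?x \<in> Wd ?\<mu>" using gen_S0 gen_Wd g by blast+
    let ?c = "\<Sum>r\<in>EE. b r * of_int (?\<mu> r)"
    have sum: "(\<Sum>r\<in>EE. b r * of_int ((?\<mu> + \<xi>) r)) = ?c + ?w"
      by (simp only: plus_fun_apply of_int_add distrib_left sum.distrib)
    have "D (br (torus b) ?x) = sc ?c (D ?x)"
      using br_torus[OF x(2), of b] DERD(3)[OF D(1) x(1)] by simp
    moreover have "D (br (torus b) ?x) = br (torus b) (D ?x) - br ?x (D (torus b))"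
      using DERD(4)[OF D(1) h x(1)] .
    moreover have "br (torus b) (D ?x) = sc (?c + ?w) (D ?x)"
      using br_torus[OF has_degreeD[OF D(2) x], of b] unfolding sum .
    moreover have "br ?x (D (torus b)) = - br (D (torus b)) ?x"
      using br_anti[OF S0_W0[OF x(1)] DW] .
    ultimately have "sc ?w (D ?x) = - br (D (torus b)) ?x"
      by (simp add: sc_add_left eq_neg_iff_add_eq_0 algebra_simps)
    hence "sc (1 / ?w) (sc ?w (D ?x)) = - br ?E ?x"
      by (simp add: br_bilinear sc_minus)
    hence "D ?x = - br ?E ?x" using w by simp
    thus "(D + restr S0 (br ?E)) ?x = 0" using x(1) by (simp add: plus_fun_apply restr_def)
  qed
  thus ?thesis using EW by blast
qed

lemma of_int_neq_0: "of_int x \<noteq> (0::'a) \<longleftrightarrow> \<not> int p dvd x"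
  by (simp add: of_int_eq_0_iff_char_dvd p_char)

text \<open>The weights on which the torus elements \<open>x\<^sub>i D\<^sub>i - x\<^sub>j D\<^sub>j\<close> and \<open>x\<^sub>i D\<^sub>i + x\<^sub>k D\<^sub>k\<close> all vanish.\<close>

definition torus_trivial :: "(nat \<Rightarrow> int) \<Rightarrow> bool" where
  "torus_trivial \<xi> \<longleftrightarrow> (\<forall>i\<in>E0. \<forall>j\<in>E0. int p dvd \<xi> i - \<xi> j) \<and> (\<forall>i\<in>E0. \<forall>k\<in>E1. int p dvd \<xi> i + \<xi> k)"

lemma nontrivial_inner:
  assumes D: "D \<in> DER" "has_degree \<xi> D" and "\<not> torus_trivial \<xi>"
  shows "\<exists>E\<in>W0. D + restr S0 (br E) = 0"
proof -
  consider i j where "i \<in> E0" "j \<in> E0" "\<not> int p dvd \<xi> i - \<xi> j"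
    | i k where "i \<in> E0" "k \<in> E1" "\<not> int p dvd \<xi> i + \<xi> k"
    using assms(3) unfolding torus_trivial_def by blast
  thus ?thesis
  proof cases
    case 1
    hence ij: "i \<noteq> j" by auto
    have "(\<Sum>r\<in>EE. (if r = i then 1 else if r = j then -1 else 0) * of_int (\<xi> r)) = (of_int (\<xi> i - \<xi> j) :: 'a)"
      by (subst sum_two_weights) (use 1 ij in \<open>auto simp: EE_cases\<close>)
    hence "(\<Sum>r\<in>EE. (if r = i then 1 else if r = j then -1 else 0) * of_int (\<xi> r)) \<noteq> (0 :: 'a)"
      using 1(3) by (simp only: of_int_neq_0 not_False_eq_True)
    thus ?thesis by (rule torus_inner[OF D torus_even_S0[OF 1(1,2) ij]])
  next
    case 2
    hence ik: "i \<noteq> k" using Y_disj by blast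
    have "(\<Sum>r\<in>EE. (if r = i then 1 else if r = k then 1 else 0) * of_int (\<xi> r)) = (of_int (\<xi> i + \<xi> k) :: 'a)"
      by (subst sum_two_weights) (use 2 ik in \<open>auto simp: EE_cases\<close>)
    hence "(\<Sum>r\<in>EE. (if r = i then 1 else if r = k then 1 else 0) * of_int (\<xi> r)) \<noteq> (0 :: 'a)"
      using 2(3) by (simp only: of_int_neq_0 not_False_eq_True)
    thus ?thesis by (rule torus_inner[OF D torus_odd_S0(2)[OF 2(1,2)]])
  qed
qed

text \<open>\<open>x\<^sub>k x\<^sub>l D\<^sub>j\<close> multiplies \<open>x\<^sup>\<gamma> (c\<^sub>k x\<^sub>k D\<^sub>k + c\<^sub>l x\<^sub>l D\<^sub>l + \<dots>)\<close> by \<open>c\<^sub>k + c\<^sub>l\<close>;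
  three odd variables then force all \<open>c\<^sub>k\<close> to vanish.\<close>

lemma odd_torus_zero:
  assumes V: "V \<in> W0" "\<And>\<alpha> u r. V (\<alpha>, u, r) \<noteq> 0 \<Longrightarrow> r \<in> E1 \<and> \<alpha> = \<gamma> \<and> u = {r}"
    and j: "j \<in> E0"
    and br: "\<And>k l. k \<in> E1 \<Longrightarrow> l \<in> E1 \<Longrightarrow> k \<noteq> l \<Longrightarrow> br (mkW (single (\<lambda>_. 0, {k, l}) 1) j) V = 0"
  shows "V = 0"
proof (rule ccontr)
  assume "V \<noteq> 0"
  then obtain \<alpha> u r where nz: "V (\<alpha>, u, r) \<noteq> 0" using nonzero_coeff by blast
  hence r: "r \<in> E1" "\<alpha> = \<gamma>" "u = {r}" using V(2) by blast+
  have "(\<gamma>, {r}) \<in> AB" using W0_supp[OF V(1) nz] r by (simp add: Wbasis_def)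
  hence G: "(\<gamma>, v) \<in> AB" if "v \<subseteq> E1" for v using that by (auto simp: AB_iff)
  define c where "c s = (if s \<in> E1 then V (\<gamma>, {s}, s) else 0)" for s
  have prod0: "(\<Prod>i\<in>E0. tbinom i (\<gamma> i) 0) = 1"
    using AB_le[OF G[of "{}"]] by (intro prod.neutral) (auto simp: tbinom_comm[of _ _ 0] tbinom_0)
  have m0: "single (\<gamma>, {}) 1 \<odot> single (\<lambda>_. 0, v) 1 = single (\<gamma>, v) 1" if "v \<subseteq> E1" for v
  proof -
    have "((\<lambda>_. 0), v) \<in> AB" using that by (auto simp: AB_iff)
    thus ?thesis using mul_e[OF G[of "{}"], of "\<lambda>_. 0" v 1 1] prod0 by (simp add: msign_empty)
  qed
  have cpV: "coef s V = sc (c s) (single (\<gamma>, {}) 1 \<odot> gvar s)" if "s \<in> EE" for s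
  proof (cases "s \<in> E1")
    case True
    have "coef s V = single (\<gamma>, {s}) (c s)"
    proof
      fix a :: "(nat \<Rightarrow> nat) \<times> nat set"
      obtain \<beta> w where a: "a = (\<beta>, w)" by (cases a)
      show "coef s V a = single (\<gamma>, {s}) (c s) a"
      proof (cases "\<beta> = \<gamma> \<and> w = {s}")
        case False
        hence "V (\<beta>, w, s) = 0" using V(2)[of \<beta> w s] by blast
        thus ?thesis using False by (auto simp: a coef_apply single_apply)
      qed (use True in \<open>simp add: a coef_apply c_def\<close>)
    qed
    thus ?thesis using True m0[of "{s}"] Y1_gt[OF True] by (simp add: gvar_def)
  next
    case False
    have "coef s V = 0"
    proof
      fix a :: "(nat \<Rightarrow> nat) \<times> nat set"
      obtain \<beta> w where a: "a = (\<beta>, w)" by (cases a)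
      show "coef s V a = 0 a" using V(2)[of \<beta> w s] False by (auto simp only: a coef_apply zero_fun_apply)
    qed
    thus ?thesis using False by (simp add: c_def)
  qed
  \<comment> \<open>V is x^\<gamma> times a diagonal field, so it acts as an Euler operator followed
    by multiplication with x^\<gamma>.\<close>
  have act: "act V f = single (\<gamma>, {}) 1 \<odot> act (torus c) f" if "f \<in> AC" for f
  proof -
    have "coef s V \<odot> pd s f = single (\<gamma>, {}) 1 \<odot> (coef s (torus c) \<odot> pd s f)" if "s \<in> EE" for s
      using that by (simp add: cpV coef_torus mul_sc_left mul_sc_right mul_assoc G gvar_AC)
    thus ?thesis by (simp add: act_def mul_sum_right)
  qed
  have sum0: "c k + c l = 0" if kl: "k \<in> E1" "l \<in> E1" "k \<noteq> l" for k l
  proof -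
    have B: "(\<lambda>_. 0, {k, l}) \<in> AB" using kl by (auto simp: AB_iff)
    let ?w = "mkW (single (\<lambda>_. 0, {k, l}) 1) j"
    have w: "?w \<in> W0" using kl mkW_odd_S0[of "{k,l}" j] j S0_W0 by simp
    have "coef j (br ?w V) = act ?w (coef j V) - act V (single (\<lambda>_. 0, {k, l}) 1)"
      using w V(1) j by (simp add: coef_br EE_cases coef_mkW)
    moreover have "coef j V = 0"
      using cpV[of j] j Y_disj by (auto simp: EE_cases c_def)
    ultimately have "act V (single (\<lambda>_. 0, {k, l}) 1) = 0"
      using br[OF kl] by (simp add: coef_simps act_simps)
    hence "single (\<gamma>, {}) 1 \<odot> act (torus c) (single (\<lambda>_. 0, {k, l}) 1) = 0"
      using act B by simp
    moreover have "act (torus c) (single (\<lambda>_. 0, {k, l}) 1) = sc (c k + c l) (single (\<lambda>_. 0, {k, l}) 1)"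
    proof -
      have "(\<Sum>r\<in>EE. c r * of_int (adeg (\<lambda>_. 0, {k, l}) r)) = (\<Sum>r\<in>EE. (if r = k then c k else 0) + (if r = l then c l else 0))"
        using kl by (intro sum.cong) (auto simp: adeg_def)
      thus ?thesis using act_torus[OF Ad_single[OF B], of c 1] kl by (simp add: sum.distrib EE_cases)
    qed
    ultimately have "single (\<gamma>, {k, l}) (c k + c l) = 0"
      using m0[of "{k, l}"] kl by (simp add: mul_sc_right del: sc_single) simp
    thus ?thesis by (metis single_same zero_fun_apply)
  qed
  obtain k where k: "k \<in> E1" "k \<noteq> r" using ex_other_odd[of r r] by auto
  obtain l where l: "l \<in> E1" "l \<noteq> r" "l \<noteq> k" using ex_other_odd[of r k] by auto
  have "c r + c k = 0" "c r + c l = 0" "c k + c l = 0" using sum0 k l r by auto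
  moreover have "2 * c r = (c r + c k) + (c r + c l) - (c k + c l)" by (simp add: algebra_simps)
  ultimately have "2 * c r = 0" by simp
  hence "c r = 0" using two_neq_0 by simp
  thus False using nz r by (simp add: c_def)
qed

lemma p_dvd_int_small: "int p dvd x \<Longrightarrow> \<bar>x\<bar> < int p \<Longrightarrow> x = 0"
  using dvd_imp_le_int[of x "int p"] by force

lemma p_dvd_pow: "i \<in> E0 \<Longrightarrow> int p dvd int (p ^ t i)"
  using t_ge_1 by (metis dvd_power int_dvd_int_iff less_eq_Suc_le One_nat_def)

text \<open>What normalization leaves of D(D_i) involves x_i only to its top power. Invisibility to
  the torus reduces it to x_i^(pm i) times a diagonal field in the odd variables, with \<xi> i =
  p^(t i). The fields x_k x_l D_j commute with D_i and are killed by \<open>D\<close>, so they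
  annihilate this remainder, and \<open>odd_torus_zero\<close> applies.\<close>

lemma DER_Dvec_zero:
  assumes D: "D \<in> DER" "has_degree \<xi> D" and tr: "torus_trivial \<xi>" and i: "i \<in> E0"
    and nf: "\<And>i \<alpha> u r. i \<in> E0 \<Longrightarrow> D (Dvec i) (\<alpha>, u, r) \<noteq> 0 \<Longrightarrow> \<alpha> i = pm i \<and> (\<forall>l\<in>E0. l \<noteq> i \<longrightarrow> \<alpha> l = 0)"
  shows "D (Dvec i) = 0"
proof (rule ccontr)
  let ?V = "D (Dvec i)"
  assume "?V \<noteq> 0"
  have VW: "?V \<in> Wd (\<xi> - ep i)"
    using has_degreeD[OF D(2) Dvec_S0[OF i] Dvec_Wd[OF i]] by simp
  have pp: "int (p ^ t i) = int (pm i) + 1" using p_pow_gt_1[OF i] by (simp add: of_nat_diff)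
  obtain j where j: "j \<in> E0" "j \<noteq> i" using ex_other[of i i] by auto
  have form: "r \<in> E1 \<and> \<alpha> = (\<lambda>_. 0)(i := pm i) \<and> u = {r} \<and> \<xi> i = int (p ^ t i)"
    if nz: "?V (\<alpha>, u, r) \<noteq> 0" for \<alpha> u r
  proof -
    have "(\<alpha>, u, r) \<in> WB" using W0_supp[OF Wd_W0[OF VW] nz] .
    hence AB: "(\<alpha>, u) \<in> AB" and rE: "r \<in> EE" by (auto simp: Wbasis_def)
    have a: "\<alpha> i = pm i" "\<And>l. l \<in> E0 \<Longrightarrow> l \<noteq> i \<Longrightarrow> \<alpha> l = 0" using nf[OF i nz] by blast+
    have dgx: "wdeg (\<alpha>, u, r) l = \<xi> l - ep i l" for l
      using WdD[OF VW nz] by (simp add: fun_eq_iff pointwise)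
    have u: "l \<in> u \<Longrightarrow> l \<in> E1" for l using AB by (auto simp: AB_iff)
    have xi: "\<xi> i = int (p ^ t i) - (if r = i then 1 else 0)"
      using dgx[of i] a pp u[of i] Y_disj i by (auto simp: wdeg_def split: if_splits)
    have xl: "\<xi> l = - (if r = l then 1 else 0)" if "l \<in> E0" "l \<noteq> i" for l
      using dgx[of l] a(2)[OF that] u[of l] Y_disj that by (auto simp: wdeg_def split: if_splits)
    \<comment> \<open>An even r would make \<xi> at i differ from \<xi> at another even index by
      p^(t i) - 1 or p^(t i) + 1, which is no multiple of p.\<close>
    have "r \<notin> E0"
    proof
      assume r: "r \<in> E0"
      show False
      proof (cases "r = i")
        case True
        have "int p dvd \<xi> i - \<xi> j" using tr i j by (auto simp: torus_trivial_def)
        hence "int p dvd int (p ^ t i) - 1" using xi xl[OF j] True j by simp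
        hence "int p dvd 1" using p_dvd_pow[OF i] by (metis dvd_diff_right_iff)
        thus False using p_gt_3 by simp
      next
        case False
        have "int p dvd \<xi> i - \<xi> r" using tr i r by (auto simp: torus_trivial_def)
        hence "int p dvd int (p ^ t i) + 1" using xi xl[OF r False] False by simp
        hence "int p dvd 1" using p_dvd_pow[OF i] by (metis dvd_add_right_iff)
        thus False using p_gt_3 by simp
      qed
    qed
    hence r: "r \<in> E1" using rE by (simp add: EE_cases)
    have xi': "\<xi> i = int (p ^ t i)" using xi r Y_disj i by auto
    have "l \<in> u \<longleftrightarrow> l = r" if l: "l \<in> E1" for l
    proof -
      have "int p dvd \<xi> i + \<xi> l" using tr i l by (auto simp: torus_trivial_def)
      hence "int p dvd \<xi> l" using xi' p_dvd_pow[OF i] by (metis dvd_add_right_iff)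
      moreover have xl: "\<xi> l = (if l \<in> u then 1 else 0) - (if r = l then 1 else 0)"
        using dgx[of l] AB l Y_disj i by (auto simp: wdeg_def AB_iff split: if_splits)
      ultimately have "\<xi> l = 0" using p_gt_3 by (intro p_dvd_int_small) (auto split: if_splits)
      thus ?thesis using xl by (auto split: if_splits)
    qed
    hence "u = {r}" using u r by blast
    moreover have "\<alpha> = (\<lambda>_. 0)(i := pm i)"
      using a AB by (auto simp: AB_iff fun_eq_iff)
    ultimately show ?thesis using r xi' by simp
  qed
  have xii: "\<xi> i = int (p ^ t i)" using form nonzero_coeff[OF \<open>?V \<noteq> 0\<close>] by blast
  have "?V = 0"
  proof (rule odd_torus_zero[OF Wd_W0[OF VW] _ j(1)])
    show "r \<in> E1 \<and> \<alpha> = (\<lambda>_. 0)(i := pm i) \<and> u = {r}" if "?V (\<alpha>, u, r) \<noteq> 0" for \<alpha> u r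
      using form[OF that] by blast
    fix k l assume kl: "k \<in> E1" "l \<in> E1" "k \<noteq> l"
    let ?w = "mkW (single (\<lambda>_. 0, {k, l}) 1) j"
    have B: "(\<lambda>_. 0, {k, l}) \<in> AB" using kl by (auto simp: AB_iff)
    have wS: "?w \<in> S0" using kl j mkW_odd_S0[of "{k, l}" j] by simp
    have wWd: "?w \<in> Wd (wdeg (\<lambda>_. 0, {k, l}, j))" using mkW_gen_Wd[OF B, of j 1] j kl by (simp add: EE_cases)
    \<comment> \<open>Shifting the weight by p^(t i) at i exceeds every exponent available
      there.\<close>
    have "D ?w = 0"
    proof (rule has_degree_kill[OF D(2) wS wWd])
      fix \<alpha> u r assume W0B: "(\<alpha>, u, r) \<in> W0B" and d: "\<forall>x. wdeg (\<lambda>_. 0, {k, l}, j) x + \<xi> x = wdeg (\<alpha>, u, r) x"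
      have AB: "(\<alpha>, u) \<in> AB" using W0B by (auto simp: W0B_def Wbasis_def)
      have "i \<notin> u" "i \<noteq> k" "i \<noteq> l" using AB i kl Y_disj by (auto simp: AB_iff)
      hence "int (\<alpha> i) \<ge> int (p ^ t i)" using d[rule_format, of i] xii j by (auto simp: wdeg_def split: if_splits)
      thus False using AB_le[OF AB i] pp by linarith
    qed
    moreover have "br ?w (Dvec i) = 0"
    proof -
      have "br (Dvec i) ?w = 0"
      proof
        fix b :: "(nat \<Rightarrow> nat) \<times> nat set \<times> nat"
        obtain \<alpha> u r where b: "b = (\<alpha>, u, r)" by (cases b)
        have "\<alpha>(i := Suc (\<alpha> i)) \<noteq> (\<lambda>_. 0)" by (metis fun_upd_same nat.distinct(1))
        thus "br (Dvec i) ?w b = 0 b"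
          unfolding b br_Dvec[OF S0_W0[OF wS] i] by (simp add: mkW_def single_apply zero_fun_apply)
      qed
      thus ?thesis using br_anti[OF S0_W0[OF wS] Dvec_W0[OF i]] by simp
    qed
    ultimately show "br ?w ?V = 0"
      using DERD(4)[OF D(1) wS Dvec_S0[OF i]] DER_0[OF D(1)] by simp
  qed
  thus False using \<open>?V \<noteq> 0\<close> by simp
qed

lemma trivial_normalize:
  assumes D: "D \<in> DER" "has_degree \<xi> D" "torus_trivial \<xi>"
  obtains E where "E \<in> Wd \<xi>" "\<And>i. i \<in> E0 \<Longrightarrow> (D + restr S0 (br E)) (Dvec i) = 0"
proof -
  from normalize_on_Dvec[OF D(1,2)] obtain E where E: "E \<in> Wd \<xi>"
    "\<And>i \<alpha> u r. i \<in> E0 \<Longrightarrow> (D + restr S0 (br E)) (Dvec i) (\<alpha>, u, r) \<noteq> 0 \<Longrightarrow>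
       \<alpha> i = pm i \<and> (\<forall>l\<in>E0. l \<noteq> i \<longrightarrow> \<alpha> l = 0)" by blast
  have "D + restr S0 (br E) \<in> DER" "has_degree \<xi> (D + restr S0 (br E))"
    using D E(1) by (auto intro!: DER_add ad_DER has_degree_add has_degree_ad Wd_W0)
  hence "(D + restr S0 (br E)) (Dvec i) = 0" if "i \<in> E0" for i
    by (rule DER_Dvec_zero[OF _ _ D(3) that E(2)])
  thus thesis using that E(1) by blast
qed

section \<open>Weights \<open>1\<close> and \<open>-1\<close> on the odd indices\<close>

abbreviation gen_deg :: "nat \<Rightarrow> nat \<Rightarrow> (nat \<Rightarrow> nat) \<Rightarrow> nat set \<Rightarrow> nat \<Rightarrow> int" where
  "gen_deg r s \<beta> u \<equiv> adeg (\<beta>, u) - ep r - ep s"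

lemma gen_deg_apply: "gen_deg r s \<beta> u i = int (\<beta> i) + (if i \<in> u then 1 else 0) - (if i = r then 1 else 0) - (if i = s then 1 else 0)"
  by (simp add: adeg_def minus_apply)

definition gen_ok :: "nat \<Rightarrow> nat \<Rightarrow> (nat \<Rightarrow> nat) \<Rightarrow> nat set \<Rightarrow> bool" where
  "gen_ok r s \<beta> u \<longleftrightarrow> (\<beta>, u) \<in> AB \<and> r \<in> EE \<and> s \<in> EE \<and> even (card u + tt r + tt s)"

lemma gen_ok_gen: "gen_ok r s \<beta> u \<Longrightarrow> gen r s \<beta> u \<in> S0" "gen_ok r s \<beta> u \<Longrightarrow> gen r s \<beta> u \<in> Wd (gen_deg r s \<beta> u)"
  unfolding gen_ok_def using gen_S0 gen_Wd by blast+

lemma gen_ok_swap: "gen_ok r s \<beta> u \<longleftrightarrow> gen_ok s r \<beta> u"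
  by (auto simp: gen_ok_def ac_simps)

lemma gen_same: "r \<in> E0 \<Longrightarrow> gen r r \<beta> u = 0"
  by (simp add: Drs_def)

lemma gen_swap_kill:
  assumes "D \<in> DER" "gen_ok r s \<beta> u" "D (gen r s \<beta> u) = 0"
  shows "D (gen s r \<beta> u) = 0"
  using DERD(3)[OF assms(1) gen_ok_gen(1)[OF assms(2)]] assms(3) unfolding DD_swap[of s r] by (simp only: sc_simps)

text \<open>The bracket of \<open>x\<^sub>a D\<^sub>b\<close> with the generator obtained from \<open>x\<^sup>\<beta>\<close> by trading one \<open>x\<^sub>a\<close> for an \<open>x\<^sub>b\<close> is \<open>\<beta>\<^sub>a\<close> times
  the given generator, up to the generators with \<open>a\<close> replaced by \<open>b\<close> among the indices.\<close>

lemma gvar_step: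
  assumes D: "D \<in> DER" and g: "gen_ok r s \<beta> u"
    and ab: "a \<in> E0" "b \<in> E0" "a \<noteq> b" "\<beta> b < pm b" "\<not> p dvd \<beta> a"
    and k: "D (mkW (gvar a) b) = 0" "D (gen r s (\<beta>(a := \<beta> a - 1, b := Suc (\<beta> b))) u) = 0"
      "r = a \<Longrightarrow> D (gen b s (\<beta>(a := \<beta> a - 1, b := Suc (\<beta> b))) u) = 0"
      "s = a \<Longrightarrow> D (gen r b (\<beta>(a := \<beta> a - 1, b := Suc (\<beta> b))) u) = 0"
  shows "D (gen r s \<beta> u) = 0"
proof -
  let ?b = "\<beta>(a := \<beta> a - 1, b := Suc (\<beta> b))"
  have pos: "\<beta> a \<ge> 1" using ab(5) by (cases "\<beta> a") auto
  have g': "(\<beta>, u) \<in> AB" "r \<in> EE" "s \<in> EE" "even (card u + tt r + tt s)" using g by (auto simp: gen_ok_def)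
  have B: "(?b, u) \<in> AB" using gvar_pd_e(1)[OF g'(1) ab(1-3) pos ab(4)] .
  have S: "gen r s ?b u \<in> S0" "gen r s \<beta> u \<in> S0" using gen_S0 B g' by blast+
  have "r = a \<Longrightarrow> even (card u + tt b + tt s)" "s = a \<Longrightarrow> even (card u + tt r + tt b)"
    using g'(4) ab by auto
  hence S': "r = a \<Longrightarrow> gen b s ?b u \<in> S0" "s = a \<Longrightarrow> gen r b ?b u \<in> S0"
    using gen_S0[OF _ _ B] g' ab by (auto simp: EE_cases)
  have eq: "sc (of_nat (\<beta> a)) (gen r s \<beta> u) = br (mkW (gvar a) b) (gen r s ?b u)
      + (if r = a then gen b s ?b u else 0) + (if s = a then gen r b ?b u else 0)"
    unfolding br_gvar_gen[OF g'(1) ab(1-3) pos ab(4) g'(2-4)] by simp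
  have z: "D (br (mkW (gvar a) b) (gen r s ?b u)) = 0"
    by (rule DER_br_kill[OF D mkW_gvar_S0(1)[OF ab(1-3)] S(1) k(1,2)])
  have "br (mkW (gvar a) b) (gen r s ?b u) \<in> S0"
    by (rule br_S0[OF mkW_gvar_S0(1)[OF ab(1-3)] S(1)])
  hence "D (sc (of_nat (\<beta> a)) (gen r s \<beta> u)) = 0"
    unfolding eq using z k(3,4) S' DER_0[OF D] S0_simps(1,2)
    by (auto simp: DERD(2)[OF D])
  thus ?thesis
    by (rule DER_sc_kill[OF D S(2), rotated]) (use ab(5) of_nat_neq_0 in blast)
qed

text \<open>The cyclic relation \<open>D\<^sub>k\<^sub>l(D\<^sub>a F) = \<plusminus> D\<^sub>a\<^sub>k(D\<^sub>l F) \<plusminus> D\<^sub>a\<^sub>l(D\<^sub>k F)\<close>.\<close>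

lemma gen_odd_odd_kill:
  assumes D: "D \<in> DER" and kl: "k \<in> E1" "l \<in> E1" and g: "gen_ok k l \<beta> u" and a: "a \<in> E0" "\<beta> a < pm a"
    and z: "l \<in> u \<Longrightarrow> D (gen a k (\<beta>(a := Suc (\<beta> a))) (u - {l})) = 0"
      "k \<in> u \<Longrightarrow> D (gen a l (\<beta>(a := Suc (\<beta> a))) (u - {k})) = 0"
  shows "D (gen k l \<beta> u) = 0"
proof -
  let ?B = "\<beta>(a := Suc (\<beta> a))" and ?F = "single (\<beta>(a := Suc (\<beta> a)), u) 1 :: 'a ael"
  have AB: "(\<beta>, u) \<in> AB" "even (card u)" using g kl by (auto simp: gen_ok_def)
  have fin: "finite u" using AB_finite[OF AB(1)] .
  have F: "(?B, u) \<in> AB" using AB a by (intro AB_upd) auto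
  have h: "hom 0 ?F" using hom_single[OF F, of 1] AB by simp
  have red: "DD a x 1 (pd y ?F) = (if y \<in> u then sc ((-1) ^ card {j\<in>u. j < y}) (gen a x ?B (u - {y})) else 0)"
    if "y \<in> E1" for x y
  proof (cases "y \<in> u")
    case True
    have "card (u - {y}) mod 2 = 1" using AB(2) fin True card.remove[OF fin True] by presburger
    thus ?thesis using True pd_e_odd[OF F that] by (simp flip: DD_simps(2))
  qed (use pd_e_odd[OF F that] in \<open>simp add: DD_simps\<close>)
  have ok: "gen_ok a x ?B (u - {y})" if "x \<in> E1" "y \<in> u" for x y
  proof -
    have "card u = Suc (card (u - {y}))" using card.remove[OF fin that(2)] .
    thus ?thesis using F AB(2) that a by (auto simp: gen_ok_def EE_cases AB_iff)
  qed
  have zero: "DD a x 1 (pd y ?F) \<in> S0 \<and> D (DD a x 1 (pd y ?F)) = 0"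
    if "x \<in> E1" "y \<in> E1" "y \<in> u \<Longrightarrow> D (gen a x ?B (u - {y})) = 0" for x y
  proof (cases "y \<in> u")
    case True
    have S: "gen a x ?B (u - {y}) \<in> S0" using gen_ok_gen ok that True by blast
    thus ?thesis unfolding red[OF that(2)] using DERD(3)[OF D S] that True S0_simps by simp
  qed (use red[OF that(2)] DER_0[OF D] S0_simps in simp)
  have "gen k l \<beta> u = DD k l 0 (pd a ?F)"
    using pd_e_even[OF F a(1)] AB(2) by simp
  also have "\<dots> = - DD a k 1 (pd l ?F) - DD a l 1 (pd k ?F)"
    by (rule DD_odd_odd[OF a(1) kl h])
  finally show ?thesis
    using zero[OF kl(1,2) z(1)] zero[OF kl(2,1) z(2)]
    by (simp add: DER_diff[OF D] DER_minus[OF D] S0_simps)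
qed

text \<open>The cyclic relation with two even indices and one odd: it leads to D_sk with x_j lowered
  and to D_js with x_k removed.\<close>

lemma gen_even_odd_kill:
  assumes D: "D \<in> DER" and js: "j \<in> E0" "s \<in> E0" "k \<in> E1" "j \<noteq> s" and g: "gen_ok j k \<beta> u" and s: "\<beta> s < pm s"
    and z: "\<beta> j > 0 \<Longrightarrow> D (gen s k (\<beta>(s := Suc (\<beta> s), j := \<beta> j - 1)) u) = 0"
      "k \<in> u \<Longrightarrow> D (gen j s (\<beta>(s := Suc (\<beta> s))) (u - {k})) = 0"
  shows "D (gen j k \<beta> u) = 0"
proof -
  let ?B = "\<beta>(s := Suc (\<beta> s))" and ?F = "single (\<beta>(s := Suc (\<beta> s)), u) 1 :: 'a ael"
  have AB: "(\<beta>, u) \<in> AB" "odd (card u)" using g js by (auto simp: gen_ok_def)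
  have fin: "finite u" using AB_finite[OF AB(1)] .
  have F: "(?B, u) \<in> AB" using AB js s by (intro AB_upd) auto
  have o: "card u mod 2 = 1" using AB(2) by presburger
  have h: "hom 1 ?F" using hom_single[OF F, of 1] o by simp
  have "DD s k 1 (pd j ?F) \<in> S0 \<and> D (DD s k 1 (pd j ?F)) = 0"
  proof (cases "\<beta> j > 0")
    case True
    have "(?B(j := \<beta> j - 1), u) \<in> AB" using AB_upd[OF F js(1), of "\<beta> j - 1"] AB_le[OF AB(1) js(1)] by simp
    hence "gen_ok s k (?B(j := \<beta> j - 1)) u" using AB js by (simp add: gen_ok_def EE_cases)
    from gen_ok_gen(1)[OF this] show ?thesis using z(1)[OF True] True js pd_e_even[OF F js(1)] o by simp
  qed (use pd_e_even[OF F js(1)] js DER_0[OF D] S0_simps in \<open>simp add: DD_simps\<close>)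
  moreover have "DD j s 0 (pd k ?F) \<in> S0 \<and> D (DD j s 0 (pd k ?F)) = 0"
  proof (cases "k \<in> u")
    case True
    have cu: "card u = Suc (card (u - {k}))" using card.remove[OF fin True] .
    hence even_part: "even (card (u - {k}))" using AB(2) by simp
    have ok: "gen_ok j s ?B (u - {k})" using F even_part js by (auto simp: gen_ok_def EE_cases AB_iff)
    have "DD j s 0 (pd k ?F) = sc ((-1) ^ card {j\<in>u. j < k}) (gen j s ?B (u - {k}))"
      using pd_e_odd[OF F js(3)] True even_part by (simp flip: DD_simps(2))
    thus ?thesis using z(2)[OF True] gen_ok_gen(1)[OF ok] DERD(3)[OF D gen_ok_gen(1)[OF ok]] S0_simps by simp
  qed (use pd_e_odd[OF F js(3)] DER_0[OF D] S0_simps in \<open>simp add: DD_simps\<close>)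
  moreover have "gen j k \<beta> u = DD j k 1 (pd s ?F)"
    using pd_e_even[OF F js(2)] o by simp
  ultimately show ?thesis
    unfolding DD_even_odd[OF js(1-3) h] by (simp add: DER_diff[OF D])
qed

lemma W0B_D: "(\<alpha>, v, q) \<in> W0B \<Longrightarrow> (\<alpha>, v) \<in> AB" "(\<alpha>, v, q) \<in> W0B \<Longrightarrow> q \<in> EE"
  "(\<alpha>, v, q) \<in> W0B \<Longrightarrow> even (card v + tt q)" "(\<alpha>, v, q) \<in> W0B \<Longrightarrow> v \<subseteq> E1"
  by (auto simp: W0B_def Wbasis_def AB_iff)

lemma wdeg_E1: "(\<alpha>, v, q) \<in> W0B \<Longrightarrow> k \<in> E1 \<Longrightarrow>
    wdeg (\<alpha>, v, q) k = (if k \<in> v then 1 else 0) - (if k = q then 1 else 0)"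
  using W0B_D(1)[of \<alpha> v q] Y_disj by (auto simp: wdeg_def AB_iff)

lemma wdeg_E0: "(\<alpha>, v, q) \<in> W0B \<Longrightarrow> i \<in> E0 \<Longrightarrow> wdeg (\<alpha>, v, q) i = int (\<alpha> i) - (if i = q then 1 else 0)"
  using W0B_D(4)[of \<alpha> v q] Y_disj by (auto simp: wdeg_def)

lemma nonzero_value_degree:
  assumes "D \<in> DER" "has_degree \<xi> D" "x \<in> S0" "x \<in> Wd \<mu>" "D x (\<alpha>, v, q) \<noteq> 0"
  shows "(\<alpha>, v, q) \<in> W0B" "\<mu> i + \<xi> i = wdeg (\<alpha>, v, q) i"
    "\<exists>\<alpha>' v' q'. (\<alpha>', v', q') \<in> W0B \<and> \<mu> = wdeg (\<alpha>', v', q')"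
proof -
  have W: "D x \<in> Wd (\<mu> + \<xi>)" using has_degreeD assms by blast
  show "(\<alpha>, v, q) \<in> W0B" using W0_supp_W0B[OF Wd_W0[OF W] assms(5)] .
  show "\<mu> i + \<xi> i = wdeg (\<alpha>, v, q) i" using WdD[OF W assms(5)] by (simp add: plus_fun_apply)
  have "x \<noteq> 0" using assms(5) DER_0[OF assms(1)] by (auto simp: zero_fun_apply)
  then obtain \<alpha>' v' q' where "x (\<alpha>', v', q') \<noteq> 0" using nonzero_coeff by blast
  thus "\<exists>\<alpha>' v' q'. (\<alpha>', v', q') \<in> W0B \<and> \<mu> = wdeg (\<alpha>', v', q')"
    using W0_supp_W0B[OF Wd_W0[OF assms(4)]] WdD[OF assms(4)] by metis
qed

lemma p_dvd_Suc_pm: "i \<in> E0 \<Longrightarrow> int p dvd int (pm i) + 1"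
proof -
  assume i: "i \<in> E0"
  have "int (pm i) + 1 = int (p ^ t i)" using p_pow_gt_1[OF i] by (simp add: of_nat_diff)
  thus ?thesis using p_dvd_pow[OF i] by simp
qed

text \<open>The top exponent is -1 modulo p, so a residue between 0 and p - 2 leaves room to raise
  the exponent by one.\<close>

lemma lt_pm:
  assumes "(\<beta>, u) \<in> AB" "i \<in> E0" "int p dvd int (\<beta> i) - z" "z \<ge> 0" "z + 1 < int p"
  shows "\<beta> i < pm i"
proof -
  have "\<beta> i \<noteq> pm i"
  proof
    assume "\<beta> i = pm i"
    hence "int p dvd int (pm i) - z" using assms(3) by (simp only:)
    hence "int p dvd (int (pm i) + 1) - (int (pm i) - z)"
      by (rule dvd_diff[OF p_dvd_Suc_pm[OF assms(2)]])
    hence "int p dvd z + 1" by (simp add: add.commute)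
    thus False using assms(4,5) zdvd_not_zless by force
  qed
  thus ?thesis using AB_le[OF assms(1,2)] by simp
qed

lemma not_dvd_resid:
  assumes "int p dvd int x - z" "\<not> int p dvd z"
  shows "\<not> p dvd x"
proof
  assume "p dvd x"
  hence "int p dvd int x" by simp
  hence "int p dvd int x - (int x - z)" using assms(1) by (rule dvd_diff)
  thus False using assms(2) by simp
qed

lemma not_dvd_small: "z \<noteq> 0 \<Longrightarrow> \<bar>z\<bar> < int p \<Longrightarrow> \<not> int p dvd z"
  using p_dvd_int_small by blast

lemma DER_zero_by_const_coeff:
  assumes D: "D \<in> DER" "has_degree \<xi> D" "\<And>i. i \<in> E0 \<Longrightarrow> D (Dvec i) = 0"
    and z: "\<And>r s \<beta> u v q. gen_ok r s \<beta> u \<Longrightarrow> D (gen r s \<beta> u) (\<lambda>_. 0, v, q) \<noteq> 0 \<Longrightarrow> D (gen r s \<beta> u) = 0"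
  shows "D = 0"
proof (rule DER_ext_gens[OF D(1)])
  fix r s \<beta> u assume g: "(\<beta>, u) \<in> AB" "r \<in> EE" "s \<in> EE" "even (card u + tt r + tt s)"
  show "D (gen r s \<beta> u) = 0"
  proof (rule ccontr)
    assume "D (gen r s \<beta> u) \<noteq> 0"
    from ex_const_coeff[OF D(1,3) g this] obtain \<beta>' v q where
      c: "(\<beta>', u) \<in> AB" "D (gen r s \<beta>' u) (\<lambda>_. 0, v, q) \<noteq> 0" by blast
    have "gen_ok r s \<beta>' u" using c(1) g by (simp add: gen_ok_def)
    from z[OF this c(2)] c(2) show False by (simp add: zero_fun_apply)
  qed
qed

text \<open>Weights of basis elements at odd indices lie in [-1, 1], so raising all of them by one
  confines the odd variables of the source to the index of its own derivation. Evenness then makes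
  the source weight 0 on Y_1. The target has weight 1 on all of Y_1, which an odd derivation index
  cannot give.\<close>

lemma plus_supp:
  assumes D: "D \<in> DER" "has_degree \<xi> D" and xi: "\<forall>k\<in>E1. \<xi> k = 1"
    and x: "x \<in> S0" "x \<in> Wd \<mu>" "D x (\<alpha>, v, q) \<noteq> 0"
  shows "q \<in> E0" "\<And>k. k \<in> E1 \<Longrightarrow> \<mu> k = 0" "\<And>i. i \<in> E0 \<Longrightarrow> \<mu> i + \<xi> i = int (\<alpha> i) - (if i = q then 1 else 0)"
proof -
  note S = nonzero_value_degree[OF D x]
  obtain \<alpha>' u' r' where W': "(\<alpha>', u', r') \<in> W0B" and mu: "\<mu> = wdeg (\<alpha>', u', r')" using S(3) by blast
  have eq: "(if k \<in> u' then 1 else 0) - (if k = r' then 1 else 0) + 1 = (if k \<in> v then 1 else 0) - (if k = q then (1::int) else 0)"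
    if "k \<in> E1" for k
    using S(2)[of k] bspec[OF xi that] wdeg_E1[OF S(1) that] wdeg_E1[OF W' that] by (simp add: mu)
  have u': "k \<in> u' \<Longrightarrow> k = r'" if "k \<in> E1" for k
    using eq[OF that] by (auto split: if_splits)
  have "r' \<in> E1 \<Longrightarrow> r' \<in> u'"
  proof (rule ccontr)
    assume r: "r' \<in> E1" "r' \<notin> u'"
    hence "u' = {}" using u' W0B_D(4)[OF W'] by blast
    thus False using W0B_D(3)[OF W'] r by simp
  qed
  hence "k \<in> u' \<longleftrightarrow> k = r'" if "k \<in> E1" for k
    using u'[OF that] that by blast
  hence mu0: "(if k \<in> u' then 1 else 0) - (if k = r' then 1 else 0) = (0::int)" if "k \<in> E1" for k
    using that by simp
  thus "\<mu> k = 0" if "k \<in> E1" for k using wdeg_E1[OF W' that] that by (simp add: mu)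
  have "q \<notin> E1" using eq[of q] mu0[of q] by (auto split: if_splits)
  thus "q \<in> E0" using W0B_D(2)[OF S(1)] by (simp add: EE_cases)
  show "\<mu> i + \<xi> i = int (\<alpha> i) - (if i = q then 1 else 0)" if "i \<in> E0" for i
    using S(2)[of i] wdeg_E0[OF S(1) that] by simp
qed

text \<open>With N = -\<xi>, which is 1 modulo p on Y_0, the residue excludes 0 and -1, so N is
  positive. Then degrees kill all x_a D_b, and brackets with these fields reach every remaining
  generator.\<close>

lemma DER_zero_plus:
  assumes D: "D \<in> DER" "has_degree \<xi> D" "\<And>i. i \<in> E0 \<Longrightarrow> D (Dvec i) = 0"
    and xi: "\<And>k. k \<in> E1 \<Longrightarrow> \<xi> k = 1" "\<And>i. i \<in> E0 \<Longrightarrow> int p dvd \<xi> i + 1"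
  shows "D = 0"
proof (rule DER_zero_by_const_coeff[OF D])
  fix r s \<beta> u v j
  assume g: "gen_ok r s \<beta> u" and nz: "D (gen r s \<beta> u) (\<lambda>_. 0, v, j) \<noteq> 0"
  have xi1: "\<forall>k\<in>E1. \<xi> k = 1" using xi(1) by blast
  note P = plus_supp[OF D(1,2) xi1]
  note C = P[OF gen_ok_gen[OF g] nz]
  define N where "N i = - \<xi> i" for i
  have j: "j \<in> E0" by (rule C(1))
  have int_p_ge_5: "int p \<ge> 5" using p_ge_5 by simp
  have dN: "int p dvd N i - 1" if "i \<in> E0" for i
  proof -
    have "N i - 1 = - (\<xi> i + 1)" by (simp add: N_def)
    thus ?thesis using xi(2)[OF that] by (simp only: dvd_minus_iff)
  qed
  have Npos: "N i \<ge> 1" if i: "i \<in> E0" for i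
  proof -
    obtain \<alpha>' u' r' where W': "(\<alpha>', u', r') \<in> W0B" and mu: "gen_deg r s \<beta> u = wdeg (\<alpha>', u', r')"
      using nonzero_value_degree(3)[OF D(1,2) gen_ok_gen[OF g] nz] by blast
    have "wdeg (\<alpha>', u', r') i \<ge> -1" using wdeg_E0[OF W' i] by simp
    hence "N i \<ge> -1" using C(3)[OF i] unfolding mu by (auto simp: N_def split: if_splits)
    moreover have "N i \<noteq> 0" using dN[OF i] not_dvd_small[of "-1"] int_p_ge_5 by auto
    moreover have "N i \<noteq> -1" using dN[OF i] not_dvd_small[of "-2"] int_p_ge_5 by auto
    ultimately show ?thesis by linarith
  qed
  \<comment> \<open>A value would have negative weight at a third index c and weight at most -2 at
    b, but a basis element has at most one negative weight, equal to -1, on Y_0.\<close>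
  have xvk: "D (mkW (gvar a) b) = 0" if ab: "a \<in> E0" "b \<in> E0" "a \<noteq> b" for a b
  proof (rule ccontr)
    assume "D (mkW (gvar a) b) \<noteq> 0"
    then obtain \<alpha> v q where n: "D (mkW (gvar a) b) (\<alpha>, v, q) \<noteq> 0" using nonzero_coeff by blast
    note Q = P[OF mkW_gvar_S0[OF ab] n]
    obtain c where c: "c \<in> E0" "c \<noteq> a" "c \<noteq> b" using ex_other[of a b] by auto
    have "q = c" using Q(3)[OF c(1)] Npos[OF c(1)] c by (auto simp: N_def minus_apply split: if_splits)
    thus False using Q(3)[OF ab(2)] Npos[OF ab(2)] ab c by (auto simp: N_def minus_apply split: if_splits)
  qed
  \<comment> \<open>Trading an x_a with a different from j creates a second index of weight -1
    besides j, so \<open>D\<close> kills the traded generator. The last two conditions make the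
    index-replacement terms of the form D_bb, which is 0.\<close>
  have step: "D (gen r s \<beta> u) = 0"
    if g: "gen_ok r s \<beta> u" and deg: "\<And>i. i \<in> E0 \<Longrightarrow> gen_deg r s \<beta> u i = N i - (if i = j then 1 else 0)"
      and ab: "a \<in> E0" "b \<in> E0" "a \<noteq> b" "a \<noteq> j" "b \<noteq> j" "\<beta> b < pm b" "\<not> p dvd \<beta> a"
      and k: "r = a \<Longrightarrow> r \<in> E0 \<and> b = s" "s = a \<Longrightarrow> s \<in> E0 \<and> b = r" for r s \<beta> u a b
  proof (rule gvar_step[OF D(1) g ab(1-3,6,7) xvk[OF ab(1-3)]])
    let ?b = "\<beta>(a := \<beta> a - 1, b := Suc (\<beta> b))"
    have pos: "\<beta> a \<ge> 1" using ab(7) by (cases "\<beta> a") auto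
    have ok: "gen_ok r s ?b u" using g gvar_pd_e(1)[OF _ ab(1-3) pos ab(6)] by (simp add: gen_ok_def)
    show "D (gen r s ?b u) = 0"
    proof (rule ccontr)
      assume "D (gen r s ?b u) \<noteq> 0"
      then obtain \<alpha> v q where n: "D (gen r s ?b u) (\<alpha>, v, q) \<noteq> 0" using nonzero_coeff by blast
      note Q = P[OF gen_ok_gen[OF ok] n]
      have e: "gen_deg r s ?b u i = gen_deg r s \<beta> u i - (if i = a then 1 else 0) + (if i = b then 1 else 0)" for i
        using pos ab(3) unfolding gen_deg_apply by (simp add: of_nat_diff)
      have "q = j" using Q(3)[OF j] ab unfolding e deg[OF j] N_def by (auto split: if_splits)
      thus False using Q(3)[OF ab(1)] ab unfolding e deg[OF ab(1)] N_def by (auto split: if_splits)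
    qed
    show "D (gen b s ?b u) = 0" if "r = a"
      using k(1)[OF that] ab gen_same[of b] DER_0[OF D(1)] by simp
    show "D (gen r b ?b u) = 0" if "s = a"
      using k(2)[OF that] ab gen_same[of b] DER_0[OF D(1)] by simp
  qed
  \<comment> \<open>Trading x_r for x_s replaces the index r by s, and D_ss = 0. If r is the
    exceptional index j itself, a third even index is traded instead.\<close>
  have typ1: "D (gen r s \<beta> u) = 0"
    if g: "gen_ok r s \<beta> u" and rs: "r \<in> E0" "s \<in> E0" and deg: "\<And>i. i \<in> E0 \<Longrightarrow> gen_deg r s \<beta> u i = N i - (if i = j then 1 else 0)"
      and sj: "s \<noteq> j" for r s \<beta> u
  proof (cases "r = s")
    case True
    thus ?thesis using gen_same rs DER_0[OF D(1)] by simp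
  next
    case False
    have AB: "(\<beta>, u) \<in> AB" using g by (simp add: gen_ok_def)
    have u: "i \<in> E0 \<Longrightarrow> i \<notin> u" for i using AB Y_disj by (auto simp: AB_iff)
    have bs: "int (\<beta> s) = N s + 1" using deg[OF rs(2)] u rs sj False unfolding gen_deg_apply by auto
    have lt: "\<beta> s < pm s"
      by (rule lt_pm[OF AB rs(2), of 2]) (use dN[OF rs(2)] bs int_p_ge_5 in auto)
    show ?thesis
    proof (cases "r = j")
      case False
      have "int (\<beta> r) = N r + 1" using deg[OF rs(1)] u rs False \<open>r \<noteq> s\<close> unfolding gen_deg_apply by auto
      hence "\<not> p dvd \<beta> r"
        using dN[OF rs(1)] int_p_ge_5 by (intro not_dvd_resid[of _ 2] not_dvd_small) auto
      thus ?thesis using step[OF g deg rs \<open>r \<noteq> s\<close> False sj lt] rs \<open>r \<noteq> s\<close> by simp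
    next
      case True
      obtain a where a: "a \<in> E0" "a \<noteq> r" "a \<noteq> s" using ex_other[of r s] by auto
      have "int (\<beta> a) = N a" using deg[OF a(1)] u a True unfolding gen_deg_apply by auto
      hence "\<not> p dvd \<beta> a"
        using dN[OF a(1)] int_p_ge_5 by (intro not_dvd_resid[of _ 1] not_dvd_small) auto
      thus ?thesis using step[OF g deg a(1) rs(2) a(3) _ sj lt] a True by simp
    qed
  qed
  have typ2: "D (gen r k \<beta> u) = 0"
    if g: "gen_ok r k \<beta> u" and rs: "r \<in> E0" "k \<in> E1" and deg: "\<And>i. i \<in> E0 \<Longrightarrow> gen_deg r k \<beta> u i = N i - (if i = j then 1 else 0)" for r k \<beta> u
  proof -
    have AB: "(\<beta>, u) \<in> AB" using g by (simp add: gen_ok_def)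
    have u: "i \<in> E0 \<Longrightarrow> i \<notin> u \<and> i \<noteq> k" for i using AB rs Y_disj by (auto simp: AB_iff)
    obtain a where a: "a \<in> E0" "a \<noteq> r" "a \<noteq> j" using ex_other[of r j] by auto
    obtain b where b: "b \<in> E0" "b \<noteq> a" "b \<noteq> j" using ex_other[of a j] by auto
    have "int (\<beta> a) = N a" using deg[OF a(1)] u a unfolding gen_deg_apply by auto
    hence na: "\<not> p dvd \<beta> a"
      using dN[OF a(1)] int_p_ge_5 by (intro not_dvd_resid[of _ 1] not_dvd_small) auto
    have "int (\<beta> b) = N b + (if b = r then 1 else 0)" using deg[OF b(1)] u b unfolding gen_deg_apply by auto
    hence lt: "\<beta> b < pm b"
      using dN[OF b(1)] int_p_ge_5 by (intro lt_pm[OF AB b(1), of "1 + (if b = r then 1 else 0)"]) auto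
    show ?thesis
      by (rule step[OF g deg a(1) b(1) _ a(3) b(3) lt na]) (use a b u[OF a(1)] in auto)
  qed
  have deg: "gen_deg r s \<beta> u i = N i - (if i = j then 1 else 0)" if "i \<in> E0" for i
    using C(3)[OF that] by (simp add: N_def)
  have deg': "gen_deg s r \<beta> u i = N i - (if i = j then 1 else 0)" if "i \<in> E0" for i
    using deg[OF that] unfolding gen_deg_apply by simp
  have AB: "(\<beta>, u) \<in> AB" and E: "r \<in> EE" "s \<in> EE" using g by (auto simp: gen_ok_def)
  have g': "gen_ok s r \<beta> u" using g gen_ok_swap by simp
  consider "r \<in> E0" "s \<in> E0" | "r \<in> E0" "s \<in> E1" | "r \<in> E1" "s \<in> E0" | "r \<in> E1" "s \<in> E1"
    using E by (auto simp: EE_cases)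
  thus "D (gen r s \<beta> u) = 0"
  proof cases
    case 1
    show ?thesis
    proof (cases "r = s")
      case True thus ?thesis using gen_same 1 DER_0[OF D(1)] by simp
    next
      case False
      show ?thesis
      proof (cases "s = j")
        case True
        hence "D (gen s r \<beta> u) = 0" using typ1[OF g' 1(2,1) deg'] False by simp
        thus ?thesis by (rule gen_swap_kill[OF D(1) g'])
      next
        case False show ?thesis by (rule typ1[OF g 1 deg False])
      qed
    qed
  next
    case 2 show ?thesis by (rule typ2[OF g 2 deg])
  next
    case 3
    show ?thesis by (rule gen_swap_kill[OF D(1) g' typ2[OF g' 3(2,1) deg']])
  next
    case 4
    have u: "i \<in> E0 \<Longrightarrow> i \<notin> u \<and> i \<noteq> r \<and> i \<noteq> s" for i using AB 4 Y_disj by (auto simp: AB_iff)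
    have rs: "r \<noteq> s"
      using C(2)[OF 4(1)] AB Y_disj 4 unfolding gen_deg_apply by (auto simp: AB_iff split: if_splits)
    obtain a where a: "a \<in> E0" "a \<noteq> j" using ex_other[of j j] by auto
    have ba: "int (\<beta> a) = N a" using deg[OF a(1)] u[OF a(1)] a unfolding gen_deg_apply by auto
    have lt: "\<beta> a < pm a" using dN[OF a(1)] int_p_ge_5 ba by (intro lt_pm[OF AB a(1), of 1]) auto
    have evu: "even (card u)" using g 4 by (simp add: gen_ok_def)
    have fin: "finite u" using AB_finite[OF AB] .
    have sub: "D (gen a x (\<beta>(a := Suc (\<beta> a))) (u - {y})) = 0" if "x \<in> E1" "y \<in> u" for x y
    proof (rule typ2[OF _ a(1) that(1)])
      have "card u = Suc (card (u - {y}))" using card.remove[OF fin that(2)] .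
      thus "gen_ok a x (\<beta>(a := Suc (\<beta> a))) (u - {y})"
        using evu AB_upd[OF AB a(1), of "Suc (\<beta> a)"] lt a that by (auto simp: gen_ok_def EE_cases AB_iff)
      show "gen_deg a x (\<beta>(a := Suc (\<beta> a))) (u - {y}) i = N i - (if i = j then 1 else 0)" if "i \<in> E0" for i
        using deg[OF that] u[OF that] \<open>x \<in> E1\<close> that Y_disj unfolding gen_deg_apply by auto
    qed
    show ?thesis
      by (rule gen_odd_odd_kill[OF D(1) 4 g a(1) lt]) (use sub 4 in auto)
  qed
qed

text \<open>The mirror image of \<open>plus_supp\<close>: now the target is confined to weight 0 on
  Y_1, so a source with nonzero value has weight 1 at every odd index.\<close>

lemma minus_supp:
  assumes D: "D \<in> DER" "has_degree \<xi> D" and xi: "\<forall>k\<in>E1. \<xi> k = - 1"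
    and x: "x \<in> S0" "x \<in> Wd \<mu>" "D x \<noteq> 0" and k: "k \<in> E1"
  shows "\<mu> k = 1"
proof -
  obtain \<alpha> v q where nz: "D x (\<alpha>, v, q) \<noteq> 0" using nonzero_coeff x(3) by blast
  note S = nonzero_value_degree[OF D x(1,2) nz]
  obtain \<alpha>' u' r' where W': "(\<alpha>', u', r') \<in> W0B" and mu: "\<mu> = wdeg (\<alpha>', u', r')" using S(3) by blast
  have eq: "(if k \<in> u' then 1 else 0) - (if k = r' then 1 else 0) - 1 = (if k \<in> v then 1 else 0) - (if k = q then (1::int) else 0)"
    if "k \<in> E1" for k
    using S(2)[of k] bspec[OF xi that] wdeg_E1[OF S(1) that] wdeg_E1[OF W' that] by (simp add: mu)
  have v: "k \<in> v \<Longrightarrow> k = q" if "k \<in> E1" for k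
    using eq[OF that] by (auto split: if_splits)
  have "q \<in> E1 \<Longrightarrow> q \<in> v"
  proof (rule ccontr)
    assume r: "q \<in> E1" "q \<notin> v"
    hence "v = {}" using v W0B_D(4)[OF S(1)] by blast
    thus False using W0B_D(3)[OF S(1)] r by simp
  qed
  hence "k \<in> v \<longleftrightarrow> k = q"
    using v[OF k] k by blast
  hence "(if k \<in> v then 1 else 0) - (if k = q then 1 else 0) = (0::int)"
    by simp
  thus ?thesis using wdeg_E1[OF W' k] eq[OF k] by (simp add: mu)
qed

text \<open>Only generators D_rs(x^\<beta> x^u) with u = Y_1 and even r, s can have a nonzero value.
  Each is a multiple of the bracket of x_c x^v D_s with a generator carrying x^(u - v); neither
  factor has weight 1 on all of Y_1, so \<open>D\<close> kills both.\<close>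

lemma DER_zero_minus:
  assumes D: "D \<in> DER" "has_degree \<xi> D" "\<And>i. i \<in> E0 \<Longrightarrow> D (Dvec i) = 0"
    and xi: "\<And>k. k \<in> E1 \<Longrightarrow> \<xi> k = - 1" "\<And>i. i \<in> E0 \<Longrightarrow> int p dvd \<xi> i - 1"
  shows "D = 0"
proof (rule DER_zero_by_const_coeff[OF D])
  fix r s \<beta> u v j
  assume g: "gen_ok r s \<beta> u" and nz: "D (gen r s \<beta> u) (\<lambda>_. 0, v, j) \<noteq> 0"
  have xi1: "\<forall>k\<in>E1. \<xi> k = - 1" using xi(1) by blast
  note P = minus_supp[OF D(1,2) xi1]
  have int_p_ge_5: "int p \<ge> 5" using p_ge_5 by simp
  have "D (gen r s \<beta> u) \<noteq> 0" using nz by (auto simp: zero_fun_apply)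
  note one = P[OF gen_ok_gen[OF g] this]
  note S = nonzero_value_degree[OF D(1,2) gen_ok_gen[OF g] nz]
  have AB: "(\<beta>, u) \<in> AB" and E: "r \<in> EE" "s \<in> EE" using g by (auto simp: gen_ok_def)
  have b0: "k \<in> E1 \<Longrightarrow> \<beta> k = 0" for k using AB Y_disj by (auto simp: AB_iff)
  have rs: "r \<in> E0" "s \<in> E0"
    using one[of r] one[of s] b0[of r] b0[of s] E unfolding gen_deg_apply by (auto simp: EE_cases split: if_splits)
  have u: "u = E1"
    using one b0 AB rs Y_disj unfolding gen_deg_apply by (fastforce simp: AB_iff split: if_splits)
  have ui: "i \<notin> u" if "i \<in> E0" for i using that u Y_disj by blast
  have deg: "gen_deg r s \<beta> u i = - \<xi> i - (if i = j then 1 else 0)" if "i \<in> E0" for i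
    using S(2)[of i] wdeg_E0[OF S(1) that] by simp
  have evn: "even (card u)" using g rs by (simp add: gen_ok_def)
  have main: "D (gen r s \<beta> u) = 0" if g: "gen_ok r s \<beta> u" and rs: "r \<in> E0" "s \<in> E0" "r \<noteq> s" and sj: "s \<noteq> j"
    and deg: "\<And>i. i \<in> E0 \<Longrightarrow> gen_deg r s \<beta> u i = - \<xi> i - (if i = j then 1 else 0)" for r s
  proof -
    obtain c where c: "c \<in> E0" "c \<noteq> r" "c \<noteq> s" using ex_other[of r s] by auto
    have "int (\<beta> s) = - \<xi> s + 1" using deg[OF rs(2)] rs sj ui unfolding gen_deg_apply by auto
    hence lt: "\<beta> s < pm s"
      using xi(2)[OF rs(2)] int_p_ge_5 by (intro lt_pm[OF AB rs(2), of 0]) (auto simp: dvd_diff_commute)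
    have "int (\<beta> c) = - \<xi> c - (if c = j then 1 else 0)" using deg[OF c(1)] c ui unfolding gen_deg_apply by auto
    moreover have "int p dvd - \<xi> c + 1" using xi(2)[OF c(1)] by (simp add: dvd_diff_commute)
    ultimately have nc: "\<not> p dvd \<beta> c"
      using int_p_ge_5 by (intro not_dvd_resid[of _ "- 1 - (if c = j then 1 else 0)"] not_dvd_small) auto
    hence pos: "\<beta> c \<ge> 1" by (cases "\<beta> c") auto
    \<comment> \<open>Two odd indices keep the first factor even, and m + 3 remains outside v. The
      first factor has weight 0 at m + 3, the second has weight 0 at m + 1.\<close>
    define v where "v = {m + 1, m + 2}"
    have v: "v \<subseteq> E1" "card v = 2" using n_ge_3 by (auto simp: v_def Y1_def)
    have k3: "m + 3 \<in> E1" "m + 3 \<notin> v" "m + 1 \<in> E1" "m + 1 \<in> v" using n_ge_3 by (auto simp: v_def Y1_def)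
    have uv: "u = v \<union> (u - v)" "card (u - v) = card u - 2"
      using v u by (auto simp: card_Diff_subset finite_subset)
    have evd: "even (card (u - v))" using evn uv(2) by simp
    let ?\<gamma> = "(\<lambda>_. 0)(c := 1) :: nat \<Rightarrow> nat" and ?\<beta>1 = "\<beta>(c := \<beta> c - 1)"
    let ?\<beta>2 = "\<beta>(c := \<beta> c - 1, s := Suc (\<beta> s))"
    have G: "(?\<gamma>, v) \<in> AB" using v c pm_pos[OF c(1)] by (auto simp: AB_iff)
    let ?X = "mkW (single (?\<gamma>, v) 1) s"
    have XS: "?X \<in> S0" using mkW_S0[OF G rs(2) _ _ rs(1)] c v rs pm_pos[OF rs(1)] by simp
    have XW: "?X \<in> Wd (wdeg (?\<gamma>, v, s))" using mkW_gen_Wd[OF G, of s 1] rs v by (simp add: EE_cases)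
    have X0: "D ?X = 0"
    proof (rule ccontr)
      assume "D ?X \<noteq> 0"
      from P[OF XS XW this k3(1)] show False using k3 c rs Y_disj by (auto simp: wdeg_def split: if_splits)
    qed
    have kill_lowered_degree: "(?\<beta>1, u - v) \<in> AB" using AB AB_le[OF AB c(1)] c by (auto simp: AB_iff)
    have B2: "(?\<beta>2, u - v) \<in> AB" using AB_upd[OF kill_lowered_degree rs(2), of "Suc (\<beta> s)"] lt by simp
    have ok2: "gen_ok r s ?\<beta>2 (u - v)" using B2 rs evd by (simp add: gen_ok_def EE_cases)
    have Z0: "D (gen r s ?\<beta>2 (u - v)) = 0"
    proof (rule ccontr)
      assume "D (gen r s ?\<beta>2 (u - v)) \<noteq> 0"
      from P[OF gen_ok_gen[OF ok2] this k3(3)] show False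
        using k3 c rs Y_disj b0[OF k3(3)] unfolding gen_deg_apply by (auto split: if_splits)
    qed
    have hg: "hom 0 (single (?\<gamma>, v) 1)" using hom_single[OF G, of 1] v by simp
    have hf: "hom 0 (single (?\<beta>2, u - v) 1)" using hom_single[OF B2, of 1] evd by simp
    have "?\<beta>2(s := ?\<beta>2 s - 1) = ?\<beta>1" using c by auto
    hence pdf: "pd s (single (?\<beta>2, u - v) 1) = single (?\<beta>1, u - v) 1"
      using pd_e_even[OF B2 rs(2)] by simp
    have "br ?X (DD r s 0 (single (?\<beta>2, u - v) 1)) = DD r s 0 (single (?\<gamma>, v) 1 \<odot> pd s (single (?\<beta>2, u - v) 1))"
      by (rule br_mkW_DD[OF rs(2) hg hf]) (use rs c pd_e_even[OF G] in \<open>auto simp: EE_cases\<close>)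
    moreover obtain d where d: "d \<noteq> 0" "single (?\<gamma>, v) 1 \<odot> single (?\<beta>1, u - v) 1 = single (\<lambda>i. ?\<gamma> i + ?\<beta>1 i, v \<union> (u - v)) d"
    proof (rule mul_e_nz[OF G kill_lowered_degree])
      show "?\<gamma> i + ?\<beta>1 i \<le> pm i \<and> \<not> p dvd (?\<gamma> i + ?\<beta>1 i choose ?\<gamma> i)" if "i \<in> E0" for i
        using AB_le[OF AB that] pos nc p_gt_3 by auto
    qed auto
    moreover have "(\<lambda>i. ?\<gamma> i + ?\<beta>1 i) = \<beta>" using pos by auto
    ultimately have "br ?X (gen r s ?\<beta>2 (u - v)) = sc d (gen r s \<beta> u)"
      using pdf evd evn uv(1) by (simp flip: DD_simps(2))
    moreover have "D (br ?X (gen r s ?\<beta>2 (u - v))) = 0"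
      by (rule DER_br_kill[OF D(1) XS gen_ok_gen(1)[OF ok2] X0 Z0])
    ultimately show ?thesis using DER_sc_kill[OF D(1) gen_ok_gen(1)[OF g] d(1)] by simp
  qed
  show "D (gen r s \<beta> u) = 0"
  proof (cases "r = s")
    case True thus ?thesis using gen_same rs DER_0[OF D(1)] by simp
  next
    case ne: False
    show ?thesis
    proof (cases "s = j")
      case False show ?thesis by (rule main[OF g rs ne False deg])
    next
      case True
      have g': "gen_ok s r \<beta> u" using g gen_ok_swap by simp
      have deg': "gen_deg s r \<beta> u i = - \<xi> i - (if i = j then 1 else 0)" if "i \<in> E0" for i
        using deg[OF that] unfolding gen_deg_apply by simp
      show ?thesis by (rule gen_swap_kill[OF D(1) g' main[OF g' rs(2,1) _ _ deg']]) (use ne True in auto)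
    qed
  qed
qed

section \<open>Powers of ad D_i and fields without even variables\<close>

lemma funpow_Dvec:
  assumes "X \<in> W0" "c \<in> E0"
  shows "(br (Dvec c) ^^ k) X (\<alpha>, u, r) = X (\<alpha>(c := \<alpha> c + k), u, r)" "(br (Dvec c) ^^ k) X \<in> W0"
proof -
  have W: "(br (Dvec c) ^^ k) X \<in> W0" for k
    by (induction k) (use assms Dvec_W0 in auto)
  thus "(br (Dvec c) ^^ k) X \<in> W0" .
  show "(br (Dvec c) ^^ k) X (\<alpha>, u, r) = X (\<alpha>(c := \<alpha> c + k), u, r)"
  proof (induction k arbitrary: \<alpha>)
    case (Suc k)
    have "(br (Dvec c) ^^ Suc k) X (\<alpha>, u, r) = (br (Dvec c) ^^ k) X (\<alpha>(c := Suc (\<alpha> c)), u, r)"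
      using br_Dvec[OF W assms(2)] by simp
    also have "\<dots> = X ((\<alpha>(c := Suc (\<alpha> c)))(c := Suc (\<alpha> c) + k), u, r)"
      using Suc[of "\<alpha>(c := Suc (\<alpha> c))"] by (simp only: fun_upd_same)
    finally show ?case by (simp only: fun_upd_upd add_Suc_right add_Suc)
  qed simp
qed

lemma funpow_Dvec_mkW:
  assumes "i \<in> E0" "j \<in> E0" "k \<le> pm i"
  shows "(br (Dvec i) ^^ k) (mkW (single ((\<lambda>_. 0)(i := k), {}) 1) j) = Dvec j"
proof
  fix b :: "(nat \<Rightarrow> nat) \<times> nat set \<times> nat"
  obtain \<alpha> u r where b: "b = (\<alpha>, u, r)" by (cases b)
  have "((\<lambda>_. 0)(i := k), {}) \<in> AB" using assms by (auto simp: AB_iff)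
  hence W: "mkW (single ((\<lambda>_. 0)(i := k), {}) 1) j \<in> W0"
    using mkW_gen_Wd[of _ "{}" j 1] assms by (auto simp: EE_cases dest: Wd_W0)
  have "\<alpha>(i := \<alpha> i + k) = (\<lambda>_. 0)(i := k) \<longleftrightarrow> \<alpha> = (\<lambda>_. 0)"
    by (auto simp: fun_eq_iff)
  thus "(br (Dvec i) ^^ k) (mkW (single ((\<lambda>_. 0)(i := k), {}) 1) j) b = Dvec j b"
    unfolding b funpow_Dvec(1)[OF W assms(1)] by (simp add: mkW_def single_apply Dvec_def)
qed

lemma has_degree_pow:
  assumes "c \<in> E0"
  shows "has_degree (\<lambda>i. - int (((\<lambda>_. 0)(c := k)) i)) (restr S0 (br (Dvec c) ^^ k))"
  unfolding has_degree_def
proof (intro allI impI)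
  fix \<mu> x assume x: "x \<in> S0 \<and> x \<in> Wd \<mu>"
  have "(br (Dvec c) ^^ k) x \<in> Wd (\<mu> + (\<lambda>i. - int (((\<lambda>_. 0)(c := k)) i)))" for k
  proof (induction k)
    case 0
    have "(\<lambda>i. - int (((\<lambda>_. 0)(c := 0)) i)) = 0" by (auto simp: fun_eq_iff pointwise)
    thus ?case using x by simp
  next
    case (Suc k)
    have "- ep c + (\<mu> + (\<lambda>i. - int (((\<lambda>_. 0)(c := k)) i))) = \<mu> + (\<lambda>i. - int (((\<lambda>_. 0)(c := Suc k)) i))"
      by (auto simp: fun_eq_iff pointwise)
    thus ?case using br_Wd[OF Dvec_Wd[OF assms] Suc] by (simp only: funpow.simps comp_apply)
  qed
  thus "restr S0 (br (Dvec c) ^^ k) x \<in> Wd (\<mu> + (\<lambda>i. - int (((\<lambda>_. 0)(c := k)) i)))"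
    using x by (simp add: restr_def)
qed

lemma pow_Dvec_zero:
  assumes "c \<in> E0" "i \<in> E0" "k > 0"
  shows "restr S0 (br (Dvec c) ^^ k) (Dvec i) = 0"
proof
  fix b :: "(nat \<Rightarrow> nat) \<times> nat set \<times> nat"
  obtain \<alpha> u r where b: "b = (\<alpha>, u, r)" by (cases b)
  have "\<alpha>(c := \<alpha> c + k) \<noteq> (\<lambda>_. 0)" using assms(3) by (metis add_is_0 fun_upd_same not_gr_zero)
  thus "restr S0 (br (Dvec c) ^^ k) (Dvec i) b = 0 b"
    using Dvec_S0[OF assms(2)] unfolding b restr_def
    by (simp add: funpow_Dvec(1)[OF Dvec_W0[OF assms(2)] assms(1)] zero_fun_apply) (simp add: Dvec_def single_apply)
qed

abbreviation oddW :: "nat set \<Rightarrow> nat \<Rightarrow> 'a wel" where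
  "oddW v b \<equiv> mkW (single (\<lambda>_. 0, v) 1) b"

lemma oddW_AB: "v \<subseteq> E1 \<Longrightarrow> (\<lambda>_. 0, v) \<in> AB"
  by (auto simp: AB_iff)

lemma oddW_Wd: "v \<subseteq> E1 \<Longrightarrow> b \<in> EE \<Longrightarrow> even (card v + tt b) \<Longrightarrow> oddW v b \<in> Wd (wdeg (\<lambda>_. 0, v, b))"
  by (rule mkW_gen_Wd[OF oddW_AB])

lemma oddW_nz: "oddW v b \<noteq> 0"
proof
  assume "oddW v b = 0"
  hence "oddW v b (\<lambda>_. 0, v, b) = 0" by (simp add: zero_fun_apply)
  thus False by (simp add: mkW_def)
qed

lemma br_mkW_mkW:
  assumes "mkW f r \<in> W0" "mkW g s \<in> W0" "r \<in> EE" "s \<in> EE"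
  shows "br (mkW f r) (mkW g s) = mkW (f \<odot> pd r g) s - mkW (g \<odot> pd s f) r"
proof -
  have "coef x (br (mkW f r) (mkW g s)) = coef x (mkW (f \<odot> pd r g) s - mkW (g \<odot> pd s f) r)" for x
    using assms by (cases "x \<in> EE") (auto simp: coef_br coef_br_outside coef_mkW coef_simps act_mkW act_simps)
  thus ?thesis
    unfolding fun_eq_iff by (metis coef_apply prod_cases3)
qed

text \<open>x_k D_l is the curl of x_a x_k: for k different from l the other half vanishes, and any
  even a serves.\<close>

lemma oddW_gen:
  assumes "k \<in> E1" "l \<in> E1" "k \<noteq> l" "a \<in> E0"
  shows "oddW {k} l = gen a l ((\<lambda>_. 0)(a := 1)) {k}" "oddW {k} l \<in> S0"
proof -
  let ?b = "(\<lambda>_. 0)(a := 1) :: nat \<Rightarrow> nat"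
  have B: "(?b, {k}) \<in> AB" using assms pm_pos[of a] by (auto simp: AB_iff)
  have "?b(a := 0) = (\<lambda>_. 0)" by auto
  thus eq: "oddW {k} l = gen a l ?b {k}"
    using assms pd_e_even[OF B assms(4)] pd_e_odd[OF B assms(2)] by (simp add: Drs_def mkW_simps)
  show "oddW {k} l \<in> S0"
    unfolding eq using assms by (intro gen_S0 B) (simp_all add: EE_cases)
qed

lemma gen_eps:
  assumes "v \<subseteq> E1" "even (card v)" "a \<in> E0" "b \<in> E0" "a \<noteq> b"
  shows "gen a b ((\<lambda>_. 0)(a := 1)) v = oddW v b"
  using mkW_eq_gen(1)[OF oddW_AB[OF assms(1)] assms(4) _ assms(2,3,5)] pm_pos[OF assms(3)] by simp

end

section \<open>Weights vanishing on the odd indices\<close>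

text \<open>The weight is written as -N with natural N: once D_i is killed for all even i, positive
  entries on Y_0 are impossible, and N lists the exponents that \<open>D\<close> removes.
  Divisibility by p is invisibility to the torus.\<close>

locale null_weight = divided_superalgebra p m n t ty
  for p m n :: nat and t :: "nat \<Rightarrow> nat" and ty :: "'a::field itself" +
  fixes D :: "'a wel \<Rightarrow> 'a wel" and N :: "nat \<Rightarrow> nat"
  assumes D: "D \<in> Der S0 W0 sc br" and weight_D: "has_degree (\<lambda>i. - int (N i)) D"
    and D0: "i \<in> E0 \<Longrightarrow> D (Dvec i) = 0"
    and pN: "i \<in> E0 \<Longrightarrow> p dvd N i" and N_out: "i \<notin> E0 \<Longrightarrow> N i = 0"
begin

lemma value_support:
  assumes "x \<in> S0" "x \<in> Wd \<mu>" "D x (\<alpha>, v, q) \<noteq> 0"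
  shows "q \<in> EE" "(\<alpha>, v) \<in> AB" "\<And>i. i \<in> E0 \<Longrightarrow> \<mu> i - int (N i) = int (\<alpha> i) - (if i = q then 1 else 0)"
    "\<And>k. k \<in> E1 \<Longrightarrow> \<mu> k = (if k \<in> v then 1 else 0) - (if k = q then 1 else 0)"
proof -
  note S = nonzero_value_degree[OF D weight_D assms]
  show "q \<in> EE" "(\<alpha>, v) \<in> AB" using W0B_D[OF S(1)] by blast+
  show "\<mu> i - int (N i) = int (\<alpha> i) - (if i = q then 1 else 0)" if "i \<in> E0" for i
    using S(2)[of i] wdeg_E0[OF S(1) that] by simp
  show "\<mu> k = (if k \<in> v then 1 else 0) - (if k = q then 1 else 0)" if "k \<in> E1" for k
    using S(2)[of k] wdeg_E1[OF S(1) that] N_out[of k] Y_disj that by auto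
qed

text \<open>Even exponents are nonnegative, so the weight of a term of D x is negative at most at
  its derivation index, and is -1 there.\<close>

lemma degree_lower_bound:
  assumes "x \<in> S0" "x \<in> Wd \<mu>" "D x \<noteq> 0"
  obtains q where "q \<in> EE" "\<And>i. i \<in> E0 \<Longrightarrow> \<mu> i - int (N i) \<ge> - (if i = q then 1 else 0)"
proof -
  obtain \<alpha> v q where nz: "D x (\<alpha>, v, q) \<noteq> 0" using nonzero_coeff assms(3) by blast
  note S = value_support[OF assms(1,2) nz]
  show thesis using that[OF S(1)] S(3) by simp
qed

lemma kill_below_minus_one: "x \<in> S0 \<Longrightarrow> x \<in> Wd \<mu> \<Longrightarrow> i \<in> E0 \<Longrightarrow> \<mu> i - int (N i) < -1 \<Longrightarrow> D x = 0"
  by (rule ccontr, erule (2) degree_lower_bound) (force split: if_splits)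

lemma kill_two_negative: "x \<in> S0 \<Longrightarrow> x \<in> Wd \<mu> \<Longrightarrow> i \<in> E0 \<Longrightarrow> j \<in> E0 \<Longrightarrow> i \<noteq> j \<Longrightarrow>
    \<mu> i - int (N i) < 0 \<Longrightarrow> \<mu> j - int (N j) < 0 \<Longrightarrow> D x = 0"
proof (rule ccontr)
  assume x: "x \<in> S0" "x \<in> Wd \<mu>" and ij: "i \<in> E0" "j \<in> E0" "i \<noteq> j"
    and n: "\<mu> i - int (N i) < 0" "\<mu> j - int (N j) < 0" and "D x \<noteq> 0"
  obtain q where "\<And>i. i \<in> E0 \<Longrightarrow> \<mu> i - int (N i) \<ge> - (if i = q then 1 else 0)"
    using degree_lower_bound[OF x \<open>D x \<noteq> 0\<close>] by metis
  from this[OF ij(1)] this[OF ij(2)] n ij(3) show False by (auto split: if_splits)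
qed

lemma gen_const_coeff:
  assumes "gen_ok r s \<beta> u" "D (gen r s \<beta> u) \<noteq> 0"
  obtains \<beta>' v q where "gen_ok r s \<beta>' u" "\<And>i. \<beta>' i \<le> \<beta> i" "D (gen r s \<beta>' u) (\<lambda>_. 0, v, q) \<noteq> 0"
    "D (gen r s \<beta>' u) \<noteq> 0" "q \<in> EE" "\<And>i. i \<in> E0 \<Longrightarrow> gen_deg r s \<beta>' u i = int (N i) - (if i = q then 1 else 0)"
proof -
  have g: "(\<beta>, u) \<in> AB" "r \<in> EE" "s \<in> EE" "even (card u + tt r + tt s)" using assms(1) by (auto simp: gen_ok_def)
  from ex_const_coeff[OF D D0 g assms(2)] obtain \<beta>' v q where
    c: "(\<beta>', u) \<in> AB" "\<forall>i. \<beta>' i \<le> \<beta> i" "D (gen r s \<beta>' u) (\<lambda>_. 0, v, q) \<noteq> 0" by blast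
  have ok: "gen_ok r s \<beta>' u" using c(1) g by (simp add: gen_ok_def)
  note S = value_support[OF gen_ok_gen[OF ok] c(3)]
  have "D (gen r s \<beta>' u) \<noteq> 0" using c(3) by (auto simp: zero_fun_apply)
  moreover have "gen_deg r s \<beta>' u i = int (N i) - (if i = q then 1 else 0)" if "i \<in> E0" for i
    using S(3)[OF that] by simp
  ultimately show thesis using that[OF ok _ c(3)] c(2) S(1) by blast
qed

definition kills_xD :: bool where "kills_xD \<longleftrightarrow> (\<forall>a\<in>E0. \<forall>b\<in>E0. a \<noteq> b \<longrightarrow> D (mkW (gvar a) b) = 0)"

definition N_in_range :: bool where "N_in_range \<longleftrightarrow> (\<forall>i\<in>E0. N i < pm i)"

text \<open>By degree these are the generators on which a nonzero \<open>D\<close> could still have a nonzero value.\<close>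

definition kills_even_gens :: bool where
  "kills_even_gens \<longleftrightarrow> (\<forall>j\<in>E0. \<forall>s\<in>E0. \<forall>u. j \<noteq> s \<longrightarrow> u \<subseteq> E1 \<longrightarrow> even (card u) \<longrightarrow> D (gen j s (N(s := Suc (N s))) u) = 0)"

definition kills_mixed_gens :: bool where
  "kills_mixed_gens \<longleftrightarrow> (\<forall>a\<in>E0. \<forall>k\<in>E1. \<forall>u. u \<subseteq> E1 \<longrightarrow> odd (card u) \<longrightarrow> D (gen a k (N(a := Suc (N a))) u) = 0)"

lemma kills_even_gensD: "kills_even_gens \<Longrightarrow> j \<in> E0 \<Longrightarrow> s \<in> E0 \<Longrightarrow> j \<noteq> s \<Longrightarrow> u \<subseteq> E1 \<Longrightarrow> even (card u) \<Longrightarrow>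
    D (gen j s (N(s := Suc (N s))) u) = 0"
  unfolding kills_even_gens_def by blast

lemma kills_mixed_gensD: "kills_mixed_gens \<Longrightarrow> a \<in> E0 \<Longrightarrow> k \<in> E1 \<Longrightarrow> u \<subseteq> E1 \<Longrightarrow> odd (card u) \<Longrightarrow>
    D (gen a k (N(a := Suc (N a))) u) = 0"
  unfolding kills_mixed_gens_def by blast

lemma int_p_ge_5: "int p \<ge> 5"
  using p_ge_5 by simp

lemma N_ge_5: "i \<in> E0 \<Longrightarrow> N i \<noteq> 0 \<Longrightarrow> N i \<ge> 5"
  using pN[of i] p_ge_5 by (meson dvd_imp_le le_trans neq0_conv)

lemma N_AB: "N_in_range \<Longrightarrow> u \<subseteq> E1 \<Longrightarrow> (N, u) \<in> AB"
  using N_out by (auto simp: N_in_range_def AB_iff less_imp_le)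

text \<open>A nonzero \<open>N c\<close> is a multiple of p, hence at least 5, whereas x_a D_b has
  weight at most 1 at c.\<close>

lemma kills_xDI: "c \<in> E0 \<Longrightarrow> N c \<noteq> 0 \<Longrightarrow> kills_xD"
  unfolding kills_xD_def
proof (intro ballI impI)
  fix a b assume c: "c \<in> E0" "N c \<noteq> 0" and ab: "a \<in> E0" "b \<in> E0" "a \<noteq> b"
  show "D (mkW (gvar a) b) = 0"
  proof (rule kill_below_minus_one[OF mkW_gvar_S0[OF ab] c(1)])
    show "(ep a - ep b) c - int (N c) < -1" using N_ge_5[OF c] by (auto simp: minus_apply)
  qed
qed

lemma residue_dvd: "i \<in> E0 \<Longrightarrow> int x = int (N i) + z \<Longrightarrow> int p dvd int x - z"
  using pN[of i] by simp

text \<open>Here the exponent of x_j is N j - 1, a unit modulo p, and j is no index of the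
  generator. Trading an x_j gives weight -2 at j after \<open>D\<close>, so the traded generator is
  killed and no replacement terms arise.\<close>

lemma kill_third_index:
  assumes kills_xD: kills_xD and g: "gen_ok r s \<beta> u" and j: "j \<in> E0" "r \<noteq> j" "s \<noteq> j"
    and deg: "\<And>i. i \<in> E0 \<Longrightarrow> gen_deg r s \<beta> u i = int (N i) - (if i = j then 1 else 0)"
  shows "D (gen r s \<beta> u) = 0"
proof -
  have AB: "(\<beta>, u) \<in> AB" using g by (simp add: gen_ok_def)
  have u: "i \<in> E0 \<Longrightarrow> i \<notin> u" for i using AB Y_disj by (auto simp: AB_iff)
  have bj: "int (\<beta> j) = int (N j) + (-1)" using deg[OF j(1)] u j unfolding gen_deg_apply by auto
  have nj: "\<not> p dvd \<beta> j"
    using residue_dvd[OF j(1) bj] int_p_ge_5 by (intro not_dvd_resid[of _ "-1"] not_dvd_small) auto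
  obtain b where b: "b \<in> E0" "b \<noteq> j" using ex_other[of j j] by auto
  have "int (\<beta> b) = int (N b) + ((if b = r then 1 else 0) + (if b = s then 1 else 0))"
    using deg[OF b(1)] u b unfolding gen_deg_apply by auto
  hence lt: "\<beta> b < pm b" using int_p_ge_5 by (intro lt_pm[OF AB b(1) residue_dvd[OF b(1)]]) auto
  let ?b = "\<beta>(j := \<beta> j - 1, b := Suc (\<beta> b))"
  have pos: "\<beta> j \<ge> 1" using nj by (cases "\<beta> j") auto
  have ok: "gen_ok r s ?b u" using g gvar_pd_e(1)[OF _ j(1) b(1) _ pos lt] b by (simp add: gen_ok_def)
  show ?thesis
  proof (rule gvar_step[OF D g j(1) b(1) _ lt nj])
    show "D (mkW (gvar j) b) = 0" using kills_xD j b by (simp add: kills_xD_def)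
    have "gen_deg r s ?b u j = gen_deg r s \<beta> u j - 1" using b pos unfolding gen_deg_apply by (simp add: of_nat_diff)
    thus "D (gen r s ?b u) = 0"
      by (intro kill_below_minus_one[OF gen_ok_gen[OF ok] j(1)]) (simp add: deg[OF j(1)])
  qed (use j b in auto)
qed

lemma gen_ok_notin: "gen_ok r s \<beta> u \<Longrightarrow> i \<in> E0 \<Longrightarrow> i \<notin> u"
  using Y_disj by (auto simp: gen_ok_def AB_iff)

lemma gen_ok_out: "gen_ok r s \<beta> u \<Longrightarrow> i \<notin> E0 \<Longrightarrow> \<beta> i = 0"
  by (auto simp: gen_ok_def AB_iff)

text \<open>If j is an index and the other one is even, the degree forces exactly the exponents of
  \<open>kills_even_gens\<close>. If the other one is odd, the exponents are N and the cyclic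
  relation leads back to that case and to \<open>kill_third_index\<close>, which also covers j not
  being an index.\<close>

lemma kill_lowered_degree:
  assumes h: kills_xD N_in_range kills_even_gens and g: "gen_ok r s \<beta> u" and j: "j \<in> E0"
    and deg: "\<And>i. i \<in> E0 \<Longrightarrow> gen_deg r s \<beta> u i = int (N i) - (if i = j then 1 else 0)"
  shows "D (gen r s \<beta> u) = 0"
proof -
  have main: "D (gen j s \<beta> u) = 0" if g: "gen_ok j s \<beta> u"
    and deg: "\<And>i. i \<in> E0 \<Longrightarrow> gen_deg j s \<beta> u i = int (N i) - (if i = j then 1 else 0)" for s
  proof (cases "s \<in> E0")
    case True
    show ?thesis
    proof (cases "s = j")
      case True thus ?thesis using gen_same[OF j] DER_0[OF D] by simp
    next
      case ne: False
      have "\<beta> = N(s := Suc (N s))"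
      proof
        fix i show "\<beta> i = (N(s := Suc (N s))) i"
        proof (cases "i \<in> E0")
          case i: True
          thus ?thesis using deg[OF i] gen_ok_notin[OF g i] ne unfolding gen_deg_apply by (auto split: if_splits)
        next
          case False
          thus ?thesis using gen_ok_out[OF g False] N_out[OF False] True by auto
        qed
      qed
      thus ?thesis using h(3) g j True ne by (auto simp: kills_even_gens_def gen_ok_def AB_iff)
    qed
  next
    case False
    hence s: "s \<in> E1" using g by (simp add: gen_ok_def EE_cases)
    have eq: "\<beta> = N"
    proof
      fix i show "\<beta> i = N i"
      proof (cases "i \<in> E0")
        case i: True
        thus ?thesis using deg[OF i] gen_ok_notin[OF g i] False unfolding gen_deg_apply by (auto split: if_splits)
      qed (use gen_ok_out[OF g] N_out in auto)
    qed
    obtain a where a: "a \<in> E0" "a \<noteq> j" using ex_other[of j j] by auto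
    have AB: "(N, u) \<in> AB" "odd (card u)" using g s j by (auto simp: gen_ok_def eq)
    have fin: "finite u" using AB_finite[OF AB(1)] .
    have lt: "N a < pm a" using h(2) a by (auto simp: N_in_range_def)
    show ?thesis
    proof (rule gen_even_odd_kill[OF D j a(1) s _ g])
      show "\<beta> a < pm a" using lt eq by simp
      show "D (gen a s (\<beta>(a := Suc (\<beta> a), j := \<beta> j - 1)) u) = 0" if pos: "\<beta> j > 0"
      proof (rule kill_third_index[OF h(1) _ j a(2)])
        have "(N(a := Suc (N a), j := N j - 1), u) \<in> AB"
          using AB a lt j AB_le[OF AB(1) j] by (auto simp: AB_iff)
        thus "gen_ok a s (\<beta>(a := Suc (\<beta> a), j := \<beta> j - 1)) u"
          using AB s a by (simp add: gen_ok_def eq EE_cases)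
        show "gen_deg a s (\<beta>(a := Suc (\<beta> a), j := \<beta> j - 1)) u i = int (N i) - (if i = j then 1 else 0)" if "i \<in> E0" for i
          using gen_ok_notin[OF g that] s that pos Y_disj a unfolding gen_deg_apply eq by (auto simp: of_nat_diff)
      qed (use s j Y_disj in auto)
      show "D (gen j a (\<beta>(a := Suc (\<beta> a))) (u - {s})) = 0" if "s \<in> u"
      proof -
        have "even (card (u - {s}))" using AB(2) card.remove[OF fin that] by simp
        moreover have "u - {s} \<subseteq> E1" using AB by (auto simp: AB_iff)
        ultimately show ?thesis unfolding eq using kills_even_gensD[OF h(3) j a(1)] a(2) by blast
      qed
    qed (use a in auto)
  qed
  consider "r = j" | "s = j" | "r \<noteq> j" "s \<noteq> j" by blast
  thus ?thesis
  proof cases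
    case 1 thus ?thesis using main[of s] g deg by simp
  next
    case 2
    have g': "gen_ok j r \<beta> u" using g gen_ok_swap 2 by simp
    have "gen_deg j r \<beta> u i = int (N i) - (if i = j then 1 else 0)" if "i \<in> E0" for i
      using deg[OF that] unfolding gen_deg_apply 2 by simp
    from main[OF g' this] show ?thesis using gen_swap_kill[OF D g'] 2 by simp
  next
    case 3 thus ?thesis using kill_third_index[OF h(1) g j _ _ deg] by simp
  qed
qed

text \<open>Lowering a nonzero value to a term without even variables leads to degree N, or to N
  minus one at a single index. The second is excluded by \<open>kill_lowered_degree\<close>, the
  first because lowering cannot raise the degree at i to N i.\<close>

lemma kill_smaller_degree:
  assumes h: kills_xD N_in_range kills_even_gens and g: "gen_ok r s \<beta> u" and i: "i \<in> E0" "gen_deg r s \<beta> u i < int (N i)"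
  shows "D (gen r s \<beta> u) = 0"
proof (rule ccontr)
  assume "D (gen r s \<beta> u) \<noteq> 0"
  from gen_const_coeff[OF g this] obtain \<beta>' v q where
    c: "gen_ok r s \<beta>' u" "\<And>i. \<beta>' i \<le> \<beta> i" "D (gen r s \<beta>' u) \<noteq> 0" "q \<in> EE"
      "\<And>i. i \<in> E0 \<Longrightarrow> gen_deg r s \<beta>' u i = int (N i) - (if i = q then 1 else 0)" by metis
  show False
  proof (cases "q \<in> E0")
    case True
    from kill_lowered_degree[OF h c(1) True c(5)] c(3) show False by simp
  next
    case False
    hence "i \<noteq> q" using i by blast
    hence "gen_deg r s \<beta>' u i = int (N i)" using c(5)[OF i(1)] by simp
    moreover have "gen_deg r s \<beta>' u i \<le> gen_deg r s \<beta> u i" using c(2)[of i] unfolding gen_deg_apply by simp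
    ultimately show False using i(2) by simp
  qed
qed

text \<open>Only degree exactly N remains. For two even indices, trading x_r for x_s leads to a
  smaller degree and to D_ss = 0; an even and an odd index give \<open>kills_mixed_gens\<close>; two
  odd indices reduce to these by the cyclic relation.\<close>

lemma D_zero:
  assumes h: kills_xD N_in_range kills_even_gens and A: kills_mixed_gens
  shows "D = 0"
proof (rule DER_zero_by_const_coeff[OF D weight_D D0])
  fix r s \<beta> u v q
  assume g: "gen_ok r s \<beta> u" and nz: "D (gen r s \<beta> u) (\<lambda>_. 0, v, q) \<noteq> 0"
  note S = value_support[OF gen_ok_gen[OF g] nz]
  have deg: "gen_deg r s \<beta> u i = int (N i) - (if i = q then 1 else 0)" if "i \<in> E0" for i
    using S(3)[OF that] by simp
  show "D (gen r s \<beta> u) = 0"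
  proof (cases "q \<in> E0")
    case True
    show ?thesis by (rule kill_lowered_degree[OF h g True deg])
  next
    case q: False
    have degN: "gen_deg r s \<beta> u i = int (N i)" if "i \<in> E0" for i
      using deg[OF that] q that by auto
    have AB: "(\<beta>, u) \<in> AB" and E: "r \<in> EE" "s \<in> EE" using g by (auto simp: gen_ok_def)
    have fin: "finite u" using AB_finite[OF AB] .
    have typ2: "D (gen a k \<beta> u) = 0" if "gen_ok a k \<beta> u" "a \<in> E0" "k \<in> E1"
      and wdeg: "\<And>i. i \<in> E0 \<Longrightarrow> gen_deg a k \<beta> u i = int (N i)" for a k
    proof -
      have "\<beta> = N(a := Suc (N a))"
      proof
        fix i show "\<beta> i = (N(a := Suc (N a))) i"
        proof (cases "i \<in> E0")
          case i: True
          thus ?thesis using wdeg[OF i] gen_ok_notin[OF g i] that Y_disj unfolding gen_deg_apply by (auto split: if_splits)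
        next
          case False
          thus ?thesis using gen_ok_out[OF g False] N_out[OF False] that by auto
        qed
      qed
      thus ?thesis using A that by (auto simp: kills_mixed_gens_def gen_ok_def AB_iff)
    qed
    consider "r \<in> E0" "s \<in> E0" | "r \<in> E0" "s \<in> E1" | "r \<in> E1" "s \<in> E0" | "r \<in> E1" "s \<in> E1"
      using E by (auto simp: EE_cases)
    thus ?thesis
    proof cases
      case 1
      show ?thesis
      proof (cases "r = s")
        case True thus ?thesis using gen_same 1 DER_0[OF D] by simp
      next
        case ne: False
        have br: "int (\<beta> r) = int (N r) + 1" and bs: "int (\<beta> s) = int (N s) + 1"
          using degN[OF 1(1)] degN[OF 1(2)] gen_ok_notin[OF g] 1 ne unfolding gen_deg_apply by auto
        have nr: "\<not> p dvd \<beta> r"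
          using residue_dvd[OF 1(1) br] int_p_ge_5 by (intro not_dvd_resid[of _ 1] not_dvd_small) auto
        have lt: "\<beta> s < pm s" using int_p_ge_5 by (intro lt_pm[OF AB 1(2) residue_dvd[OF 1(2) bs]]) auto
        have pos: "\<beta> r \<ge> 1" using br by simp
        let ?b = "\<beta>(r := \<beta> r - 1, s := Suc (\<beta> s))"
        have ok: "gen_ok r s ?b u" using g gvar_pd_e(1)[OF AB 1 ne pos lt] by (simp add: gen_ok_def)
        show ?thesis
        proof (rule gvar_step[OF D g 1 ne lt nr])
          show "D (mkW (gvar r) s) = 0" using h(1) 1 ne by (simp add: kills_xD_def)
          show "D (gen r s ?b u) = 0"
            by (rule kill_smaller_degree[OF h ok 1(1)]) (use degN[OF 1(1)] pos ne in \<open>simp add: gen_deg_apply of_nat_diff\<close>)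
          show "D (gen s s ?b u) = 0" using gen_same[OF 1(2)] DER_0[OF D] by simp
        qed (use ne in auto)
      qed
    next
      case 2 show ?thesis by (rule typ2[OF g 2 degN])
    next
      case 3
      have g': "gen_ok s r \<beta> u" using g gen_ok_swap by simp
      have "gen_deg s r \<beta> u i = int (N i)" if "i \<in> E0" for i
        using degN[OF that] unfolding gen_deg_apply by simp
      from typ2[OF g' 3(2,1) this] show ?thesis by (rule gen_swap_kill[OF D g'])
    next
      case 4
      have eq: "\<beta> = N"
      proof
        fix i show "\<beta> i = N i"
        proof (cases "i \<in> E0")
          case i: True
          thus ?thesis using degN[OF i] gen_ok_notin[OF g i] 4 Y_disj unfolding gen_deg_apply by (auto split: if_splits)
        qed (use gen_ok_out[OF g] N_out in auto)
      qed
      obtain a where a: "a \<in> E0" using ex_other by blast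
      have evu: "even (card u)" using g 4 by (simp add: gen_ok_def)
      have sub: "D (gen a x (\<beta>(a := Suc (\<beta> a))) (u - {y})) = 0" if "x \<in> E1" "y \<in> u" for x y
      proof -
        have "card u = Suc (card (u - {y}))" using card.remove[OF fin that(2)] .
        hence "odd (card (u - {y}))" using evu by simp
        moreover have "u - {y} \<subseteq> E1" using AB by (auto simp: AB_iff)
        ultimately show ?thesis unfolding eq using kills_mixed_gensD[OF A a that(1)] by blast
      qed
      show ?thesis
        by (rule gen_odd_odd_kill[OF D 4 g a]) (use sub 4 h(2) a eq in \<open>auto simp: N_in_range_def\<close>)
    qed
  qed
qed

text \<open>For a different from c the whole power x_c^(N c) is split off: the generator is a
  multiple of the bracket of x_c^(N c) D_b with a generator free of x_c. Both have a degree below N,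
  and the binomial coefficients involved are 1. The case a = c follows by trading x_c for
  x_b.\<close>

lemma kills_mixed_gens_nonzero:
  assumes h: kills_xD N_in_range kills_even_gens and c: "c \<in> E0" "N c \<noteq> 0"
  shows kills_mixed_gens
proof -
  have main: "D (gen a k (N(a := Suc (N a))) u) = 0"
    if a: "a \<in> E0" "a \<noteq> c" and k: "k \<in> E1" and u: "u \<subseteq> E1" "odd (card u)" for a k u
  proof -
    obtain b where b: "b \<in> E0" "b \<noteq> a" "b \<noteq> c" using ex_other[of a c] by auto
    have lt: "N i < pm i" if "i \<in> E0" for i using h(2) that by (simp add: N_in_range_def)
    let ?g = "(\<lambda>_. 0)(c := N c) :: nat \<Rightarrow> nat"
    \<comment> \<open>The extra x_b is the one that D_b removes again in the bracket.\<close>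
    let ?f = "N(c := 0, b := Suc (N b), a := Suc (N a))" and ?f1 = "N(c := 0, a := Suc (N a))"
    have G: "(?g, {}) \<in> AB" using c lt[OF c(1)] by (auto simp: AB_iff)
    have F: "(?f, u) \<in> AB" "(?f1, u) \<in> AB" using N_AB[OF h(2) u(1)] a b c lt
      by (auto simp: AB_iff Suc_le_eq)
    have B: "(N(a := Suc (N a)), u) \<in> AB" using N_AB[OF h(2) u(1)] a lt by (auto simp: AB_iff Suc_le_eq)
    have o: "card u mod 2 = 1" using u(2) by presburger
    let ?X = "mkW (single (?g, {}) 1) b"
    have ga: "?g a < pm a" using a pm_pos[OF a(1)] by simp
    have gb: "?g b = 0" using b by simp
    have okX: "gen_ok a b (?g(a := Suc (?g a))) {}"
      unfolding gen_ok_def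
    proof (intro conjI)
      show "(?g(a := Suc (?g a)), {}) \<in> AB"
        by (rule mkW_eq_gen(2)[OF G b(1) gb _ a(1) b(2)[symmetric] ga]) simp
    qed (use a b in \<open>simp_all add: EE_cases\<close>)
    have XS: "?X \<in> S0" by (rule mkW_S0[OF G b(1) gb _ a(1) b(2)[symmetric] ga]) simp
    have "D (gen a b (?g(a := Suc (?g a))) {}) = 0"
      by (rule kill_smaller_degree[OF h okX b(1)]) (use b in \<open>simp add: gen_deg_apply\<close>)
    moreover have "?X = gen a b (?g(a := Suc (?g a))) {}"
      by (rule mkW_eq_gen(1)[OF G b(1) gb _ a(1) b(2)[symmetric] ga]) simp
    ultimately have X0: "D ?X = 0" by (simp only:)
    have okf: "gen_ok a k ?f u" using F a k u by (simp add: gen_ok_def EE_cases)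
    have Z0: "D (gen a k ?f u) = 0"
      by (rule kill_smaller_degree[OF h okf c(1)]) (use c a b gen_ok_notin[OF okf c(1)] k Y_disj in \<open>auto simp: gen_deg_apply\<close>)
    have hg: "hom 0 (single (?g, {}) 1)" using hom_single[OF G, of 1] by simp
    have hf: "hom 1 (single (?f, u) 1)" using hom_single[OF F(1), of 1] o by simp
    have "?f(b := ?f b - 1) = ?f1" using a b c by (auto simp: fun_eq_iff)
    hence pdf: "pd b (single (?f, u) 1) = single (?f1, u) 1"
      using pd_e_even[OF F(1) b(1)] b by simp
    obtain d where d: "d \<noteq> 0" "single (?g, {}) 1 \<odot> single (?f1, u) 1 = single (\<lambda>i. ?g i + ?f1 i, {} \<union> u) d"
    proof (rule mul_e_nz[OF G F(2)])
      show "?g i + ?f1 i \<le> pm i \<and> \<not> p dvd (?g i + ?f1 i choose ?g i)" if "i \<in> E0" for i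
        using lt[OF that] a p_gt_3 AB_le[OF F(2) that] by auto
    qed auto
    have "(\<lambda>i. ?g i + ?f1 i) = N(a := Suc (N a))" using a by auto
    hence prod: "single (?g, {}) 1 \<odot> pd b (single (?f, u) 1) = sc d (single (N(a := Suc (N a)), u) 1)"
      using d(2) pdf by simp
    have "br ?X (DD a k 1 (single (?f, u) 1)) = DD a k 1 (single (?g, {}) 1 \<odot> pd b (single (?f, u) 1))"
      by (rule br_mkW_DD[OF b(1) hg hf])
        (use a k c in \<open>simp_all add: EE_cases pd_e_even[OF G a(1)] pd_e_odd[OF G k]\<close>)
    hence "br ?X (gen a k ?f u) = sc d (gen a k (N(a := Suc (N a))) u)"
      unfolding prod using o by (simp only: DD_simps(2))
    moreover have "D (br ?X (gen a k ?f u)) = 0"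
      by (rule DER_br_kill[OF D XS gen_ok_gen(1)[OF okf] X0 Z0])
    moreover have "gen a k (N(a := Suc (N a))) u \<in> S0"
      using B a k u by (intro gen_S0) (auto simp: EE_cases)
    ultimately show ?thesis using DER_sc_kill[OF D _ d(1)] by simp
  qed
  show ?thesis unfolding kills_mixed_gens_def
  proof (intro ballI allI impI)
    fix a k u assume a: "a \<in> E0" "k \<in> E1" "u \<subseteq> E1" "odd (card u)"
    show "D (gen a k (N(a := Suc (N a))) u) = 0"
    proof (cases "a = c")
      case False thus ?thesis using main a by simp
    next
      case True
      obtain b where b: "b \<in> E0" "b \<noteq> c" using ex_other[of c c] by auto
      have lt: "N i < pm i" if "i \<in> E0" for i using h(2) that by (simp add: N_in_range_def)
      let ?B = "N(c := Suc (N c))"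
      have B: "(?B, u) \<in> AB" using N_AB[OF h(2) a(3)] c lt by (auto simp: AB_iff Suc_le_eq)
      have g: "gen_ok c k ?B u" using B a c by (simp add: gen_ok_def EE_cases)
      have eq: "?B(c := ?B c - 1, b := Suc (?B b)) = N(b := Suc (N b))" using b by auto
      have B': "(N(b := Suc (N b)), u) \<in> AB" using N_AB[OF h(2) a(3)] b lt by (auto simp: AB_iff Suc_le_eq)
      have ok': "gen_ok c k (N(b := Suc (N b))) u" using B' a c by (simp add: gen_ok_def EE_cases)
      have nc: "\<not> p dvd ?B c"
        using residue_dvd[OF c(1), of "?B c" 1] int_p_ge_5 by (intro not_dvd_resid[of _ 1] not_dvd_small) auto
      show ?thesis unfolding True
      proof (rule gvar_step[OF D g c(1) b(1) _ _ nc], unfold eq)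
        show "D (gen c k (N(b := Suc (N b))) u) = 0"
          by (rule kill_smaller_degree[OF h ok' c(1)]) (use b c gen_ok_notin[OF g c(1)] a Y_disj in \<open>auto simp: gen_deg_apply\<close>)
        show "D (gen b k (N(b := Suc (N b))) u) = 0"
          using main[of b k u] b a by simp
      qed (use b c a lt h(1) Y_disj in \<open>auto simp: kills_xD_def\<close>)
    qed
  qed
qed

section \<open>Generators with two even indices\<close>

lemma N_lt: "N_in_range \<Longrightarrow> i \<in> E0 \<Longrightarrow> N i < pm i"
  by (simp add: N_in_range_def)

lemma N_upd_AB: "N_in_range \<Longrightarrow> u \<subseteq> E1 \<Longrightarrow> s \<in> E0 \<Longrightarrow> (N(s := Suc (N s)), u) \<in> AB"
  using AB_upd[OF N_AB[of u], of s "Suc (N s)"] N_lt[of s] by simp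

lemma N_upd_ok: "N_in_range \<Longrightarrow> u \<subseteq> E1 \<Longrightarrow> even (card u) \<Longrightarrow> s \<in> E0 \<Longrightarrow> j \<in> E0 \<Longrightarrow> r \<in> E0 \<Longrightarrow> gen_ok j r (N(s := Suc (N s))) u"
  using N_upd_AB[of u s] by (simp add: gen_ok_def EE_cases)

lemma Suc_N_dvd: "s \<in> E0 \<Longrightarrow> \<not> p dvd Suc (N s)"
  using residue_dvd[of s "Suc (N s)" 1] int_p_ge_5 by (intro not_dvd_resid[of _ 1] not_dvd_small) auto

text \<open>Trade x_s' for x_s: the generator with index s' left in place has weight -1 at both j
  and s' after \<open>D\<close>, and the replacement term is the one assumed to be killed.\<close>

lemma kills_even_indep:
  assumes h: kills_xD N_in_range and u: "u \<subseteq> E1" "even (card u)" and j: "j \<in> E0" "s \<in> E0" "s' \<in> E0" "s \<noteq> j" "s' \<noteq> j"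
    and z: "D (gen j s (N(s := Suc (N s))) u) = 0"
  shows "D (gen j s' (N(s' := Suc (N s'))) u) = 0"
proof (cases "s = s'")
  case False
  let ?B = "N(s' := Suc (N s'))"
  have eq: "?B(s' := ?B s' - 1, s := Suc (?B s)) = N(s := Suc (N s))" using False by auto
  have g: "gen_ok j s' ?B u" and g': "gen_ok j s' (N(s := Suc (N s))) u" using N_upd_ok h u j by blast+
  have g2: "i \<in> E0 \<Longrightarrow> i \<notin> u" for i using gen_ok_notin[OF g] .
  show ?thesis
  proof (rule gvar_step[OF D g j(3) j(2) _ _ _ _ _ _ _], unfold eq)
    show "D (gen j s' (N(s := Suc (N s))) u) = 0"
      by (rule kill_two_negative[OF gen_ok_gen[OF g'] j(1) j(3)]) (use j False g2 in \<open>auto simp: gen_deg_apply\<close>)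
    show "D (gen j s (N(s := Suc (N s))) u) = 0" by (rule z)
  qed (use False j h N_lt Suc_N_dvd in \<open>auto simp: kills_xD_def\<close>)
qed (use z in simp)

text \<open>[x_a D_b, D_as(f)] = D_as(x_a D_b f) - D_bs(f). The first term on the right has lowered
  degree at b, which is not among its indices, so \<open>kill_third_index\<close> disposes of
  it.\<close>

lemma kills_even_transfer:
  assumes h: kills_xD N_in_range and u: "u \<subseteq> E1" "even (card u)" and a: "a \<in> E0" "b \<in> E0" "s \<in> E0" "a \<noteq> b" "a \<noteq> s" "b \<noteq> s"
    and z: "D (gen a s (N(s := Suc (N s))) u) = 0"
  shows "D (gen b s (N(s := Suc (N s))) u) = 0"
proof -
  let ?B = "N(s := Suc (N s))"
  have B: "(?B, u) \<in> AB" using N_upd_AB h u a by blast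
  have ok: "gen_ok a s ?B u" "gen_ok b s ?B u" using N_upd_ok h u a by blast+
  have E: "a \<in> EE" "b \<in> EE" "s \<in> EE" using a by (simp_all add: EE_cases)
  have q: "card u mod 2 = 0" using u by presburger
  have hf: "hom 0 (single (?B, u) 1)" using hom_single[OF B, of 1] q by simp
  let ?P = "DD a s 0 (gvar a \<odot> pd b (single (?B, u) 1))"
  have P: "?P \<in> S0 \<and> D ?P = 0"
  proof (cases "N b = 0")
    case True
    thus ?thesis using a pd_e_even[OF B a(2)] DER_0[OF D] S0_simps by (simp add: DD_simps)
  next
    case False
    let ?B' = "?B(b := N b - 1, a := Suc (N a))"
    have B': "(?B', u) \<in> AB"
      using AB_upd[OF AB_upd[OF B a(2), of "N b - 1"] a(1), of "Suc (N a)"] N_lt[OF h(2) a(1)] N_lt[OF h(2) a(2)] by auto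
    have le: "?B' a \<ge> 1" "?B' b < pm b" using N_lt[OF h(2) a(2)] a False by auto
    have eq: "?B'(a := ?B' a - 1, b := Suc (?B' b)) = ?B" using a False by (auto simp: fun_eq_iff)
    have "gvar a \<odot> pd b (single (?B, u) 1) = single (?B', u) (of_nat (?B' a))"
      using gvar_pd_e(2)[OF B' a(1,2,4) le] unfolding eq .
    hence P: "?P = sc (of_nat (?B' a)) (gen a s ?B' u)"
      using q by (simp flip: DD_simps(2))
    have ok': "gen_ok a s ?B' u" using B' E a u by (simp add: gen_ok_def)
    have "D (gen a s ?B' u) = 0"
    proof (rule kill_third_index[OF h(1) ok' a(2)])
      show "gen_deg a s ?B' u i = int (N i) - (if i = b then 1 else 0)" if "i \<in> E0" for i
        using gen_ok_notin[OF ok(1) that] a False unfolding gen_deg_apply by (auto simp: of_nat_diff)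
    qed (use a in auto)
    thus ?thesis unfolding P using DERD(3)[OF D gen_ok_gen(1)[OF ok']] gen_ok_gen(1)[OF ok'] S0_simps by simp
  qed
  have "br (mkW (gvar a) b) (DD a s 0 (single (?B, u) 1)) = ?P - DD b s 0 (single (?B, u) 1)"
    using br_gvar_DD[OF a(1,2) hf _ E(1,3) _ a(4)] a by simp
  hence eq: "gen b s ?B u = ?P - br (mkW (gvar a) b) (gen a s ?B u)" using q by simp
  have "D (br (mkW (gvar a) b) (gen a s ?B u)) = 0"
    by (rule DER_br_kill[OF D mkW_gvar_S0(1)[OF a(1,2,4)] gen_ok_gen(1)[OF ok(1)] _ z]) (use h a in \<open>simp add: kills_xD_def\<close>)
  moreover have "br (mkW (gvar a) b) (gen a s ?B u) \<in> S0"
    by (rule br_S0[OF mkW_gvar_S0(1)[OF a(1,2,4)] gen_ok_gen(1)[OF ok(1)]])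
  ultimately show ?thesis unfolding eq using P DER_diff[OF D] by simp
qed

text \<open>One pair (j, s) suffices for every odd part u: the second index moves freely by
  \<open>kills_even_indep\<close>, and the first is exchanged while the second is parked at an
  auxiliary index.\<close>

lemma kills_even_gensI:
  assumes h: kills_xD N_in_range and j: "j \<in> E0" "s \<in> E0" "j \<noteq> s"
    and z: "\<And>u. u \<subseteq> E1 \<Longrightarrow> even (card u) \<Longrightarrow> D (gen j s (N(s := Suc (N s))) u) = 0"
  shows kills_even_gens
  unfolding kills_even_gens_def
proof (intro ballI allI impI)
  fix b s' u assume b: "b \<in> E0" "s' \<in> E0" "b \<noteq> s'" and u: "u \<subseteq> E1" "even (card u)"
  note J = kills_even_indep[OF h u j(1,2) _ _ _ z[OF u]]
  show "D (gen b s' (N(s' := Suc (N s'))) u) = 0"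
  proof (cases "b = j")
    case True thus ?thesis using J[of s'] b j by simp
  next
    case False
    obtain c where c: "c \<in> E0" "c \<noteq> j" "c \<noteq> b" using ex_other[of j b] by auto
    have "D (gen j c (N(c := Suc (N c))) u) = 0" using J[of c] c j by simp
    from kills_even_transfer[OF h u j(1) b(1) c(1) _ _ _ this] have "D (gen b c (N(c := Suc (N c))) u) = 0"
      using False c by auto
    from kills_even_indep[OF h u b(1) c(1) b(2) _ _ this] show ?thesis using c b by auto
  qed
qed

text \<open>\<open>[f D\<^sub>j, g D\<^sub>s] = \<plusminus> D\<^sub>j\<^sub>s(f g)\<close> if \<open>D\<^sub>j f = 0\<close> and \<open>D\<^sub>s g = 0\<close>; the coefficient in \<open>f g\<close> must be a unit.\<close>

lemma gen_split_kill:
  assumes js: "j \<in> E0" "s \<in> E0" "j \<noteq> s"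
    and vw: "v \<subseteq> E1" "w \<subseteq> E1" "v \<inter> w = {}" "even (card v)" "even (card w)"
    and G: "(\<gamma>, v) \<in> AB" "\<gamma> j = 0" "a \<in> E0" "a \<noteq> j" "\<gamma> a < pm a"
    and F: "(\<delta>, w) \<in> AB" "\<delta> s = 0" "b \<in> E0" "b \<noteq> s" "\<delta> b < pm b"
    and sum: "(\<lambda>i. \<gamma> i + \<delta> i) = \<epsilon>" "(\<epsilon>, v \<union> w) \<in> AB"
    and nd: "\<And>i. i \<in> E0 \<Longrightarrow> \<not> p dvd (\<epsilon> i choose \<gamma> i)"
    and z: "D (mkW (single (\<gamma>, v) 1) j) = 0" "D (mkW (single (\<delta>, w) 1) s) = 0"
  shows "D (gen j s \<epsilon> (v \<union> w)) = 0"
proof -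
  have hf: "hom 0 (single (\<gamma>, v) 1)" "hom 0 (single (\<delta>, w) 1)"
    using hom_single[OF G(1), of 1] hom_single[OF F(1), of 1] vw by simp_all
  obtain d where d: "d \<noteq> 0" "single (\<gamma>, v) 1 \<odot> single (\<delta>, w) 1 = single (\<lambda>i. \<gamma> i + \<delta> i, v \<union> w) d"
  proof (rule mul_e_nz[OF G(1) F(1) vw(3)])
    show "\<gamma> i + \<delta> i \<le> pm i \<and> \<not> p dvd (\<gamma> i + \<delta> i choose \<gamma> i)" if "i \<in> E0" for i
      using AB_le[OF sum(2) that] nd[OF that] unfolding sum(1)[symmetric] by simp
  qed
  have "card (v \<union> w) = card v + card w"
    using vw AB_finite[OF G(1)] AB_finite[OF F(1)] by (simp add: card_Un_disjoint)
  hence even_part: "even (card (v \<union> w))" using vw by simp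
  have "DD j s 0 (single (\<gamma>, v) 1 \<odot> single (\<delta>, w) 1) = br (mkW (single (\<gamma>, v) 1) j) (mkW (single (\<delta>, w) 1) s)"
    by (rule DD_mul[OF js(1,2) hf]) (use pd_e_even[OF G(1) js(1)] pd_e_even[OF F(1) js(2)] G F in auto)
  moreover have "D (br (mkW (single (\<gamma>, v) 1) j) (mkW (single (\<delta>, w) 1) s)) = 0"
    by (rule DER_br_kill[OF D mkW_S0[OF G(1) js(1) G(2) vw(4) G(3-5)] mkW_S0[OF F(1) js(2) F(2) vw(5) F(3-5)] z])
  moreover have "DD j s 0 (single (\<gamma>, v) 1 \<odot> single (\<delta>, w) 1) = sc d (gen j s \<epsilon> (v \<union> w))"
    unfolding d(2) sum(1) using even_part by (simp flip: DD_simps(2))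
  ultimately have "D (sc d (gen j s \<epsilon> (v \<union> w))) = 0" by simp
  thus ?thesis
  proof (rule DER_sc_kill[OF D _ d(1), rotated])
    show "gen j s \<epsilon> (v \<union> w) \<in> S0"
      by (rule gen_S0) (use sum(2) js even_part in \<open>simp_all add: EE_cases\<close>)
  qed
qed

text \<open>Put the whole power of x_j into one factor and everything else into the other. After
  \<open>D\<close> the first is far below -1 at c and the second far below -1 at j; no exponent in
  an even variable is shared, so all binomial coefficients are 1.\<close>

lemma kills_even_gens_two:
  assumes h: N_in_range and j: "j \<in> E0" "N j \<noteq> 0" and c: "c \<in> E0" "N c \<noteq> 0" "c \<noteq> j"
  shows kills_even_gens
proof -
  have kills_xD: kills_xD using kills_xDI[OF j] .
  obtain s where s: "s \<in> E0" "s \<noteq> j" using ex_other[of j j] by auto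
  obtain a where a: "a \<in> E0" "a \<noteq> j" "a \<noteq> s" using ex_other[of j s] by auto
  show ?thesis
  proof (rule kills_even_gensI[OF kills_xD h j(1) s(1)])
    fix u assume u: "u \<subseteq> E1" "even (card u)"
    let ?g = "N(j := 0, s := Suc (N s))" and ?d = "(\<lambda>_. 0)(j := N j) :: nat \<Rightarrow> nat"
    have B: "(N(s := Suc (N s)), u) \<in> AB" using N_upd_AB h u s by blast
    have B0: "(N(s := Suc (N s)), {}) \<in> AB" using N_upd_AB[OF h, of "{}"] s by blast
    have G: "(?g, {}) \<in> AB" using AB_upd[OF B0 j(1), of 0] s by (simp add: fun_upd_twist)
    have F: "(?d, u) \<in> AB" using u j N_lt[OF h j(1)] by (auto simp: AB_iff)
    have gW: "mkW (single (?g, {}) 1) j \<in> Wd (wdeg (?g, {}, j))" using mkW_gen_Wd[OF G, of j 1] j by (simp add: EE_cases)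
    have dW: "mkW (single (?d, u) 1) s \<in> Wd (wdeg (?d, u, s))" using mkW_gen_Wd[OF F, of s 1] s u by (simp add: EE_cases)
    have ga: "?g j = 0" "?g a < pm a" "?d s = 0" "?d a < pm a"
      using a s N_lt[OF h a(1)] pm_pos[OF a(1)] by auto
    have gS: "mkW (single (?g, {}) 1) j \<in> S0" by (rule mkW_S0[OF G j(1) ga(1) _ a(1) a(2) ga(2)]) simp
    have dS: "mkW (single (?d, u) 1) s \<in> S0" by (rule mkW_S0[OF F s(1) ga(3) u(2) a(1) a(3) ga(4)])
    have "c \<notin> u" "j \<notin> u" using u c j Y_disj by blast+
    have z1: "D (mkW (single (?g, {}) 1) j) = 0"
      by (rule kill_below_minus_one[OF gS gW j(1)]) (use N_ge_5[OF j] s in \<open>auto simp: wdeg_def\<close>)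
    have z2: "D (mkW (single (?d, u) 1) s) = 0"
      by (rule kill_below_minus_one[OF dS dW c(1)]) (use N_ge_5[OF c(1,2)] c \<open>c \<notin> u\<close> in \<open>auto simp: wdeg_def\<close>)
    have "D (gen j s (N(s := Suc (N s))) ({} \<union> u)) = 0"
    proof (rule gen_split_kill[OF j(1) s(1) _ _ u(1) _ _ u(2) G ga(1) a(1,2) ga(2) F ga(3) a(1,3) ga(4) _ _ _ z1 z2])
      show "(\<lambda>i. ?g i + ?d i) = N(s := Suc (N s))" using s by auto
      show "\<not> p dvd ((N(s := Suc (N s))) i choose ?g i)" if "i \<in> E0" for i
        using p_gt_3 s by auto
    qed (use B s in auto)
    thus "D (gen j s (N(s := Suc (N s))) u) = 0" by simp
  qed (use s in auto)
qed

text \<open>If \<open>N c\<close> is not a power of \<open>p\<close> there is a splitting \<open>N c = A + B\<close> with unit binomial coefficient.\<close>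

lemma kills_even_gens_binomial:
  assumes h: N_in_range and c: "c \<in> E0" "N c \<noteq> 0" and one: "\<And>i. i \<in> E0 \<Longrightarrow> i \<noteq> c \<Longrightarrow> N i = 0"
    and A: "0 < A" "A < N c" "\<not> p dvd (N c choose A)"
  shows kills_even_gens
proof -
  have kills_xD: kills_xD using kills_xDI[OF c] .
  obtain j where j: "j \<in> E0" "j \<noteq> c" using ex_other[of c c] by auto
  obtain s where s: "s \<in> E0" "s \<noteq> j" "s \<noteq> c" using ex_other[of j c] by auto
  have N0: "N i = 0" if "i \<noteq> c" for i using one that N_out by blast
  show ?thesis
  proof (rule kills_even_gensI[OF kills_xD h j(1) s(1)])
    fix u assume u: "u \<subseteq> E1" "even (card u)"
    \<comment> \<open>The shares A and N c - A of x_c are both less than N c, so each factor has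
      negative weight at c after \<open>D\<close>; the derivation indices j and s supply the second
      negative weight.\<close>
    let ?g = "(\<lambda>_. 0)(c := A, s := 1) :: nat \<Rightarrow> nat" and ?d = "(\<lambda>_. 0)(c := N c - A) :: nat \<Rightarrow> nat"
    have B: "(N(s := Suc (N s)), u) \<in> AB" using N_upd_AB h u s by blast
    have lc: "N c < pm c" using N_lt[OF h c(1)] .
    have G: "(?g, {}) \<in> AB" using s c lc A pm_pos[OF s(1)] by (auto simp: AB_iff)
    have F: "(?d, u) \<in> AB" using u c lc by (auto simp: AB_iff)
    have gW: "mkW (single (?g, {}) 1) j \<in> Wd (wdeg (?g, {}, j))" using mkW_gen_Wd[OF G, of j 1] j by (simp add: EE_cases)
    have dW: "mkW (single (?d, u) 1) s \<in> Wd (wdeg (?d, u, s))" using mkW_gen_Wd[OF F, of s 1] s u by (simp add: EE_cases)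
    have ga: "?g j = 0" "?g c < pm c" "?d s = 0" "?d j < pm j"
      using j s lc A pm_pos[OF j(1)] by auto
    have gS: "mkW (single (?g, {}) 1) j \<in> S0" by (rule mkW_S0[OF G j(1) ga(1) _ c(1) j(2)[symmetric] ga(2)]) simp
    have dS: "mkW (single (?d, u) 1) s \<in> S0" by (rule mkW_S0[OF F s(1) ga(3) u(2) j(1) s(2)[symmetric] ga(4)])
    have nu: "c \<notin> u" "j \<notin> u" "s \<notin> u" using u c j s Y_disj by blast+
    have z1: "D (mkW (single (?g, {}) 1) j) = 0"
      by (rule kill_two_negative[OF gS gW c(1) j(1) j(2)[symmetric]]) (use j s A N0 in \<open>auto simp: wdeg_def\<close>)
    have z2: "D (mkW (single (?d, u) 1) s) = 0"
      by (rule kill_two_negative[OF dS dW c(1) s(1) s(3)[symmetric]]) (use j s A N0 nu in \<open>auto simp: wdeg_def of_nat_diff\<close>)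
    have "D (gen j s (N(s := Suc (N s))) ({} \<union> u)) = 0"
    proof (rule gen_split_kill[OF j(1) s(1) _ _ u(1) _ _ u(2) G ga(1) c(1) j(2)[symmetric] ga(2) F ga(3) j(1) s(2)[symmetric] ga(4) _ _ _ z1 z2])
      show "(\<lambda>i. ?g i + ?d i) = N(s := Suc (N s))" using s A N0 by (auto simp: fun_eq_iff)
      show "\<not> p dvd ((N(s := Suc (N s))) i choose ?g i)" if "i \<in> E0" for i
        using p_gt_3 s A N0 by auto
    qed (use B s in auto)
    thus "D (gen j s (N(s := Suc (N s))) u) = 0" by simp
  qed (use s in auto)
qed

text \<open>This replaces the binomial splitting when N c is a power of p. The factors are x_j x^u
  D_s, killed by degree, and x^N D_j, the field on which a power of ad D_c is nonzero; its vanishing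
  is therefore an assumption.\<close>

lemma kills_even_gens_pow:
  assumes h: N_in_range and c: "c \<in> E0" "N c \<noteq> 0" and j: "j \<in> E0" "N j = 0"
    and z: "D (mkW (single (N, {}) 1) j) = 0"
  shows kills_even_gens
proof -
  have kills_xD: kills_xD using kills_xDI[OF c] .
  have jc: "j \<noteq> c" using c j by auto
  obtain s where s: "s \<in> E0" "s \<noteq> j" "s \<noteq> c" using ex_other[of j c] by auto
  show ?thesis
  proof (rule kills_even_gensI[OF kills_xD h s(1) j(1)])
    fix u assume u: "u \<subseteq> E1" "even (card u)"
    let ?g = "(\<lambda>_. 0)(j := 1) :: nat \<Rightarrow> nat"
    have B: "(N(j := Suc (N j)), u) \<in> AB" using N_upd_AB h u j by blast
    have G: "(?g, u) \<in> AB" using u j pm_pos[OF j(1)] by (auto simp: AB_iff)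
    have F: "(N, {}) \<in> AB" using N_AB[OF h] by simp
    have gW: "mkW (single (?g, u) 1) s \<in> Wd (wdeg (?g, u, s))" using mkW_gen_Wd[OF G, of s 1] s u by (simp add: EE_cases)
    have ga: "?g s = 0" "?g c < pm c" using s jc pm_pos[OF c(1)] by auto
    have lc: "N c < pm c" using N_lt[OF h c(1)] .
    have gS: "mkW (single (?g, u) 1) s \<in> S0" by (rule mkW_S0[OF G s(1) ga(1) u(2) c(1) s(3)[symmetric] ga(2)])
    have nu: "c \<notin> u" using u c Y_disj by blast
    have z1: "D (mkW (single (?g, u) 1) s) = 0"
      by (rule kill_below_minus_one[OF gS gW c(1)]) (use s jc N_ge_5[OF c] nu in \<open>auto simp: wdeg_def\<close>)
    have "D (gen s j (N(j := Suc (N j))) (u \<union> {})) = 0"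
    proof (rule gen_split_kill[OF s(1) j(1) s(2) u(1) _ _ u(2) _ G ga(1) c(1) s(3)[symmetric] ga(2) F j(2) c(1) jc[symmetric] lc _ _ _ z1 z])
      show "(\<lambda>i. ?g i + N i) = N(j := Suc (N j))" by auto
      show "\<not> p dvd ((N(j := Suc (N j))) i choose ?g i)" if "i \<in> E0" for i
        using p_gt_3 j by auto
    qed (use B in auto)
    thus "D (gen s j (N(j := Suc (N j))) u) = 0" by simp
  qed (use s in auto)
qed

text \<open>As p divides N i but not the top exponent, N i exceeds the top exponent. A generator
  with a constant term in its value can reach this only if the missing unit is the derivation index
  i of that term and i is not an index of the generator.\<close>

lemma out_of_range_zero:
  assumes kills_xD "\<not> N_in_range"
  shows "D = 0"
proof (rule DER_zero_by_const_coeff[OF D weight_D D0])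
  fix r s \<beta> u v q
  assume g: "gen_ok r s \<beta> u" and nz: "D (gen r s \<beta> u) (\<lambda>_. 0, v, q) \<noteq> 0"
  note S = value_support[OF gen_ok_gen[OF g] nz]
  have deg: "gen_deg r s \<beta> u i = int (N i) - (if i = q then 1 else 0)" if "i \<in> E0" for i
    using S(3)[OF that] by simp
  obtain i where i: "i \<in> E0" "\<not> N i < pm i" using assms(2) by (auto simp: N_in_range_def)
  have "N i \<noteq> pm i"
  proof
    assume "N i = pm i"
    hence "int p dvd (int (pm i) + 1) - int (pm i)"
      using p_dvd_Suc_pm[OF i(1)] pN[OF i(1)] by (intro dvd_diff) (simp_all flip: \<open>N i = pm i\<close>)
    thus False using p_gt_3 by simp
  qed
  hence gt: "N i > pm i" using i by simp
  have AB: "(\<beta>, u) \<in> AB" using g by (simp add: gen_ok_def)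
  have "\<beta> i \<le> pm i" using AB_le[OF AB i(1)] .
  hence "q = i" "r \<noteq> i" "s \<noteq> i"
    using deg[OF i(1)] gt gen_ok_notin[OF g i(1)] unfolding gen_deg_apply by (auto split: if_splits)
  from kill_third_index[OF assms(1) g i(1) this(2,3)] deg \<open>q = i\<close> show "D (gen r s \<beta> u) = 0" by blast
qed

lemma non_p_power_zero:
  assumes c: "c \<in> E0" "N c \<noteq> 0" and np: "\<And>e. e \<ge> 1 \<Longrightarrow> N \<noteq> (\<lambda>_. 0)(c := p ^ e)"
  shows "D = 0"
proof (cases N_in_range)
  case True
  have kills_xD: kills_xD using kills_xDI[OF c] .
  have kills_even_gens
  proof (cases "\<exists>j\<in>E0. j \<noteq> c \<and> N j \<noteq> 0")
    case j: True
    thus ?thesis using kills_even_gens_two[OF True c] by blast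
  next
    case False
    hence one: "N i = 0" if "i \<in> E0" "i \<noteq> c" for i using that by blast
    have "N c \<noteq> p ^ e" if "e \<ge> 1" for e
    proof
      assume "N c = p ^ e"
      hence "N = (\<lambda>_. 0)(c := p ^ e)" using one N_out by (auto simp: fun_eq_iff)
      thus False using np[OF that] by blast
    qed
    then obtain A where "0 < A" "A < N c" "\<not> p dvd (N c choose A)"
      using choose_not_dvd[OF p_prime _ pN[OF c(1)]] c(2) by (metis neq0_conv)
    thus ?thesis using kills_even_gens_binomial[OF True c one] by blast
  qed
  thus ?thesis using D_zero[OF kills_xD True] kills_mixed_gens_nonzero[OF kills_xD True _ c] by blast
qed (use out_of_range_zero kills_xDI[OF c] in blast)

text \<open>By degree \<open>D\<close> maps x^N D_j to a multiple of D_j, while (ad D_c)^(p^e) maps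
  it to D_j itself. Subtracting that multiple leaves a derivation of the same weight to which
  \<open>kills_even_gens_pow\<close> applies.\<close>

lemma nonzero_weight_class:
  assumes c: "c \<in> E0" "N c \<noteq> 0"
  shows "D = 0 \<or> (\<exists>e\<ge>1. e < t c \<and> (\<exists>a. D = (\<lambda>x. sc a (restr S0 (br (Dvec c) ^^ (p ^ e)) x))))"
proof (cases "N_in_range \<and> (\<exists>e\<ge>1. N = (\<lambda>_. 0)(c := p ^ e))")
  case False
  thus ?thesis using non_p_power_zero[OF c] out_of_range_zero[OF kills_xDI[OF c]] by blast
next
  case True
  then obtain e where N_in_range: N_in_range and e: "e \<ge> 1" and Ne: "N = (\<lambda>_. 0)(c := p ^ e)" by blast
  have kills_xD: kills_xD using kills_xDI[OF c] .
  have "p ^ e < p ^ t c" using N_lt[OF N_in_range c(1)] by (simp add: Ne)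
  hence et: "e < t c" using p_gt_3 by (simp add: power_strict_increasing_iff)
  obtain j where j: "j \<in> E0" "j \<noteq> c" using ex_other[of c c] by auto
  let ?x = "mkW (single (N, {}) 1) j" and ?G = "restr S0 (br (Dvec c) ^^ (p ^ e))"
  have NA: "(N, {}) \<in> AB" using N_AB[OF N_in_range] by simp
  have Nj: "N j = 0" using j Ne by simp
  have xS: "?x \<in> S0" by (rule mkW_S0[OF NA j(1) Nj _ c(1) j(2)[symmetric] N_lt[OF N_in_range c(1)]]) simp
  have xW: "?x \<in> Wd (wdeg (N, {}, j))" using mkW_gen_Wd[OF NA, of j 1] j by (simp add: EE_cases)
  have Gx: "?G ?x = Dvec j"
    using funpow_Dvec_mkW[OF c(1) j(1), of "p ^ e"] N_lt[OF N_in_range c(1)] xS by (simp add: Ne restr_def)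
  define a where "a = D ?x (\<lambda>_. 0, {}, j)"
  have Dx: "D ?x = sc a (Dvec j)"
  proof
    fix b :: "(nat \<Rightarrow> nat) \<times> nat set \<times> nat"
    obtain \<alpha> v q where b: "b = (\<alpha>, v, q)" by (cases b)
    show "D ?x b = sc a (Dvec j) b"
    proof (cases "D ?x b = 0")
      case True
      thus ?thesis by (auto simp: a_def b sc_apply Dvec_def single_apply)
    next
      case False
      note S = value_support[OF xS xW False[unfolded b]]
      have al: "int (\<alpha> i) - (if i = q then 1 else 0) = - (if i = j then 1 else 0)" if "i \<in> E0" for i
        using S(3)[OF that] by (simp add: wdeg_def)
      have "q = j" using al[OF j(1)] by (auto split: if_splits)
      moreover have "\<alpha> i = 0" for i
        using al[of i] \<open>q = j\<close> S(2) by (cases "i \<in> E0") (auto simp: AB_iff split: if_splits)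
      hence "\<alpha> = (\<lambda>_. 0)" by auto
      moreover have "k \<notin> v" for k
        using S(4)[of k] S(2) \<open>q = j\<close> j Y_disj N_out[of k] by (auto simp: AB_iff wdeg_def split: if_splits)
      hence "v = {}" by auto
      ultimately show ?thesis by (simp add: a_def b sc_apply Dvec_def single_apply)
    qed
  qed
  define D1 where "D1 = D + (\<lambda>x. sc (- a) (?G x))"
  have "null_weight p m n t D1 N"
  proof (unfold_locales)
    show "D1 \<in> DER" unfolding D1_def by (intro DER_add D DER_scale pow_DER c)
    show "has_degree (\<lambda>i. - int (N i)) D1"
      unfolding D1_def using has_degree_pow[OF c(1), of "p ^ e"] weight_D by (intro has_degree_add has_degree_scale) (simp_all add: Ne)
    show "D1 (Dvec i) = 0" if "i \<in> E0" for i
      using D0[OF that] pow_Dvec_zero[OF c(1) that, of "p ^ e"] p_gt_3 by (simp add: D1_def plus_fun_apply)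
  qed (use pN N_out in auto)
  then interpret A: null_weight p m n t "TYPE('a)" D1 N .
  have "D1 ?x = 0" using Dx Gx by (simp add: D1_def plus_fun_apply sc_minus_left)
  moreover have NB1: A.N_in_range using N_in_range by (simp add: A.N_in_range_def N_in_range_def)
  ultimately have "A.kills_even_gens" using A.kills_even_gens_pow[OF _ c j(1) Nj] by blast
  hence "D1 = 0" using A.D_zero[OF A.kills_xDI[OF c] NB1 _ A.kills_mixed_gens_nonzero[OF A.kills_xDI[OF c] NB1 _ c]] by blast
  have "D = (\<lambda>x. sc a (?G x))"
  proof
    fix x
    have "D1 x = 0" using \<open>D1 = 0\<close> by (simp add: zero_fun_apply)
    thus "D x = sc a (?G x)" by (simp add: D1_def plus_fun_apply sc_minus_left)
  qed
  thus ?thesis using e et by blast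
qed

text \<open>For b outside v the weight of x^v D_b determines the basis element: the only negative
  weight sits at b, so nothing can cancel against a variable. A derivation of weight zero therefore
  acts on it by a scalar.\<close>

lemma oddW_eigen:
  assumes "v \<subseteq> E1" "b \<in> EE" "b \<notin> v" "even (card v + tt b)" "oddW v b \<in> S0" and N: "N = (\<lambda>_. 0)"
  shows "D (oddW v b) = sc (D (oddW v b) (\<lambda>_. 0, v, b)) (oddW v b)"
proof
  fix x :: "(nat \<Rightarrow> nat) \<times> nat set \<times> nat"
  obtain \<alpha> w q where x: "x = (\<alpha>, w, q)" by (cases x)
  show "D (oddW v b) x = sc (D (oddW v b) (\<lambda>_. 0, v, b)) (oddW v b) x"
  proof (cases "D (oddW v b) x = 0")
    case True
    thus ?thesis by (auto simp: x sc_apply mkW_def single_apply)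
  next
    case False
    note S = value_support[OF assms(5) oddW_Wd[OF assms(1,2,4)] False[unfolded x]]
    have v0: "i \<in> E0 \<Longrightarrow> i \<notin> v" for i using assms(1) Y_disj by blast
    have e0: "int (\<alpha> i) - (if i = q then 1 else 0) = - (if i = b then 1 else 0)" if "i \<in> E0" for i
      using S(3)[OF that] v0[OF that] by (simp add: wdeg_def N)
    have e1: "(if k \<in> v then 1 else 0) - (if k = b then 1 else 0) = (if k \<in> w then 1 else 0) - (if k = q then (1::int) else 0)"
      if "k \<in> E1" for k
      using S(4)[OF that] by (simp add: wdeg_def)
    have q: "q = b"
    proof (cases "b \<in> E0")
      case True thus ?thesis using e0[OF True] by (auto split: if_splits)
    next
      case False
      hence "b \<in> E1" using assms(2) by (simp add: EE_cases)
      thus ?thesis using e1[of b] assms(3) by (auto split: if_splits)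
    qed
    have "\<alpha> i = 0" for i
      using e0[of i] q S(2) by (cases "i \<in> E0") (auto simp: AB_iff)
    hence "\<alpha> = (\<lambda>_. 0)" by auto
    moreover have "k \<in> w \<longleftrightarrow> k \<in> v" for k
      using e1[of k] q assms(1) S(2) by (cases "k \<in> E1") (auto simp: AB_iff split: if_splits)
    hence "w = v" by blast
    ultimately show ?thesis using q by (simp add: x sc_apply mkW_def)
  qed
qed

lemma eigen_br:
  assumes "x \<in> S0" "z \<in> S0" "D x = sc a x" "D z = sc b z" "br x z = sc d y" "d \<noteq> 0" "D y = sc c y" "y \<in> S0" "y \<noteq> 0"
  shows "c = a + b"
proof -
  have "D (br x z) = sc b (br x z) - sc a (br z x)"
    using DERD(4)[OF D assms(1,2)] assms(3,4) by (simp add: br_bilinear)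
  also have "\<dots> = sc (a + b) (br x z)"
    using br_anti[OF S0_W0[OF assms(2)] S0_W0[OF assms(1)]] by (simp add: sc_minus sc_add_left add.commute)
  finally have "sc (d * c) y = sc (d * (a + b)) y"
    using DERD(3)[OF D assms(8), of d] assms(5,7) by (simp add: mult.commute)
  hence eq: "sc (d * c - d * (a + b)) y = 0" by (simp add: sc_diff_left)
  obtain t where "y t \<noteq> 0" using assms(9) by (auto simp: fun_eq_iff zero_fun_apply)
  moreover have "(d * c - d * (a + b)) * y t = 0" using fun_cong[OF eq, of t] by (simp add: sc_apply zero_fun_apply)
  ultimately have "d * c - d * (a + b) = 0" by simp
  hence "d * c = d * (a + b)" by simp
  thus ?thesis using assms(6) by simp
qed

text \<open>Weight zero: the eigenvalues of \<open>D\<close> on \<open>x\<^sub>k x\<^sub>l D\<^sub>i\<close> and on \<open>x\<^sub>k D\<^sub>l\<close>.\<close>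

definition eig_even :: "nat \<Rightarrow> nat \<Rightarrow> nat \<Rightarrow> 'a" where
  "eig_even i k l = D (oddW {k, l} i) (\<lambda>_. 0, {k, l}, i)"

definition eig_odd :: "nat \<Rightarrow> nat \<Rightarrow> 'a" where
  "eig_odd k l = D (oddW {k} l) (\<lambda>_. 0, {k}, l)"

lemma eig_even_eigen: "N = (\<lambda>_. 0) \<Longrightarrow> i \<in> E0 \<Longrightarrow> k \<in> E1 \<Longrightarrow> l \<in> E1 \<Longrightarrow> k \<noteq> l \<Longrightarrow> D (oddW {k, l} i) = sc (eig_even i k l) (oddW {k, l} i)"
  unfolding eig_even_def using Y_disj by (intro oddW_eigen mkW_odd_S0) (auto simp: EE_cases)

lemma eig_odd_eigen: "N = (\<lambda>_. 0) \<Longrightarrow> k \<in> E1 \<Longrightarrow> l \<in> E1 \<Longrightarrow> k \<noteq> l \<Longrightarrow> D (oddW {k} l) = sc (eig_odd k l) (oddW {k} l)"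
proof -
  assume a: "N = (\<lambda>_. 0)" "k \<in> E1" "l \<in> E1" "k \<noteq> l"
  obtain i where "i \<in> E0" using ex_other by blast
  thus ?thesis unfolding eig_odd_def using a oddW_gen(2)[OF a(2-4)] by (intro oddW_eigen) (auto simp: EE_cases)
qed

lemma eig_even_sym: "eig_even i k l = eig_even i l k"
  by (simp add: eig_even_def insert_commute)

text \<open>[x_k D_l, x_l x_r D_i] is a nonzero multiple of x_k x_r D_i, and eigenvalues add under
  brackets.\<close>

lemma eig_even_odd:
  assumes N: "N = (\<lambda>_. 0)" and i: "i \<in> E0" and k: "k \<in> E1" "l \<in> E1" "r \<in> E1" "k \<noteq> l" "k \<noteq> r" "l \<noteq> r"
  shows "eig_even i k r = eig_odd k l + eig_even i l r"
proof -
  have S: "oddW {k} l \<in> S0" "oddW {l, r} i \<in> S0" "oddW {k, r} i \<in> S0"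
    using oddW_gen(2)[OF k(1,2,4) i] mkW_odd_S0[of "{l, r}" i] mkW_odd_S0[of "{k, r}" i] k i by simp_all
  have E: "l \<in> EE" "i \<in> EE" using k i by (simp_all add: EE_cases)
  have B: "(\<lambda>_. 0, {k}) \<in> AB" "(\<lambda>_. 0, {l, r}) \<in> AB" "(\<lambda>_. 0, {r}) \<in> AB" "(\<lambda>_. 0, {k, r}) \<in> AB"
    using k by (auto simp: AB_iff)
  obtain d where d: "d \<noteq> 0" "single (\<lambda>_. 0, {k}) 1 \<odot> single (\<lambda>_. 0, {r}) 1 = single (\<lambda>i. 0 + 0, {k} \<union> {r}) d"
    by (rule mul_e_nz[OF B(1,3)]) (use k p_gt_3 in auto)
  let ?s = "(-1) ^ card {j \<in> {l, r}. j < l} :: 'a"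
  have "{l, r} - {l} = {r}" using k by auto
  hence p: "pd l (single (\<lambda>_. 0, {l, r}) 1) = sc ?s (single (\<lambda>_. 0, {r}) 1)"
    using pd_e_odd[OF B(2) k(2)] by simp
  have "br (oddW {k} l) (oddW {l, r} i) = mkW (single (\<lambda>_. 0, {k}) 1 \<odot> pd l (single (\<lambda>_. 0, {l, r}) 1)) i
      - mkW (single (\<lambda>_. 0, {l, r}) 1 \<odot> pd i (single (\<lambda>_. 0, {k}) 1)) l"
    by (rule br_mkW_mkW[OF S0_W0[OF S(1)] S0_W0[OF S(2)] E])
  also have "\<dots> = sc (?s * d) (oddW {k, r} i)"
    using d(2) pd_e_even[OF B(1) i] unfolding p mul_sc_right by (simp add: mkW_simps insert_commute flip: mkW_simps(3))
  finally have br: "br (oddW {k} l) (oddW {l, r} i) = sc (?s * d) (oddW {k, r} i)" .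
  show ?thesis
    by (rule eigen_br[OF S(1,2) eig_odd_eigen[OF N k(1,2,4)] eig_even_eigen[OF N i k(2,3,6)] br _ eig_even_eigen[OF N i k(1,3,5)] S(3) oddW_nz])
      (use d(1) in simp)
qed

text \<open>The field is the curl of x_a^(2) x^v. If its value were nonzero, lowering would produce
  a term without even variables, and weight zero forces exactly one x_a to be removed, which leaves
  x^v D_b.\<close>

lemma kill_linear:
  assumes N: "N = (\<lambda>_. 0)" and v: "v \<subseteq> E1" "even (card v)" and ab: "a \<in> E0" "b \<in> E0" "a \<noteq> b" and z: "D (oddW v b) = 0"
  shows "D (mkW (single ((\<lambda>_. 0)(a := 1), v) 1) b) = 0"
proof (rule ccontr)
  let ?e = "(\<lambda>_. 0)(a := 1) :: nat \<Rightarrow> nat"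
  assume nz: "D (mkW (single (?e, v) 1) b) \<noteq> 0"
  have B: "(?e, v) \<in> AB" using v ab pm_pos[OF ab(1)] by (auto simp: AB_iff)
  have eb: "?e b = 0" "?e a < pm a" using ab pm_ge[OF ab(1)] by auto
  have eq: "mkW (single (?e, v) 1) b = gen a b (?e(a := Suc (?e a))) v"
    by (rule mkW_eq_gen(1)[OF B ab(2) eb(1) v(2) ab(1,3) eb(2)])
  have "(?e(a := Suc (?e a)), v) \<in> AB"
    by (rule mkW_eq_gen(2)[OF B ab(2) eb(1) v(2) ab(1,3) eb(2)])
  hence ok: "gen_ok a b (?e(a := Suc (?e a))) v" using ab v by (simp add: gen_ok_def EE_cases)
  from gen_const_coeff[OF ok nz[unfolded eq]] obtain \<beta>' q where
    c: "gen_ok a b \<beta>' v" "\<And>i. \<beta>' i \<le> (?e(a := Suc (?e a))) i" "D (gen a b \<beta>' v) \<noteq> 0"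
      "\<And>i. i \<in> E0 \<Longrightarrow> gen_deg a b \<beta>' v i = int (N i) - (if i = q then 1 else 0)" by metis
  have u: "a \<notin> v" "b \<notin> v" using gen_ok_notin[OF c(1)] ab by blast+
  have "\<beta>' i = 0" if "i \<noteq> a" for i using c(2)[of i] that by simp
  moreover have "q = b" using c(4)[OF ab(2)] \<open>\<And>i. i \<noteq> a \<Longrightarrow> \<beta>' i = 0\<close>[of b] ab u unfolding gen_deg_apply N by (auto split: if_splits)
  hence "\<beta>' a = 1" using c(4)[OF ab(1)] ab u unfolding gen_deg_apply N by (auto split: if_splits)
  ultimately have "\<beta>' = ?e" by auto
  thus False using c(3) z gen_eps[OF v ab] by simp
qed

text \<open>The eigenvalues at pairs containing k1 and at the pair (k2, k3) determine all others.
  Once they vanish, \<open>D\<close> kills every x^v D_b, then the generators with two even indices,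
  the diagonal elements of S and the mixed generators.\<close>

lemma zero_weight_normalized:
  assumes N: "N = (\<lambda>_. 0)" and i0: "i0 \<in> E0" and k: "k1 \<in> E1" "k2 \<in> E1" "k3 \<in> E1" "k1 \<noteq> k2" "k1 \<noteq> k3" "k2 \<noteq> k3"
    and c1: "\<And>k. k \<in> E1 \<Longrightarrow> k \<noteq> k1 \<Longrightarrow> eig_even i0 k1 k = 0" and c23: "eig_even i0 k2 k3 = 0"
  shows "D = 0"
proof -
  note rel = eig_even_odd[OF N i0]
  \<comment> \<open>The relation makes this eigenvalue independent of l. Symmetry in k and l then
    identifies \<open>eig_odd k k1\<close> for all k, and the pair (k2, k3) shows the common value
    to be 0.\<close>
  have e: "eig_even i0 k l = eig_odd k k1" if "k \<in> E1" "l \<in> E1" "k \<noteq> k1" "l \<noteq> k" "l \<noteq> k1" for k l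
    using rel[of k k1 l] c1[of l] that k by simp
  have e23: "eig_odd k2 k1 = 0" "eig_odd k3 k1 = 0"
    using e[OF k(2,3) k(4)[symmetric] k(6)[symmetric] k(5)[symmetric]]
      e[OF k(3,2) k(5)[symmetric] k(6) k(4)[symmetric]] c23 eig_even_sym[of i0 k3 k2] by (metis, metis)
  have ez: "eig_odd k k1 = 0" if "k \<in> E1" "k \<noteq> k1" for k
  proof (cases "k = k2")
    case False
    thus ?thesis using e[of k k2] e[of k2 k] e23 eig_even_sym[of i0 k k2] that k by simp
  qed (use e23 in simp)
  have cz: "eig_even i0 k l = 0" if "k \<in> E1" "l \<in> E1" "k \<noteq> l" for k l
    using e[of k l] ez c1 eig_even_sym[of i0 k l] that by (cases "k = k1"; cases "l = k1") auto
  have dz: "eig_odd k l = 0" if kl: "k \<in> E1" "l \<in> E1" "k \<noteq> l" for k l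
  proof -
    obtain r where "r \<in> E1" "r \<noteq> k" "r \<noteq> l" using ex_other_odd[of k l] by auto
    thus ?thesis using rel[of k l r] cz kl by simp
  qed
  have D1: "D (oddW {k} l) = 0" if "k \<in> E1" "l \<in> E1" "k \<noteq> l" for k l
    using eig_odd_eigen[OF N that] dz[OF that] by simp
  have od0: "oddW {} b = Dvec b" for b by (simp add: Dvec_mkW one_def)
  have XVi: "D (mkW (gvar a) b) = 0" if ab: "a \<in> E0" "b \<in> E0" "a \<noteq> b" for a b
    using kill_linear[OF N _ _ ab, of "{}"] D0[OF ab(2)] by (simp add: gvar_e[OF ab(1)] od0)
  hence kills_xD: kills_xD by (simp add: kills_xD_def)
  have tr: "D (oddW v b) = 0" if v: "v \<subseteq> E1" "even (card v)" and ab: "a \<in> E0" "b \<in> E0" and z: "D (oddW v a) = 0" for v a b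
  proof (cases "a = b")
    case False
    have B: "(\<lambda>_. 0, v) \<in> AB" by (rule oddW_AB[OF v(1)])
    have E: "a \<in> EE" "b \<in> EE" using ab by (simp_all add: EE_cases)
    have S: "mkW (gvar a) b \<in> S0" "oddW v a \<in> S0" "oddW v b \<in> S0"
      using mkW_gvar_S0(1)[OF ab False] mkW_odd_S0[OF v(1) _ v(2)] ab by simp_all
    have "br (mkW (gvar a) b) (oddW v a) = - oddW v b"
      using br_mkW_mkW[OF S0_W0[OF S(1)] S0_W0[OF S(2)] E(2,1)] pd_e_even[OF B ab(2)] B
      by (simp add: pd_gvar E mul_one mkW_simps)
    hence eq: "oddW v b = - br (mkW (gvar a) b) (oddW v a)" by simp
    have "D (br (mkW (gvar a) b) (oddW v a)) = 0"
      by (rule DER_br_kill[OF D S(1,2) XVi[OF ab False] z])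
    thus ?thesis
      using DER_minus[OF D br_S0[OF S(1,2)]] eq by simp
  qed (use z in simp)
  \<comment> \<open>Induction removes two odd variables: with w = v - {k, l}, x^v D_b is a multiple
    of [x_k x_l D_a, x_a x^w D_b], whose second entry is covered by
    \<open>kill_linear\<close>.\<close>
  have K: "D (oddW v b) = 0" if "v \<subseteq> E1" "even (card v)" "b \<in> E0" for v b
    using that
  proof (induction "card v" arbitrary: v b rule: less_induct)
    case less
    have fin: "finite v" by (rule finite_subset[OF less(2)]) simp
    show ?case
    proof (cases "v = {}")
      case True thus ?thesis using D0 less(4) by (simp add: od0)
    next
      case False
      then obtain k where k: "k \<in> v" by blast
      have "card v \<noteq> 1" using less(3) by auto
      hence "v \<noteq> {k}" by auto
      then obtain l where l: "l \<in> v" "l \<noteq> k" using k by blast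
      let ?w = "v - {k, l}"
      have vw: "v = {k, l} \<union> ?w" using k l by auto
      have l': "l \<in> v - {k}" using l by simp
      have cw: "card v = 2 + card ?w"
        by (simp only: card.remove[OF fin k(1)] card.remove[OF _ l'] finite_Diff fin Diff_insert2[symmetric] add_2_eq_Suc)
      have w: "?w \<subseteq> E1" "even (card ?w)" "{k, l} \<subseteq> E1"
        using less(2) k l by (blast, use less(3) in \<open>simp only: cw even_add even_numeral\<close>, blast)
      have kl0: "D (oddW {k, l} a) = 0" if "a \<in> E0" for a
        using tr[OF w(3) _ i0 that] eig_even_eigen[OF N i0, of k l] cz[of k l] w(3) l(2) by simp
      obtain a where a: "a \<in> E0" "a \<noteq> b" using ex_other[of b b] by auto
      let ?e = "(\<lambda>_. 0)(a := 1) :: nat \<Rightarrow> nat"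
      have wb: "D (oddW ?w b) = 0" using less(1)[of ?w b] cw w less(4) by simp
      have zw: "D (mkW (single (?e, ?w) 1) b) = 0" by (rule kill_linear[OF N w(1,2) a(1) less(4) a(2) wb])
      have G: "(\<lambda>_. 0, {k, l}) \<in> AB" by (rule oddW_AB[OF w(3)])
      have F: "(?e, ?w) \<in> AB" using w a pm_pos[OF a(1)] by (auto simp: AB_iff)
      have Ev: "(?e, v) \<in> AB" using less(2) a pm_pos[OF a(1)] by (auto simp: AB_iff)
      have l1: "(\<lambda>_. 0) b < pm b" "?e a < pm a" using pm_pos[OF less(4)] pm_ge[OF a(1)] by auto
      have "D (gen a b ?e ({k, l} \<union> ?w)) = 0"
      proof (rule gen_split_kill[OF a(1) less(4) a(2) w(3,1) _ _ w(2) G _ less(4) a(2)[symmetric] l1(1) F _ a(1,2) l1(2) _ _ _ kl0[OF a(1)] zw])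
        show "\<not> p dvd (?e i choose 0)" for i using p_gt_3 by simp
        show "(?e, {k, l} \<union> ?w) \<in> AB" using Ev vw by simp
      qed (use l a in auto)
      hence "D (gen a b ?e v) = 0" using vw by simp
      thus ?thesis using gen_eps[OF less(2,3) a(1) less(4) a(2)] by simp
    qed
  qed
  have N_in_range: N_in_range unfolding N_in_range_def by (simp only: N) (use pm_pos in simp)
  have kills_even_gens: kills_even_gens unfolding kills_even_gens_def
  proof (intro ballI allI impI)
    fix j s u assume js: "j \<in> E0" "s \<in> E0" "j \<noteq> s" and u: "u \<subseteq> E1" "even (card u)"
    have eqN: "N(s := Suc (N s)) = (\<lambda>_. 0)(s := 1)" by (simp add: N)
    have "D (gen s j ((\<lambda>_. 0)(s := 1)) u) = 0"
      unfolding gen_eps[OF u js(2,1) js(3)[symmetric]] by (rule K[OF u js(1)])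
    moreover have "gen_ok s j ((\<lambda>_. 0)(s := 1)) u" using N_upd_ok[OF N_in_range u js(2) js(2,1)] unfolding eqN .
    ultimately show "D (gen j s (N(s := Suc (N s))) u) = 0"
      unfolding eqN by (rule gen_swap_kill[OF D, rotated])
  qed
  have base: "D (gen a l ((\<lambda>_. 0)(a := 1)) {k}) = 0" if al: "a \<in> E0" "l \<in> E1" "k \<in> E1" for a k l
  proof (cases "k = l")
    case False
    thus ?thesis using oddW_gen(1)[OF al(3,2) False al(1)] D1[OF al(3,2) False] by simp
  next
    case True
    let ?b = "\<lambda>r. if r = a then 1 else if r = l then 1 else 0 :: 'a" and ?h = "gen a l ((\<lambda>_. 0)(a := 1)) {l}"
    have h: "?h = torus ?b" "?h \<in> S0" using torus_odd_S0[OF al(1,2)] by simp_all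
    have hW: "?h \<in> Wd 0" unfolding h(1) by (rule torus_Wd)
    \<comment> \<open>The diagonal element h acts on x by a scalar, so applying \<open>D\<close> to
      [x, h] shows that every homogeneous x killed by \<open>D\<close> commutes with D h.\<close>
    have bD: "br x (D ?h) = 0" if x: "x \<in> S0" "x \<in> Wd \<mu>" "D x = 0" for x \<mu>
    proof -
      have "br x ?h = - br ?h x" by (rule br_anti[OF S0_W0[OF x(1)] S0_W0[OF h(2)]])
      hence "br x ?h = sc (- (\<Sum>r\<in>EE. ?b r * of_int (\<mu> r))) x"
        unfolding h(1) br_torus[OF x(2)] by (simp only: sc_minus_left)
      hence "D (br x ?h) = 0" using DERD(3)[OF D x(1)] x(3) by (simp only: sc_simps)
      thus ?thesis using DERD(4)[OF D x(1) h(2)] x(3) by simp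
    qed
    have "D ?h = 0"
    proof (rule odd_torus_zero[OF DERD(1)[OF D h(2)] _ al(1)])
      fix \<alpha> v q assume nz: "D ?h (\<alpha>, v, q) \<noteq> 0"
      note S = value_support[OF h(2) hW nz]
      have e0: "int (\<alpha> i) = (if i = q then 1 else 0)" if "i \<in> E0" for i
        using S(3)[OF that] by (simp add: N zero_fun_apply)
      have e1: "k \<in> v \<longleftrightarrow> k = q" if "k \<in> E1" for k
        using S(4)[OF that] by (auto simp: zero_fun_apply split: if_splits)
      \<comment> \<open>An even q would give a term x_q D_q, which the bracket with D_q turns into
        D_q instead of 0.\<close>
      have "q \<notin> E0"
      proof
        assume q: "q \<in> E0"
        have "br (Dvec q) (D ?h) = 0" by (rule bD[OF Dvec_S0[OF q] Dvec_Wd[OF q] D0[OF q]])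
        hence "D ?h ((\<alpha>(q := 0))(q := Suc ((\<alpha>(q := 0)) q)), v, q) = 0"
          using br_Dvec[OF DERD(1)[OF D h(2)] q, of "\<alpha>(q := 0)" v q] by (simp only: zero_fun_apply)
        moreover have "(\<alpha>(q := 0))(q := Suc ((\<alpha>(q := 0)) q)) = \<alpha>" using e0[OF q] by auto
        ultimately show False using nz by simp
      qed
      hence q: "q \<in> E1" using S(1) by (simp add: EE_cases)
      have "\<alpha> i = 0" for i
      proof (cases "i \<in> E0")
        case True
        hence "i \<noteq> q" using \<open>q \<notin> E0\<close> by blast
        thus ?thesis using e0[OF True] by simp
      qed (use S(2) in \<open>simp add: AB_iff\<close>)
      moreover have "v = {q}" using e1 q S(2) by (auto simp: AB_iff)
      ultimately show "q \<in> E1 \<and> \<alpha> = (\<lambda>_. 0) \<and> v = {q}" using q by auto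
    next
      fix k l assume kl: "k \<in> E1" "l \<in> E1" "k \<noteq> l"
      show "br (oddW {k, l} a) (D ?h) = 0"
        by (rule bD[OF mkW_odd_S0 oddW_Wd K]) (use kl al in \<open>auto simp: EE_cases\<close>)
    qed
    thus ?thesis using True by simp
  qed
  have kills_mixed_gens: kills_mixed_gens unfolding kills_mixed_gens_def
  proof (intro ballI allI impI)
    fix a l u assume al: "a \<in> E0" "l \<in> E1" and u: "u \<subseteq> E1" "odd (card u)"
    have fin: "finite u" by (rule finite_subset[OF u(1)]) simp
    obtain b where b: "b \<in> E0" "b \<noteq> a" using ex_other[of a a] by auto
    \<comment> \<open>If l occurs in u it must be the variable split off, so that D_l annihilates
      the remaining x^(u - {k}) as \<open>br_mkW_DD\<close> requires.\<close>
    obtain k where k: "k \<in> u" "l \<in> u \<Longrightarrow> k = l"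
    proof (cases "l \<in> u")
      case False
      have "u \<noteq> {}" using u(2) by auto
      thus thesis using that False by blast
    qed (use that in blast)
    let ?v = "u - {k}" and ?e = "(\<lambda>_. 0)(a := 1) :: nat \<Rightarrow> nat"
    let ?f = "(\<lambda>_. 0)(a := 1, b := 1) :: nat \<Rightarrow> nat"
    have kE: "k \<in> E1" using k u by blast
    have lv: "l \<notin> ?v" using k by auto
    have "card u = Suc (card ?v)" using card.remove[OF fin k(1)] .
    hence v: "?v \<subseteq> E1" "even (card ?v)" using u by auto
    have F: "(?f, {k}) \<in> AB" using kE al b pm_pos[OF al(1)] pm_pos[OF b(1)] by (auto simp: AB_iff)
    have Ek: "(?e, {k}) \<in> AB" "(?e, u) \<in> AB" using kE u al pm_pos[OF al(1)] by (auto simp: AB_iff)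
    have ok: "gen_ok a l ?f {k}" using F al by (simp add: gen_ok_def EE_cases)
    \<comment> \<open>Lowering a nonzero value can only remove x_b, since removing x_a gives a
      smaller degree, and that leads to \<open>base\<close>.\<close>
    have z: "D (gen a l ?f {k}) = 0"
    proof (rule ccontr)
      assume "D (gen a l ?f {k}) \<noteq> 0"
      from gen_const_coeff[OF ok this] obtain \<beta>' q where
        c: "gen_ok a l \<beta>' {k}" "\<And>i. \<beta>' i \<le> ?f i" "D (gen a l \<beta>' {k}) \<noteq> 0"
          "\<And>i. i \<in> E0 \<Longrightarrow> gen_deg a l \<beta>' {k} i = int (N i) - (if i = q then 1 else 0)" by metis
      have ne: "a \<noteq> k" "a \<noteq> l" "b \<noteq> k" "b \<noteq> l" using al b kE Y_disj by blast+
      have "\<not> gen_deg a l \<beta>' {k} a < 0" using kill_smaller_degree[OF kills_xD N_in_range kills_even_gens c(1) al(1)] c(3) by (auto simp: N)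
      hence "\<beta>' a = 1" using c(2)[of a] ne b unfolding gen_deg_apply by (auto split: if_splits)
      moreover have "\<beta>' b = 0" using c(4)[OF b(1)] ne b unfolding gen_deg_apply N by (auto split: if_splits)
      moreover have "\<beta>' i = 0" if "i \<noteq> a" "i \<noteq> b" for i using c(2)[of i] that by simp
      ultimately have "\<beta>' = ?e" by (auto simp: fun_eq_iff)
      thus False using c(3) base[OF al kE] by simp
    qed
    have XS: "oddW ?v b \<in> S0" by (rule mkW_odd_S0[OF v(1) b(1) v(2)])
    have X0: "D (oddW ?v b) = 0" by (rule K[OF v b(1)])
    have G: "(\<lambda>_. 0, ?v) \<in> AB" by (rule oddW_AB[OF v(1)])
    have hg: "hom 0 (single (\<lambda>_. 0, ?v) 1)" using hom_single[OF G, of 1] v by simp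
    have hf: "hom 1 (single (?f, {k}) 1)" using hom_single[OF F, of 1] by simp
    have "?f(b := ?f b - 1) = ?e" using b by (auto simp: fun_eq_iff)
    hence pdf: "pd b (single (?f, {k}) 1) = single (?e, {k}) 1" using pd_e_even[OF F b(1)] by simp
    obtain d where d: "d \<noteq> 0" "single (\<lambda>_. 0, ?v) 1 \<odot> single (?e, {k}) 1 = single (\<lambda>i. 0 + ?e i, ?v \<union> {k}) d"
    proof (rule mul_e_nz[OF G Ek(1)])
      show "0 + ?e i \<le> pm i \<and> \<not> p dvd (0 + ?e i choose 0)" if "i \<in> E0" for i
        using AB_le[OF Ek(1) that] p_gt_3 by simp
    qed auto
    have "?v \<union> {k} = u" using k by auto
    moreover have "(\<lambda>i. 0 + ?e i) = ?e" by (simp only: add_0)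
    ultimately have prod: "single (\<lambda>_. 0, ?v) 1 \<odot> pd b (single (?f, {k}) 1) = sc d (single (?e, u) 1)"
      unfolding pdf d(2) by (simp only: sc_single mult_1_right)
    have pdl: "pd l (single (\<lambda>_. 0, ?v) 1) = 0" using pd_e_odd[OF G al(2)] lv by (simp only: if_False)
    have "br (oddW ?v b) (DD a l 1 (single (?f, {k}) 1)) = DD a l 1 (single (\<lambda>_. 0, ?v) 1 \<odot> pd b (single (?f, {k}) 1))"
      by (rule br_mkW_DD[OF b(1) hg hf])
        (use al pdl in \<open>simp_all add: EE_cases pd_e_even[OF G al(1)]\<close>)
    moreover have "card u mod 2 = 1" using u(2) by presburger
    ultimately have "br (oddW ?v b) (gen a l ?f {k}) = sc d (gen a l ?e u)"
      unfolding prod DD_simps(2) by simp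
    moreover have "D (br (oddW ?v b) (gen a l ?f {k})) = 0"
      by (rule DER_br_kill[OF D XS gen_ok_gen(1)[OF ok] X0 z])
    moreover have "gen a l ?e u \<in> S0" using Ek(2) al u by (intro gen_S0) (simp_all add: EE_cases)
    ultimately have "D (gen a l ?e u) = 0" using DER_sc_kill[OF D _ d(1)] by simp
    thus "D (gen a l (N(a := Suc (N a))) u) = 0" by (simp add: N)
  qed
  show ?thesis by (rule D_zero[OF kills_xD N_in_range kills_even_gens kills_mixed_gens])
qed

text \<open>A torus element of W supported on Y_1 leaves the D_i undisturbed and shifts the
  eigenvalue on x_k x_l D_i0 by b k + b l. Its weights are solved so as to meet the hypotheses of
  \<open>zero_weight_normalized\<close>.\<close>

lemma zero_weight_inner:
  assumes N: "N = (\<lambda>_. 0)"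
  shows "\<exists>E\<in>W0. D + restr S0 (br E) = 0"
proof -
  obtain i0 where i0: "i0 \<in> E0" using ex_other by blast
  obtain k1 where k1: "k1 \<in> E1" using ex_other_odd by blast
  obtain k2 where k2: "k2 \<in> E1" "k2 \<noteq> k1" using ex_other_odd[of k1 k1] by auto
  obtain k3 where k3: "k3 \<in> E1" "k3 \<noteq> k1" "k3 \<noteq> k2" using ex_other_odd[of k1 k2] by auto
  \<comment> \<open>\<open>b\<close> solves \<open>b k + b l = - eig_even i0 k l\<close> for \<open>k = k1\<close> and for the pair \<open>k2, k3\<close>.\<close>
  define B where "B = (eig_even i0 k1 k2 + eig_even i0 k1 k3 - eig_even i0 k2 k3) / 2"
  define b where "b k = (if k = k1 then - B else if k \<in> E1 then B - eig_even i0 k1 k else 0)" for k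
  have b0: "b i = 0" if "i \<in> E0" for i using that k1 Y_disj by (auto simp: b_def)
  define D' where "D' = D + restr S0 (br (torus b))"
  have "null_weight p m n t D' N"
  proof (unfold_locales)
    show "D' \<in> DER" unfolding D'_def by (intro DER_add D ad_DER torus_W0)
    have "(\<lambda>i. - int (N i)) = 0" by (simp add: N fun_eq_iff zero_fun_apply)
    thus "has_degree (\<lambda>i. - int (N i)) D'" unfolding D'_def using weight_D has_degree_ad[OF torus_Wd, of b] has_degree_add by simp
    show "D' (Dvec i) = 0" if i: "i \<in> E0" for i
    proof -
      have "(\<Sum>r\<in>EE. b r * of_int ((- ep i) r)) = 0"
        using b0[OF i] by (intro sum.neutral) (auto simp: uminus_apply)
      thus ?thesis
        using D0[OF i] Dvec_S0[OF i] br_torus[OF Dvec_Wd[OF i], of b] by (simp add: D'_def plus_fun_apply restr_def)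
    qed
  qed (use pN N_out in auto)
  then interpret A: null_weight p m n t "TYPE('a)" D' N .
  have ce': "A.eig_even i0 k l = eig_even i0 k l + (b k + b l)" if kl: "k \<in> E1" "l \<in> E1" "k \<noteq> l" for k l
  proof -
    have S: "oddW {k, l} i0 \<in> S0" "oddW {k, l} i0 \<in> Wd (wdeg (\<lambda>_. 0, {k, l}, i0))"
      using kl i0 mkW_odd_S0[of "{k, l}" i0] oddW_Wd[of "{k, l}" i0] by (simp_all add: EE_cases)
    have "(\<Sum>r\<in>EE. b r * of_int (wdeg (\<lambda>_. 0, {k, l}, i0) r)) = (\<Sum>r\<in>EE. (if r = k then b k else 0) + (if r = l then b l else 0))"
      using kl i0 b0[OF i0] Y_disj by (intro sum.cong refl) (auto simp: wdeg_def)
    also have "\<dots> = b k + b l" using kl by (simp add: sum.distrib EE_cases)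
    finally have w: "(\<Sum>r\<in>EE. b r * of_int (wdeg (\<lambda>_. 0, {k, l}, i0) r)) = b k + b l" .
    have "D' (oddW {k, l} i0) = D (oddW {k, l} i0) + sc (b k + b l) (oddW {k, l} i0)"
      using S(1) br_torus[OF S(2), of b] by (simp add: D'_def plus_fun_apply restr_def w)
    thus ?thesis by (simp add: A.eig_even_def eig_even_def plus_fun_apply sc_apply mkW_def)
  qed
  have "D' = 0"
  proof (rule A.zero_weight_normalized[OF N i0 k1 k2(1) k3(1)])
    show "A.eig_even i0 k1 k = 0" if "k \<in> E1" "k \<noteq> k1" for k
      using ce'[OF k1 that(1) that(2)[symmetric]] that by (simp add: b_def)
    have "b k2 = B - eig_even i0 k1 k2" "b k3 = B - eig_even i0 k1 k3"
      using k2 k3 by (simp_all add: b_def)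
    moreover have "eig_even i0 k1 k2 + eig_even i0 k1 k3 - eig_even i0 k2 k3 = B + B"
      unfolding B_def mult_2[symmetric] using two_neq_0 by (simp only: nonzero_mult_div_cancel_left times_divide_eq_right not_False_eq_True)
    ultimately have "eig_even i0 k2 k3 + (b k2 + b k3) = 0" by (simp only:) algebra
    thus "A.eig_even i0 k2 k3 = 0"
      using ce'[OF k2(1) k3(1) k3(3)[symmetric]] by simp
  qed (use k2 k3 in auto)
  thus ?thesis using torus_W0 unfolding D'_def by blast
qed

end

context divided_superalgebra
begin

section \<open>The space of derivations\<close>

lemma module_sc_pointwise: "module (\<lambda>(c::'a) (D :: 'c \<Rightarrow> 'b \<Rightarrow> 'a) x. sc c (D x))"
  by unfold_locales (auto simp: fun_eq_iff pointwise algebra_simps)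

interpretation sc_pointwise: module "\<lambda>(c::'a) (D :: 'c \<Rightarrow> 'b \<Rightarrow> 'a) x. sc c (D x)"
  by (rule module_sc_pointwise)

definition inner_ders :: "('a wel \<Rightarrow> 'a wel) set" where
  "inner_ders = {restr S0 (br E) | E. E \<in> W0}"

abbreviation pw :: "nat \<Rightarrow> nat \<Rightarrow> 'a wel \<Rightarrow> 'a wel" where
  "pw i e \<equiv> restr S0 (br (Dvec i) ^^ (p ^ e))"

definition pow_ders :: "('a wel \<Rightarrow> 'a wel) set" where
  "pow_ders = sc_pointwise.span {pw i e | i e. i \<in> E0 \<and> 1 \<le> e \<and> e < t i}"

definition sum_ders :: "('a wel \<Rightarrow> 'a wel) set" where
  "sum_ders = {A + B | A B. A \<in> inner_ders \<and> B \<in> pow_ders}"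

lemma inner_ders_add: "A \<in> inner_ders \<Longrightarrow> B \<in> inner_ders \<Longrightarrow> A + B \<in> inner_ders"
proof -
  assume "A \<in> inner_ders" "B \<in> inner_ders"
  then obtain E F where EF: "E \<in> W0" "F \<in> W0" "A = restr S0 (br E)" "B = restr S0 (br F)"
    unfolding inner_ders_def by blast
  have "A + B = restr S0 (br (E + F))"
    unfolding EF by (rule ext) (simp add: restr_def plus_fun_apply br_bilinear)
  thus ?thesis using EF(1,2) unfolding inner_ders_def by auto
qed

lemma inner_ders_DER: "D \<in> inner_ders \<Longrightarrow> D \<in> DER"
proof -
  assume "D \<in> inner_ders"
  then obtain E where "E \<in> W0" "D = restr S0 (br E)" unfolding inner_ders_def by blast
  thus ?thesis using ad_DER[of E] by simp
qed

lemma zero_inner_ders: "0 \<in> inner_ders"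
proof -
  have "(0 :: 'a wel \<Rightarrow> 'a wel) = restr S0 (br 0)" by (rule ext) (simp add: restr_def zero_fun_apply)
  thus ?thesis using W0_simps(1) unfolding inner_ders_def by blast
qed

lemma pow_ders_sum: "B \<in> pow_ders \<Longrightarrow> B \<in> sum_ders"
  unfolding sum_ders_def using zero_inner_ders by force

lemma sum_ders_add: "A \<in> sum_ders \<Longrightarrow> B \<in> sum_ders \<Longrightarrow> A + B \<in> sum_ders"
proof -
  assume "A \<in> sum_ders" "B \<in> sum_ders"
  then obtain A1 A2 kill_lowered_degree B2 where h: "A1 \<in> inner_ders" "kill_lowered_degree \<in> inner_ders" "A2 \<in> pow_ders" "B2 \<in> pow_ders"
    "A = A1 + A2" "B = kill_lowered_degree + B2"
    unfolding sum_ders_def by blast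
  have "A + B = (A1 + kill_lowered_degree) + (A2 + B2)" by (simp add: h add_ac)
  moreover have "A2 + B2 \<in> pow_ders" using h(3,4) unfolding pow_ders_def by (rule sc_pointwise.span_add)
  ultimately show ?thesis using inner_ders_add[OF h(1,2)] unfolding sum_ders_def by blast
qed

lemma sum_ders_zero: "0 \<in> sum_ders"
  by (rule pow_ders_sum) (simp add: pow_ders_def sc_pointwise.span_zero)

lemma sum_ders_sum: "(\<And>a. a \<in> A \<Longrightarrow> f a \<in> sum_ders) \<Longrightarrow> (\<Sum>a\<in>A. f a) \<in> sum_ders"
  by (induction A rule: infinite_finite_induct) (simp_all add: sum_ders_zero sum_ders_add)

lemma inner_cancel:
  assumes "E \<in> W0" "D + restr S0 (br E) \<in> sum_ders"
  shows "D \<in> sum_ders"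
proof -
  have "- E \<in> W0" using assms(1) by simp
  hence "restr S0 (br (- E)) \<in> inner_ders" unfolding inner_ders_def by blast
  moreover have "0 \<in> pow_ders" unfolding pow_ders_def by (rule sc_pointwise.span_zero)
  ultimately have "restr S0 (br (- E)) + 0 \<in> sum_ders" unfolding sum_ders_def by blast
  moreover have "D = (D + restr S0 (br E)) + (restr S0 (br (- E)) + 0)"
    by (rule ext) (simp add: restr_def plus_fun_apply zero_fun_apply br_minus)
  ultimately show ?thesis using sum_ders_add[OF assms(2)] by metis
qed

text \<open>A term without even variables bounds \<xi> on the odd indices, and the torus congruences
  then leave only the constant values 1, -1 and 0 there, each settled by an earlier
  classification.\<close>

lemma normalized_sum_ders:
  assumes D: "D \<in> DER" "has_degree \<xi> D" "torus_trivial \<xi>" "\<And>i. i \<in> E0 \<Longrightarrow> D (Dvec i) = 0" and out: "\<And>i. i \<notin> EE \<Longrightarrow> \<xi> i = 0"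
  shows "D \<in> sum_ders"
proof (cases "D = 0")
  case True
  thus ?thesis by (simp add: sum_ders_zero)
next
  case False
  then obtain r s \<beta> u where g0: "(\<beta>, u) \<in> AB" "r \<in> EE" "s \<in> EE" "even (card u + tt r + tt s)" "D (gen r s \<beta> u) \<noteq> 0"
    using DER_ext_gens[OF D(1)] by blast
  then obtain \<beta>' v q where g: "(\<beta>', u) \<in> AB" "D (gen r s \<beta>' u) (\<lambda>_. 0, v, q) \<noteq> 0"
    using ex_const_coeff[OF D(1,4) g0] by blast
  have ok: "gen_ok r s \<beta>' u" using g(1) g0 by (simp add: gen_ok_def)
  note S = nonzero_value_degree[OF D(1,2) gen_ok_gen[OF ok] g(2)]
  obtain \<alpha>' v' q' where w: "(\<alpha>', v', q') \<in> W0B" "gen_deg r s \<beta>' u = wdeg (\<alpha>', v', q')" using S(3) by blast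
  have xi: "\<xi> i = wdeg (\<lambda>_. 0, v, q) i - wdeg (\<alpha>', v', q') i" for i
    using S(2)[of i] unfolding w(2) by simp
  have b: "\<bar>wdeg (\<lambda>_. 0, v, q) k\<bar> \<le> 1" "\<bar>wdeg (\<alpha>', v', q') k\<bar> \<le> 1" if "k \<in> E1" for k
    unfolding wdeg_E1[OF S(1) that] wdeg_E1[OF w(1) that] by simp_all
  have b2: "\<bar>\<xi> k\<bar> \<le> 2" if "k \<in> E1" for k using b[OF that] xi[of k] by linarith
  obtain i0 where i0: "i0 \<in> E0" using ex_other by blast
  obtain k where k: "k \<in> E1" using ex_other_odd by blast
  obtain l where l: "l \<in> E1" "l \<noteq> k" using ex_other_odd[of k k] by auto
  have pk: "int p dvd \<xi> i + \<xi> k" if "i \<in> E0" "k \<in> E1" for i k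
    using D(3) that unfolding torus_trivial_def by blast
  \<comment> \<open>The values lie in [-2, 2] and are congruent modulo p; a difference of at most 4
    is less than p.\<close>
  have const: "\<xi> k' = \<xi> k" if k': "k' \<in> E1" for k'
  proof -
    have "int p dvd (\<xi> i0 + \<xi> k') - (\<xi> i0 + \<xi> k)" using pk[OF i0] k k' by (intro dvd_diff)
    hence "int p dvd \<xi> k' - \<xi> k" by simp
    moreover have "\<bar>\<xi> k' - \<xi> k\<bar> < int p" using b2[OF k] b2[OF k'] p_ge_5 by linarith
    ultimately show ?thesis using p_dvd_int_small by fastforce
  qed
  \<comment> \<open>A shift by 2 at two odd indices would need source weight -1 at both, but only
    the derivation index contributes -1.\<close>
  have ne2: "\<xi> k \<noteq> 2"
  proof
    assume "\<xi> k = 2"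
    hence "wdeg (\<alpha>', v', q') k = -1" "wdeg (\<alpha>', v', q') l = -1"
      using b[OF k] b[OF l(1)] xi[of k] xi[of l] const[OF l(1)] by linarith+
    thus False using l(2) unfolding wdeg_E1[OF w(1) k] wdeg_E1[OF w(1) l(1)] by (auto split: if_splits)
  qed
  have nem2: "\<xi> k \<noteq> - 2"
  proof
    assume "\<xi> k = - 2"
    hence "wdeg (\<lambda>_. 0, v, q) k = -1" "wdeg (\<lambda>_. 0, v, q) l = -1"
      using b[OF k] b[OF l(1)] xi[of k] xi[of l] const[OF l(1)] by linarith+
    thus False using l(2) unfolding wdeg_E1[OF S(1) k] wdeg_E1[OF S(1) l(1)] by (auto split: if_splits)
  qed
  have "\<xi> k = 1 \<or> \<xi> k = -1 \<or> \<xi> k = 0" using b2[OF k] ne2 nem2 by linarith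
  thus ?thesis
  proof (elim disjE)
    assume "\<xi> k = 1"
    thus ?thesis using DER_zero_plus[OF D(1,2,4)] const pk[OF _ k] False by metis
  next
    assume x: "\<xi> k = - 1"
    have "int p dvd \<xi> i - 1" if "i \<in> E0" for i using pk[OF that k] unfolding x by simp
    thus ?thesis using DER_zero_minus[OF D(1,2,4)] const x False by metis
  next
    assume x: "\<xi> k = 0"
    have x0: "int p dvd \<xi> i" if "i \<in> E0" for i using pk[OF that k] unfolding x by simp
    \<comment> \<open>The target term has no even variable, so its weight at i is at most 0, and the
      source weight is at least -1; divisibility by p excludes the value 1.\<close>
    have le: "\<xi> i \<le> 0" if i: "i \<in> E0" for i
    proof -
      have "\<xi> i \<le> 1" using xi[of i] unfolding wdeg_E0[OF S(1) i] wdeg_E0[OF w(1) i] by (auto split: if_splits)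
      moreover have "\<xi> i \<noteq> 1" using x0[OF i] p_gt_3 by auto
      ultimately show ?thesis by linarith
    qed
    define N where "N i = nat (- \<xi> i)" for i
    have out0: "\<xi> i = 0" if "i \<notin> E0" for i
      using that out[of i] const[of i] x by (cases "i \<in> E1") (auto simp: EE_cases)
    have xiN: "\<xi> = (\<lambda>i. - int (N i))"
    proof
      fix i
      show "\<xi> i = - int (N i)" using le[of i] out0[of i] by (cases "i \<in> E0") (auto simp: N_def)
    qed
    have "null_weight p m n t D N"
    proof unfold_locales
      show "D \<in> DER" by (rule D(1))
      show "has_degree (\<lambda>i. - int (N i)) D" using D(2) unfolding xiN .
      show "D (Dvec i) = 0" if "i \<in> E0" for i by (rule D(4)[OF that])
      show "p dvd N i" if "i \<in> E0" for i
        using x0[OF that] fun_cong[OF xiN, of i] by simp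
      show "N i = 0" if "i \<notin> E0" for i using out0[OF that] by (simp add: N_def)
    qed
    then interpret nw: null_weight p m n t "TYPE('a)" D N .
    show ?thesis
    proof (cases "N = (\<lambda>_. 0)")
      case True
      obtain E where "E \<in> W0" "D + restr S0 (br E) = 0" using nw.zero_weight_inner[OF True] by blast
      thus ?thesis using inner_cancel[of E D] sum_ders_zero by metis
    next
      case False
      then obtain c where c: "N c \<noteq> 0" by auto
      hence "c \<in> E0" using nw.N_out[of c] by (cases "c \<in> E0") simp_all
      from nw.nonzero_weight_class[OF this c] \<open>D \<noteq> 0\<close> obtain e a where e: "1 \<le> e" "e < t c" "D = (\<lambda>x. sc a (pw c e x))"
        by blast
      have "pw c e \<in> pow_ders" unfolding pow_ders_def using e \<open>c \<in> E0\<close> by (intro sc_pointwise.span_base) blast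
      hence "D \<in> pow_ders" unfolding e(3) pow_ders_def by (rule sc_pointwise.span_scale)
      thus ?thesis by (rule pow_ders_sum)
    qed
  qed
qed

lemma homogeneous_sum_ders:
  assumes D: "D \<in> DER" "has_degree \<xi> D" and out: "\<And>i. i \<notin> EE \<Longrightarrow> \<xi> i = 0"
  shows "D \<in> sum_ders"
proof (cases "torus_trivial \<xi>")
  case True
  obtain E where E: "E \<in> Wd \<xi>" "\<And>i. i \<in> E0 \<Longrightarrow> (D + restr S0 (br E)) (Dvec i) = 0"
    using trivial_normalize[OF D True] by blast
  have "D + restr S0 (br E) \<in> sum_ders"
    by (rule normalized_sum_ders[OF DER_add[OF D(1) ad_DER[OF Wd_W0[OF E(1)]]] has_degree_add[OF D(2) has_degree_ad[OF E(1)]] True E(2) out])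
  thus ?thesis by (rule inner_cancel[OF Wd_W0[OF E(1)]])
next
  case False
  then obtain E where "E \<in> W0" "D + restr S0 (br E) = 0" using nontrivial_inner[OF D] by blast
  thus ?thesis using inner_cancel[of E D] sum_ders_zero by metis
qed

lemma DER_sum_ders:
  assumes D: "D \<in> DER"
  shows "D \<in> sum_ders"
proof -
  have out: "\<nu> i = 0" if "\<nu> \<in> degrees" "i \<notin> EE" for \<nu> i
    using that by (auto simp: degrees_def wdeg_def Wbasis_def AB_iff EE_cases split: if_splits)
  have "(\<Sum>\<xi>\<in>(\<lambda>(\<mu>, \<nu>). \<nu> - \<mu>) ` (degrees \<times> degrees). der_part D \<xi>) \<in> sum_ders"
  proof (intro sum_ders_sum homogeneous_sum_ders[OF der_part_DER[OF D] has_degree_der_part[OF D]])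
    fix \<xi> i assume x: "\<xi> \<in> (\<lambda>(\<mu>, \<nu>). \<nu> - \<mu>) ` (degrees \<times> degrees)" and i: "i \<notin> EE"
    obtain \<mu> \<nu> where h: "\<mu> \<in> degrees" "\<nu> \<in> degrees" "\<xi> = \<nu> - \<mu>" using x by (auto split: prod.splits)
    show "\<xi> i = 0" unfolding h(3) minus_apply out[OF h(1) i] out[OF h(2) i] by simp
  qed
  thus ?thesis unfolding sum_der_part[OF D, symmetric] .
qed

lemma DER_eq: "DER = sum_ders"
proof (intro equalityI subsetI)
  fix D assume "D \<in> sum_ders"
  then obtain A B where AB: "A \<in> inner_ders" "B \<in> pow_ders" "D = A + B" unfolding sum_ders_def by blast
  have "B \<in> DER"
    using AB(2) unfolding pow_ders_def
  proof (induction rule: sc_pointwise.span_induct_alt)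
    case base
    show ?case using zero_inner_ders by (rule inner_ders_DER)
  next
    case (step c x y)
    thus ?case using pow_DER by (intro DER_add DER_scale) auto
  qed
  thus "D \<in> DER" unfolding AB(3) using inner_ders_DER[OF AB(1)] by (intro DER_add)
qed (rule DER_sum_ders)

section \<open>Directness of the sum\<close>

text \<open>Reading off the coefficient of \<open>D\<^sub>j\<close> after applying the map to this field separates the powers \<open>(ad D\<^sub>i)\<close> to \<open>p\<^sup>e\<close>.\<close>

definition probe :: "nat \<Rightarrow> nat \<Rightarrow> nat \<Rightarrow> 'a wel" where
  "probe i j e = mkW (single ((\<lambda>_. 0)(i := p ^ e), {}) 1) j"

lemma p_pow_le_pm: "e < t i \<Longrightarrow> p ^ e \<le> pm i"
proof -
  assume "e < t i"
  hence "p ^ e < p ^ t i" using p_gt_3 by (intro power_strict_increasing) auto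
  thus ?thesis by simp
qed

lemma probe_S0:
  assumes "i \<in> E0" "j \<in> E0" "j \<noteq> i" "e < t i"
  shows "probe i j e \<in> S0"
proof -
  obtain a where a: "a \<in> E0" "a \<noteq> i" "a \<noteq> j" using ex_other[of i j] by auto
  have "((\<lambda>_. 0)(i := p ^ e), {}) \<in> AB" using assms p_pow_le_pm by (auto simp: AB_iff)
  thus ?thesis unfolding probe_def using assms a pm_pos[OF a(1)] by (intro mkW_S0[where a = a]) auto
qed

lemma pw_probe:
  assumes "i \<in> E0" "j \<in> E0" "j \<noteq> i" "e < t i" "c \<in> E0"
  shows "pw c e' (probe i j e) (\<lambda>_. 0, {}, j) = (if c = i \<and> e' = e then 1 else 0)"
proof -
  have p0: "p ^ e > 0" "p ^ e' > 0" using p_gt_3 by simp_all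
  have "(\<lambda>_. 0)(c := p ^ e') = (\<lambda>_. 0)(i := p ^ e) \<longleftrightarrow> c = i \<and> p ^ e' = p ^ e"
    using p0 by (auto simp: fun_eq_iff)
  also have "\<dots> \<longleftrightarrow> c = i \<and> e' = e" using p_gt_3 by (simp add: power_inject_exp)
  finally have eq: "(\<lambda>_. 0)(c := p ^ e') = (\<lambda>_. 0)(i := p ^ e) \<longleftrightarrow> c = i \<and> e' = e" .
  have "pw c e' (probe i j e) (\<lambda>_. 0, {}, j) = probe i j e ((\<lambda>_. 0)(c := p ^ e'), {}, j)"
    using funpow_Dvec(1)[OF S0_W0[OF probe_S0[OF assms(1-4)]] assms(5), of "p ^ e'" "\<lambda>_. 0" "{}" j] probe_S0[OF assms(1-4)]
    by (simp add: restr_def)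
  thus ?thesis using eq by (simp add: probe_def mkW_def single_apply)
qed

lemma mul_const_coeff:
  assumes "f (\<lambda>_. 0, {}) = 0 \<or> g (\<lambda>_. 0, {}) = 0"
  shows "(f \<odot> g) (\<lambda>_. 0, {}) = 0"
proof -
  have z: "sc (f a * g b) (amul_basis p m n t a b) (\<lambda>_. 0, {}) = 0" for a b
  proof (cases "a = (\<lambda>_. 0, {}) \<and> b = (\<lambda>_. 0, {})")
    case True
    thus ?thesis using assms by (auto simp: sc_apply)
  next
    case False
    obtain \<alpha> u \<beta> v where ab: "a = (\<alpha>, u)" "b = (\<beta>, v)" by (cases a, cases b)
    have "(\<lambda>_. 0, {}) \<noteq> (\<lambda>i. \<alpha> i + \<beta> i, u \<union> v)"
    proof
      assume "(\<lambda>_. 0, {}) = (\<lambda>i. \<alpha> i + \<beta> i, u \<union> v)"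
      hence "(\<lambda>_. 0) = (\<lambda>i. \<alpha> i + \<beta> i)" "u \<union> v = {}" by simp_all
      hence "\<alpha> i + \<beta> i = 0" "u = {}" "v = {}" for i by (metis, simp_all)
      thus False using False unfolding ab by auto
    qed
    thus ?thesis
      unfolding ab amul_basis_def by (simp only: prod.case single_apply sc_apply zero_fun_apply if_False mult_zero_right split: if_split) simp
  qed
  show ?thesis unfolding amul_def sum_fun_apply by (simp only: z sum.neutral_const)
qed

text \<open>Since p^e > 1, neither x_i^(p^e) nor any of its first derivatives has a constant term,
  and the bracket with E involves only products with these. For e = 0 it would fail, as D_i itself
  is inner.\<close>

lemma inner_probe:
  assumes "A \<in> inner_ders" "i \<in> E0" "j \<in> E0" "j \<noteq> i" "1 \<le> e" "e < t i"
  shows "A (probe i j e) (\<lambda>_. 0, {}, j) = 0"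
proof -
  obtain E where E: "E \<in> W0" "A = restr S0 (br E)" using assms(1) unfolding inner_ders_def by blast
  let ?f = "single ((\<lambda>_. 0)(i := p ^ e), {}) 1 :: 'a ael"
  have B: "((\<lambda>_. 0)(i := p ^ e), {}) \<in> AB" using assms p_pow_le_pm by (auto simp: AB_iff)
  have jE: "j \<in> EE" using assms by (simp add: EE_cases)
  have pe: "p ^ e > 1" using assms(5) p_gt_3 by (intro one_less_power) auto
  have f: "?f \<in> AC" using B by simp
  have pd0: "pd r ?f (\<lambda>_. 0, {}) = 0" if "r \<in> EE" for r
  proof (cases "r \<in> E0")
    case True
    have "((\<lambda>_. 0)(r := Suc 0), {}) \<noteq> ((\<lambda>_. 0)(i := p ^ e), {} :: nat set)"
    proof
      assume "((\<lambda>_. 0)(r := Suc 0), {}) = ((\<lambda>_. 0)(i := p ^ e), {} :: nat set)"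
      hence "((\<lambda>_. 0)(r := Suc 0)) i = ((\<lambda>_. 0)(i := p ^ e)) i" by simp
      thus False using pe by (auto split: if_splits)
    qed
    thus ?thesis using pd_even_apply[OF f True] by (simp only: single_apply if_False)
  next
    case False
    hence "r \<in> E1" using that by (simp add: EE_cases)
    thus ?thesis using pd_odd_apply[OF f, of r] by (simp add: single_apply)
  qed
  have f0: "?f (\<lambda>_. 0, {}) = 0"
  proof -
    have "(\<lambda>_. 0, {} :: nat set) \<noteq> ((\<lambda>_. 0)(i := p ^ e), {})"
    proof
      assume "(\<lambda>_. 0, {} :: nat set) = ((\<lambda>_. 0)(i := p ^ e), {})"
      hence "(\<lambda>_. 0) i = ((\<lambda>_. 0)(i := p ^ e)) i" by (metis prod.inject)
      hence "p ^ e = 0" by (simp only: fun_upd_same)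
      thus False using pe by linarith
    qed
    thus ?thesis by (simp only: single_apply if_False)
  qed
  have S: "probe i j e \<in> S0" by (rule probe_S0) (use assms in auto)
  have "A (probe i j e) (\<lambda>_. 0, {}, j) = coef j (br E (probe i j e)) (\<lambda>_. 0, {})"
    using S by (simp add: E restr_def coef_apply)
  also have "\<dots> = act E ?f (\<lambda>_. 0, {}) - (?f \<odot> pd j (coef j E)) (\<lambda>_. 0, {})"
    unfolding coef_br[OF E(1) S0_W0[OF S] jE] by (simp add: probe_def coef_mkW act_mkW[OF jE] minus_apply)
  also have "act E ?f (\<lambda>_. 0, {}) = 0"
    unfolding act_def sum_fun_apply using pd0 by (intro sum.neutral ballI mul_const_coeff) simp
  also have "(?f \<odot> pd j (coef j E)) (\<lambda>_. 0, {}) = 0"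
    by (rule mul_const_coeff) (simp only: f0 simp_thms)
  finally show ?thesis by simp
qed

lemma inner_pow_disjoint: "inner_ders \<inter> pow_ders = {0}"
proof -
  define I where "I = (SIGMA i:E0. {1..<t i})"
  define j where "j i = (SOME j. j \<in> E0 \<and> j \<noteq> i)" for i
  have j: "j i \<in> E0" "j i \<noteq> i" for i
  proof -
    obtain c where "c \<in> E0" "c \<noteq> i" using ex_other[of i i] by metis
    hence "j i \<in> E0 \<and> j i \<noteq> i" unfolding j_def by (intro someI[where P = "\<lambda>j. j \<in> E0 \<and> j \<noteq> i"] conjI)
    thus "j i \<in> E0" "j i \<noteq> i" by (rule conjunct1, rule conjunct2)
  qed
  have fin: "finite I" by (auto simp: I_def)
  define \<phi> :: "nat \<times> nat \<Rightarrow> ('a wel \<Rightarrow> 'a wel) \<Rightarrow> 'a"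
    where "\<phi> x B = B (probe (fst x) (j (fst x)) (snd x)) (\<lambda>_. 0, {}, j (fst x))" for x B
  \<comment> \<open>The functionals \<phi> are dual to the powers of the ad D_i, so an element of
    their span is recovered from its values on the probes, where inner derivations vanish.\<close>
  have expand: "B y = (\<Sum>x\<in>I. sc (\<phi> x B) (pw (fst x) (snd x) y))" if "B \<in> pow_ders" for B y
    using that unfolding pow_ders_def
  proof (induction rule: sc_pointwise.span_induct_alt)
    case base
    thus ?case by (simp add: \<phi>_def zero_fun_apply)
  next
    case (step c x z)
    then obtain i e where x: "x = pw i e" "i \<in> E0" "1 \<le> e" "e < t i" by blast
    hence iI: "(i, e) \<in> I" by (simp add: I_def)
    have ph: "\<phi> b x = (if b = (i, e) then 1 else 0)" if "b \<in> I" for b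
      unfolding \<phi>_def x(1) using pw_probe[OF _ j, of "fst b" "snd b" i e] that x(2)
      by (cases b) (auto simp: I_def)
    have ph2: "\<phi> b ((\<lambda>x'. sc c (x x')) + z) = c * \<phi> b x + \<phi> b z" for b
      by (simp add: \<phi>_def plus_fun_apply sc_apply)
    have "(\<Sum>b\<in>I. sc (\<phi> b ((\<lambda>x'. sc c (x x')) + z)) (pw (fst b) (snd b) y))
        = (\<Sum>b\<in>I. sc (c * \<phi> b x) (pw (fst b) (snd b) y)) + z y"
      unfolding ph2 step(2) by (simp add: sc_add_left sum.distrib)
    also have "(\<Sum>b\<in>I. sc (c * \<phi> b x) (pw (fst b) (snd b) y)) = (\<Sum>b\<in>I. if b = (i, e) then sc c (x y) else 0)"
    proof (rule sum.cong[OF refl])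
      fix b assume b: "b \<in> I"
      show "sc (c * \<phi> b x) (pw (fst b) (snd b) y) = (if b = (i, e) then sc c (x y) else 0)"
        unfolding ph[OF b] by (cases "b = (i, e)") (simp_all add: x(1) zero_fun_apply)
    qed
    also have "\<dots> = sc c (x y)" using iI fin by simp
    finally show ?case by (simp add: plus_fun_apply)
  qed
  have "D = 0" if D: "D \<in> inner_ders" "D \<in> pow_ders" for D
  proof
    fix y
    have "\<phi> x D = 0" if "x \<in> I" for x
      unfolding \<phi>_def by (rule inner_probe[OF D(1) _ j]) (use that in \<open>auto simp: I_def\<close>)
    hence "(\<Sum>x\<in>I. sc (\<phi> x D) (pw (fst x) (snd x) y)) = 0" by (intro sum.neutral) (simp add: zero_fun_apply)
    thus "D y = 0 y" using expand[OF D(2), of y] by (simp add: zero_fun_apply)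
  qed
  moreover have "0 \<in> pow_ders" unfolding pow_ders_def by (rule sc_pointwise.span_zero)
  ultimately show ?thesis using zero_inner_ders by blast
qed

end

theorem theorem4p3p6:
  fixes m n :: nat and t :: "nat \<Rightarrow> nat"
  assumes "prime CHAR('a::field)" and "CHAR('a) > 3"
    and "m \<ge> 3" and "n \<ge> 3"
    and "\<forall>i\<in>Y0 m. t i \<ge> 1"
  defines "p \<equiv> CHAR('a)"
  defines "SS \<equiv> (Seven p m n t :: 'a wel set)"
  defines "WW \<equiv> (Weven p m n t :: 'a wel set)"
  defines "adW \<equiv> {restr SS (bracket p m n t E) | E. E \<in> WW}"
  defines "P \<equiv> module.span (\<lambda>c D x. sc c (D x))
                 {restr SS (bracket p m n t (Dvec i) ^^ (p ^ r)) | i r. i \<in> Y0 m \<and> 1 \<le> r \<and> r < t i}"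
  shows "Der SS WW sc (bracket p m n t) = {A + B | A B. A \<in> adW \<and> B \<in> P}
         \<and> adW \<inter> P = {0}"
proof -
  interpret divided_superalgebra p m n t "TYPE('a)"
    by unfold_locales (use assms(1-5) in \<open>simp_all add: p_def\<close>)
  have "adW = inner_ders" "P = pow_ders"
    unfolding adW_def P_def inner_ders_def pow_ders_def SS_def WW_def by (rule refl)+
  thus ?thesis
    using DER_eq inner_pow_disjoint unfolding sum_ders_def SS_def WW_def by simp
qed

end
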